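(* Let $X$ be a simply-connected Riemann surface, $g_0$ a flat metric on $X$ compatible with its complex structure, and let $\alpha_-,\alpha_+\colon X\to\mathbb{R}^{>0}$ be smooth functions satisfying $$\Delta_0\log(\alpha_-^2)=-4(3\alpha_-^2+\alpha_+^2-2)\gamma^2,\qquad \Delta_0\log(\alpha_+^2)=-4(3\alpha_+^2+\alpha_-^2-2)\gamma^2,$$ where $\gamma=(\alpha_-\alpha_+)^{-1/4}$ and $\Delta_0$ is the Laplace operator of $g_0$. Then there is a (transverse) $J$-holomorphic immersion $\varphi\colon X\to\mathbb{CP}^3$ into nearly Kähler $\mathbb{CP}^3$ whose angle functions are exactly $\alpha_-$ and $\alpha_+$. The immersion is unique up to isometries of $\mathbb{CP}^3$, a choice of a constant $\lambda>0$ (the scale of the induced metric, $g_{\mathcal H}=\lambda^2\gamma^2g_0$), and an element of $S^1/\mathbb{Z}_4\cong S^1$ which parametrises a choice of a unitary $(1,0)$-form $\omega_0$ on $X$ (unitary for $g_{\mathcal H}$) such that $d(\gamma^{-1}\omega_0)=0$. That is: if two such immersions have the same $\lambda$, and their associated forms $\omega_0$ agree up to a fourth root of unity, then they differ by an isometry of $\mathbb{CP}^3$.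
   Context: Nearly Kähler $\mathbb{CP}^3$: identify $\mathbb{H}=\mathbb{C}\oplus j\mathbb{C}$ and $\mathbb{H}^2\cong\mathbb{C}^4$ via $(z_0+jz_1,z_2+jz_3)\leftrightarrow(z_0,z_1,z_2,z_3)$. $\mathrm{Sp}(2)$ acts transitively on $\mathbb{CP}^3$ with stabiliser $S^1\times S^3=\{\mathrm{diag}(z,q)\}$ of $[1,0,0,0]$. Write the left-invariant Maurer–Cartan form as $$\Omega_{MC}=\begin{pmatrix} i\rho_1+j\overline{\omega_3} & -\frac{\overline{\omega_1}}{\sqrt2}+j\frac{\omega_2}{\sqrt2}\\ \frac{\omega_1}{\sqrt2}+j\frac{\omega_2}{\sqrt2} & i\rho_2+j\tau\end{pmatrix}$$ with $\omega_i,\tau$ complex-valued and $\rho_i$ real. $J$ and $g$ are determined by requiring that $s^*\omega_1,s^*\omega_2,s^*\omega_3$ be unitary $(1,0)$-forms for every local section $s$ of $\mathrm{Sp}(2)\to\mathbb{CP}^3$. Isometries of nearly Kähler $\mathbb{CP}^3$ are the elements of $\mathrm{Sp}(2)$. $\mathcal V$ (where $\omega_1=\omega_2=0$) is the vertical bundle of the twistor fibration $\mathbb{CP}^3\to S^4$, $\mathcal H=\mathcal V^\perp$ (where $\omega_3=0$); $g_{\mathcal H}=|\omega_1|^2+|\omega_2|^2$, $g_{\mathcal V}=|\omega_3|^2$, also denoting pullbacks to curves. For a nowhere vertical $J$-holomorphic curve $\varphi\colon X\to\mathbb{CP}^3$, $\varphi^*\mathrm{Sp}(2)$ reduces to the $S^1\times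 S^1$-bundle $P$ cut out by $\omega_2=0$, on which $\tau$ is of type $(1,0)$. The curve is transverse if it is nowhere tangent to $\mathcal H$, nowhere tangent to $\mathcal V$, and this $\tau$ vanishes nowhere. Its angle functions are $\alpha_-(x)=\|\xi\|_{\mathcal V}/\|\xi\|_{\mathcal H}$ and $\alpha_+(x)=|\tau(\xi)|/|\omega_1(\xi)|$ (on $P$), $0\ne\xi\in T_xX$. Associated form: for a transverse curve on simply-connected $X$ there is a lift $\Phi\colon X\to\mathrm{Sp}(2)$ of $\varphi$ with $\Phi^*\omega_2=0$, $\Phi^*\omega_3=\alpha_-\Phi^*\omega_1$, $\Phi^*\tau=\alpha_+\Phi^*\omega_1$; the form associated to $\varphi$ is $\omega_0=\Phi^*\omega_1$, which is unitary for $g_{\mathcal H}$, satisfies $d(\gamma^{-1}\omega_0)=0$, and is determined by $\varphi$ up to multiplication by a fourth root of unity. $\Delta_0=\partial_x^2+\partial_y^2$ in local Euclidean coordinates of $g_0$. *)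

theory Defs
  imports "HOL-Analysis.Analysis"
begin

section \<open>Smooth maps\<close>

text \<open>\<open>C\<^sup>k\<close> maps on an open subset of a finite-dimensional space, by iterated directional
  derivatives.\<close>

fun Ck_on :: "nat \<Rightarrow> 'a::real_normed_vector set \<Rightarrow> ('a \<Rightarrow> 'b::real_normed_vector) \<Rightarrow> bool" where
  "Ck_on 0 S f \<longleftrightarrow> continuous_on S f"
| "Ck_on (Suc k) S f \<longleftrightarrow>
     (\<forall>p\<in>S. f differentiable at p) \<and> (\<forall>v. Ck_on k S (\<lambda>p. frechet_derivative f (at p) v))"

definition smooth_on :: "'a::real_normed_vector set \<Rightarrow> ('a \<Rightarrow> 'b::real_normed_vector) \<Rightarrow> bool" where
  "smooth_on S f \<longleftrightarrow> open S \<and> (\<forall>k. Ck_on k S f)"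

definition partial :: "'a::real_normed_vector \<Rightarrow> ('a \<Rightarrow> 'b::real_normed_vector) \<Rightarrow> 'a \<Rightarrow> 'b" where
  "partial v f p = frechet_derivative f (at p) v"

definition laplacian :: "(complex \<Rightarrow> real) \<Rightarrow> complex \<Rightarrow> real" where
  "laplacian f p = partial 1 (partial 1 f) p + partial \<i> (partial \<i> f) p"


section \<open>Riemann surfaces\<close>

text \<open>A surface is a type with an atlas of complex charts; the charts need not form a
  maximal atlas.  Second countability is not required (Rado's theorem).\<close>

type_synonym 'x chart = "'x set \<times> ('x \<Rightarrow> complex)"

definition chart_inv :: "'x chart \<Rightarrow> complex \<Rightarrow> 'x" where
  "chart_inv c = inv_into (fst c) (snd c)"

definition coordinates :: "'x::topological_space chart \<Rightarrow> bool" where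
  "coordinates c \<longleftrightarrow> open (fst c) \<and> open (snd c ` fst c) \<and>
     homeomorphism (fst c) (snd c ` fst c) (snd c) (chart_inv c)"

definition riemann_surface :: "'x::t2_space chart set \<Rightarrow> bool" where
  "riemann_surface X \<longleftrightarrow>
     connected (UNIV :: 'x set) \<and>
     (\<forall>c\<in>X. coordinates c) \<and> (\<Union>c\<in>X. fst c) = UNIV \<and>
     (\<forall>c\<in>X. \<forall>d\<in>X. (snd d \<circ> chart_inv c) holomorphic_on (snd c ` (fst c \<inter> fst d)))"

definition smooth_map :: "'x::t2_space chart set \<Rightarrow> 'x set \<Rightarrow> ('x \<Rightarrow> 'b::real_normed_vector) \<Rightarrow> bool" where
  "smooth_map X U F \<longleftrightarrow> open U \<and> (\<forall>c\<in>X. smooth_on (snd c ` (fst c \<inter> U)) (F \<circ> chart_inv c))"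

text \<open>A tangent vector of the surface at \<open>x\<close> is given by a chart \<open>c\<close> around \<open>x\<close> and its
  coordinate vector \<open>v\<close> in that chart, multiplication by \<open>\<i>\<close> being the complex structure.
  Accordingly tensors are families of components, one for each chart of the atlas, subject
  to the usual transformation law; \<open>chart_deriv c (snd d) x v\<close> is the coordinate vector in
  the chart \<open>d\<close> of the tangent vector with coordinate vector \<open>v\<close> in \<open>c\<close>.\<close>

definition chart_deriv :: "'x chart \<Rightarrow> ('x \<Rightarrow> 'b::real_normed_vector) \<Rightarrow> 'x \<Rightarrow> complex \<Rightarrow> 'b" where
  "chart_deriv c F x v = frechet_derivative (F \<circ> chart_inv c) (at (snd c x)) v"

type_synonym 'x metric = "'x chart \<Rightarrow> 'x \<Rightarrow> complex \<Rightarrow> complex \<Rightarrow> real"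
type_synonym 'x form = "'x chart \<Rightarrow> 'x \<Rightarrow> complex \<Rightarrow> complex"

definition riemannian_metric :: "'x::t2_space chart set \<Rightarrow> 'x metric \<Rightarrow> bool" where
  "riemannian_metric X g \<longleftrightarrow>
     (\<forall>c\<in>X. \<forall>x\<in>fst c. bilinear (g c x) \<and>
        (\<forall>v w. g c x v w = g c x w v) \<and> (\<forall>v. v \<noteq> 0 \<longrightarrow> g c x v v > 0)) \<and>
     (\<forall>c\<in>X. \<forall>v w. smooth_on (snd c ` fst c) (\<lambda>p. g c (chart_inv c p) v w)) \<and>
     (\<forall>c\<in>X. \<forall>d\<in>X. \<forall>x\<in>fst c \<inter> fst d. \<forall>v w.
        g c x v w = g d x (chart_deriv c (snd d) x v) (chart_deriv c (snd d) x w))"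

definition compatible_metric :: "'x::t2_space chart set \<Rightarrow> 'x metric \<Rightarrow> bool" where
  "compatible_metric X g \<longleftrightarrow> riemannian_metric X g \<and>
     (\<forall>c\<in>X. \<forall>x\<in>fst c. \<forall>v w. g c x (\<i> * v) (\<i> * w) = g c x v w)"

definition euclidean_coordinates :: "'x::t2_space chart set \<Rightarrow> 'x metric \<Rightarrow> 'x chart \<Rightarrow> bool" where
  "euclidean_coordinates X g e \<longleftrightarrow> coordinates e \<and> smooth_map X (fst e) (snd e) \<and>
     (\<forall>c\<in>X. \<forall>x\<in>fst c \<inter> fst e. \<forall>v w.
        g c x v w = chart_deriv c (snd e) x v \<bullet> chart_deriv c (snd e) x w)"

definition flat_metric :: "'x::t2_space chart set \<Rightarrow> 'x metric \<Rightarrow> bool" where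
  "flat_metric X g \<longleftrightarrow> (\<forall>x. \<exists>e. euclidean_coordinates X g e \<and> x \<in> fst e)"

text \<open>\<open>\<Delta>\<^sub>0 f = h\<close>, in all local Euclidean coordinates.\<close>

definition has_laplacian ::
    "'x::t2_space chart set \<Rightarrow> 'x metric \<Rightarrow> ('x \<Rightarrow> real) \<Rightarrow> ('x \<Rightarrow> real) \<Rightarrow> bool" where
  "has_laplacian X g f h \<longleftrightarrow>
     (\<forall>e. euclidean_coordinates X g e \<longrightarrow>
        (\<forall>x\<in>fst e. laplacian (f \<circ> chart_inv e) (snd e x) = h x))"

definition smooth_form :: "'x::t2_space chart set \<Rightarrow> 'x form \<Rightarrow> bool" where
  "smooth_form X \<beta> \<longleftrightarrow>
     (\<forall>c\<in>X. \<forall>x\<in>fst c. linear (\<beta> c x)) \<and>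
     (\<forall>c\<in>X. \<forall>v. smooth_on (snd c ` fst c) (\<lambda>p. \<beta> c (chart_inv c p) v)) \<and>
     (\<forall>c\<in>X. \<forall>d\<in>X. \<forall>x\<in>fst c \<inter> fst d. \<forall>v. \<beta> c x v = \<beta> d x (chart_deriv c (snd d) x v))"

definition type_1_0 :: "'x chart set \<Rightarrow> 'x form \<Rightarrow> bool" where
  "type_1_0 X \<beta> \<longleftrightarrow> (\<forall>c\<in>X. \<forall>x\<in>fst c. \<forall>v. \<beta> c x (\<i> * v) = \<i> * \<beta> c x v)"

text \<open>For \<open>\<beta> = P dx + Q dy\<close> in a chart, \<open>d\<beta> = 0\<close> reads \<open>\<partial>Q/\<partial>x = \<partial>P/\<partial>y\<close>.\<close>

definition closed_form :: "'x chart set \<Rightarrow> 'x form \<Rightarrow> bool" where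
  "closed_form X \<beta> \<longleftrightarrow>
     (\<forall>c\<in>X. \<forall>x\<in>fst c. chart_deriv c (\<lambda>y. \<beta> c y \<i>) x 1 = chart_deriv c (\<lambda>y. \<beta> c y 1) x \<i>)"


section \<open>Quaternions and Sp(2)\<close>

text \<open>The pair \<open>(a, b)\<close> stands for the quaternion \<open>a + j b\<close>; since \<open>b j = j b\<^sup>*\<close> and
  \<open>j\<^sup>2 = -1\<close>, the product of \<open>a + j b\<close> and \<open>c + j d\<close> is
  \<open>(a c - b\<^sup>* d) + j (b c + a\<^sup>* d)\<close>.\<close>

type_synonym quat = "complex \<times> complex"

definition qmult :: "quat \<Rightarrow> quat \<Rightarrow> quat" where
  "qmult p q = (fst p * fst q - cnj (snd p) * snd q, snd p * fst q + cnj (fst p) * snd q)"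

definition qcnj :: "quat \<Rightarrow> quat" where
  "qcnj p = (cnj (fst p), - snd p)"

definition qmat_mult :: "quat^2^2 \<Rightarrow> quat^2^2 \<Rightarrow> quat^2^2" where
  "qmat_mult A B = (\<chi> i k. \<Sum>l\<in>UNIV. qmult (A $ i $ l) (B $ l $ k))"

definition qadjoint :: "quat^2^2 \<Rightarrow> quat^2^2" where
  "qadjoint A = (\<chi> i k. qcnj (A $ k $ i))"

definition qmat_vec :: "quat^2^2 \<Rightarrow> quat^2 \<Rightarrow> quat^2" where
  "qmat_vec A q = (\<chi> i. \<Sum>l\<in>UNIV. qmult (A $ i $ l) (q $ l))"

definition Sp2 :: "(quat^2^2) set" where
  "Sp2 = {A. qmat_mult (qadjoint A) A = (\<chi> i k. if i = k then (1, 0) else 0)}"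

text \<open>The components of the left-invariant Maurer--Cartan form \<open>A\<^sup>-\<^sup>1 dA\<close>, evaluated on a
  tangent vector \<open>W\<close> of \<open>Sp2\<close> at \<open>A\<close>; note that \<open>A\<^sup>-\<^sup>1\<close> is the adjoint of \<open>A\<close>.  It has
  entries \<open>i \<rho>\<^sub>1 + j \<omega>\<^sub>3\<^sup>*\<close> at (1,1), \<open>(\<omega>\<^sub>1 + j \<omega>\<^sub>2)/sqrt 2\<close> at (2,1) and \<open>i \<rho>\<^sub>2 + j \<tau>\<close> at
  (2,2).\<close>

type_synonym sp2_form = "quat^2^2 \<Rightarrow> quat^2^2 \<Rightarrow> complex"

definition maurer_cartan :: "quat^2^2 \<Rightarrow> quat^2^2 \<Rightarrow> quat^2^2" where
  "maurer_cartan A W = qmat_mult (qadjoint A) W"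

definition omega1 :: sp2_form where
  "omega1 A W = sqrt 2 * fst (maurer_cartan A W $ 2 $ 1)"

definition omega2 :: sp2_form where
  "omega2 A W = sqrt 2 * snd (maurer_cartan A W $ 2 $ 1)"

definition omega3 :: sp2_form where
  "omega3 A W = cnj (snd (maurer_cartan A W $ 1 $ 1))"

definition tau :: sp2_form where
  "tau A W = snd (maurer_cartan A W $ 2 $ 2)"


section \<open>Complex projective 3-space\<close>

text \<open>The identification of \<open>\<complex>\<^sup>4\<close> with pairs of quaternions is
  \<open>(z\<^sub>0, z\<^sub>1, z\<^sub>2, z\<^sub>3) \<leftrightarrow> (z\<^sub>0 + j z\<^sub>1, z\<^sub>2 + j z\<^sub>3)\<close>; the indices of the type \<open>4\<close> start at 1.
  Complex scalars act on quaternions from the right, so the left action of \<open>Sp2\<close> is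
  complex linear.\<close>

definition to_H2 :: "complex^4 \<Rightarrow> quat^2" where
  "to_H2 z = vector [(z $ 1, z $ 2), (z $ 3, z $ 4)]"

definition of_H2 :: "quat^2 \<Rightarrow> complex^4" where
  "of_H2 q = vector [fst (q $ 1), snd (q $ 1), fst (q $ 2), snd (q $ 2)]"

type_synonym cp3 = "(complex^4) set"

definition line :: "complex^4 \<Rightarrow> cp3" where
  "line z = range (\<lambda>c. c *s z)"

definition CP3 :: "cp3 set" where
  "CP3 = line ` {z. z \<noteq> 0}"

definition sp2_act :: "quat^2^2 \<Rightarrow> cp3 \<Rightarrow> cp3" where
  "sp2_act A L = (\<lambda>z. of_H2 (qmat_vec A (to_H2 z))) ` L"

definition base_point :: cp3 where
  "base_point = line (vector [1, 0, 0, 0])"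

text \<open>\<open>CP3\<close> carries the topology and smooth structure of the quotient of \<open>\<complex>\<^sup>4 - {0}\<close> by the
  submersion \<open>line\<close>.  Its tangent vector \<open>d line\<^sub>z (w)\<close> is modelled by the set of all pairs
  representing it; differentiating \<open>line (a(t) z(t)) = line (z(t))\<close> shows that these are the
  pairs \<open>(a z, a w + b z)\<close> with \<open>a \<noteq> 0\<close>.\<close>

type_synonym cp3_tangent = "((complex^4) \<times> (complex^4)) set"

definition tangent :: "complex^4 \<Rightarrow> complex^4 \<Rightarrow> cp3_tangent" where
  "tangent z w = {(a *s z, a *s w + b *s z) | a b. a \<noteq> 0}"

definition tangent_space :: "cp3 \<Rightarrow> cp3_tangent set" where
  "tangent_space L = {tangent z w | z w. z \<noteq> 0 \<and> line z = L}"

definition foot :: "cp3_tangent \<Rightarrow> cp3" where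
  "foot T = (THE L. \<forall>(z, w)\<in>T. L = line z)"

definition local_section :: "cp3 set \<Rightarrow> (cp3 \<Rightarrow> quat^2^2) \<Rightarrow> bool" where
  "local_section V s \<longleftrightarrow> V \<subseteq> CP3 \<and>
     smooth_on {z. z \<noteq> 0 \<and> line z \<in> V} (\<lambda>z. s (line z)) \<and>
     (\<forall>L\<in>V. s L \<in> Sp2 \<and> sp2_act (s L) base_point = L)"

text \<open>The pullback \<open>s\<^sup>*\<omega>\<close>, evaluated on a tangent vector of \<open>CP3\<close>.\<close>

definition section_form :: "(cp3 \<Rightarrow> quat^2^2) \<Rightarrow> sp2_form \<Rightarrow> cp3_tangent \<Rightarrow> complex" where
  "section_form s \<omega> T =
     (THE r. \<forall>(z, w)\<in>T. r = \<omega> (s (line z)) (frechet_derivative (\<lambda>z. s (line z)) (at z) w))"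

text \<open>The nearly Kaehler almost complex structure and the two parts \<open>g\<^sub>\<H>\<close>, \<open>g\<^sub>\<V>\<close> of the
  nearly Kaehler metric (as quadratic forms): the forms \<open>s\<^sup>*\<omega>\<^sub>1\<close>, \<open>s\<^sup>*\<omega>\<^sub>2\<close>, \<open>s\<^sup>*\<omega>\<^sub>3\<close> are
  unitary (1,0)-forms for every local section \<open>s\<close>.\<close>

definition nk_J :: "cp3_tangent \<Rightarrow> cp3_tangent" where
  "nk_J T = (THE T'. T' \<in> tangent_space (foot T) \<and>
     (\<forall>V s. local_section V s \<and> foot T \<in> V \<longrightarrow>
        (\<forall>\<omega>\<in>{omega1, omega2, omega3}. section_form s \<omega> T' = \<i> * section_form s \<omega> T)))"

definition g_H :: "cp3_tangent \<Rightarrow> real" where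
  "g_H T = (THE r. \<forall>V s. local_section V s \<and> foot T \<in> V \<longrightarrow>
     r = (cmod (section_form s omega1 T))\<^sup>2 + (cmod (section_form s omega2 T))\<^sup>2)"

definition g_V :: "cp3_tangent \<Rightarrow> real" where
  "g_V T = (THE r. \<forall>V s. local_section V s \<and> foot T \<in> V \<longrightarrow>
     r = (cmod (section_form s omega3 T))\<^sup>2)"

definition vertical :: "cp3_tangent set" where
  "vertical = {T. \<forall>V s. local_section V s \<and> foot T \<in> V \<longrightarrow>
     section_form s omega1 T = 0 \<and> section_form s omega2 T = 0}"

definition horizontal :: "cp3_tangent set" where
  "horizontal = {T. \<forall>V s. local_section V s \<and> foot T \<in> V \<longrightarrow> section_form s omega3 T = 0}"


section \<open>Curves in nearly Kaehler projective space\<close>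

definition homogeneous_lift ::
    "'x::t2_space chart set \<Rightarrow> ('x \<Rightarrow> cp3) \<Rightarrow> 'x set \<Rightarrow> ('x \<Rightarrow> complex^4) \<Rightarrow> bool" where
  "homogeneous_lift X \<phi> U f \<longleftrightarrow> smooth_map X U f \<and> (\<forall>x\<in>U. f x \<noteq> 0 \<and> \<phi> x = line (f x))"

definition smooth_curve :: "'x::t2_space chart set \<Rightarrow> ('x \<Rightarrow> cp3) \<Rightarrow> bool" where
  "smooth_curve X \<phi> \<longleftrightarrow> (\<forall>x. \<exists>U f. x \<in> U \<and> homogeneous_lift X \<phi> U f)"

definition curve_deriv ::
    "'x::t2_space chart set \<Rightarrow> ('x \<Rightarrow> cp3) \<Rightarrow> 'x chart \<Rightarrow> 'x \<Rightarrow> complex \<Rightarrow> cp3_tangent" where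
  "curve_deriv X \<phi> c x v = (THE T. \<forall>U f. homogeneous_lift X \<phi> U f \<and> x \<in> U \<longrightarrow>
     T = tangent (f x) (chart_deriv c f x v))"

definition J_holomorphic :: "'x::t2_space chart set \<Rightarrow> ('x \<Rightarrow> cp3) \<Rightarrow> bool" where
  "J_holomorphic X \<phi> \<longleftrightarrow> smooth_curve X \<phi> \<and>
     (\<forall>c\<in>X. \<forall>x\<in>fst c. \<forall>v. curve_deriv X \<phi> c x (\<i> * v) = nk_J (curve_deriv X \<phi> c x v))"

definition immersion :: "'x::t2_space chart set \<Rightarrow> ('x \<Rightarrow> cp3) \<Rightarrow> bool" where
  "immersion X \<phi> \<longleftrightarrow> smooth_curve X \<phi> \<and>
     (\<forall>c\<in>X. \<forall>x\<in>fst c. \<forall>v. v \<noteq> 0 \<longrightarrow> curve_deriv X \<phi> c x v \<notin> range (\<lambda>z. tangent z 0))"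

definition tangent_to :: "'x::t2_space chart set \<Rightarrow> ('x \<Rightarrow> cp3) \<Rightarrow> 'x \<Rightarrow> cp3_tangent set \<Rightarrow> bool" where
  "tangent_to X \<phi> x E \<longleftrightarrow> (\<forall>c\<in>X. x \<in> fst c \<longrightarrow> range (curve_deriv X \<phi> c x) \<subseteq> E)"

definition sp2_lift ::
    "'x::t2_space chart set \<Rightarrow> ('x \<Rightarrow> cp3) \<Rightarrow> 'x set \<Rightarrow> ('x \<Rightarrow> quat^2^2) \<Rightarrow> bool" where
  "sp2_lift X \<phi> U F \<longleftrightarrow> smooth_map X U F \<and>
     (\<forall>x\<in>U. F x \<in> Sp2 \<and> sp2_act (F x) base_point = \<phi> x)"

definition lift_form :: "('x \<Rightarrow> quat^2^2) \<Rightarrow> sp2_form \<Rightarrow> 'x form" where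
  "lift_form F \<omega> c x v = \<omega> (F x) (chart_deriv c F x v)"

text \<open>Sections over \<open>U\<close> of the \<open>S\<^sup>1 \<times> S\<^sup>1\<close>-bundle \<open>P\<close> over the curve cut out by \<open>\<omega>\<^sub>2 = 0\<close>.\<close>

definition P_section ::
    "'x::t2_space chart set \<Rightarrow> ('x \<Rightarrow> cp3) \<Rightarrow> 'x set \<Rightarrow> ('x \<Rightarrow> quat^2^2) \<Rightarrow> bool" where
  "P_section X \<phi> U F \<longleftrightarrow> sp2_lift X \<phi> U F \<and>
     (\<forall>c\<in>X. \<forall>x\<in>fst c \<inter> U. \<forall>v. lift_form F omega2 c x v = 0)"

text \<open>On \<open>P\<close> the form \<open>\<tau>\<close> is semibasic and changes by a unit factor under the structure
  group, so its vanishing and its modulus can be read off from local sections of \<open>P\<close>.\<close>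

definition transverse :: "'x::t2_space chart set \<Rightarrow> ('x \<Rightarrow> cp3) \<Rightarrow> bool" where
  "transverse X \<phi> \<longleftrightarrow>
     (\<forall>x. \<not> tangent_to X \<phi> x horizontal) \<and> (\<forall>x. \<not> tangent_to X \<phi> x vertical) \<and>
     (\<forall>U F. P_section X \<phi> U F \<longrightarrow>
        (\<forall>c\<in>X. \<forall>x\<in>fst c \<inter> U. \<exists>v. lift_form F tau c x v \<noteq> 0))"

definition angle_functions ::
    "'x::t2_space chart set \<Rightarrow> ('x \<Rightarrow> cp3) \<Rightarrow> ('x \<Rightarrow> real) \<Rightarrow> ('x \<Rightarrow> real) \<Rightarrow> bool" where
  "angle_functions X \<phi> \<alpha>m \<alpha>p \<longleftrightarrow>
     (\<forall>c\<in>X. \<forall>x\<in>fst c. \<forall>v. v \<noteq> 0 \<longrightarrow>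
        \<alpha>m x = sqrt (g_V (curve_deriv X \<phi> c x v)) / sqrt (g_H (curve_deriv X \<phi> c x v))) \<and>
     (\<forall>U F. P_section X \<phi> U F \<longrightarrow> (\<forall>c\<in>X. \<forall>x\<in>fst c \<inter> U. \<forall>v. v \<noteq> 0 \<longrightarrow>
        \<alpha>p x = cmod (lift_form F tau c x v) / cmod (lift_form F omega1 c x v)))"

definition gamma_fun :: "('x \<Rightarrow> real) \<Rightarrow> ('x \<Rightarrow> real) \<Rightarrow> 'x \<Rightarrow> real" where
  "gamma_fun \<alpha>m \<alpha>p x = (\<alpha>m x * \<alpha>p x) powr (- 1 / 4)"

definition transverse_immersion ::
    "'x::t2_space chart set \<Rightarrow> ('x \<Rightarrow> real) \<Rightarrow> ('x \<Rightarrow> real) \<Rightarrow> ('x \<Rightarrow> cp3) \<Rightarrow> bool" where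
  "transverse_immersion X \<alpha>m \<alpha>p \<phi> \<longleftrightarrow>
     J_holomorphic X \<phi> \<and> immersion X \<phi> \<and> transverse X \<phi> \<and> angle_functions X \<phi> \<alpha>m \<alpha>p"

text \<open>The scale \<open>lam\<close> of the induced metric: \<open>g\<^sub>\<H> = lam\<^sup>2 \<gamma>\<^sup>2 g\<^sub>0\<close> on \<open>X\<close>.\<close>

definition has_scale :: "'x::t2_space chart set \<Rightarrow> 'x metric \<Rightarrow> ('x \<Rightarrow> real) \<Rightarrow> ('x \<Rightarrow> real) \<Rightarrow>
    ('x \<Rightarrow> cp3) \<Rightarrow> real \<Rightarrow> bool" where
  "has_scale X g0 \<alpha>m \<alpha>p \<phi> lam \<longleftrightarrow> lam > 0 \<and>
     (\<forall>c\<in>X. \<forall>x\<in>fst c. \<forall>v.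
        g_H (curve_deriv X \<phi> c x v) = lam\<^sup>2 * (gamma_fun \<alpha>m \<alpha>p x)\<^sup>2 * g0 c x v v)"

text \<open>Unitary (1,0)-forms \<open>\<omega>\<^sub>0\<close> for the metric \<open>lam\<^sup>2 \<gamma>\<^sup>2 g\<^sub>0\<close> with \<open>d(\<gamma>\<^sup>-\<^sup>1 \<omega>\<^sub>0) = 0\<close>.\<close>

definition admissible_form :: "'x::t2_space chart set \<Rightarrow> 'x metric \<Rightarrow> ('x \<Rightarrow> real) \<Rightarrow>
    ('x \<Rightarrow> real) \<Rightarrow> real \<Rightarrow> 'x form \<Rightarrow> bool" where
  "admissible_form X g0 \<alpha>m \<alpha>p lam \<beta> \<longleftrightarrow> smooth_form X \<beta> \<and> type_1_0 X \<beta> \<and>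
     (\<forall>c\<in>X. \<forall>x\<in>fst c. \<forall>v.
        (cmod (\<beta> c x v))\<^sup>2 = lam\<^sup>2 * (gamma_fun \<alpha>m \<alpha>p x)\<^sup>2 * g0 c x v v) \<and>
     closed_form X (\<lambda>c x v. \<beta> c x v / gamma_fun \<alpha>m \<alpha>p x)"

definition associated_form :: "'x::t2_space chart set \<Rightarrow> ('x \<Rightarrow> real) \<Rightarrow> ('x \<Rightarrow> real) \<Rightarrow>
    ('x \<Rightarrow> cp3) \<Rightarrow> 'x form \<Rightarrow> bool" where
  "associated_form X \<alpha>m \<alpha>p \<phi> \<beta> \<longleftrightarrow> (\<exists>\<Phi>. sp2_lift X \<phi> UNIV \<Phi> \<and>
     (\<forall>c\<in>X. \<forall>x\<in>fst c. \<forall>v.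
        lift_form \<Phi> omega2 c x v = 0 \<and>
        lift_form \<Phi> omega3 c x v = \<alpha>m x * lift_form \<Phi> omega1 c x v \<and>
        lift_form \<Phi> tau c x v = \<alpha>p x * lift_form \<Phi> omega1 c x v \<and>
        \<beta> c x v = lift_form \<Phi> omega1 c x v))"

text \<open>Only the components of \<open>\<beta>\<close>, \<open>\<beta>'\<close> in the charts of the atlas are meaningful.\<close>

definition form_multiple :: "'x chart set \<Rightarrow> complex \<Rightarrow> 'x form \<Rightarrow> 'x form \<Rightarrow> bool" where
  "form_multiple X u \<beta> \<beta>' \<longleftrightarrow> (\<forall>c\<in>X. \<forall>x\<in>fst c. \<forall>v. \<beta>' c x v = u * \<beta> c x v)"

end

theory Submission
  imports Defs "HOL-Complex_Analysis.Conformal_Mappings"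
begin

text \<open>Along a transverse curve with adapted lift \<open>\<Phi>\<close>, the forms \<open>\<omega>\<^sub>i\<close> and \<open>\<tau>\<close> are multiples of
  \<open>\<omega>\<^sub>0\<close>, and the structure equations for \<open>d\<omega>\<^sub>1\<close>, \<open>d\<omega>\<^sub>3\<close>, \<open>d\<tau>\<close> determine the remaining
  components as \<open>\<rho>\<^sub>1 = *d(3 ln \<alpha>\<^sub>- - ln \<alpha>\<^sub>+)/8\<close> and \<open>\<rho>\<^sub>2 = *d(ln \<alpha>\<^sub>- - 3 ln \<alpha>\<^sub>+)/8\<close>. So the whole
  Maurer--Cartan form \<open>\<Omega>\<close> is determined by \<open>\<alpha>\<^sub>-\<close>, \<open>\<alpha>\<^sub>+\<close> and \<open>\<omega>\<^sub>0\<close>, which gives uniqueness. Conversely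
  \<open>\<Omega>\<close>, built from these formulas, satisfies \<open>d\<Omega> = -\<Omega> \<and> \<Omega>\<close> exactly when the two Laplace equations
  hold and the scale is \<open>1\<close>; then \<open>d\<Phi> = \<Phi> \<Omega>\<close> is solvable locally by the Frobenius theorem and
  globally because the surface is simply connected. The same monodromy argument yields the parallel
  (1,0)-forms of a flat metric, that is, the admissible forms.\<close>

section \<open>Calculus of smooth maps\<close>

text \<open>Along an adapted lift \<open>d\<omega>1 = i(\<rho>1 - \<rho>2) \<and> \<omega>1\<close>,
  \<open>d\<omega>3 = -2i \<rho>1 \<and> \<omega>3\<close> and
  \<open>d\<tau> = 2i \<rho>2 \<and> \<tau>\<close>. With
  \<open>\<omega>3 = \<alpha>m \<omega>1\<close> and \<open>\<tau> = \<alpha>p \<omega>1\<close>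
  this makes \<open>d ln \<alpha>m + i(3\<rho>1 - \<rho>2)\<close> and
  \<open>d ln \<alpha>p + i(\<rho>1 - 3\<rho>2)\<close> forms of type (1,0), hence the Hodge duals.
  Their sum contains \<open>4i(\<rho>1 - \<rho>2)\<close>, which is why the exponent -1/4 in
  \<gamma> makes \<open>\<omega>1 / \<gamma>\<close> closed. The equations left are those for
  \<open>d\<rho>1\<close> and \<open>d\<rho>2\<close>; \<open>\<omega>1 \<and> cnj \<omega>1\<close>
  enters them, so they are quadratic in the scale, and scale 1 turns them into combinations of the
  two Laplace equations. On the target side the obstacle is that the almost complex structure and
  the metric are descriptions ranging over all local sections. Evaluating them needs a section
  through every point and a comparison of frames over one line; such frames differ by a factor
  \<open>diag(c, q)\<close> of units, under which the relevant norms are invariant.\<close>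

lemma frechet_derivative_eq:
  assumes "(f has_derivative f') (at p)"
  shows "frechet_derivative f (at p) v = f' v"
  using fun_cong[OF frechet_derivative_at[OF assms], of v] by simp

text \<open>The congruence rule for order \<open>k\<close> is a hypothesis because
  \<open>Ck_on_cong\<close> is itself proved by an induction whose step goes through this lemma;
  \<open>Ck_onI\<close> is the version for use.\<close>

lemma Ck_on_SucI:
  fixes f :: "'a::real_normed_vector \<Rightarrow> 'b::real_normed_vector"
  assumes d: "\<And>p. p \<in> S \<Longrightarrow> (f has_derivative f' p) (at p)"
    and k: "\<And>v. Ck_on k S (\<lambda>p. f' p v)"
    and cong: "\<And>(g::'a::real_normed_vector \<Rightarrow> 'b::real_normed_vector) h.
       (\<And>p. p \<in> S \<Longrightarrow> g p = h p) \<Longrightarrow> Ck_on k S g \<Longrightarrow> Ck_on k S h"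
  shows "Ck_on (Suc k) S f"
proof -
  have "Ck_on k S (\<lambda>p. frechet_derivative f (at p) v)" for v
  proof (rule cong[of "\<lambda>p. f' p v"])
    show "f' p v = frechet_derivative f (at p) v" if "p \<in> S" for p
      by (rule frechet_derivative_eq[OF d[OF that], symmetric])
  qed (rule k)
  then show ?thesis
    using d by (auto simp: differentiable_def)
qed

lemma Ck_on_cong:
  fixes f g :: "'a::real_normed_vector \<Rightarrow> 'b::real_normed_vector"
  assumes "open S" "\<And>p. p \<in> S \<Longrightarrow> f p = g p" "Ck_on k S f"
  shows "Ck_on k S g"
  using assms(2,3)
proof (induction k arbitrary: f g)
  case 0
  then show ?case using continuous_on_cong by force
next
  case (Suc k)
  have d: "(g has_derivative frechet_derivative f (at p)) (at p)" if "p \<in> S" for p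
  proof -
    have "(f has_derivative frechet_derivative f (at p)) (at p)"
      using Suc.prems(2) that by (auto simp: frechet_derivative_works)
    then show ?thesis
      using has_derivative_transform_within_open[OF _ \<open>open S\<close> that] Suc.prems(1) by blast
  qed
  show ?case
    by (rule Ck_on_SucI[OF d]) (use Suc in auto)
qed

lemma Ck_onI:
  assumes "open S" "\<And>p. p \<in> S \<Longrightarrow> (f has_derivative f' p) (at p)"
    and "\<And>v. Ck_on k S (\<lambda>p. f' p v)"
  shows "Ck_on (Suc k) S f"
  by (rule Ck_on_SucI[OF assms(2,3)]) (use Ck_on_cong[OF \<open>open S\<close>] in blast)+

lemma Ck_on_has_derivative:
  assumes "Ck_on (Suc k) S f" "p \<in> S"
  shows "(f has_derivative frechet_derivative f (at p)) (at p)"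
  using assms by (auto simp: frechet_derivative_works)

lemma Ck_on_Suc_D: "Ck_on (Suc k) S f \<Longrightarrow> Ck_on k S f"
proof (induction k arbitrary: f)
  case 0
  then show ?case
    by (auto intro!: continuous_at_imp_continuous_on differentiable_imp_continuous_within)
next
  case (Suc k)
  then show ?case by auto
qed

lemma Ck_on_subset: "Ck_on k S f \<Longrightarrow> T \<subseteq> S \<Longrightarrow> Ck_on k T f"
  by (induction k arbitrary: f) (auto intro: continuous_on_subset)

lemma Ck_on_local:
  assumes "\<And>p. p \<in> S \<Longrightarrow> \<exists>T. open T \<and> p \<in> T \<and> Ck_on k T f"
  shows "Ck_on k S f"
  using assms
proof (induction k arbitrary: f)
  case 0
  then show ?case
    by (metis Ck_on.simps(1) continuous_at_imp_continuous_on continuous_on_eq_continuous_at)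
next
  case (Suc k)
  have "Ck_on k S (\<lambda>p. frechet_derivative f (at p) v)" for v
  proof (rule Suc.IH)
    fix p assume "p \<in> S"
    then show "\<exists>T. open T \<and> p \<in> T \<and> Ck_on k T (\<lambda>p. frechet_derivative f (at p) v)"
      using Suc.prems[of p] by auto
  qed
  moreover have "\<forall>p\<in>S. f differentiable at p"
    using Suc.prems by fastforce
  ultimately show ?case by simp
qed

lemma Ck_on_const [simp]: "Ck_on k S (\<lambda>_. c)"
  by (induction k arbitrary: c) auto

lemma Ck_on_bounded_linear:
  assumes "open S" "bounded_linear L" "Ck_on k S f"
  shows "Ck_on k S (\<lambda>p. L (f p))"
  using assms(3)
proof (induction k arbitrary: f)
  case 0
  then show ?case using assms(2) by (auto intro: bounded_linear.continuous_on)
next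
  case (Suc k)
  show ?case
    by (rule Ck_onI[OF \<open>open S\<close> bounded_linear.has_derivative[OF assms(2) Ck_on_has_derivative[OF Suc.prems]]])
      (use Suc in auto)
qed

lemma Ck_on_add:
  assumes "open S" "Ck_on k S f" "Ck_on k S g"
  shows "Ck_on k S (\<lambda>p. f p + g p)"
  using assms(2,3)
proof (induction k arbitrary: f g)
  case 0
  then show ?case by (auto intro: continuous_intros)
next
  case (Suc k)
  show ?case
    by (rule Ck_onI[OF \<open>open S\<close> has_derivative_add[OF Ck_on_has_derivative[OF Suc.prems(1)] Ck_on_has_derivative[OF Suc.prems(2)]]])
      (use Suc in auto)
qed

lemma Ck_on_bounded_bilinear:
  assumes "open S" "bounded_bilinear B" "Ck_on k S f" "Ck_on k S g"
  shows "Ck_on k S (\<lambda>p. B (f p) (g p))"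
  using assms(3,4)
proof (induction k arbitrary: f g)
  case 0
  then show ?case using assms(2) by (auto intro: bounded_bilinear.continuous_on)
next
  case (Suc k)
  \<comment> \<open>The product rule keeps one factor undifferentiated; that factor is also of class
    k, so the induction hypothesis covers both summands.\<close>
  have "Ck_on k S (\<lambda>p. B (f p) (frechet_derivative g (at p) v) + B (frechet_derivative f (at p) v) (g p))" for v
    by (rule Ck_on_add[OF \<open>open S\<close>]; rule Suc.IH)
      (use Suc.prems Ck_on_Suc_D in auto)
  then show ?case
    by (intro Ck_onI[OF \<open>open S\<close> bounded_bilinear.FDERIV[OF assms(2) Ck_on_has_derivative[OF Suc.prems(1)] Ck_on_has_derivative[OF Suc.prems(2)]]])
qed

lemma Ck_on_sum:
  assumes "open S" "finite I" "\<And>i. i \<in> I \<Longrightarrow> Ck_on k S (f i)"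
  shows "Ck_on k S (\<lambda>p. \<Sum>i\<in>I. f i p)"
  using assms(2,3) by (induction I) (auto intro!: Ck_on_add assms(1))

lemma Ck_on_compose:
  fixes g :: "'a::real_normed_vector \<Rightarrow> 'b::euclidean_space"
  assumes "open S" "open T" "\<And>p. p \<in> S \<Longrightarrow> g p \<in> T" "Ck_on k S g" "Ck_on k T f"
  shows "Ck_on k S (\<lambda>p. f (g p))"
  using assms(4,5)
proof (induction k arbitrary: f)
  case 0
  then show ?case using assms(3) by (auto intro: continuous_on_compose2)
next
  case (Suc k)
  let ?f' = "\<lambda>q. frechet_derivative f (at q)" and ?g' = "\<lambda>p. frechet_derivative g (at p)"
  have d: "((\<lambda>p. f (g p)) has_derivative (\<lambda>v. ?f' (g p) (?g' p v))) (at p)" if "p \<in> S" for p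
    by (rule has_derivative_compose[OF Ck_on_has_derivative[OF Suc.prems(1) that]])
      (use Ck_on_has_derivative[OF Suc.prems(2)] assms(3) that in auto)
  \<comment> \<open>\<open>Ck_on\<close> controls the derivative of f in fixed directions only,
    whereas the chain rule has the moving direction \<open>?g' p v\<close>. Expanding it in the
    basis leaves fixed directions with coefficients of class k.\<close>
  have eq: "(\<Sum>b\<in>Basis. (?g' p v \<bullet> b) *\<^sub>R ?f' (g p) b) = ?f' (g p) (?g' p v)" if "p \<in> S" for p v
  proof -
    have "linear (?f' (g p))"
      using Ck_on_has_derivative[OF Suc.prems(2)] assms(3) that has_derivative_linear by blast
    then have "?f' (g p) (\<Sum>b\<in>Basis. (?g' p v \<bullet> b) *\<^sub>R b) = (\<Sum>b\<in>Basis. (?g' p v \<bullet> b) *\<^sub>R ?f' (g p) b)"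
      by (simp add: linear_sum linear_scale)
    then show ?thesis by (simp add: euclidean_representation)
  qed
  have "Ck_on k S (\<lambda>p. (\<Sum>b\<in>Basis. (?g' p v \<bullet> b) *\<^sub>R ?f' (g p) b))" for v
  proof (intro Ck_on_sum[OF \<open>open S\<close>] Ck_on_bounded_bilinear[OF \<open>open S\<close> bounded_bilinear_scaleR])
    fix b :: 'b
    show "Ck_on k S (\<lambda>p. ?g' p v \<bullet> b)"
      by (rule Ck_on_bounded_linear[OF \<open>open S\<close> bounded_linear_inner_left]) (use Suc.prems in auto)
    show "Ck_on k S (\<lambda>p. ?f' (g p) b)"
      by (rule Suc.IH) (use Suc.prems Ck_on_Suc_D in auto)
  qed auto
  then have k: "Ck_on k S (\<lambda>p. ?f' (g p) (?g' p v))" for v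
    by (rule Ck_on_cong[OF \<open>open S\<close> eq, rotated])
  show ?case
    by (rule Ck_onI[OF \<open>open S\<close> d]) (assumption, rule k)
qed

section \<open>Smooth maps on open sets\<close>

lemma smooth_on_open: "smooth_on S f \<Longrightarrow> open S"
  by (simp add: smooth_on_def)

lemma smooth_on_has_derivative:
  "smooth_on S f \<Longrightarrow> p \<in> S \<Longrightarrow> (f has_derivative frechet_derivative f (at p)) (at p)"
  unfolding smooth_on_def using Ck_on_has_derivative by blast

lemma smooth_on_imp_continuous_on: "smooth_on S f \<Longrightarrow> continuous_on S f"
  unfolding smooth_on_def using Ck_on.simps(1) by blast

lemma smooth_on_derivative: "smooth_on S f \<Longrightarrow> smooth_on S (\<lambda>p. frechet_derivative f (at p) v)"
  unfolding smooth_on_def using Ck_on.simps(2) by blast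

lemma smooth_on_cong:
  "smooth_on S f \<Longrightarrow> (\<And>p. p \<in> S \<Longrightarrow> f p = g p) \<Longrightarrow> smooth_on S g"
  unfolding smooth_on_def using Ck_on_cong by blast

lemma smooth_on_subset: "smooth_on S f \<Longrightarrow> open T \<Longrightarrow> T \<subseteq> S \<Longrightarrow> smooth_on T f"
  unfolding smooth_on_def using Ck_on_subset by blast

lemma smooth_on_local:
  assumes "\<And>p. p \<in> S \<Longrightarrow> \<exists>T. p \<in> T \<and> smooth_on T f" "open S"
  shows "smooth_on S f"
  unfolding smooth_on_def
proof (intro conjI allI assms(2) Ck_on_local)
  fix k p assume "p \<in> S"
  then show "\<exists>T. open T \<and> p \<in> T \<and> Ck_on k T f"
    using assms(1)[of p] unfolding smooth_on_def by auto
qed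

lemma smooth_on_const: "open S \<Longrightarrow> smooth_on S (\<lambda>_. c)"
  by (simp add: smooth_on_def)

lemma smooth_on_bounded_linear:
  "smooth_on S f \<Longrightarrow> bounded_linear L \<Longrightarrow> smooth_on S (\<lambda>p. L (f p))"
  by (simp add: smooth_on_def Ck_on_bounded_linear)

lemma smooth_on_id: "open S \<Longrightarrow> smooth_on S (\<lambda>p. p)"
proof -
  assume S: "open S"
  have "Ck_on k S (\<lambda>p. p)" for k
  proof (cases k)
    case (Suc n)
    then show ?thesis using Ck_onI[OF S has_derivative_ident] by auto
  qed simp
  with S show ?thesis by (simp add: smooth_on_def)
qed

lemma smooth_on_linear:
  fixes L :: "'a::euclidean_space \<Rightarrow> 'b::real_normed_vector"
  shows "smooth_on S f \<Longrightarrow> linear L \<Longrightarrow> smooth_on S (\<lambda>p. L (f p))"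
  by (simp add: smooth_on_bounded_linear linear_conv_bounded_linear)

lemma smooth_on_bounded_bilinear:
  "bounded_bilinear B \<Longrightarrow> smooth_on S f \<Longrightarrow> smooth_on S g \<Longrightarrow> smooth_on S (\<lambda>p. B (f p) (g p))"
  by (simp add: smooth_on_def Ck_on_bounded_bilinear)

lemma smooth_on_add: "smooth_on S f \<Longrightarrow> smooth_on S g \<Longrightarrow> smooth_on S (\<lambda>p. f p + g p)"
  by (simp add: smooth_on_def Ck_on_add)

lemma smooth_on_minus: "smooth_on S f \<Longrightarrow> smooth_on S (\<lambda>p. - f p)"
  using smooth_on_bounded_linear[OF _ bounded_linear_minus[OF bounded_linear_ident]] .

lemma smooth_on_diff: "smooth_on S f \<Longrightarrow> smooth_on S g \<Longrightarrow> smooth_on S (\<lambda>p. f p - g p)"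
  using smooth_on_add[OF _ smooth_on_minus] by fastforce

lemma smooth_on_mult:
  fixes f g :: "_ \<Rightarrow> 'b::real_normed_algebra"
  shows "smooth_on S f \<Longrightarrow> smooth_on S g \<Longrightarrow> smooth_on S (\<lambda>p. f p * g p)"
  by (rule smooth_on_bounded_bilinear[OF bounded_bilinear_mult])

lemma smooth_on_scaleR:
  "smooth_on S f \<Longrightarrow> smooth_on S g \<Longrightarrow> smooth_on S (\<lambda>p. f p *\<^sub>R g p)"
  by (rule smooth_on_bounded_bilinear[OF bounded_bilinear_scaleR])

lemma smooth_on_inner:
  "smooth_on S f \<Longrightarrow> smooth_on S g \<Longrightarrow> smooth_on S (\<lambda>p. f p \<bullet> g p)"
  by (rule smooth_on_bounded_bilinear[OF bounded_bilinear_inner])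

lemma smooth_on_compose:
  fixes g :: "'a::real_normed_vector \<Rightarrow> 'b::euclidean_space"
  assumes "smooth_on S g" "smooth_on T f" "\<And>p. p \<in> S \<Longrightarrow> g p \<in> T"
  shows "smooth_on S (\<lambda>p. f (g p))"
  using assms unfolding smooth_on_def by (auto intro!: Ck_on_compose[of S T g _ f])

lemma smooth_on_of_real: "smooth_on S f \<Longrightarrow> smooth_on S (\<lambda>p. complex_of_real (f p))"
  by (rule smooth_on_bounded_linear[OF _ bounded_linear_of_real])

lemma smooth_on_cnj: "smooth_on S f \<Longrightarrow> smooth_on S (\<lambda>p. cnj (f p))"
  by (rule smooth_on_bounded_linear[OF _ bounded_linear_cnj])

lemma smooth_on_Pair:
  assumes "smooth_on S f" "smooth_on S g"
  shows "smooth_on S (\<lambda>p. (f p, g p))"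
proof -
  have "smooth_on S (\<lambda>p. (f p, 0) + (0, g p))"
    by (intro smooth_on_add smooth_on_bounded_linear[OF assms(1)] smooth_on_bounded_linear[OF assms(2)]
        bounded_linear_Pair bounded_linear_ident bounded_linear_zero)
  then show ?thesis by simp
qed

lemma smooth_on_vec_nth: "smooth_on S f \<Longrightarrow> smooth_on S (\<lambda>p. f p $ i)"
  by (rule smooth_on_bounded_linear[OF _ bounded_linear_vec_nth])

lemma smooth_on_powr: "smooth_on {0<..} (\<lambda>t::real. t powr a)"
proof -
  have "Ck_on k {0<..} (\<lambda>t::real. t powr a)" for k
  \<comment> \<open>The exponent must be arbitrary, since differentiation lowers it by 1.\<close>
  proof (induction k arbitrary: a)
    case 0
    then show ?case by (auto intro!: continuous_intros)
  next
    case (Suc k)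
    have d: "((\<lambda>t. t powr a) has_derivative (\<lambda>v. (a * p powr (a - 1)) * v)) (at p)"
      if "p \<in> {0<..}" for p
      using has_real_derivative_powr[of p a] that by (simp add: has_field_derivative_def)
    have k: "Ck_on k {0<..} (\<lambda>p. (a * p powr (a - 1)) * v)" for v
      by (rule Ck_on_bounded_linear[OF open_greaterThan _ Suc, of "\<lambda>t. (a * t) * v"])
        (intro bounded_linear_mult_const bounded_linear_const_mult bounded_linear_ident)
    show ?case by (rule Ck_onI[OF open_greaterThan d]) (assumption, rule k)
  qed
  then show ?thesis by (simp add: smooth_on_def)
qed

lemma smooth_on_ln: "smooth_on {0<..} (ln :: real \<Rightarrow> real)"
proof -
  have "Ck_on k {0<..} (ln :: real \<Rightarrow> real)" for k
  proof (cases k)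
    case 0
    then show ?thesis by (auto intro!: continuous_intros)
  next
    case (Suc n)
    have d: "(ln has_derivative (\<lambda>v. p powr (-1) * v)) (at p)" if "p \<in> {0<..}" for p :: real
      using DERIV_ln[of p] that by (simp add: has_field_derivative_def powr_minus)
    have k: "Ck_on n {0<..} (\<lambda>p::real. p powr (-1) * v)" for v
      by (rule Ck_on_bounded_linear[OF open_greaterThan bounded_linear_mult_left])
        (use smooth_on_powr[of "-1"] in \<open>simp only: smooth_on_def\<close>)
    show ?thesis unfolding Suc by (rule Ck_onI[OF open_greaterThan d]) (assumption, rule k)
  qed
  then show ?thesis by (simp add: smooth_on_def)
qed

text \<open>Complex differentiation stays within the holomorphic functions, and the real derivative
  is multiplication by the complex one, so an induction on the order closes up.\<close>

lemma smooth_on_holomorphic: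
  assumes "open S" "f holomorphic_on S"
  shows "smooth_on S f"
proof -
  have "Ck_on k S f" for k
    using assms(2)
  proof (induction k arbitrary: f)
    case 0
    then show ?case by (simp add: holomorphic_on_imp_continuous_on)
  next
    case (Suc k)
    have d: "(f has_derivative (\<lambda>v. deriv f p * v)) (at p)" if "p \<in> S" for p
      using holomorphic_derivI[OF Suc.prems \<open>open S\<close> that] by (simp add: has_field_derivative_def)
    show ?case
      by (rule Ck_onI[OF \<open>open S\<close> d], assumption)
        (rule Ck_on_bounded_linear[OF \<open>open S\<close> bounded_linear_mult_left Suc.IH], rule holomorphic_deriv[OF Suc.prems \<open>open S\<close>])
  qed
  with assms show ?thesis by (simp add: smooth_on_def)
qed

section \<open>Symmetry of second derivatives\<close>

lemma second_difference_mean_value: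
  fixes f :: "'a::real_normed_vector \<Rightarrow> real"
  assumes "h > 0"
    and R: "\<And>s t. 0 \<le> s \<Longrightarrow> s \<le> h \<Longrightarrow> 0 \<le> t \<Longrightarrow> t \<le> h \<Longrightarrow> p + s *\<^sub>R u + t *\<^sub>R v \<in> S"
    and f: "\<And>q. q \<in> S \<Longrightarrow> (f has_derivative f' q) (at q)"
    and g: "\<And>q. q \<in> S \<Longrightarrow> ((\<lambda>q. f' q u) has_derivative g' q) (at q)"
  shows "\<exists>s t. 0 \<le> s \<and> s \<le> h \<and> 0 \<le> t \<and> t \<le> h \<and>
    f (p + h *\<^sub>R u + h *\<^sub>R v) - f (p + h *\<^sub>R u) - f (p + h *\<^sub>R v) + f p
      = h * h * g' (p + s *\<^sub>R u + t *\<^sub>R v) v"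
proof -
  \<comment> \<open>The second difference is \<open>\<phi> h - \<phi> 0\<close>. The mean value
    theorem in the direction u, followed by one for \<open>\<psi>\<close> in the direction v, turns
    it into a second derivative at a point of the parallelogram. The second difference itself is
    symmetric in u and v, which is what the comparison of mixed derivatives exploits.\<close>
  define \<phi> where "\<phi> s = f (p + s *\<^sub>R u + h *\<^sub>R v) - f (p + s *\<^sub>R u)" for s
  have lin: "f' q (x *\<^sub>R w) = x * f' q w" if "q \<in> S" for q x w
    using has_derivative_linear[OF f[OF that]] linear_scale by fastforce
  have ling: "g' q (x *\<^sub>R w) = x * g' q w" if "q \<in> S" for q x w
    using has_derivative_linear[OF g[OF that]] linear_scale by fastforce
  have R0: "p + s *\<^sub>R u \<in> S" if "0 \<le> s" "s \<le> h" for s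
    using R[of s 0] that \<open>h > 0\<close> by simp
  have d\<phi>: "(\<phi> has_real_derivative f' (p + s *\<^sub>R u + h *\<^sub>R v) u - f' (p + s *\<^sub>R u) u) (at s)"
    if s: "0 \<le> s" "s \<le> h" for s
  proof -
    have "((\<lambda>s. f (p + s *\<^sub>R u + h *\<^sub>R v)) has_derivative (\<lambda>x. f' (p + s *\<^sub>R u + h *\<^sub>R v) (x *\<^sub>R u))) (at s)"
      by (rule has_derivative_compose[OF _ f]) (use R[of s h] s \<open>h > 0\<close> in \<open>auto intro!: derivative_eq_intros\<close>)
    moreover have "((\<lambda>s. f (p + s *\<^sub>R u)) has_derivative (\<lambda>x. f' (p + s *\<^sub>R u) (x *\<^sub>R u))) (at s)"
      by (rule has_derivative_compose[OF _ f]) (use R0[of s] s \<open>h > 0\<close> in \<open>auto intro!: derivative_eq_intros\<close>)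
    ultimately have "(\<phi> has_derivative (\<lambda>x. f' (p + s *\<^sub>R u + h *\<^sub>R v) (x *\<^sub>R u) - f' (p + s *\<^sub>R u) (x *\<^sub>R u))) (at s)"
      unfolding \<phi>_def by (rule has_derivative_diff)
    then have "(\<phi> has_derivative (\<lambda>x. x * (f' (p + s *\<^sub>R u + h *\<^sub>R v) u - f' (p + s *\<^sub>R u) u))) (at s)"
      using lin R[of s h] R0[of s] s \<open>h > 0\<close> by (simp add: right_diff_distrib)
    then show ?thesis
      by (simp only: has_field_derivative_def mult_commute_abs)
  qed
  obtain s where s: "0 < s" "s < h" and 1: "\<phi> h - \<phi> 0 = (h - 0) * (f' (p + s *\<^sub>R u + h *\<^sub>R v) u - f' (p + s *\<^sub>R u) u)"
    using MVT2[OF \<open>h > 0\<close> d\<phi>] by blast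
  define \<psi> where "\<psi> t = f' (p + s *\<^sub>R u + t *\<^sub>R v) u" for t
  have d\<psi>: "(\<psi> has_real_derivative g' (p + s *\<^sub>R u + t *\<^sub>R v) v) (at t)" if t: "0 \<le> t" "t \<le> h" for t
  proof -
    have "(\<psi> has_derivative (\<lambda>x. g' (p + s *\<^sub>R u + t *\<^sub>R v) (x *\<^sub>R v))) (at t)"
      unfolding \<psi>_def
      by (rule has_derivative_compose[OF _ g]) (use R[of s t] s t \<open>h > 0\<close> in \<open>auto intro!: derivative_eq_intros\<close>)
    then have "(\<psi> has_derivative (\<lambda>x. x * g' (p + s *\<^sub>R u + t *\<^sub>R v) v)) (at t)"
      using ling R[of s t] s t by simp
    then show ?thesis
      by (simp only: has_field_derivative_def mult_commute_abs)
  qed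
  obtain t where t: "0 < t" "t < h" and 2: "\<psi> h - \<psi> 0 = (h - 0) * g' (p + s *\<^sub>R u + t *\<^sub>R v) v"
    using MVT2[OF \<open>h > 0\<close> d\<psi>] by blast
  show ?thesis
    using 1 2 s t by (intro exI[of _ s] exI[of _ t]) (auto simp: \<phi>_def \<psi>_def algebra_simps)
qed

lemma mixed_partials_real:
  fixes f :: "'a::real_normed_vector \<Rightarrow> real"
  assumes "smooth_on S f" "p \<in> S"
  shows "frechet_derivative (\<lambda>q. frechet_derivative f (at q) u) (at p) v =
    frechet_derivative (\<lambda>q. frechet_derivative f (at q) v) (at p) u"
proof (rule ccontr)
  let ?D = "\<lambda>u v q. frechet_derivative (\<lambda>q. frechet_derivative f (at q) u) (at q) v"
  assume ne: "\<not> ?thesis"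
  \<comment> \<open>Half the gap between the two mixed derivatives: near p each stays within
    \<open>e\<close> of its value at p, so a value of one cannot equal a value of the other
    there.\<close>
  define e where "e = \<bar>?D u v p - ?D v u p\<bar> / 2"
  have e: "\<bar>?D u v p - ?D v u p\<bar> = 2 * e" and "e > 0" using ne by (auto simp: e_def)
  have S: "open S" using assms smooth_on_open by blast
  have c: "isCont (?D u v) p" for u v
    using smooth_on_imp_continuous_on[OF smooth_on_derivative[OF smooth_on_derivative[OF assms(1)]]]
      S assms(2) continuous_on_eq_continuous_at by blast
  from S assms(2) obtain r0 where r0: "r0 > 0" "ball p r0 \<subseteq> S" by (meson openE)
  from c[of u v] \<open>e > 0\<close> obtain r1 where r1: "r1 > 0" "\<And>q. dist q p < r1 \<Longrightarrow> dist (?D u v q) (?D u v p) < e"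
    unfolding continuous_at_eps_delta by blast
  from c[of v u] \<open>e > 0\<close> obtain r2 where r2: "r2 > 0" "\<And>q. dist q p < r2 \<Longrightarrow> dist (?D v u q) (?D v u p) < e"
    unfolding continuous_at_eps_delta by blast
  define r where "r = min r0 (min r1 r2)"
  have "r > 0" using r0 r1 r2 by (simp add: r_def)
  \<comment> \<open>Chosen so that the parallelogram spanned by \<open>h u\<close> and
    \<open>h v\<close> stays in the ball of radius r; the summand 1 keeps the denominator
    positive.\<close>
  define h where "h = r / (2 * (norm u + norm v + 1))"
  define n where "n = norm u + norm v + 1"
  have "n > 0" using norm_ge_zero[of u] norm_ge_zero[of v] unfolding n_def by linarith
  then have "h > 0" using \<open>r > 0\<close> by (simp add: h_def n_def)
  have h: "h * (norm u + norm v) < r"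
  proof -
    have "h * (norm u + norm v) \<le> h * n" using \<open>h > 0\<close> by (simp add: n_def)
    also have "\<dots> = r / 2"
      using \<open>n > 0\<close> unfolding h_def n_def[symmetric] by simp
    finally show ?thesis using \<open>r > 0\<close> by simp
  qed
  have R: "dist (p + s *\<^sub>R u + t *\<^sub>R v) p < r" if "0 \<le> s" "s \<le> h" "0 \<le> t" "t \<le> h" for s t
  proof -
    have "norm (s *\<^sub>R u + t *\<^sub>R v) \<le> s * norm u + t * norm v"
      using that norm_triangle_ineq[of "s *\<^sub>R u" "t *\<^sub>R v"] by simp
    also have "\<dots> \<le> h * norm u + h * norm v"
      using that by (intro add_mono mult_right_mono) auto
    finally show ?thesis using h by (simp add: dist_norm distrib_left add.assoc)
  qed
  have R': "dist (p + t *\<^sub>R v + s *\<^sub>R u) p < r" if "0 \<le> s" "s \<le> h" "0 \<le> t" "t \<le> h" for s t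
    using R[OF that] by (simp add: add_ac)
  have mem: "q \<in> S" if "dist q p < r" for q
    using that r0 by (auto simp: r_def dist_commute)
  note f = smooth_on_has_derivative[OF assms(1)]
    and g = smooth_on_has_derivative[OF smooth_on_derivative[OF assms(1)]]
  note mv = second_difference_mean_value[OF \<open>h > 0\<close>, where S = S and f = f
      and f' = "\<lambda>q. frechet_derivative f (at q)" and p = p]
  obtain s t where 1: "0 \<le> s" "s \<le> h" "0 \<le> t" "t \<le> h"
    "f (p + h *\<^sub>R u + h *\<^sub>R v) - f (p + h *\<^sub>R u) - f (p + h *\<^sub>R v) + f p
      = h * h * ?D u v (p + s *\<^sub>R u + t *\<^sub>R v)"
    using mv[where u = u and v = v and g' = "\<lambda>q. frechet_derivative (\<lambda>q. frechet_derivative f (at q) u) (at q)"]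
      mem[OF R] f g by auto
  obtain s' t' where 2: "0 \<le> s'" "s' \<le> h" "0 \<le> t'" "t' \<le> h"
    "f (p + h *\<^sub>R v + h *\<^sub>R u) - f (p + h *\<^sub>R v) - f (p + h *\<^sub>R u) + f p
      = h * h * ?D v u (p + s' *\<^sub>R v + t' *\<^sub>R u)"
    using mv[where u = v and v = u and g' = "\<lambda>q. frechet_derivative (\<lambda>q. frechet_derivative f (at q) v) (at q)"]
      mem[OF R'] f g by auto
  have "p + h *\<^sub>R v + h *\<^sub>R u = p + h *\<^sub>R u + h *\<^sub>R v" by (simp add: add_ac)
  then have "h * h * ?D u v (p + s *\<^sub>R u + t *\<^sub>R v) = h * h * ?D v u (p + s' *\<^sub>R v + t' *\<^sub>R u)"
    using 1(5) 2(5) by (metis diff_diff_eq add.commute)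
  then have "?D u v (p + s *\<^sub>R u + t *\<^sub>R v) = ?D v u (p + s' *\<^sub>R v + t' *\<^sub>R u)"
    using \<open>h > 0\<close> by simp
  moreover have "dist (?D u v (p + s *\<^sub>R u + t *\<^sub>R v)) (?D u v p) < e"
    using r1(2) R[OF 1(1-4)] by (simp add: r_def)
  moreover have "dist (?D v u (p + s' *\<^sub>R v + t' *\<^sub>R u)) (?D v u p) < e"
    using r2(2) R'[OF 2(3,4,1,2)] by (simp add: r_def)
  ultimately show False
    unfolding dist_real_def using e by linarith
qed

lemma mixed_partials:
  fixes f :: "'a::real_normed_vector \<Rightarrow> 'b::euclidean_space"
  assumes "smooth_on S f" "p \<in> S"
  shows "frechet_derivative (\<lambda>q. frechet_derivative f (at q) u) (at p) v =
    frechet_derivative (\<lambda>q. frechet_derivative f (at q) v) (at p) u"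
proof (rule euclidean_eqI)
  fix b :: 'b assume "b \<in> Basis"
  have S: "open S" using assms smooth_on_open by blast
  have sb: "smooth_on S (\<lambda>q. f q \<bullet> b)"
    using smooth_on_bounded_linear[OF assms(1) bounded_linear_inner_left] .
  have fd: "frechet_derivative (\<lambda>q. g q \<bullet> b) (at q) w = frechet_derivative g (at q) w \<bullet> b"
    if "smooth_on S g" "q \<in> S" for g :: "'a \<Rightarrow> 'b" and q w
    by (rule frechet_derivative_eq[OF bounded_linear.has_derivative[OF bounded_linear_inner_left smooth_on_has_derivative[OF that]]])
  have fd2: "frechet_derivative (\<lambda>q. frechet_derivative (\<lambda>q. f q \<bullet> b) (at q) w) (at p) w'
      = frechet_derivative (\<lambda>q. frechet_derivative f (at q) w) (at p) w' \<bullet> b" for w w'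
  proof -
    have d: "((\<lambda>q. frechet_derivative f (at q) w \<bullet> b) has_derivative
        (\<lambda>w'. frechet_derivative (\<lambda>q. frechet_derivative f (at q) w) (at p) w' \<bullet> b)) (at p)"
      using bounded_linear.has_derivative[OF bounded_linear_inner_left
          smooth_on_has_derivative[OF smooth_on_derivative[OF assms(1)] assms(2)]] .
    have "((\<lambda>q. frechet_derivative (\<lambda>q. f q \<bullet> b) (at q) w) has_derivative
        (\<lambda>w'. frechet_derivative (\<lambda>q. frechet_derivative f (at q) w) (at p) w' \<bullet> b)) (at p)"
      by (rule has_derivative_transform_within_open[OF d S assms(2)]) (simp add: fd[OF assms(1)])
    then show ?thesis by (rule frechet_derivative_eq)
  qed
  show "frechet_derivative (\<lambda>q. frechet_derivative f (at q) u) (at p) v \<bullet> b =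
    frechet_derivative (\<lambda>q. frechet_derivative f (at q) v) (at p) u \<bullet> b"
    using mixed_partials_real[OF sb assms(2), of u v] by (simp add: fd2)
qed

section \<open>Quaternionic matrices\<close>

abbreviation qmat_times :: "quat^2^2 \<Rightarrow> quat^2^2 \<Rightarrow> quat^2^2" (infixl "\<odot>" 70)
  where "A \<odot> B \<equiv> qmat_mult A B"

definition qid :: "quat^2^2" where
  "qid = (\<chi> i k. if i = k then (1, 0) else 0)"

definition qmat :: "quat \<Rightarrow> quat \<Rightarrow> quat \<Rightarrow> quat \<Rightarrow> quat^2^2" where
  "qmat a b c d = vector [vector [a, b], vector [c, d]]"

lemma qmat_nth [simp]:
  "qmat a b c d $ 1 $ 1 = a" "qmat a b c d $ 1 $ 2 = b"
  "qmat a b c d $ 2 $ 1 = c" "qmat a b c d $ 2 $ 2 = d"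
  by (simp_all add: qmat_def)

lemma qmat_eq_iff:
  "A = B \<longleftrightarrow> A $ 1 $ 1 = B $ 1 $ 1 \<and> A $ 1 $ 2 = B $ 1 $ 2 \<and> A $ 2 $ 1 = B $ 2 $ 1 \<and> A $ 2 $ 2 = B $ 2 $ 2"
  for A B :: "quat^2^2"
  by (auto simp: vec_eq_iff forall_2)

lemma qid_nth [simp]:
  "qid $ 1 $ 1 = (1, 0)" "qid $ 1 $ 2 = 0" "qid $ 2 $ 1 = 0" "qid $ 2 $ 2 = (1, 0)"
  by (simp_all add: qid_def)

lemma Sp2_iff: "A \<in> Sp2 \<longleftrightarrow> qadjoint A \<odot> A = qid"
  by (simp add: Sp2_def qid_def)

lemma qmat_mult_nth: "(A \<odot> B) $ i $ k = qmult (A $ i $ 1) (B $ 1 $ k) + qmult (A $ i $ 2) (B $ 2 $ k)"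
  by (simp add: qmat_mult_def sum_2)

lemma qadjoint_nth [simp]: "qadjoint A $ i $ k = qcnj (A $ k $ i)"
  by (simp add: qadjoint_def)

lemma qmult_assoc: "qmult (qmult p q) r = qmult p (qmult q r)"
  by (simp add: qmult_def algebra_simps)

lemma qmult_add: "qmult (p + p') q = qmult p q + qmult p' q" "qmult p (q + q') = qmult p q + qmult p q'"
  by (simp_all add: qmult_def algebra_simps prod_eq_iff)

lemma qmult_scaleR: "qmult (x *\<^sub>R p) q = x *\<^sub>R qmult p q" "qmult p (x *\<^sub>R q) = x *\<^sub>R qmult p q"
  by (simp_all add: qmult_def scaleR_conv_of_real algebra_simps prod_eq_iff)

lemma qmult_0 [simp]: "qmult 0 q = 0" "qmult p 0 = 0"
  by (simp_all add: qmult_def prod_eq_iff)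

lemma qmult_1 [simp]: "qmult (1, 0) q = q" "qmult p (1, 0) = p"
  by (simp_all add: qmult_def prod_eq_iff)

lemma qcnj_qmult: "qcnj (qmult p q) = qmult (qcnj q) (qcnj p)"
  by (simp add: qmult_def qcnj_def algebra_simps)

lemma qcnj_add: "qcnj (p + q) = qcnj p + qcnj q"
  by (simp add: qcnj_def)

lemma qcnj_qcnj [simp]: "qcnj (qcnj p) = p"
  by (simp add: qcnj_def)

lemma qcnj_0 [simp]: "qcnj 0 = 0" and qcnj_1 [simp]: "qcnj (1, 0) = (1, 0)"
  by (simp_all add: qcnj_def prod_eq_iff)

lemma linear_qcnj: "linear qcnj"
  by (rule linearI) (simp_all add: qcnj_def scaleR_conv_of_real prod_eq_iff)

lemma bounded_bilinear_qmult: "bounded_bilinear qmult"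
proof -
  have "bilinear qmult"
    unfolding bilinear_def by (intro conjI allI linearI) (simp_all add: qmult_add qmult_scaleR)
  then show ?thesis by (simp add: bilinear_conv_bounded_bilinear)
qed

lemma norm_quat: "(norm p)\<^sup>2 = (cmod (fst p))\<^sup>2 + (cmod (snd p))\<^sup>2" for p :: quat
  by (cases p) (simp add: norm_Pair)

text \<open>After expansion into real and imaginary parts this is Euler's four-square
  identity.\<close>

lemma norm_qmult: "norm (qmult p q) = norm p * norm q"
proof -
  have "(norm (qmult p q))\<^sup>2 = (norm p * norm q)\<^sup>2"
    unfolding power_mult_distrib norm_quat cmod_power2
    by (simp add: qmult_def power2_eq_square algebra_simps)
  then show ?thesis by simp
qed

lemma norm_qcnj: "norm (qcnj p) = norm p"
  by (cases p) (simp add: qcnj_def norm_Pair)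

lemma qcnj_qmult_self: "qmult (qcnj p) p = (of_real ((norm p)\<^sup>2), 0)"
  unfolding norm_quat cmod_power2
  by (simp add: qmult_def qcnj_def complex_eq_iff power2_eq_square algebra_simps)

lemma qmult_complex: "qmult p (c, 0) = (fst p * c, snd p * c)" "qmult (c, 0) p = (c * fst p, cnj c * snd p)"
  by (simp_all add: qmult_def)

lemma qmat_mult_assoc: "(A \<odot> B) \<odot> C = A \<odot> (B \<odot> C)"
  by (simp add: vec_eq_iff qmat_mult_nth qmult_add qmult_assoc)

lemma qmat_mult_add: "(A + A') \<odot> B = A \<odot> B + A' \<odot> B" "A \<odot> (B + B') = A \<odot> B + A \<odot> B'"
  by (simp_all add: vec_eq_iff qmat_mult_nth qmult_add algebra_simps)

lemma qmat_mult_scaleR: "(x *\<^sub>R A) \<odot> B = x *\<^sub>R (A \<odot> B)" "A \<odot> (x *\<^sub>R B) = x *\<^sub>R (A \<odot> B)"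
  by (simp_all add: vec_eq_iff qmat_mult_nth qmult_scaleR algebra_simps)

lemma bounded_bilinear_qmat_mult: "bounded_bilinear qmat_mult"
proof -
  have "bilinear qmat_mult"
    unfolding bilinear_def by (auto intro!: linearI simp: qmat_mult_add qmat_mult_scaleR)
  then show ?thesis by (simp add: bilinear_conv_bounded_bilinear)
qed

interpretation qmat_mult: bounded_bilinear qmat_mult
  by (rule bounded_bilinear_qmat_mult)

lemma linear_qadjoint: "linear qadjoint"
  by (rule linearI)
    (auto simp: vec_eq_iff qcnj_add linear_scale[OF linear_qcnj])

lemma bounded_linear_qadjoint: "bounded_linear qadjoint"
  using linear_qadjoint linear_conv_bounded_linear by blast

lemma qmat_mult_id [simp]: "qid \<odot> A = A" "A \<odot> qid = A"
  by (simp_all add: qmat_eq_iff qmat_mult_nth)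

lemma qadjoint_mult: "qadjoint (A \<odot> B) = qadjoint B \<odot> qadjoint A"
  by (simp add: vec_eq_iff qmat_mult_nth qcnj_add qcnj_qmult)

lemma qadjoint_qadjoint [simp]: "qadjoint (qadjoint A) = A"
  by (simp add: vec_eq_iff)

lemma qadjoint_qid [simp]: "qadjoint qid = qid"
  by (simp add: qmat_eq_iff)

text \<open>Left multiplication by \<open>A\<close> is an endomorphism of a finite-dimensional space, so a left
  inverse of \<open>A\<close> is also a right inverse.\<close>

lemma Sp2_right:
  assumes "A \<in> Sp2"
  shows "A \<odot> qadjoint A = qid"
proof -
  have lin: "linear ((\<odot>) B)" for B
    by (rule linearI) (simp_all add: qmat_mult_add qmat_mult_scaleR)
  have "(\<odot>) (qadjoint A) \<circ> (\<odot>) A = id"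
    using assms by (auto simp: Sp2_iff fun_eq_iff qmat_mult_assoc[symmetric])
  then have "(\<odot>) A \<circ> (\<odot>) (qadjoint A) = id"
    using linear_inverse_left[OF lin lin] by blast
  then show ?thesis
    by (metis comp_apply id_apply qmat_mult_id(2))
qed

lemma Sp2_qadjoint: "A \<in> Sp2 \<Longrightarrow> qadjoint A \<in> Sp2"
  using Sp2_right by (simp add: Sp2_iff)

lemma Sp2_cancel:
  assumes "A \<in> Sp2"
  shows "qadjoint A \<odot> (A \<odot> B) = B" "A \<odot> (qadjoint A \<odot> B) = B"
    "(B \<odot> A) \<odot> qadjoint A = B" "(B \<odot> qadjoint A) \<odot> A = B"
  using assms Sp2_right[OF assms]
  by (simp_all add: Sp2_iff qmat_mult_assoc[of B] flip: qmat_mult_assoc[of "qadjoint A"] qmat_mult_assoc[of A])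

lemma Sp2_mult: "A \<in> Sp2 \<Longrightarrow> B \<in> Sp2 \<Longrightarrow> A \<odot> B \<in> Sp2"
  unfolding Sp2_iff by (metis qadjoint_mult qmat_mult_assoc qmat_mult_id(2) qmat_mult_id(1))

lemma qid_Sp2 [simp]: "qid \<in> Sp2"
  by (simp add: Sp2_iff)

lemma qmat_add: "qmat a b c d + qmat a' b' c' d' = qmat (a + a') (b + b') (c + c') (d + d')"
  by (simp add: qmat_eq_iff)

lemma qmat_diff: "qmat a b c d - qmat a' b' c' d' = qmat (a - a') (b - b') (c - c') (d - d')"
  by (simp add: qmat_eq_iff)

lemma bounded_linear_qmat: "bounded_linear (\<lambda>(a, b, c, d). qmat a b c d)"
proof -
  have "linear (\<lambda>(a, b, c, d). qmat a b c d)"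
    by (rule linearI) (auto simp: qmat_eq_iff)
  then show ?thesis by (simp add: linear_conv_bounded_linear)
qed

section \<open>The action on complex 4-space\<close>

lemma vector_4 [simp]:
  "(vector [a, b, c, d] :: 'a::zero^4) $ 1 = a" "(vector [a, b, c, d] :: 'a^4) $ 2 = b"
  "(vector [a, b, c, d] :: 'a^4) $ 3 = c" "(vector [a, b, c, d] :: 'a^4) $ 4 = d"
  unfolding vector_def by simp_all

lemma vec4_eq_iff: "z = w \<longleftrightarrow> z $ 1 = w $ 1 \<and> z $ 2 = w $ 2 \<and> z $ 3 = w $ 3 \<and> z $ 4 = w $ 4"
  for z w :: "'a^4"
  by (auto simp: vec_eq_iff forall_4)

lemma to_H2_nth [simp]: "to_H2 z $ 1 = (z $ 1, z $ 2)" "to_H2 z $ 2 = (z $ 3, z $ 4)"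
  by (simp_all add: to_H2_def)

lemma of_H2_nth [simp]: "of_H2 q $ 1 = fst (q $ 1)" "of_H2 q $ 2 = snd (q $ 1)"
  "of_H2 q $ 3 = fst (q $ 2)" "of_H2 q $ 4 = snd (q $ 2)"
  by (simp_all add: of_H2_def)

lemma H2_inverse [simp]: "of_H2 (to_H2 z) = z" "to_H2 (of_H2 q) = q"
  by (simp_all add: vec4_eq_iff vec_eq_iff[of _ q] forall_2)

lemma linear_to_H2: "linear to_H2"
  by (rule linearI) (simp_all add: vec_eq_iff forall_2)

lemma linear_of_H2: "linear of_H2"
  by (rule linearI) (simp_all add: vec4_eq_iff)

lemma to_H2_cscale: "to_H2 (c *s z) $ i = qmult (to_H2 z $ i) (c, 0)"
  using exhaust_2[of i] by (auto simp: qmult_complex mult.commute)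

lemma qmat_vec_nth: "qmat_vec A q $ i = qmult (A $ i $ 1) (q $ 1) + qmult (A $ i $ 2) (q $ 2)"
  by (simp add: qmat_vec_def sum_2)

lemma qmat_vec_mult: "qmat_vec (A \<odot> B) q = qmat_vec A (qmat_vec B q)"
  by (simp add: vec_eq_iff qmat_vec_nth qmat_mult_nth qmult_add qmult_assoc)

lemma qmat_vec_id [simp]: "qmat_vec qid q = q"
  by (simp add: vec_eq_iff forall_2 qmat_vec_nth)

lemma qmat_vec_linear: "linear (qmat_vec A)"
  by (rule linearI) (simp_all add: vec_eq_iff qmat_vec_nth qmult_add qmult_scaleR algebra_simps)

definition act4 :: "quat^2^2 \<Rightarrow> complex^4 \<Rightarrow> complex^4" where
  "act4 A z = of_H2 (qmat_vec A (to_H2 z))"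

lemma act4_mult: "act4 (A \<odot> B) z = act4 A (act4 B z)"
  by (simp add: act4_def qmat_vec_mult)

lemma act4_id [simp]: "act4 qid z = z"
  by (simp add: act4_def)

text \<open>Complex scalars multiply quaternions from the right and matrices from the left, so the
  two operations commute; this is what lets \<open>Sp2\<close> act on complex lines.\<close>

lemma act4_cscale: "act4 A (c *s z) = c *s act4 A z"
  by (simp add: act4_def vec4_eq_iff qmat_vec_nth qmult_def algebra_simps)

lemma linear_act4: "linear (act4 A)"
  unfolding act4_def
  using linear_compose[OF linear_compose[OF linear_to_H2 qmat_vec_linear] linear_of_H2]
  by (simp add: o_def)

lemma sp2_act_line: "sp2_act A (line z) = line (act4 A z)"
  by (simp add: sp2_act_def line_def image_image act4_cscale flip: act4_def)

lemma sp2_act_mult: "sp2_act (A \<odot> B) L = sp2_act A (sp2_act B L)"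
  by (simp add: sp2_act_def image_image qmat_vec_mult)

text \<open>The orbit map of the base vector: \<open>A\<close> lies over the point
  \<open>line (col1 A)\<close> of projective space.\<close>

definition col1 :: "quat^2^2 \<Rightarrow> complex^4" where
  "col1 A = of_H2 (\<chi> i. A $ i $ 1)"

lemma col1_nth [simp]: "col1 A $ 1 = fst (A $ 1 $ 1)" "col1 A $ 2 = snd (A $ 1 $ 1)"
  "col1 A $ 3 = fst (A $ 2 $ 1)" "col1 A $ 4 = snd (A $ 2 $ 1)"
  by (simp_all add: col1_def)

lemma linear_col1: "linear col1"
  by (rule linearI) (simp_all add: vec4_eq_iff)

lemma bounded_linear_col1: "bounded_linear col1"
  using linear_col1 linear_conv_bounded_linear by blast

lemma act4_base: "act4 A (vector [1, 0, 0, 0]) = col1 A"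
  by (simp add: vec4_eq_iff act4_def qmat_vec_nth flip: zero_prod_def)

lemma sp2_act_base_point: "sp2_act A base_point = line (col1 A)"
  by (simp add: base_point_def sp2_act_line act4_base)

lemma act4_col1: "act4 A (col1 B) = col1 (A \<odot> B)"
  by (simp flip: act4_base act4_mult)

lemma col1_nonzero: "A \<in> Sp2 \<Longrightarrow> col1 A \<noteq> 0"
proof
  assume "A \<in> Sp2" "col1 A = 0"
  then have "col1 (qadjoint A \<odot> A) = 0"
    by (simp flip: act4_col1 add: linear_0[OF linear_act4])
  with \<open>A \<in> Sp2\<close> show False by (simp add: Sp2_iff vec4_eq_iff)
qed

text \<open>The first column of the Maurer--Cartan form: for \<open>y = col1 W\<close>, \<open>horiz A y\<close> is
  \<open>(\<omega>\<^sub>1 + j \<omega>\<^sub>2)/sqrt 2\<close> and \<open>vert A y\<close> is the conjugate of \<open>\<omega>\<^sub>3\<close>.\<close>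

definition horiz :: "quat^2^2 \<Rightarrow> complex^4 \<Rightarrow> quat" where
  "horiz A y = to_H2 (act4 (qadjoint A) y) $ 2"

definition vert :: "quat^2^2 \<Rightarrow> complex^4 \<Rightarrow> complex" where
  "vert A y = snd (to_H2 (act4 (qadjoint A) y) $ 1)"

lemma omega_col1:
  "omega1 A W = sqrt 2 * fst (horiz A (col1 W))"
  "omega2 A W = sqrt 2 * snd (horiz A (col1 W))"
  "omega3 A W = cnj (vert A (col1 W))"
  by (simp_all add: omega1_def omega2_def omega3_def horiz_def vert_def act4_col1 maurer_cartan_def)

lemma linear_horiz: "linear (horiz A)"
  unfolding horiz_def
  by (rule linearI) (simp_all add: linear_add[OF linear_act4] linear_scale[OF linear_act4]
      linear_add[OF linear_to_H2] linear_scale[OF linear_to_H2])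

lemma linear_vert: "linear (vert A)"
  unfolding vert_def
  by (rule linearI) (simp_all add: linear_add[OF linear_act4] linear_scale[OF linear_act4]
      linear_add[OF linear_to_H2] linear_scale[OF linear_to_H2])

lemma horiz_cscale: "horiz A (c *s y) = qmult (horiz A y) (c, 0)"
  by (simp add: horiz_def act4_cscale to_H2_cscale del: to_H2_nth)

lemma vert_cscale: "vert A (c *s y) = vert A y * c"
  by (simp add: vert_def act4_cscale to_H2_cscale qmult_complex)

text \<open>\<open>qadjoint A \<odot> A\<close> is the identity, whose first column has neither
  component. Hence both maps are insensitive to adding a multiple of the representative to a tangent
  vector.\<close>

lemma horiz_vert_col1:
  assumes "A \<in> Sp2"
  shows "horiz A (col1 A) = 0" "vert A (col1 A) = 0"
  using assms by (auto simp: horiz_def vert_def act4_col1 Sp2_iff zero_prod_def)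

text \<open>A vector whose image under \<open>qadjoint A\<close> has only a first coordinate is a
  multiple of the first column of \<open>A\<close>. So \<open>horiz\<close> and \<open>vert\<close>
  together are coordinates on the tangent space at the line.\<close>

lemma horiz_vert_eq_0:
  assumes "A \<in> Sp2" "horiz A y = 0" "vert A y = 0"
  shows "\<exists>b. y = b *s col1 A"
proof -
  define b where "b = act4 (qadjoint A) y $ 1"
  have "act4 (qadjoint A) y = b *s vector [1, 0, 0, 0]"
    using assms(2,3) by (simp add: horiz_def vert_def vec4_eq_iff b_def zero_prod_def)
  then have "act4 A (act4 (qadjoint A) y) = b *s col1 A"
    by (simp add: act4_cscale act4_base)
  then show ?thesis
    using Sp2_right[OF assms(1)] by (metis act4_id act4_mult)
qed

text \<open>The stabiliser computation for the base point. The first column of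
  \<open>qadjoint A \<odot> B\<close> is \<open>(c, 0)\<close>; orthonormality of the columns forces
  the entry (1,2) to vanish and both diagonal entries to be units.\<close>

lemma Sp2_same_line:
  assumes A: "A \<in> Sp2" and B: "B \<in> Sp2" and c: "col1 B = c *s col1 A"
  shows "\<exists>q. cmod c = 1 \<and> norm q = 1 \<and> qadjoint A \<odot> B = qmat (c, 0) 0 0 q \<and>
    (\<forall>y. vert B y = c * vert A y) \<and> (\<forall>y. horiz B y = qmult (qcnj q) (horiz A y))"
proof -
  define h where "h = qadjoint A \<odot> B"
  have hS: "h \<in> Sp2" using Sp2_mult Sp2_qadjoint A B by (simp add: h_def)
  have "col1 h = c *s col1 (qadjoint A \<odot> A)"
    unfolding h_def act4_col1[symmetric] c act4_cscale ..
  then have "col1 h = c *s col1 qid" using A by (simp add: Sp2_iff)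
  then have h1: "h $ 1 $ 1 = (c, 0)" "h $ 2 $ 1 = 0"
    by (auto simp: vec4_eq_iff prod_eq_iff)
  have hh: "qadjoint h \<odot> h = qid" using hS Sp2_iff by blast
  from arg_cong[OF hh, of "\<lambda>M. M $ 1 $ 1"] have "qmult (qcnj (c, 0)) (c, 0) = (1, 0)"
    by (simp add: qmat_mult_nth h1)
  then have c1: "cmod c = 1"
    using norm_qmult[of "qcnj (c, 0)" "(c, 0)"] by (simp add: norm_qcnj norm_Pair abs_square_eq_1 flip: power2_eq_square)
  then have "c \<noteq> 0" by auto
  from arg_cong[OF hh, of "\<lambda>M. M $ 1 $ 2"] have "qmult (qcnj (c, 0)) (h $ 1 $ 2) = 0"
    by (simp add: qmat_mult_nth h1)
  then have h12: "h $ 1 $ 2 = 0"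
    using \<open>c \<noteq> 0\<close> norm_qmult[of "qcnj (c, 0)" "h $ 1 $ 2"] by (simp add: norm_qcnj)
  from arg_cong[OF hh, of "\<lambda>M. M $ 2 $ 2"] have "qmult (qcnj (h $ 2 $ 2)) (h $ 2 $ 2) = (1, 0)"
    by (simp add: qmat_mult_nth h12)
  then have q1: "norm (h $ 2 $ 2) = 1"
    using norm_qmult[of "qcnj (h $ 2 $ 2)" "h $ 2 $ 2"] by (simp add: norm_qcnj norm_Pair abs_square_eq_1 flip: power2_eq_square)
  have B': "B = A \<odot> h" using A by (simp add: h_def Sp2_cancel)
  have "act4 (qadjoint B) y = act4 (qadjoint h) (act4 (qadjoint A) y)" for y
    unfolding B' qadjoint_mult act4_mult ..
  \<comment> \<open>Left multiplication by \<open>cnj c\<close> sends \<open>x + j y\<close> to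
    \<open>cnj c x + j c y\<close>, so the j-part seen by \<open>vert\<close> is multiplied by c
    itself.\<close>
  then have "vert B y = c * vert A y" "horiz B y = qmult (qcnj (h $ 2 $ 2)) (horiz A y)" for y
    by (simp_all add: vert_def horiz_def act4_def qmat_vec_nth h1 h12 qcnj_def qmult_complex flip: zero_prod_def)
  moreover have "h = qmat (c, 0) 0 0 (h $ 2 $ 2)"
    by (simp add: qmat_eq_iff h1 h12)
  ultimately show ?thesis
    using c1 q1 unfolding h_def by blast
qed

section \<open>Projective space and its tangent vectors\<close>

lemma line_cscale: "a \<noteq> 0 \<Longrightarrow> line (a *s z) = line z" for z :: "complex^4"
proof -
  assume a: "a \<noteq> 0"
  have "c *s (a *s z) \<in> line z" "c *s z \<in> line (a *s z)" for c
  proof -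
    show "c *s (a *s z) \<in> line z" unfolding line_def vector_smult_assoc by (rule rangeI)
    have "c *s z = (c / a) *s (a *s z)" using a by (simp add: vector_smult_assoc)
    then show "c *s z \<in> line (a *s z)" unfolding line_def by blast
  qed
  then show ?thesis by (auto simp: line_def)
qed

lemma mem_line: "z \<in> line z"
  unfolding line_def by (rule range_eqI[of _ _ 1]) simp

lemma line_eqD:
  assumes "line z = line z'" "z' \<noteq> 0"
  shows "\<exists>a. a \<noteq> 0 \<and> z' = a *s z"
proof -
  have "z' \<in> line z" using assms(1) mem_line by blast
  then obtain a where "z' = a *s z" by (auto simp: line_def)
  with assms(2) show ?thesis by (auto intro!: exI[of _ a])
qed

lemma tangentI: "a \<noteq> 0 \<Longrightarrow> (a *s z, a *s w + b *s z) \<in> tangent z w"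
  by (auto simp: tangent_def)

lemma mem_tangent: "(z, w) \<in> tangent z w"
  using tangentI[of 1 z w 0] by simp

lemma tangent_subset: "a \<noteq> 0 \<Longrightarrow> tangent (a *s z) (a *s w + b *s z) \<subseteq> tangent z w"
proof
  fix x assume a: "a \<noteq> 0" and "x \<in> tangent (a *s z) (a *s w + b *s z)"
  then obtain a' b' where x: "a' \<noteq> 0" "x = (a' *s (a *s z), a' *s (a *s w + b *s z) + b' *s (a *s z))"
    by (auto simp: tangent_def)
  have "x = ((a' * a) *s z, (a' * a) *s w + (a' * b + b' * a) *s z)"
    by (simp add: x vector_smult_assoc vector_add_ldistrib vector_sadd_rdistrib add.assoc)
  then show "x \<in> tangent z w" using tangentI[of "a' * a" z w "a' * b + b' * a"] x(1) a by simp
qed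

lemma tangent_eq:
  assumes "a \<noteq> 0"
  shows "tangent (a *s z) (a *s w + b *s z) = tangent z w"
proof
  show "tangent (a *s z) (a *s w + b *s z) \<subseteq> tangent z w" by (rule tangent_subset[OF assms])
  have "z = (1/a) *s (a *s z)" using assms by (simp add: vector_smult_assoc)
  moreover have "w = (1/a) *s (a *s w + b *s z) + (- b / (a * a)) *s (a *s z)"
    using assms by (simp add: vec_eq_iff field_simps)
  ultimately show "tangent z w \<subseteq> tangent (a *s z) (a *s w + b *s z)"
    using tangent_subset[of "1/a" "a *s z" "a *s w + b *s z" "- b / (a * a)"] assms by simp
qed

lemma tangent_eqD: "tangent z w = tangent z' w' \<Longrightarrow> \<exists>a b. a \<noteq> 0 \<and> z' = a *s z \<and> w' = a *s w + b *s z"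
proof -
  assume "tangent z w = tangent z' w'"
  then have "(z', w') \<in> tangent z w" using mem_tangent by metis
  then show ?thesis by (auto simp: tangent_def)
qed

lemma foot_tangent:
  assumes "z \<noteq> 0"
  shows "foot (tangent z w) = line z"
  unfolding foot_def
proof (rule the_equality)
  show "\<forall>(z', w')\<in>tangent z w. line z = line z'"
    by (auto simp: tangent_def line_cscale)
  show "L = line z" if "\<forall>(z', w')\<in>tangent z w. L = line z'" for L
    using bspec[OF that mem_tangent[of z w]] by simp
qed

lemma bounded_bilinear_cscale: "bounded_bilinear ((*s) :: complex \<Rightarrow> complex^'n \<Rightarrow> complex^'n)"
proof -
  have "bilinear ((*s) :: complex \<Rightarrow> complex^'n \<Rightarrow> complex^'n)"
    unfolding bilinear_def by (intro conjI allI linearI) (simp_all add: vec_eq_iff ring_distribs)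
  then show ?thesis by (simp add: bilinear_conv_bounded_bilinear)
qed

text \<open>Where a coordinate of f does not vanish, the factor between two representatives is a
  quotient of coordinates and thus differentiable. The derivative of this factor accounts for the
  term \<open>b *s f p\<close>, which is the ambiguity built into \<open>tangent\<close>.\<close>

lemma line_derivative:
  fixes f g :: "'a::real_normed_vector \<Rightarrow> complex^4"
  assumes f: "(f has_derivative f') (at p)" and g: "(g has_derivative g') (at p)"
    and S: "open S" "p \<in> S" "\<And>q. q \<in> S \<Longrightarrow> line (f q) = line (g q)"
    and nz: "f p \<noteq> 0" "g p \<noteq> 0"
  shows "\<exists>a. a \<noteq> 0 \<and> g p = a *s f p \<and> (\<forall>v. \<exists>b. g' v = a *s f' v + b *s f p)"
proof -
  obtain i where i: "f p $ i \<noteq> 0" using nz(1) by (metis vec_eq_iff zero_index)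
  have fi: "((\<lambda>q. f q $ i) has_derivative (\<lambda>v. f' v $ i)) (at p)"
    and gi: "((\<lambda>q. g q $ i) has_derivative (\<lambda>v. g' v $ i)) (at p)"
    using bounded_linear.has_derivative[OF bounded_linear_vec_nth] f g by blast+
  define c where "c q = g q $ i / f q $ i" for q
  obtain c' where c': "(c has_derivative c') (at p)"
    unfolding c_def using has_derivative_divide[OF gi fi i] by blast
  have "isCont (\<lambda>q. f q $ i) p" using fi has_derivative_continuous by blast
  then have "\<forall>\<^sub>F q in nhds p. f q $ i \<noteq> 0"
    using i by (metis isCont_def t1_space_nhds tendsto_imp_eventually_ne eventually_nhds_conv_at)
  then obtain T where T: "open T" "p \<in> T" "\<And>q. q \<in> T \<Longrightarrow> f q $ i \<noteq> 0"
    by (auto simp: eventually_nhds)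
  have eq: "g q = c q *s f q" if "q \<in> S \<inter> T" for q
  proof -
    have "g q \<in> line (f q)" using S(3)[of q] that mem_line by blast
    then obtain a where a: "g q = a *s f q" by (auto simp: line_def)
    moreover have "c q = a" using T(3)[of q] that by (simp add: c_def a)
    ultimately show ?thesis by simp
  qed
  have d: "((\<lambda>q. c q *s f q) has_derivative (\<lambda>v. c p *s f' v + c' v *s f p)) (at p)"
    by (rule bounded_bilinear.FDERIV[OF bounded_bilinear_cscale c' f])
  have "(g has_derivative (\<lambda>v. c p *s f' v + c' v *s f p)) (at p)"
    by (rule has_derivative_transform_within_open[OF d, of "S \<inter> T"]) (use S T eq in auto)
  then have "g' = (\<lambda>v. c p *s f' v + c' v *s f p)"
    using has_derivative_unique[OF g] by blast
  moreover have "g p = c p *s f p" using eq S T by auto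
  ultimately show ?thesis
    using nz(2) by (intro exI[of _ "c p"]) auto
qed

section \<open>Local sections of Sp(2) over projective space and their forms\<close>

lemma local_section_col1:
  assumes "local_section V s" "line z \<in> V" "z \<noteq> 0"
  shows "s (line z) \<in> Sp2" "\<exists>c. c \<noteq> 0 \<and> col1 (s (line z)) = c *s z"
proof -
  show S: "s (line z) \<in> Sp2" using assms by (auto simp: local_section_def)
  have "line z = line (col1 (s (line z)))"
    using assms by (simp add: local_section_def sp2_act_base_point)
  then show "\<exists>c. c \<noteq> 0 \<and> col1 (s (line z)) = c *s z"
    using line_eqD col1_nonzero[OF S] by blast
qed

text \<open>Changing the representing pair adds multiples of the base vector to the derivative of
  the section's first column. These are killed by \<open>L\<close>, so the description in
  \<open>section_form\<close> has exactly one solution.\<close>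

lemma section_form_tangent:
  assumes s: "local_section V s" and z: "line z \<in> V" "z \<noteq> 0"
    and c: "col1 (s (line z)) = c *s z" "c \<noteq> 0"
    and \<omega>: "\<And>A W. \<omega> A W = L A (col1 W)"
    and L: "\<And>A. linear (L A)" "\<And>A b. A \<in> Sp2 \<Longrightarrow> L A (b *s col1 A) = 0"
  shows "section_form s \<omega> (tangent z w) = L (s (line z)) (c *s w)"
proof -
  let ?A = "s (line z)"
  have A: "?A \<in> Sp2" using local_section_col1[OF s z] by simp
  let ?S = "{z. z \<noteq> 0 \<and> line z \<in> V}"
  have sm: "smooth_on ?S (\<lambda>z. s (line z))" using s by (simp add: local_section_def)
  have key: "\<omega> (s (line z')) (frechet_derivative (\<lambda>z. s (line z)) (at z') w') = L ?A (c *s w)"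
    if zw: "(z', w') \<in> tangent z w" for z' w'
  proof -
    obtain a b where a: "a \<noteq> 0" and z': "z' = a *s z" and w': "w' = a *s w + b *s z"
      using zw by (auto simp: tangent_def)
    have lz: "line z' = line z" by (simp add: z' line_cscale a)
    have z'0: "z' \<in> ?S" using z a lz by (auto simp: z')
    let ?D = "frechet_derivative (\<lambda>z. s (line z)) (at z')"
    have d: "((\<lambda>q. col1 (s (line q))) has_derivative (\<lambda>v. col1 (?D v))) (at z')"
      by (rule bounded_linear.has_derivative[OF bounded_linear_col1 smooth_on_has_derivative[OF sm z'0]])
    have "line q = line (col1 (s (line q)))" if "q \<in> ?S" for q
      using s that by (simp add: local_section_def sp2_act_base_point)
    then obtain a2 where a2: "a2 \<noteq> 0" "col1 (s (line z')) = a2 *s z'"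
      and "\<forall>v. \<exists>b. col1 (?D v) = a2 *s v + b *s z'"
      using line_derivative[OF has_derivative_ident d smooth_on_open[OF sm] z'0] col1_nonzero[OF A] lz z'0
      by auto
    then obtain b2 where b2: "col1 (?D w') = a2 *s w' + b2 *s z'" by blast
    have "(a2 * a) *s z = c *s z" using a2(2) c(1) lz by (simp only: z' vector_smult_assoc)
    moreover obtain i where "z $ i \<noteq> 0" using z(2) by (metis vec_eq_iff zero_index)
    \<comment> \<open>\<open>a\<close> rescales the representative and \<open>a2\<close> leads from
      the new representative to the section's column; together they give the fixed factor c.\<close>
    ultimately have ac: "a2 * a = c" by (metis mult_right_cancel vector_smult_component)
    have "col1 (?D w') = c *s w + (a2 * b + b2 * a) *s z"
      unfolding b2 by (simp add: w' z' ac[symmetric] vec_eq_iff algebra_simps)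
    also have "(a2 * b + b2 * a) *s z = ((a2 * b + b2 * a) * (1/c)) *s col1 ?A"
      unfolding c(1) vector_smult_assoc using c(2) by simp
    finally have "col1 (?D w') = c *s w + ((a2 * b + b2 * a) * (1/c)) *s col1 ?A" .
    then show ?thesis
      unfolding \<omega> lz by (simp add: linear_add[OF L(1)] L(2)[OF A])
  qed
  show ?thesis
    unfolding section_form_def
  proof (rule the_equality)
    show "\<forall>(z', w')\<in>tangent z w. L ?A (c *s w) = \<omega> (s (line z')) (frechet_derivative (\<lambda>z. s (line z)) (at z') w')"
      using key by auto
    show "r = L ?A (c *s w)"
      if "\<forall>(z', w')\<in>tangent z w. r = \<omega> (s (line z')) (frechet_derivative (\<lambda>z. s (line z)) (at z') w')" for r
      using bspec[OF that mem_tangent] key[OF mem_tangent] by simp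
  qed
qed

lemma section_forms_tangent:
  assumes s: "local_section V s" "line z \<in> V" "z \<noteq> 0"
    and c: "col1 (s (line z)) = c *s z" "c \<noteq> 0"
  shows "section_form s omega1 (tangent z w) = sqrt 2 * fst (horiz (s (line z)) (c *s w))"
    "section_form s omega2 (tangent z w) = sqrt 2 * snd (horiz (s (line z)) (c *s w))"
    "section_form s omega3 (tangent z w) = cnj (vert (s (line z)) (c *s w))"
proof -
  note lin = linear_add[OF linear_horiz] linear_scale[OF linear_horiz]
    linear_add[OF linear_vert] linear_scale[OF linear_vert]
  note * = section_form_tangent[OF s c]
  show "section_form s omega1 (tangent z w) = sqrt 2 * fst (horiz (s (line z)) (c *s w))"
    by (rule *[where L = "\<lambda>A y. sqrt 2 * fst (horiz A y)"])
      (auto simp: omega_col1 lin ring_distribs horiz_cscale horiz_vert_col1 intro!: linearI)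
  show "section_form s omega2 (tangent z w) = sqrt 2 * snd (horiz (s (line z)) (c *s w))"
    by (rule *[where L = "\<lambda>A y. sqrt 2 * snd (horiz A y)"])
      (auto simp: omega_col1 lin ring_distribs horiz_cscale horiz_vert_col1 intro!: linearI)
  show "section_form s omega3 (tangent z w) = cnj (vert (s (line z)) (c *s w))"
    by (rule *[where L = "\<lambda>A y. cnj (vert A y)"])
      (auto simp: omega_col1 lin ring_distribs vert_cscale horiz_vert_col1 intro!: linearI)
qed

text \<open>Away from 0 the norm is a real power of the smooth positive function
  \<open>f p \<bullet> f p\<close>.\<close>

lemma smooth_on_norm_powr:
  fixes f :: "'a::real_normed_vector \<Rightarrow> 'b::real_inner"
  assumes "smooth_on S f" "\<And>p. p \<in> S \<Longrightarrow> f p \<noteq> 0"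
  shows "smooth_on S (\<lambda>p. norm (f p) powr r)"
proof -
  have "smooth_on S (\<lambda>p. (f p \<bullet> f p) powr (r / 2))"
    by (rule smooth_on_compose[OF smooth_on_inner[OF assms(1) assms(1)] smooth_on_powr]) (use assms(2) in auto)
  then show ?thesis
  proof (rule smooth_on_cong)
    fix p assume "p \<in> S"
    have "f p \<bullet> f p = norm (f p) powr 2"
      using assms(2)[OF \<open>p \<in> S\<close>] by (simp add: dot_square_norm)
    then show "(f p \<bullet> f p) powr (r / 2) = norm (f p) powr r"
      by (simp only: powr_powr) simp
  qed
qed

text \<open>Unit representatives \<open>f\<close> of the lines near \<open>line z0\<close>, normalised by \<open>\<langle>z0, f\<rangle> > 0\<close>, are completed
  to matrices in \<open>Sp2\<close>.\<close>

lemma local_section_from_completion: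
  assumes W: "open W" "z0 \<in> W" "0 \<notin> W" "\<And>a z. a \<noteq> 0 \<Longrightarrow> z \<in> W \<Longrightarrow> a *s z \<in> W"
    and M: "smooth_on W M" "\<And>f. f \<in> W \<Longrightarrow> norm f = 1 \<Longrightarrow> M f \<in> Sp2 \<and> col1 (M f) = f"
  shows "\<exists>V s. local_section V s \<and> line z0 \<in> V"
proof -
  define h where "h z = (\<Sum>i\<in>UNIV. cnj (z0 $ i) * z $ i)" for z
  define W' where "W' = {z \<in> W. h z \<noteq> 0}"
  \<comment> \<open>This is \<open>cnj (h z)\<close> divided by the moduli of \<open>h z\<close> and
    of z. Its phase makes the Hermitian product with \<open>z0\<close> positive, its modulus makes
    \<open>f z\<close> a unit vector, and \<open>u (a z) * a = u z\<close>. Inverse powers are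
    written with \<open>powr\<close> so that \<open>smooth_on_norm_powr\<close> applies.\<close>
  define u where "u z = cnj (h z) * of_real (norm (h z) powr (-1) * norm z powr (-1))" for z
  define f where "f z = u z *s z" for z
  \<comment> \<open>Any representative may be chosen, because \<open>f\<close> takes the same value
    on all of them.\<close>
  define s where "s L = M (f (SOME z. z \<noteq> 0 \<and> line z = L))" for L
  define V where "V = line ` W'"
  have hs: "h (a *s z) = a * h z" for a z by (simp add: h_def sum_distrib_left algebra_simps)
  have norms: "norm (a *s z) = cmod a * norm z" for a and z :: "complex^4"
    unfolding norm_vec_def by (simp add: norm_mult L2_set_right_distrib)
  have fs: "f (a *s z) = f z" if "a \<noteq> 0" "z \<in> W'" for a z
  proof -
    have n: "cmod a > 0" using that by simp
    have "(cmod a)\<^sup>2 * (norm (h (a *s z)) powr (-1) * norm (a *s z) powr (-1)) = norm (h z) powr (-1) * norm z powr (-1)"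
      using n by (simp add: hs norms norm_mult powr_minus power2_eq_square) (simp add: field_simps)
    moreover have "u (a *s z) * a = cnj (h z) * (of_real ((cmod a)\<^sup>2) * of_real (norm (h (a *s z)) powr (-1) * norm (a *s z) powr (-1)))"
      unfolding complex_norm_square by (simp add: u_def hs)
    ultimately have "u (a *s z) * a = u z"
      unfolding u_def of_real_mult[symmetric] by simp
    then show ?thesis by (simp add: f_def vector_smult_assoc)
  qed
  have u0: "u z \<noteq> 0" "norm (f z) = 1" if "z \<in> W'" for z
  proof -
    have z: "z \<noteq> 0" "h z \<noteq> 0" using that W(3) by (auto simp: W'_def)
    then show "u z \<noteq> 0" by (simp add: u_def)
    have "cmod (u z) = norm (h z) * (norm (h z) powr (-1) * norm z powr (-1))"
      unfolding u_def norm_mult norm_of_real by simp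
    then show "norm (f z) = 1"
      using z by (simp add: f_def norms powr_minus) (simp add: field_simps)
  qed
  have W's: "a *s z \<in> W'" if "a \<noteq> 0" "z \<in> W'" for a z
    using that W(4) by (auto simp: W'_def hs)
  have sl: "s (line z) = M (f z)" if "z \<in> W'" for z
  proof -
    have z: "z \<noteq> 0" using that W(3) by (auto simp: W'_def)
    define z' where "z' = (SOME z'. z' \<noteq> 0 \<and> line z' = line z)"
    have z': "z' \<noteq> 0 \<and> line z' = line z"
      unfolding z'_def by (rule someI[of _ z]) (use z in auto)
    then obtain a where "a \<noteq> 0" "z' = a *s z" using line_eqD by metis
    then have "f z' = f z" using fs that by simp
    then show ?thesis by (simp add: s_def z'_def)
  qed
  have lin: "linear h" unfolding h_def
    by (rule linearI) (simp_all add: sum.distrib ring_distribs scaleR_sum_right)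
  have W'open: "open W'"
  proof -
    have "continuous_on UNIV h" using lin linear_continuous_on linear_conv_bounded_linear by blast
    then have "open (h -` (- {0}))" by (simp add: continuous_on_open_vimage open_Compl)
    moreover have "W' = W \<inter> h -` (- {0})" by (auto simp: W'_def)
    ultimately show ?thesis using W(1) by auto
  qed
  have smf: "smooth_on W' f"
    unfolding f_def u_def using W(3)
    by (intro smooth_on_bounded_bilinear[OF bounded_bilinear_cscale] smooth_on_mult smooth_on_cnj
        smooth_on_of_real smooth_on_norm_powr smooth_on_linear[OF _ lin] smooth_on_id W'open)
      (auto simp: W'_def)
  have fW: "f z \<in> W" if "z \<in> W'" for z
    using W(4) u0 that by (auto simp: f_def W'_def)
  have "smooth_on W' (\<lambda>z. M (f z))" by (rule smooth_on_compose[OF smf M(1) fW])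
  then have "smooth_on W' (\<lambda>z. s (line z))" by (rule smooth_on_cong) (simp add: sl)
  moreover have "{z. z \<noteq> 0 \<and> line z \<in> V} = W'"
  proof (intro set_eqI iffI)
    fix z assume "z \<in> {z. z \<noteq> 0 \<and> line z \<in> V}"
    then obtain z' where "z \<noteq> 0" "z' \<in> W'" "line z = line z'" by (auto simp: V_def)
    then show "z \<in> W'" using line_eqD W's by metis
  qed (use W(3) in \<open>auto simp: V_def W'_def\<close>)
  moreover have "V \<subseteq> CP3" using W(3) by (auto simp: V_def CP3_def W'_def)
  moreover have "s L \<in> Sp2 \<and> sp2_act (s L) base_point = L" if L: "L \<in> V" for L
  proof -
    obtain z where z: "z \<in> W'" "L = line z" using L by (auto simp: V_def)
    have "M (f z) \<in> Sp2 \<and> col1 (M (f z)) = f z" by (rule M(2)[OF fW u0(2)]) (use z in auto)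
    then show ?thesis
      using z u0(1)[OF z(1)] by (simp add: sl sp2_act_base_point f_def line_cscale)
  qed
  ultimately have "local_section V s" by (simp add: local_section_def)
  moreover have "h z0 = of_real ((norm z0)\<^sup>2)"
  proof -
    have "h z0 = of_real (\<Sum>i\<in>UNIV. (cmod (z0 $ i))\<^sup>2)"
      unfolding h_def of_real_sum by (intro sum.cong) (auto simp: complex_norm_square[symmetric] mult.commute simp flip: of_real_power)
    then show ?thesis by (simp add: norm_vec_def L2_set_def sum_nonneg)
  qed
  then have "z0 \<in> W'" using W by (auto simp: W'_def)
  ultimately show ?thesis by (auto simp: V_def)
qed

lemma norm_vec4: "(norm f)\<^sup>2 = (norm (f $ 1, f $ 2))\<^sup>2 + (norm (f $ 3, f $ 4))\<^sup>2" for f :: "complex^4"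
  unfolding norm_vec_def L2_set_def sum_4 norm_Pair by simp

text \<open>A unit vector \<open>(p, q)\<close> of quaternions is completed to an orthonormal frame
  by the column \<open>(- p qcnj(q) / norm p, norm p)\<close> where \<open>p \<noteq> 0\<close>, and
  by \<open>(norm q, - q qcnj(p) / norm q)\<close> where \<open>q \<noteq> 0\<close>. The two
  regions cover projective space.\<close>

lemma local_section_exists:
  assumes "z \<noteq> 0"
  shows "\<exists>V s. local_section V s \<and> line z \<in> V"
proof -
  let ?a = "\<lambda>f::complex^4. (f $ 1, f $ 2)" and ?b = "\<lambda>f::complex^4. (f $ 3, f $ 4)"
  define U1 where "U1 = {f. ?a f \<noteq> 0}"
  define U2 where "U2 = {f. ?b f \<noteq> 0}"
  \<comment> \<open>The exponent 1 is kept so that the smoothness of every entry follows from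
    \<open>smooth_on_norm_powr\<close>.\<close>
  define M1 where "M1 f = qmat (?a f) (- (norm (?a f) powr (-1) *\<^sub>R qmult (?a f) (qcnj (?b f)))) (?b f) (complex_of_real (norm (?a f) powr 1), 0)" for f
  define M2 where "M2 f = qmat (?a f) (complex_of_real (norm (?b f) powr 1), 0) (?b f) (- (norm (?b f) powr (-1) *\<^sub>R qmult (?b f) (qcnj (?a f))))" for f
  have o: "open U1" "open U2"
    unfolding U1_def U2_def
    by (intro open_Collect_neq continuous_intros)+
  have a: "smooth_on U1 ?a" "smooth_on U1 ?b" "smooth_on U2 ?a" "smooth_on U2 ?b"
    by (intro smooth_on_Pair smooth_on_vec_nth smooth_on_id o)+
  have s4: "smooth_on U (\<lambda>f. qmat (p f) (q f) (r f) (t f))"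
    if "smooth_on U p" "smooth_on U q" "smooth_on U r" "smooth_on U t" for U :: "(complex^4) set" and p q r t
    using smooth_on_bounded_linear[OF _ bounded_linear_qmat, of U "\<lambda>f. (p f, q f, r f, t f)"] that
    by (simp add: smooth_on_Pair)
  have sm: "smooth_on U1 M1" "smooth_on U2 M2"
    unfolding M1_def M2_def
    by (intro s4 a smooth_on_minus smooth_on_scaleR smooth_on_norm_powr smooth_on_of_real
        smooth_on_bounded_bilinear[OF bounded_bilinear_qmult] smooth_on_linear[OF _ linear_qcnj] smooth_on_Pair[OF _ smooth_on_const] o;
        simp add: U1_def U2_def)+
  have col: "col1 (M1 f) = f" "col1 (M2 f) = f" for f
    by (simp_all add: M1_def M2_def vec4_eq_iff)
  have r: "qmult (x *\<^sub>R 1, 0) q = x *\<^sub>R q" "qmult q (x *\<^sub>R 1, 0) = x *\<^sub>R q" for x and q :: quat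
    by (simp_all add: qmult_complex prod_eq_iff scaleR_conv_of_real)
  have m: "qcnj (- p) = - qcnj p" "qmult (- p) q = - qmult p q" "qmult p (- q) = - qmult p q"
      "qcnj (x *\<^sub>R p) = x *\<^sub>R qcnj p" "qcnj (of_real x, 0) = (of_real x, 0)" for p q x
    by (simp_all add: qmult_def qcnj_def prod_eq_iff scaleR_conv_of_real algebra_simps)
  have r': "qmult (of_real x, 0) q = x *\<^sub>R q" "qmult q (of_real x, 0) = x *\<^sub>R q" for x and q :: quat
    by (simp_all add: qmult_complex prod_eq_iff scaleR_conv_of_real)
  have cs: "qmult (qcnj p) (qmult p q) = (norm p)\<^sup>2 *\<^sub>R q" for p q
    unfolding qmult_assoc[symmetric] qcnj_qmult_self r' ..
  have cs'': "qmult (qmult p (qcnj q)) q = (norm q)\<^sup>2 *\<^sub>R p" for p q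
    unfolding qmult_assoc qcnj_qmult_self r' ..
  have cs': "qmult (qmult p (qcnj q)) (qmult q (qcnj p)) = ((norm p)\<^sup>2 * (norm q)\<^sup>2) *\<^sub>R (1, 0)" for p q
  proof -
    have "qmult (qmult p (qcnj q)) (qmult q (qcnj p)) = qmult p (qmult (qcnj q) (qmult q (qcnj p)))"
      by (simp add: qmult_assoc)
    also have "\<dots> = (norm q)\<^sup>2 *\<^sub>R qmult (qcnj (qcnj p)) (qcnj p)" by (simp add: cs qmult_scaleR)
    also have "\<dots> = ((norm p)\<^sup>2 * (norm q)\<^sup>2) *\<^sub>R (1, 0)"
      by (simp only: qcnj_qmult_self norm_qcnj) (simp add: scaleR_conv_of_real)
    finally show ?thesis .
  qed
  have u: "M1 f \<in> Sp2" if "f \<in> U1" "norm f = 1" for f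
  proof -
    define p q where "p = ?a f" and "q = ?b f"
    define n where "n = norm p"
    have n0: "n > 0" using that(1) by (simp add: U1_def n_def p_def)
    have nq: "(norm q)\<^sup>2 = 1 - n\<^sup>2" using norm_vec4[of f] that(2) by (simp add: p_def q_def n_def)
    have M: "M1 f = qmat p (- ((1/n) *\<^sub>R qmult p (qcnj q))) q (complex_of_real n, 0)"
      using n0 by (simp add: M1_def p_def q_def n_def powr_minus inverse_eq_divide)
    show ?thesis
      unfolding Sp2_iff M qmat_eq_iff
      using n0
      apply (simp add: qmat_mult_nth m qmult_scaleR r' cs cs' cs'' qcnj_qmult_self nq n_def[symmetric] qcnj_qmult)
      apply (simp add: scaleR_conv_of_real power2_eq_square prod_eq_iff field_simps)
      done
  qed
  have u': "M2 f \<in> Sp2" if "f \<in> U2" "norm f = 1" for f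
  proof -
    define p q where "p = ?a f" and "q = ?b f"
    define n where "n = norm q"
    have n0: "n > 0" using that(1) by (simp add: U2_def n_def q_def)
    have np: "(norm p)\<^sup>2 = 1 - n\<^sup>2" using norm_vec4[of f] that(2) by (simp add: p_def q_def n_def)
    have M: "M2 f = qmat p (complex_of_real n, 0) q (- ((1/n) *\<^sub>R qmult q (qcnj p)))"
      using n0 by (simp add: M2_def p_def q_def n_def powr_minus inverse_eq_divide)
    show ?thesis
      unfolding Sp2_iff M qmat_eq_iff
      using n0
      apply (simp add: qmat_mult_nth m qmult_scaleR r' cs cs' cs'' qcnj_qmult_self np n_def[symmetric] qcnj_qmult)
      apply (simp add: scaleR_conv_of_real power2_eq_square prod_eq_iff field_simps)
      done
  qed
  have "z \<in> U1 \<or> z \<in> U2"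
    using assms by (auto simp: U1_def U2_def vec4_eq_iff zero_prod_def)
  then show ?thesis
  proof
    assume "z \<in> U1"
    then show ?thesis
      by (intro local_section_from_completion[OF o(1) _ _ _ sm(1)]) (use u col in \<open>auto simp: U1_def zero_prod_def\<close>)
  next
    assume "z \<in> U2"
    then show ?thesis
      by (intro local_section_from_completion[OF o(2) _ _ _ sm(2)]) (use u' col in \<open>auto simp: U2_def zero_prod_def\<close>)
  qed
qed

section \<open>Metric and almost complex structure read off from a frame\<close>

lemma section_forms_lift:
  assumes A: "A \<in> Sp2" and s: "local_section V s" "line (col1 A) \<in> V"
  shows "\<exists>c q. c \<noteq> 0 \<and> cmod c = 1 \<and> norm q = 1 \<and>
    (\<forall>w. section_form s omega1 (tangent (col1 A) w) = sqrt 2 * (fst (qmult (qcnj q) (horiz A w)) * c) \<and>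
         section_form s omega2 (tangent (col1 A) w) = sqrt 2 * (snd (qmult (qcnj q) (horiz A w)) * c) \<and>
         section_form s omega3 (tangent (col1 A) w) = cnj (c * c * vert A w))"
proof -
  \<comment> \<open>The section's frame over this line differs from \<open>A\<close> by
    \<open>diag(c, q)\<close>. Hence a unit quaternion acts on \<open>horiz\<close> from the left
    and a unit complex number from the right, while \<open>vert\<close> picks up c twice, once from
    the frame and once from the representative.\<close>
  obtain c where c: "c \<noteq> 0" "col1 (s (line (col1 A))) = c *s col1 A"
    and B: "s (line (col1 A)) \<in> Sp2"
    using local_section_col1[OF s col1_nonzero[OF A]] by blast
  obtain q where q: "cmod c = 1" "norm q = 1"
    "\<And>y. vert (s (line (col1 A))) y = c * vert A y"
    "\<And>y. horiz (s (line (col1 A))) y = qmult (qcnj q) (horiz A y)"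
    using Sp2_same_line[OF A B c(2)] by blast
  show ?thesis
    using section_forms_tangent[OF s col1_nonzero[OF A] c(2,1)] c q
    by (intro exI[of _ c] exI[of _ q]) (simp add: horiz_cscale vert_cscale qmult_complex qmult_assoc[symmetric])
qed

text \<open>Multiplication by units preserves the quaternion norm, so every section gives the same
  value, and the existence of a section makes the description unique. The factor 2 undoes the
  \<open>1 / sqrt 2\<close> in the Maurer-Cartan form.\<close>

lemma g_H_lift:
  assumes A: "A \<in> Sp2"
  shows "g_H (tangent (col1 A) w) = 2 * (norm (horiz A w))\<^sup>2"
  unfolding g_H_def foot_tangent[OF col1_nonzero[OF A]]
proof (rule the_equality)
  show *: "\<forall>V s. local_section V s \<and> line (col1 A) \<in> V \<longrightarrow> 2 * (norm (horiz A w))\<^sup>2 =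
      (cmod (section_form s omega1 (tangent (col1 A) w)))\<^sup>2 + (cmod (section_form s omega2 (tangent (col1 A) w)))\<^sup>2"
  proof (intro allI impI)
    fix V s assume "local_section V s \<and> line (col1 A) \<in> V"
    then obtain c q where "cmod c = 1" "norm q = 1"
      "section_form s omega1 (tangent (col1 A) w) = sqrt 2 * (fst (qmult (qcnj q) (horiz A w)) * c)"
      "section_form s omega2 (tangent (col1 A) w) = sqrt 2 * (snd (qmult (qcnj q) (horiz A w)) * c)"
      using section_forms_lift[OF A] by metis
    then show "2 * (norm (horiz A w))\<^sup>2 =
      (cmod (section_form s omega1 (tangent (col1 A) w)))\<^sup>2 + (cmod (section_form s omega2 (tangent (col1 A) w)))\<^sup>2"
      using norm_quat[of "qmult (qcnj q) (horiz A w)"]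
      by (simp add: norm_mult power_mult_distrib norm_qmult norm_qcnj)
  qed
  show "r = 2 * (norm (horiz A w))\<^sup>2" if "\<forall>V s. local_section V s \<and> line (col1 A) \<in> V \<longrightarrow> r =
      (cmod (section_form s omega1 (tangent (col1 A) w)))\<^sup>2 + (cmod (section_form s omega2 (tangent (col1 A) w)))\<^sup>2" for r
    using local_section_exists[OF col1_nonzero[OF A]] * that by metis
qed

lemma g_V_lift:
  assumes A: "A \<in> Sp2"
  shows "g_V (tangent (col1 A) w) = (cmod (vert A w))\<^sup>2"
  unfolding g_V_def foot_tangent[OF col1_nonzero[OF A]]
proof (rule the_equality)
  show *: "\<forall>V s. local_section V s \<and> line (col1 A) \<in> V \<longrightarrow>
      (cmod (vert A w))\<^sup>2 = (cmod (section_form s omega3 (tangent (col1 A) w)))\<^sup>2"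
  proof (intro allI impI)
    fix V s assume "local_section V s \<and> line (col1 A) \<in> V"
    then obtain c where "cmod c = 1"
      "section_form s omega3 (tangent (col1 A) w) = cnj (c * c * vert A w)"
      using section_forms_lift[OF A] by metis
    then show "(cmod (vert A w))\<^sup>2 = (cmod (section_form s omega3 (tangent (col1 A) w)))\<^sup>2"
      by (simp add: norm_mult)
  qed
  show "r = (cmod (vert A w))\<^sup>2" if "\<forall>V s. local_section V s \<and> line (col1 A) \<in> V \<longrightarrow>
      r = (cmod (section_form s omega3 (tangent (col1 A) w)))\<^sup>2" for r
    using local_section_exists[OF col1_nonzero[OF A]] * that by metis
qed

lemma vertical_lift:
  assumes A: "A \<in> Sp2" and v: "tangent (col1 A) w \<in> vertical"
  shows "horiz A w = 0"
proof -
  obtain V s where s: "local_section V s" "line (col1 A) \<in> V"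
    using local_section_exists[OF col1_nonzero[OF A]] by blast
  then have 0: "section_form s omega1 (tangent (col1 A) w) = 0" "section_form s omega2 (tangent (col1 A) w) = 0"
    using v by (auto simp: vertical_def foot_tangent[OF col1_nonzero[OF A]])
  obtain c q where "c \<noteq> 0" "norm q = 1"
      "section_form s omega1 (tangent (col1 A) w) = sqrt 2 * (fst (qmult (qcnj q) (horiz A w)) * c)"
      "section_form s omega2 (tangent (col1 A) w) = sqrt 2 * (snd (qmult (qcnj q) (horiz A w)) * c)"
    using section_forms_lift[OF A s] by blast
  with 0 have "qmult (qcnj q) (horiz A w) = 0" by (simp add: prod_eq_iff)
  then show ?thesis using norm_qmult[of "qcnj q" "horiz A w"] \<open>norm q = 1\<close> by (simp add: norm_qcnj)
qed

lemma horizontal_lift: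
  assumes A: "A \<in> Sp2" and v: "tangent (col1 A) w \<in> horizontal"
  shows "vert A w = 0"
proof -
  obtain V s where s: "local_section V s" "line (col1 A) \<in> V"
    using local_section_exists[OF col1_nonzero[OF A]] by blast
  then have 0: "section_form s omega3 (tangent (col1 A) w) = 0"
    using v by (auto simp: horizontal_def foot_tangent[OF col1_nonzero[OF A]])
  obtain c where "c \<noteq> 0" "section_form s omega3 (tangent (col1 A) w) = cnj (c * c * vert A w)"
    using section_forms_lift[OF A s] by blast
  with 0 show ?thesis by simp
qed

text \<open>Right multiplication by i multiplies both parts of \<open>horiz\<close>, that is
  \<omega>1 and \<omega>2, by i; \<open>vert\<close> takes the factor -i because it is the conjugate
  of \<omega>3.\<close>

lemma nk_J_lift:
  assumes A: "A \<in> Sp2" and h: "horiz A w' = qmult (horiz A w) (\<i>, 0)" and v: "vert A w' = - \<i> * vert A w"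
  shows "nk_J (tangent (col1 A) w) = tangent (col1 A) w'"
proof -
  let ?z = "col1 A"
  have z0: "?z \<noteq> 0" by (rule col1_nonzero[OF A])
  have h': "fst (qmult p (horiz A w')) = \<i> * fst (qmult p (horiz A w))"
    "snd (qmult p (horiz A w')) = \<i> * snd (qmult p (horiz A w))" for p
    unfolding h qmult_assoc[symmetric, of p] qmult_complex(1)[of "qmult p _"] by simp_all
  show ?thesis
    unfolding nk_J_def foot_tangent[OF z0]
  proof (rule the_equality, intro conjI allI impI ballI)
    show "tangent ?z w' \<in> tangent_space (line ?z)"
      using z0 by (auto simp: tangent_space_def)
    fix V s \<omega> assume s: "local_section V s \<and> line ?z \<in> V" and \<omega>: "\<omega> \<in> {omega1, omega2, omega3}"
    obtain c q where
      "\<And>w. section_form s omega1 (tangent (col1 A) w) = sqrt 2 * (fst (qmult (qcnj q) (horiz A w)) * c)"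
      "\<And>w. section_form s omega2 (tangent (col1 A) w) = sqrt 2 * (snd (qmult (qcnj q) (horiz A w)) * c)"
      "\<And>w. section_form s omega3 (tangent (col1 A) w) = cnj (c * c * vert A w)"
      using section_forms_lift[OF A] s by metis
    then show "section_form s \<omega> (tangent ?z w') = \<i> * section_form s \<omega> (tangent ?z w)"
      using \<omega> by (auto simp: h' v)
  next
    fix T' assume T': "T' \<in> tangent_space (line ?z) \<and> (\<forall>V s. local_section V s \<and> line ?z \<in> V \<longrightarrow>
       (\<forall>\<omega>\<in>{omega1, omega2, omega3}. section_form s \<omega> T' = \<i> * section_form s \<omega> (tangent ?z w)))"
    then obtain z1 w1 where 1: "z1 \<noteq> 0" "line z1 = line ?z" "T' = tangent z1 w1"
      by (auto simp: tangent_space_def)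
    then obtain a where a: "a \<noteq> 0" "z1 = a *s ?z" using line_eqD by metis
    \<comment> \<open>Moves the unknown tangent vector to the representative \<open>?z\<close>, so
      that it can be compared with \<open>w'\<close>.\<close>
    define w2 where "w2 = (1/a) *s w1"
    have T2: "T' = tangent ?z w2"
      using tangent_eq[OF a(1), of ?z w2 0] a by (simp add: 1(3) w2_def vector_smult_assoc)
    obtain V s where s: "local_section V s" "line ?z \<in> V"
      using local_section_exists[OF z0] by blast
    obtain c q where cq: "c \<noteq> 0" "norm q = 1"
      "\<And>w. section_form s omega1 (tangent (col1 A) w) = sqrt 2 * (fst (qmult (qcnj q) (horiz A w)) * c)"
      "\<And>w. section_form s omega2 (tangent (col1 A) w) = sqrt 2 * (snd (qmult (qcnj q) (horiz A w)) * c)"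
      "\<And>w. section_form s omega3 (tangent (col1 A) w) = cnj (c * c * vert A w)"
      using section_forms_lift[OF A s] by metis
    have "section_form s omega1 T' = \<i> * section_form s omega1 (tangent ?z w)"
      "section_form s omega2 T' = \<i> * section_form s omega2 (tangent ?z w)"
      "section_form s omega3 T' = \<i> * section_form s omega3 (tangent ?z w)"
      using T' s by auto
    then have "fst (qmult (qcnj q) (horiz A w2)) = fst (qmult (qcnj q) (horiz A w'))"
      "snd (qmult (qcnj q) (horiz A w2)) = snd (qmult (qcnj q) (horiz A w'))" and v2: "vert A w2 = vert A w'"
      using cq(1) by (auto simp: T2 cq h' v complex_cnj_cancel_iff[of "vert A w2", symmetric])
    then have "qmult (qcnj q) (horiz A w2 - horiz A w') = 0"
      by (simp add: prod_eq_iff bounded_bilinear.diff_right[OF bounded_bilinear_qmult])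
    then have "horiz A (w2 - w') = 0"
      using norm_qmult[of "qcnj q" "horiz A w2 - horiz A w'"] cq(2) by (simp add: norm_qcnj linear_diff[OF linear_horiz])
    moreover have "vert A (w2 - w') = 0" using v2 by (simp add: linear_diff[OF linear_vert])
    ultimately obtain b where "w2 - w' = b *s ?z" using horiz_vert_eq_0[OF A] by blast
    then have "w2 = 1 *s w' + b *s ?z" by (simp add: algebra_simps)
    then show "T' = tangent ?z w'"
      using tangent_eq[of 1 ?z w' b] by (simp add: T2)
  qed
qed

section \<open>Charts\<close>

lemma coordinates_inverse:
  assumes "coordinates c"
  shows "x \<in> fst c \<Longrightarrow> chart_inv c (snd c x) = x"
    and "p \<in> snd c ` fst c \<Longrightarrow> snd c (chart_inv c p) = p"
    and "p \<in> snd c ` fst c \<Longrightarrow> chart_inv c p \<in> fst c"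
  using assms by (auto simp: coordinates_def homeomorphism_def)

lemma coordinates_image:
  assumes "coordinates c"
  shows "snd c ` (fst c \<inter> U) = {p \<in> snd c ` fst c. chart_inv c p \<in> U}"
  using coordinates_inverse[OF assms] by (auto intro!: image_eqI)

lemma coordinates_open_image:
  assumes "coordinates c" "open U"
  shows "open (snd c ` (fst c \<inter> U))"
proof -
  have "open (snd c ` fst c)" "continuous_on (snd c ` fst c) (chart_inv c)"
    using assms(1) by (auto simp: coordinates_def homeomorphism_def)
  then have "open (snd c ` fst c \<inter> chart_inv c -` U)"
    using assms(2) by (simp add: continuous_on_open_vimage Int_commute)
  moreover have "snd c ` (fst c \<inter> U) = snd c ` fst c \<inter> chart_inv c -` U"
    by (auto simp: coordinates_image[OF assms(1)])
  ultimately show ?thesis by simp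
qed

lemma surface_coordinates: "riemann_surface X \<Longrightarrow> c \<in> X \<Longrightarrow> coordinates c"
  by (simp add: riemann_surface_def)

lemma surface_chart_exists: "riemann_surface X \<Longrightarrow> \<exists>c\<in>X. x \<in> fst c"
  unfolding riemann_surface_def by blast

lemma smooth_map_has_derivative:
  assumes "riemann_surface X" "smooth_map X U F" "c \<in> X" "x \<in> fst c \<inter> U"
  shows "((F \<circ> chart_inv c) has_derivative chart_deriv c F x) (at (snd c x))"
  using smooth_on_has_derivative[of "snd c ` (fst c \<inter> U)" "F \<circ> chart_inv c" "snd c x"] assms
  unfolding smooth_map_def chart_deriv_def by auto

section \<open>Curves and their lifts\<close>

text \<open>Two homogeneous lifts differ by a nowhere zero differentiable factor, so
  \<open>line_derivative\<close> and \<open>tangent_eq\<close> give the same tangent vector; the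
  description is therefore settled by any single lift.\<close>

lemma curve_deriv_homogeneous:
  assumes X: "riemann_surface X" and f: "homogeneous_lift X \<phi> U f" "x \<in> U" and c: "c \<in> X" "x \<in> fst c"
  shows "curve_deriv X \<phi> c x v = tangent (f x) (chart_deriv c f x v)"
  unfolding curve_deriv_def
proof (rule the_equality, intro allI impI)
  fix U2 f2 assume 2: "homogeneous_lift X \<phi> U2 f2 \<and> x \<in> U2"
  note ci = coordinates_inverse[OF surface_coordinates[OF X c(1)]]
  let ?S = "snd c ` (fst c \<inter> (U \<inter> U2))"
  have o: "open ?S"
    using coordinates_open_image[OF surface_coordinates[OF X c(1)]] f 2
    by (auto simp: homogeneous_lift_def smooth_map_def)
  have d1: "((f \<circ> chart_inv c) has_derivative chart_deriv c f x) (at (snd c x))"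
    by (rule smooth_map_has_derivative[OF X, where U=U]) (use f c in \<open>auto simp: homogeneous_lift_def\<close>)
  have d2: "((f2 \<circ> chart_inv c) has_derivative chart_deriv c f2 x) (at (snd c x))"
    by (rule smooth_map_has_derivative[OF X, where U=U2]) (use 2 c in \<open>auto simp: homogeneous_lift_def\<close>)
  have "\<exists>a. a \<noteq> 0 \<and> (f2 \<circ> chart_inv c) (snd c x) = a *s (f \<circ> chart_inv c) (snd c x) \<and>
    (\<forall>v. \<exists>b. chart_deriv c f2 x v = a *s chart_deriv c f x v + b *s (f \<circ> chart_inv c) (snd c x))"
  proof (rule line_derivative[OF d1 d2 o])
    show "snd c x \<in> ?S" using f 2 c by auto
    show "line ((f \<circ> chart_inv c) q) = line ((f2 \<circ> chart_inv c) q)" if "q \<in> ?S" for q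
      using that f 2 by (auto simp: homogeneous_lift_def ci)
  qed (use f 2 c in \<open>auto simp: homogeneous_lift_def ci\<close>)
  then obtain a where a: "a \<noteq> 0" "f2 x = a *s f x" "\<forall>v. \<exists>b. chart_deriv c f2 x v = a *s chart_deriv c f x v + b *s f x"
    using c by (auto simp: ci)
  then show "tangent (f x) (chart_deriv c f x v) = tangent (f2 x) (chart_deriv c f2 x v)"
    using tangent_eq[OF a(1)] by metis
next
  fix T assume "\<forall>U f. homogeneous_lift X \<phi> U f \<and> x \<in> U \<longrightarrow> T = tangent (f x) (chart_deriv c f x v)"
  then show "T = tangent (f x) (chart_deriv c f x v)" using f by blast
qed

lemma sp2_lift_homogeneous:
  assumes X: "riemann_surface X" and F: "sp2_lift X \<phi> U F"
  shows "homogeneous_lift X \<phi> U (col1 \<circ> F)"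
  unfolding homogeneous_lift_def smooth_map_def
proof (intro conjI ballI)
  show "open U" using F by (simp add: sp2_lift_def smooth_map_def)
  show "smooth_on (snd c ` (fst c \<inter> U)) (col1 \<circ> F \<circ> chart_inv c)" if "c \<in> X" for c
    using smooth_on_bounded_linear[OF _ bounded_linear_col1] F that
    by (fastforce simp: sp2_lift_def smooth_map_def o_def)
  show "(col1 \<circ> F) x \<noteq> 0" "\<phi> x = line ((col1 \<circ> F) x)" if "x \<in> U" for x
    using F that col1_nonzero by (auto simp: sp2_lift_def sp2_act_base_point)
qed

lemma curve_deriv_lift:
  assumes X: "riemann_surface X" and F: "sp2_lift X \<phi> U F" "x \<in> U" and c: "c \<in> X" "x \<in> fst c"
  shows "curve_deriv X \<phi> c x v = tangent (col1 (F x)) (col1 (chart_deriv c F x v))"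
proof -
  have "((F \<circ> chart_inv c) has_derivative chart_deriv c F x) (at (snd c x))"
    by (rule smooth_map_has_derivative[OF X, where U=U]) (use F c in \<open>auto simp: sp2_lift_def\<close>)
  from bounded_linear.has_derivative[OF bounded_linear_col1 this]
  have "((col1 \<circ> F \<circ> chart_inv c) has_derivative (\<lambda>v. col1 (chart_deriv c F x v))) (at (snd c x))"
    by (simp add: o_def)
  then have "chart_deriv c (col1 \<circ> F) x v = col1 (chart_deriv c F x v)"
    unfolding chart_deriv_def[of c "col1 \<circ> F"] by (rule frechet_derivative_eq)
  then show ?thesis
    using curve_deriv_homogeneous[OF X sp2_lift_homogeneous[OF X F(1)] F(2) c] by simp
qed

lemma lift_form_col1:
  "lift_form F omega1 c x v = sqrt 2 * fst (horiz (F x) (col1 (chart_deriv c F x v)))"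
  "lift_form F omega2 c x v = sqrt 2 * snd (horiz (F x) (col1 (chart_deriv c F x v)))"
  "lift_form F omega3 c x v = cnj (vert (F x) (col1 (chart_deriv c F x v)))"
  by (simp_all add: lift_form_def omega_col1)

lemma g_curve_lift:
  assumes X: "riemann_surface X" and F: "sp2_lift X \<phi> U F" "x \<in> U" and c: "c \<in> X" "x \<in> fst c"
  shows "g_H (curve_deriv X \<phi> c x v) = (cmod (lift_form F omega1 c x v))\<^sup>2 + (cmod (lift_form F omega2 c x v))\<^sup>2"
    and "g_V (curve_deriv X \<phi> c x v) = (cmod (lift_form F omega3 c x v))\<^sup>2"
proof -
  have A: "F x \<in> Sp2" using F by (simp add: sp2_lift_def)
  show "g_H (curve_deriv X \<phi> c x v) = (cmod (lift_form F omega1 c x v))\<^sup>2 + (cmod (lift_form F omega2 c x v))\<^sup>2"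
    unfolding curve_deriv_lift[OF X F c] g_H_lift[OF A] lift_form_col1 norm_quat
    by (simp add: norm_mult power_mult_distrib)
  show "g_V (curve_deriv X \<phi> c x v) = (cmod (lift_form F omega3 c x v))\<^sup>2"
    unfolding curve_deriv_lift[OF X F c] g_V_lift[OF A] lift_form_col1 by simp
qed

lemma smooth_curve_lift:
  "riemann_surface X \<Longrightarrow> sp2_lift X \<phi> UNIV F \<Longrightarrow> smooth_curve X \<phi>"
  unfolding smooth_curve_def using sp2_lift_homogeneous by blast

text \<open>In a frame the almost complex structure multiplies \<omega>1, \<omega>2 and \<omega>3 by
  i; the conjugation between \<omega>3 and \<open>vert\<close> supplies the sign required by
  \<open>nk_J_lift\<close>.\<close>

lemma J_holomorphic_lift:
  assumes X: "riemann_surface X" and F: "sp2_lift X \<phi> UNIV F"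
    and J: "\<And>c x v \<omega>. c \<in> X \<Longrightarrow> x \<in> fst c \<Longrightarrow> \<omega> \<in> {omega1, omega2, omega3} \<Longrightarrow>
      lift_form F \<omega> c x (\<i> * v) = \<i> * lift_form F \<omega> c x v"
  shows "J_holomorphic X \<phi>"
  unfolding J_holomorphic_def
proof (intro conjI ballI allI smooth_curve_lift[OF X F])
  fix c x v assume c: "c \<in> X" "x \<in> fst c"
  have A: "F x \<in> Sp2" using F by (simp add: sp2_lift_def)
  have "horiz (F x) (col1 (chart_deriv c F x (\<i> * v))) = qmult (horiz (F x) (col1 (chart_deriv c F x v))) (\<i>, 0)"
    using J[OF c, of omega1 v] J[OF c, of omega2 v] by (simp add: lift_form_col1 qmult_complex prod_eq_iff)
  moreover have "vert (F x) (col1 (chart_deriv c F x (\<i> * v))) = - \<i> * vert (F x) (col1 (chart_deriv c F x v))"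
    using arg_cong[OF J[OF c, of omega3 v], of cnj] by (simp add: lift_form_col1)
  ultimately show "curve_deriv X \<phi> c x (\<i> * v) = nk_J (curve_deriv X \<phi> c x v)"
    unfolding curve_deriv_lift[OF X F UNIV_I c] using nk_J_lift[OF A] by simp
qed

text \<open>Two sections of P differ by \<open>diag(a, q)\<close>, and the vanishing of \<omega>2 on
  both, with \<omega>1 nonzero, forces the unit quaternion q to be complex. Then \<tau> changes by
  the unit \<open>q * q\<close>.\<close>

lemma P_section_moduli:
  assumes X: "riemann_surface X" and \<Phi>: "P_section X \<phi> UNIV \<Phi>" and F: "P_section X \<phi> U F"
    and nz: "\<And>c x. c \<in> X \<Longrightarrow> x \<in> fst c \<Longrightarrow> lift_form \<Phi> omega1 c x 1 \<noteq> 0"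
    and c: "c \<in> X" "x \<in> fst c \<inter> U"
  shows "cmod (lift_form F tau c x v) = cmod (lift_form \<Phi> tau c x v)"
    and "cmod (lift_form F omega1 c x v) = cmod (lift_form \<Phi> omega1 c x v)"
proof -
  have l\<Phi>: "sp2_lift X \<phi> UNIV \<Phi>" and lF: "sp2_lift X \<phi> U F"
    using \<Phi> F by (auto simp: P_section_def)
  have S\<Phi>: "\<Phi> y \<in> Sp2" for y using l\<Phi> by (simp add: sp2_lift_def)
  have U: "open U" using lF by (simp add: sp2_lift_def smooth_map_def)
  have diag: "\<exists>a q. cmod a = 1 \<and> cmod q = 1 \<and> qadjoint (\<Phi> y) \<odot> F y = qmat (a, 0) 0 0 (q, 0)" if y: "y \<in> U" for y
  proof -
    obtain d where d: "d \<in> X" "y \<in> fst d" using surface_chart_exists[OF X] by blast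
    have SF: "F y \<in> Sp2" using lF y by (simp add: sp2_lift_def)
    have "tangent (col1 (\<Phi> y)) (col1 (chart_deriv d \<Phi> y 1)) = tangent (col1 (F y)) (col1 (chart_deriv d F y 1))"
      using curve_deriv_lift[OF X l\<Phi> UNIV_I d] curve_deriv_lift[OF X lF y d] by simp
    then obtain a b where a: "a \<noteq> 0" "col1 (F y) = a *s col1 (\<Phi> y)"
      "col1 (chart_deriv d F y 1) = a *s col1 (chart_deriv d \<Phi> y 1) + b *s col1 (\<Phi> y)"
      using tangent_eqD by blast
    obtain q where q: "cmod a = 1" "norm q = 1" "qadjoint (\<Phi> y) \<odot> F y = qmat (a, 0) 0 0 q"
      "\<And>y'. horiz (F y) y' = qmult (qcnj q) (horiz (\<Phi> y) y')"
      using Sp2_same_line[OF S\<Phi> SF a(2)] by blast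
    have h: "horiz (F y) (col1 (chart_deriv d F y 1)) = qmult (qcnj q) (qmult (horiz (\<Phi> y) (col1 (chart_deriv d \<Phi> y 1))) (a, 0))"
      by (simp add: q(4) a(3) linear_add[OF linear_horiz] horiz_cscale horiz_vert_col1[OF S\<Phi>] qmult_assoc)
    have "lift_form F omega2 d y 1 = 0" "lift_form \<Phi> omega2 d y 1 = 0"
      using F \<Phi> d y by (auto simp: P_section_def)
    then have z: "snd (horiz (F y) (col1 (chart_deriv d F y 1))) = 0"
        "snd (horiz (\<Phi> y) (col1 (chart_deriv d \<Phi> y 1))) = 0"
      by (simp_all add: lift_form_col1)
    moreover have "fst (horiz (\<Phi> y) (col1 (chart_deriv d \<Phi> y 1))) \<noteq> 0"
      using nz[OF d] by (simp add: lift_form_col1)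
    \<comment> \<open>For complex x the product of \<open>qcnj q\<close>, x and a has the j-part
      \<open>- snd q * x * a\<close>, and here x and a are nonzero.\<close>
    ultimately have q0: "snd q = 0"
      using a(1) by (simp add: h qmult_complex) (simp add: qmult_def qcnj_def)
    then have "q = (fst q, 0)" by (simp add: prod_eq_iff)
    moreover have "cmod (fst q) = 1"
      using norm_quat[of q] q(2) q0 abs_square_eq_1[of "cmod (fst q)"] by simp
    ultimately show ?thesis
      using q(1,3) by metis
  qed
  note ci = coordinates_inverse[OF surface_coordinates[OF X c(1)]]
  let ?S = "snd c ` (fst c \<inter> U)" and ?p = "snd c x"
  have S: "open ?S" "?p \<in> ?S" using coordinates_open_image[OF surface_coordinates[OF X c(1)] U] c by auto
  define f g where "f = F \<circ> chart_inv c" and "g = \<Phi> \<circ> chart_inv c"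
  define f' g' where "f' = chart_deriv c F x" and "g' = chart_deriv c \<Phi> x"
  have f': "(f has_derivative f') (at ?p)" unfolding f_def f'_def
    by (rule smooth_map_has_derivative[OF X]) (use lF c in \<open>auto simp: sp2_lift_def\<close>)
  have g': "(g has_derivative g') (at ?p)" unfolding g_def g'_def
    by (rule smooth_map_has_derivative[OF X]) (use l\<Phi> c in \<open>auto simp: sp2_lift_def\<close>)
  define h where "h p = qadjoint (g p) \<odot> f p" for p
  have hd: "\<exists>a q. cmod a = 1 \<and> cmod q = 1 \<and> h p = qmat (a, 0) 0 0 (q, 0)" if "p \<in> ?S" for p
    using diag[of "chart_inv c p"] that by (auto simp: h_def f_def g_def ci)
  obtain h' where h': "(h has_derivative h') (at ?p)"
    unfolding h_def using qmat_mult.FDERIV[OF bounded_linear.has_derivative[OF bounded_linear_qadjoint g'] f'] by blast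
  have gh: "f p = g p \<odot> h p" for p
    using S\<Phi> by (simp add: h_def g_def Sp2_cancel)
  have f'eq: "f' v = g ?p \<odot> h' v + g' v \<odot> h ?p" for v
  proof -
    have "(f has_derivative (\<lambda>v. g ?p \<odot> h' v + g' v \<odot> h ?p)) (at ?p)"
      unfolding gh[abs_def] by (rule qmat_mult.FDERIV[OF g' h'])
    from fun_cong[OF has_derivative_unique[OF f' this]] show ?thesis .
  qed
  \<comment> \<open>The inhomogeneous term \<open>h'\<close> of the gauge transformation could
    contribute to \<tau>. It does not, because the (2,2) entry of h is complex on a whole
    neighbourhood, so its j-part has derivative zero.\<close>
  have "((\<lambda>p. snd (h p $ 2 $ 2)) has_derivative (\<lambda>v. snd (h' v $ 2 $ 2))) (at ?p)"
    by (intro bounded_linear.has_derivative[OF bounded_linear_snd]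
        bounded_linear.has_derivative[OF bounded_linear_vec_nth] h')
  moreover have "((\<lambda>p. snd (h p $ 2 $ 2)) has_derivative (\<lambda>v. 0)) (at ?p)"
    by (rule has_derivative_transform_within_open[OF has_derivative_const[of 0] S]) (use hd in fastforce)
  ultimately have h'22: "snd (h' v $ 2 $ 2) = 0" for v
    by (rule fun_cong[OF has_derivative_unique])
  obtain a q where aq: "cmod a = 1" "cmod q = 1" "h ?p = qmat (a, 0) 0 0 (q, 0)"
    using hd[OF S(2)] by blast
  have F\<Phi>: "F x = \<Phi> x \<odot> h ?p" using gh[of ?p] c by (simp add: f_def g_def ci)
  have gp: "g ?p = \<Phi> x" using c by (simp add: g_def ci)
  have "qadjoint (F x) \<odot> f' v = qadjoint (h ?p) \<odot> (h' v + (qadjoint (\<Phi> x) \<odot> g' v) \<odot> h ?p)"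
    unfolding F\<Phi> f'eq gp qadjoint_mult qmat_mult_add qmat_mult_assoc by (simp add: Sp2_cancel[OF S\<Phi>])
  then have N: "maurer_cartan (F x) (f' v) = qadjoint (h ?p) \<odot> (h' v + maurer_cartan (\<Phi> x) (g' v) \<odot> h ?p)"
    by (simp add: maurer_cartan_def)
  have "tau (F x) (f' v) = q * tau (\<Phi> x) (g' v) * q"
    unfolding tau_def N aq(3)
    by (simp add: qmat_mult_nth qmult_complex qcnj_def h'22 flip: zero_prod_def)
  then show "cmod (lift_form F tau c x v) = cmod (lift_form \<Phi> tau c x v)"
    using aq(2) by (simp add: lift_form_def f'_def g'_def norm_mult)
  have "lift_form F omega2 c x v = 0" "lift_form \<Phi> omega2 c x v = 0"
    using F \<Phi> c by (auto simp: P_section_def)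
  then have "(cmod (lift_form F omega1 c x v))\<^sup>2 = (cmod (lift_form \<Phi> omega1 c x v))\<^sup>2"
    using g_curve_lift(1)[OF X l\<Phi> UNIV_I c(1), of x v] g_curve_lift(1)[OF X lF _ c(1), of x v] c by simp
  then show "cmod (lift_form F omega1 c x v) = cmod (lift_form \<Phi> omega1 c x v)" by simp
qed

section \<open>Curves with a global adapted lift\<close>

lemma transverse_immersion_lift:
  assumes X: "riemann_surface X" and \<Phi>: "sp2_lift X \<phi> UNIV \<Phi>"
    and pos: "\<And>x. \<alpha>m x > 0" "\<And>x. \<alpha>p x > 0"
    and w: "\<And>c x v. c \<in> X \<Longrightarrow> x \<in> fst c \<Longrightarrow> lift_form \<Phi> omega2 c x v = 0"
      "\<And>c x v. c \<in> X \<Longrightarrow> x \<in> fst c \<Longrightarrow> lift_form \<Phi> omega3 c x v = \<alpha>m x * lift_form \<Phi> omega1 c x v"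
      "\<And>c x v. c \<in> X \<Longrightarrow> x \<in> fst c \<Longrightarrow> lift_form \<Phi> tau c x v = \<alpha>p x * lift_form \<Phi> omega1 c x v"
      "\<And>c x v. c \<in> X \<Longrightarrow> x \<in> fst c \<Longrightarrow> lift_form \<Phi> omega1 c x (\<i> * v) = \<i> * lift_form \<Phi> omega1 c x v"
      "\<And>c x v. c \<in> X \<Longrightarrow> x \<in> fst c \<Longrightarrow> v \<noteq> 0 \<Longrightarrow> lift_form \<Phi> omega1 c x v \<noteq> 0"
  shows "transverse_immersion X \<alpha>m \<alpha>p \<phi>"
proof -
  have P: "P_section X \<phi> UNIV \<Phi>" using \<Phi> w(1) by (auto simp: P_section_def)
  have S\<Phi>: "\<Phi> y \<in> Sp2" for y using \<Phi> by (simp add: sp2_lift_def)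
  note cd = curve_deriv_lift[OF X \<Phi> UNIV_I]
  note mods = P_section_moduli[OF X P _ w(5)]
  have J: "J_holomorphic X \<phi>"
    by (rule J_holomorphic_lift[OF X \<Phi>]) (use w in \<open>auto simp: algebra_simps\<close>)
  have gH: "g_H (curve_deriv X \<phi> c x v) = (cmod (lift_form \<Phi> omega1 c x v))\<^sup>2" if "c \<in> X" "x \<in> fst c" for c x v
    using g_curve_lift(1)[OF X \<Phi> UNIV_I that] w(1)[OF that] by simp
  have gV: "g_V (curve_deriv X \<phi> c x v) = (\<alpha>m x * cmod (lift_form \<Phi> omega1 c x v))\<^sup>2" if "c \<in> X" "x \<in> fst c" for c x v
    using g_curve_lift(2)[OF X \<Phi> UNIV_I that] w(2)[OF that] pos(1)[of x] by (simp add: norm_mult)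
  have I: "immersion X \<phi>"
    unfolding immersion_def
  proof (intro conjI smooth_curve_lift[OF X \<Phi>] ballI allI impI notI)
    fix c x and v :: complex assume c: "c \<in> X" "x \<in> fst c" and v: "v \<noteq> 0" and "curve_deriv X \<phi> c x v \<in> range (\<lambda>z. tangent z 0)"
    then obtain z where "tangent z 0 = tangent (col1 (\<Phi> x)) (col1 (chart_deriv c \<Phi> x v))"
      using cd[OF c] by auto
    then obtain a b where ab: "a \<noteq> 0" "col1 (\<Phi> x) = a *s z" "col1 (chart_deriv c \<Phi> x v) = a *s 0 + b *s z"
      using tangent_eqD by blast
    \<comment> \<open>A pair \<open>(z, 0)\<close> represents the zero tangent vector, so the
      derivative of the lift's column would be a multiple of the column, on which \<omega>1
      vanishes.\<close>
    then have "col1 (chart_deriv c \<Phi> x v) = (b / a) *s col1 (\<Phi> x)" by (simp add: vector_smult_assoc)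
    then have "lift_form \<Phi> omega1 c x v = 0"
      by (simp add: lift_form_col1 horiz_cscale horiz_vert_col1[OF S\<Phi>])
    with w(5)[OF c v] show False by simp
  qed
  have T: "transverse X \<phi>"
    unfolding transverse_def tangent_to_def
  proof (intro conjI allI impI notI ballI)
    fix x assume *: "\<forall>c\<in>X. x \<in> fst c \<longrightarrow> range (curve_deriv X \<phi> c x) \<subseteq> horizontal"
    obtain c where c: "c \<in> X" "x \<in> fst c" using surface_chart_exists[OF X] by blast
    with * have "curve_deriv X \<phi> c x 1 \<in> horizontal" by blast
    then have "lift_form \<Phi> omega3 c x 1 = 0"
      using horizontal_lift[OF S\<Phi>] by (simp add: cd[OF c] lift_form_col1)
    then show False using w(2,5)[OF c] pos(1)[of x] by auto
  next
    fix x assume *: "\<forall>c\<in>X. x \<in> fst c \<longrightarrow> range (curve_deriv X \<phi> c x) \<subseteq> vertical"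
    obtain c where c: "c \<in> X" "x \<in> fst c" using surface_chart_exists[OF X] by blast
    with * have "curve_deriv X \<phi> c x 1 \<in> vertical" by blast
    then have "lift_form \<Phi> omega1 c x 1 = 0"
      using vertical_lift[OF S\<Phi>] by (simp add: cd[OF c] lift_form_col1)
    then show False using w(5)[OF c] by auto
  next
    fix U F c x assume F: "P_section X \<phi> U F" and c: "c \<in> X" "x \<in> fst c \<inter> U"
    \<comment> \<open>The section F of P is arbitrary; its moduli agree with those of the given
      lift.\<close>
    have "cmod (lift_form F tau c x 1) \<noteq> 0"
      using mods(1)[OF F _ _ _ c, of 1] w(3,5)[OF c(1), of x 1] c pos(2)[of x] by (simp add: norm_mult)
    then show "\<exists>v. lift_form F tau c x v \<noteq> 0" by auto
  qed
  have A: "angle_functions X \<phi> \<alpha>m \<alpha>p"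
    unfolding angle_functions_def
  proof (intro conjI allI impI ballI)
    fix c x and v :: complex assume c: "c \<in> X" "x \<in> fst c" and v: "v \<noteq> 0"
    show "\<alpha>m x = sqrt (g_V (curve_deriv X \<phi> c x v)) / sqrt (g_H (curve_deriv X \<phi> c x v))"
      unfolding gH[OF c] gV[OF c] using w(5)[OF c v] pos(1)[of x] by (simp add: abs_mult)
  next
    fix U F c x and v :: complex assume F: "P_section X \<phi> U F" and c: "c \<in> X" "x \<in> fst c \<inter> U" and v: "v \<noteq> 0"
    show "\<alpha>p x = cmod (lift_form F tau c x v) / cmod (lift_form F omega1 c x v)"
      using mods[OF F _ _ _ c, of v] w(3,5)[OF c(1), of x v] v c pos(2)[of x] by (simp add: norm_mult)
  qed
  from J I T A show ?thesis by (simp add: transverse_immersion_def)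
qed

section \<open>Monodromy\<close>

text \<open>A locally constant sheaf, given by its local sections \<open>sol U f\<close>; the stalk at \<open>x\<close> is
  identified with \<open>vals x\<close> by evaluation at \<open>x\<close>.\<close>

locale local_system =
  fixes sol :: "'x::topological_space set \<Rightarrow> ('x \<Rightarrow> 'b) \<Rightarrow> bool" and vals :: "'x \<Rightarrow> 'b set"
  assumes sol_open: "sol U f \<Longrightarrow> open U"
    and sol_vals: "sol U f \<Longrightarrow> x \<in> U \<Longrightarrow> f x \<in> vals x"
    and sol_exists: "\<exists>W. open W \<and> x \<in> W \<and> path_connected W \<and> (\<forall>y\<in>W. \<forall>b\<in>vals y. \<exists>f. sol W f \<and> f y = b)"
    and sol_agree: "sol U f \<Longrightarrow> sol V g \<Longrightarrow> x \<in> U \<Longrightarrow> x \<in> V \<Longrightarrow>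
      \<exists>W. open W \<and> x \<in> W \<and> ((\<forall>y\<in>W. f y = g y) \<or> (\<forall>y\<in>W. f y \<noteq> g y))"
begin

text \<open>A lift of the map k to the etale space of the sheaf, in other words a section of its
  pullback. The parameter space is any metric space, so that paths and homotopies of paths are
  treated alike.\<close>

definition sect :: "('s::metric_space \<Rightarrow> 'x) \<Rightarrow> 's set \<Rightarrow> ('s \<Rightarrow> 'b) \<Rightarrow> bool" where
  "sect k R g \<longleftrightarrow> (\<forall>s\<in>R. \<exists>U f. sol U f \<and> (\<forall>\<^sub>F t in nhds s. t \<in> R \<longrightarrow> k t \<in> U \<and> g t = f (k t)))"

lemma sect_vals: "sect k R g \<Longrightarrow> t \<in> R \<Longrightarrow> g t \<in> vals (k t)"
proof -
  assume g: "sect k R g" and t: "t \<in> R"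
  obtain U f where 1: "sol U f" "\<forall>\<^sub>F s in nhds t. s \<in> R \<longrightarrow> k s \<in> U \<and> g s = f (k s)"
    using g t unfolding sect_def by blast
  then show ?thesis
    using eventually_nhds_x_imp_x[OF 1(2)] t sol_vals[OF 1(1), of "k t"] by simp
qed

lemma continuous_on_eventually:
  assumes "continuous_on R k" "s \<in> R" "open W" "k s \<in> W"
  shows "\<forall>\<^sub>F t in nhds s. t \<in> R \<longrightarrow> k t \<in> W"
proof -
  obtain A where "open A" "s \<in> A" "\<forall>t\<in>R. t \<in> A \<longrightarrow> k t \<in> W"
    using assms unfolding continuous_on_topological by meson
  then show ?thesis unfolding eventually_nhds by blast
qed

text \<open>By \<open>sol_agree\<close> both the set of agreement and its complement are open:
  unique lifting for a covering.\<close>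

lemma sect_unique:
  assumes k: "continuous_on R k" "connected R" and g: "sect k R g" "sect k R g'"
    and r: "r \<in> R" "g r = g' r" and t: "t \<in> R"
  shows "g t = g' t"
proof -
  have "(g r = g' r) = (g t = g' t)"
  proof (rule connected_local_const[OF k(2) r(1) t, of "\<lambda>t. g t = g' t"], rule ballI)
    fix s assume s: "s \<in> R"
    obtain U f where 1: "sol U f" "\<forall>\<^sub>F t in nhds s. t \<in> R \<longrightarrow> k t \<in> U \<and> g t = f (k t)"
      using g(1) s unfolding sect_def by blast
    obtain V f' where 2: "sol V f'" "\<forall>\<^sub>F t in nhds s. t \<in> R \<longrightarrow> k t \<in> V \<and> g' t = f' (k t)"
      using g(2) s unfolding sect_def by blast
    have ks: "k s \<in> U" "k s \<in> V" "g s = f (k s)" "g' s = f' (k s)"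
      using eventually_nhds_x_imp_x[OF 1(2)] eventually_nhds_x_imp_x[OF 2(2)] s by auto
    obtain W where W: "open W" "k s \<in> W" "(\<forall>y\<in>W. f y = f' y) \<or> (\<forall>y\<in>W. f y \<noteq> f' y)"
      using sol_agree[OF 1(1) 2(1) ks(1,2)] by blast
    have "\<forall>\<^sub>F t in nhds s. t \<in> R \<longrightarrow> (g s = g' s) = (g t = g' t)"
      using 1(2) 2(2) continuous_on_eventually[OF k(1) s W(1,2)]
    proof eventually_elim
      case (elim t)
      then show ?case using W(2,3) ks by metis
    qed
    then show "\<forall>\<^sub>F t in at s within R. (g s = g' s) = (g t = g' t)"
      unfolding eventually_at_filter by eventually_elim auto
  qed
  with r show ?thesis by simp
qed

lemma sect_pullback:
  assumes "sect k R g" "continuous_on R' j" "\<And>t. t \<in> R' \<Longrightarrow> j t \<in> R"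
  shows "sect (\<lambda>t. k (j t)) R' (\<lambda>t. g (j t))"
  unfolding sect_def
proof
  fix s assume s: "s \<in> R'"
  then have "j s \<in> R" by (rule assms(3))
  then obtain U f where 1: "sol U f" "\<forall>\<^sub>F t in nhds (j s). t \<in> R \<longrightarrow> k t \<in> U \<and> g t = f (k t)"
    using assms(1) unfolding sect_def by blast
  then obtain T where T: "open T" "j s \<in> T" "\<And>t. t \<in> T \<Longrightarrow> t \<in> R \<longrightarrow> k t \<in> U \<and> g t = f (k t)"
    unfolding eventually_nhds by blast
  have "\<forall>\<^sub>F t in nhds s. t \<in> R' \<longrightarrow> k (j t) \<in> U \<and> g (j t) = f (k (j t))"
    using continuous_on_eventually[OF assms(2) s T(1,2)]
    by eventually_elim (use T(3) assms(3) in auto)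
  with 1(1) show "\<exists>U f. sol U f \<and> (\<forall>\<^sub>F t in nhds s. t \<in> R' \<longrightarrow> k (j t) \<in> U \<and> g (j t) = f (k (j t)))"
    by blast
qed

lemma sect_cong:
  assumes "sect k R g" "\<And>t. t \<in> R \<Longrightarrow> k' t = k t" "\<And>t. t \<in> R \<Longrightarrow> g' t = g t"
  shows "sect k' R g'"
  unfolding sect_def
proof
  fix s assume "s \<in> R"
  then obtain U f where 1: "sol U f" "\<forall>\<^sub>F t in nhds s. t \<in> R \<longrightarrow> k t \<in> U \<and> g t = f (k t)"
    using assms(1) by (auto simp: sect_def)
  from 1(2) have "\<forall>\<^sub>F t in nhds s. t \<in> R \<longrightarrow> k' t \<in> U \<and> g' t = f (k' t)"
    by eventually_elim (use assms in auto)
  with 1(1) show "\<exists>U f. sol U f \<and> (\<forall>\<^sub>F t in nhds s. t \<in> R \<longrightarrow> k' t \<in> U \<and> g' t = f (k' t))" by blast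
qed

lemma sect_sol:
  assumes "sol U f" "continuous_on R k" "\<And>t. t \<in> R \<Longrightarrow> k t \<in> U"
  shows "sect k R (\<lambda>t. f (k t))"
  unfolding sect_def
  by (intro ballI exI[of _ U] exI[of _ f]) (use assms in \<open>auto intro: always_eventually\<close>)

lemma sect_const:
  assumes "sect (\<lambda>_. x) R g" "connected R" "s \<in> R" "t \<in> R"
  shows "g s = g t"
proof -
  obtain U f where 1: "sol U f" "\<forall>\<^sub>F t in nhds s. t \<in> R \<longrightarrow> x \<in> U \<and> g t = f x"
    using assms(1,3) by (auto simp: sect_def)
  have "x \<in> U" "g s = f x" using eventually_nhds_x_imp_x[OF 1(2)] assms(3) by auto
  then have "sect (\<lambda>_. x) R (\<lambda>t. f x)" by (intro sect_sol[OF 1(1)]) auto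
  then show ?thesis
    using sect_unique[OF _ assms(2) assms(1) _ assms(3) _ assms(4)] \<open>g s = f x\<close> by fastforce
qed

text \<open>The value may be prescribed at any point of R, which keeps the condition symmetric in
  the two pieces when they are glued.\<close>

definition solvable :: "('s::metric_space \<Rightarrow> 'x) \<Rightarrow> 's set \<Rightarrow> bool" where
  "solvable k R \<longleftrightarrow> (\<forall>r\<in>R. \<forall>b\<in>vals (k r). \<exists>g. sect k R g \<and> g r = b)"

text \<open>Agreement at one point of the connected overlap extends to all of it. Since the pieces
  are closed, a point outside one of them has a neighbourhood that misses it, so near every point a
  single local solution describes the glued section.\<close>

lemma sect_glue:
  assumes k: "continuous_on (R1 \<union> R2) k" and cl: "closed R1" "closed R2"
    and I: "connected (R1 \<inter> R2)" "m \<in> R1 \<inter> R2"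
    and g: "sect k R1 g1" "sect k R2 g2" "g1 m = g2 m"
  shows "sect k (R1 \<union> R2) (\<lambda>t. if t \<in> R1 then g1 t else g2 t)"
proof -
  have sub: "sect k (R1 \<inter> R2) g1" "sect k (R1 \<inter> R2) g2"
    using sect_pullback[OF g(1), of "R1 \<inter> R2" "\<lambda>t. t"] sect_pullback[OF g(2), of "R1 \<inter> R2" "\<lambda>t. t"]
    by auto
  have eq: "g1 t = g2 t" if "t \<in> R1 \<inter> R2" for t
    using sect_unique[OF continuous_on_subset[OF k] I(1) sub I(2) g(3) that] by blast
  show ?thesis
    unfolding sect_def
  proof
    fix s assume s: "s \<in> R1 \<union> R2"
    consider "s \<in> R1 \<inter> R2" | "s \<in> R1" "s \<notin> R2" | "s \<in> R2" "s \<notin> R1" using s by blast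
    then show "\<exists>U f. sol U f \<and> (\<forall>\<^sub>F t in nhds s. t \<in> R1 \<union> R2 \<longrightarrow> k t \<in> U \<and> (if t \<in> R1 then g1 t else g2 t) = f (k t))"
    proof cases
      case 1
      obtain U f where 2: "sol U f" "\<forall>\<^sub>F t in nhds s. t \<in> R1 \<longrightarrow> k t \<in> U \<and> g1 t = f (k t)"
        using g(1) 1 unfolding sect_def by blast
      obtain V f' where 3: "sol V f'" "\<forall>\<^sub>F t in nhds s. t \<in> R2 \<longrightarrow> k t \<in> V \<and> g2 t = f' (k t)"
        using g(2) 1 unfolding sect_def by blast
      have ks: "k s \<in> U" "k s \<in> V" "f (k s) = f' (k s)"
        using eventually_nhds_x_imp_x[OF 2(2)] eventually_nhds_x_imp_x[OF 3(2)] 1 eq[OF 1] by auto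
      obtain W where W: "open W" "k s \<in> W" "(\<forall>y\<in>W. f y = f' y)"
        using sol_agree[OF 2(1) 3(1) ks(1,2)] ks(3) by blast
      have "k s \<in> W \<inter> U" using W ks by simp
      have "\<forall>\<^sub>F t in nhds s. t \<in> R1 \<union> R2 \<longrightarrow> k t \<in> U \<and> (if t \<in> R1 then g1 t else g2 t) = f (k t)"
        using 2(2) 3(2) continuous_on_eventually[OF k s open_Int[OF W(1) sol_open[OF 2(1)]] \<open>k s \<in> W \<inter> U\<close>]
        by eventually_elim (use W(3) in auto)
      with 2(1) show ?thesis by blast
    next
      case 2
      obtain U f where 3: "sol U f" "\<forall>\<^sub>F t in nhds s. t \<in> R1 \<longrightarrow> k t \<in> U \<and> g1 t = f (k t)"
        using g(1) 2 unfolding sect_def by blast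
      have "\<forall>\<^sub>F t in nhds s. t \<notin> R2"
        using 2(2) cl(2) eventually_nhds_in_open[of "- R2" s] by (simp add: open_Compl)
      with 3(2) have "\<forall>\<^sub>F t in nhds s. t \<in> R1 \<union> R2 \<longrightarrow> k t \<in> U \<and> (if t \<in> R1 then g1 t else g2 t) = f (k t)"
        by eventually_elim auto
      with 3(1) show ?thesis by blast
    next
      case 3
      obtain U f where 4: "sol U f" "\<forall>\<^sub>F t in nhds s. t \<in> R2 \<longrightarrow> k t \<in> U \<and> g2 t = f (k t)"
        using g(2) 3 unfolding sect_def by blast
      have "\<forall>\<^sub>F t in nhds s. t \<notin> R1"
        using 3(2) cl(1) eventually_nhds_in_open[of "- R1" s] by (simp add: open_Compl)
      with 4(2) have "\<forall>\<^sub>F t in nhds s. t \<in> R1 \<union> R2 \<longrightarrow> k t \<in> U \<and> (if t \<in> R1 then g1 t else g2 t) = f (k t)"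
        by eventually_elim auto
      with 4(1) show ?thesis by blast
    qed
  qed
qed

lemma solvable_glue1:
  assumes k: "continuous_on (R1 \<union> R2) k" and cl: "closed R1" "closed R2"
    and I: "connected (R1 \<inter> R2)" "R1 \<inter> R2 \<noteq> {}" and s: "solvable k R1" "solvable k R2"
    and r: "r \<in> R1" "b \<in> vals (k r)"
  shows "\<exists>g. sect k (R1 \<union> R2) g \<and> g r = b"
proof -
  obtain m where m: "m \<in> R1 \<inter> R2" using I(2) by blast
  obtain g1 where g1: "sect k R1 g1" "g1 r = b" using s(1) r by (auto simp: solvable_def)
  have "g1 m \<in> vals (k m)" using sect_vals[OF g1(1)] m by blast
  then obtain g2 where "sect k R2 g2" "g2 m = g1 m" using s(2) m by (auto simp: solvable_def)
  then have "sect k (R1 \<union> R2) (\<lambda>t. if t \<in> R1 then g1 t else g2 t)"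
    by (intro sect_glue[OF k cl I(1) m g1(1)]) auto
  then show ?thesis using g1(2) r(1) by (intro exI) auto
qed

lemma solvable_glue:
  assumes k: "continuous_on (R1 \<union> R2) k" and cl: "closed R1" "closed R2"
    and I: "connected (R1 \<inter> R2)" "R1 \<inter> R2 \<noteq> {}" and s: "solvable k R1" "solvable k R2"
  shows "solvable k (R1 \<union> R2)"
  unfolding solvable_def
proof (intro ballI)
  fix r b assume r: "r \<in> R1 \<union> R2" and b: "b \<in> vals (k r)"
  show "\<exists>g. sect k (R1 \<union> R2) g \<and> g r = b"
  proof (cases "r \<in> R1")
    case True
    then show ?thesis using solvable_glue1[OF assms _ b] by blast
  next
    case False
    then have "r \<in> R2" using r by blast
    then show ?thesis using solvable_glue1[of R2 R1 k r b] assms b by (simp add: Un_commute Int_commute)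
  qed
qed

text \<open>Near s everything is mapped into one set W on which each stalk value extends to a
  solution; the solution is pulled back to any subset R', however it is shaped.\<close>

lemma solvable_local:
  assumes "continuous_on R k" "s \<in> R"
  shows "\<exists>T. open T \<and> s \<in> T \<and> (\<forall>R'. R' \<subseteq> R \<inter> T \<longrightarrow> solvable k R')"
proof -
  obtain W where W: "open W" "k s \<in> W" "\<forall>y\<in>W. \<forall>b\<in>vals y. \<exists>f. sol W f \<and> f y = b"
    using sol_exists by blast
  obtain T where T: "open T" "s \<in> T" "\<forall>t\<in>R. t \<in> T \<longrightarrow> k t \<in> W"
    using assms W(1,2) unfolding continuous_on_topological by meson
  have "solvable k R'" if R': "R' \<subseteq> R \<inter> T" for R'
    unfolding solvable_def
  proof (intro ballI)
    fix r b assume r: "r \<in> R'" "b \<in> vals (k r)"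
    have kW: "k t \<in> W" if "t \<in> R'" for t using T(3) R' that by blast
    then obtain f where f: "sol W f" "f (k r) = b" using W(3) r by blast
    have "sect k R' (\<lambda>t. f (k t))"
      by (rule sect_sol[OF f(1) continuous_on_subset[OF assms(1)] kW]) (use R' in auto)
    then show "\<exists>g. sect k R' g \<and> g r = b" using f(2) by (intro exI) auto
  qed
  with T show ?thesis by blast
qed

text \<open>A Lebesgue number argument by two nested bisections: strips
  \<open>{a..b} \<times> {0..1}\<close> outside and, for strips around a fixed x, rectangles over
  \<open>{c..d}\<close> inside.\<close>

lemma solvable_square:
  fixes k :: "real \<times> real \<Rightarrow> 'x"
  assumes k: "continuous_on ({0..1} \<times> {0..1}) k"
  shows "solvable k ({0..1} \<times> {0..1})"
proof -
  define P where "P a b \<longleftrightarrow> (0 \<le> a \<and> b \<le> 1 \<longrightarrow> solvable k ({a..b} \<times> {0..1}))" for a b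
  have "P 0 1"
  proof (induction rule: Bolzano[OF zero_le_one])
    case (1 a b c)
    show ?case
      unfolding P_def
    proof
      assume ac: "0 \<le> a \<and> c \<le> 1"
      have eq: "{a..c} \<times> {0..1} = {a..b} \<times> {0..1} \<union> {b..c} \<times> {0..1::real}"
        and I: "({a..b} \<times> {0..1}) \<inter> ({b..c} \<times> {0..1}) = {b} \<times> {0..1::real}"
        using 1(3,4) by auto
      show "solvable k ({a..c} \<times> {0..1})"
        unfolding eq
      proof (rule solvable_glue)
        show "continuous_on ({a..b} \<times> {0..1} \<union> {b..c} \<times> {0..1}) k"
          unfolding eq[symmetric] by (rule continuous_on_subset[OF k]) (use ac in auto)
        show "connected (({a..b} \<times> {0..1}) \<inter> ({b..c} \<times> {0..1::real}))"
          unfolding I by (intro connected_Times) auto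
        show "({a..b} \<times> {0..1}) \<inter> ({b..c} \<times> {0..1::real}) \<noteq> {}" unfolding I by auto
        show "solvable k ({a..b} \<times> {0..1})" "solvable k ({b..c} \<times> {0..1})"
          using 1 ac by (auto simp: P_def)
      qed (auto intro: closed_Times)
    qed
  next
    case (2 x)
    \<comment> \<open>One width \<delta> has to serve all intervals around x. Gluing two rectangles
      takes the minimum of their widths, and the bisection ends with a single width for the full
      height.\<close>
    define Q where "Q c d \<longleftrightarrow> (0 \<le> c \<and> d \<le> 1 \<longrightarrow> (\<exists>\<delta>>0. \<forall>a b. 0 \<le> a \<and> a \<le> x \<and> x \<le> b \<and> b \<le> 1 \<and> b - a < \<delta> \<longrightarrow>
        solvable k ({a..b} \<times> {c..d})))" for c d
    have "Q 0 1"
    proof (induction rule: Bolzano[OF zero_le_one])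
      case (1 c d e)
      show ?case
        unfolding Q_def
      proof
        assume ce: "0 \<le> c \<and> e \<le> 1"
        obtain \<delta>1 \<delta>2 where \<delta>: "\<delta>1 > 0" "\<delta>2 > 0"
          "\<And>a b. 0 \<le> a \<and> a \<le> x \<and> x \<le> b \<and> b \<le> 1 \<and> b - a < \<delta>1 \<Longrightarrow> solvable k ({a..b} \<times> {c..d})"
          "\<And>a b. 0 \<le> a \<and> a \<le> x \<and> x \<le> b \<and> b \<le> 1 \<and> b - a < \<delta>2 \<Longrightarrow> solvable k ({a..b} \<times> {d..e})"
          using 1 ce unfolding Q_def by fastforce
        have "solvable k ({a..b} \<times> {c..e})" if ab: "0 \<le> a" "a \<le> x" "x \<le> b" "b \<le> 1" "b - a < min \<delta>1 \<delta>2" for a b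
        proof -
          have eq: "{a..b} \<times> {c..e} = {a..b} \<times> {c..d} \<union> {a..b} \<times> {d..e}"
            and I: "({a..b} \<times> {c..d}) \<inter> ({a..b} \<times> {d..e}) = {a..b} \<times> {d}"
            using 1(3,4) by auto
          show ?thesis
            unfolding eq
          proof (rule solvable_glue)
            show "continuous_on ({a..b} \<times> {c..d} \<union> {a..b} \<times> {d..e}) k"
              unfolding eq[symmetric] by (rule continuous_on_subset[OF k]) (use ab ce in auto)
            show "connected (({a..b} \<times> {c..d}) \<inter> ({a..b} \<times> {d..e}))"
              unfolding I by (intro connected_Times) auto
            show "({a..b} \<times> {c..d}) \<inter> ({a..b} \<times> {d..e}) \<noteq> {}" unfolding I using ab by auto
            show "solvable k ({a..b} \<times> {c..d})" "solvable k ({a..b} \<times> {d..e})"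
              using ab \<delta> by auto
          qed (auto intro: closed_Times)
        qed
        then show "\<exists>\<delta>>0. \<forall>a b. 0 \<le> a \<and> a \<le> x \<and> x \<le> b \<and> b \<le> 1 \<and> b - a < \<delta> \<longrightarrow> solvable k ({a..b} \<times> {c..e})"
          using \<delta>(1,2) by (intro exI[of _ "min \<delta>1 \<delta>2"]) auto
      qed
    next
      case (2 y)
      obtain T where T: "open T" "(x, y) \<in> T" "\<And>R'. R' \<subseteq> ({0..1} \<times> {0..1}) \<inter> T \<Longrightarrow> solvable k R'"
        using solvable_local[OF k, of "(x, y)"] 2 \<open>0 \<le> x\<close> \<open>x \<le> 1\<close> by auto
      then obtain A B where AB: "open A" "open B" "x \<in> A" "y \<in> B" "A \<times> B \<subseteq> T"
        by (elim open_prod_elim) auto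
      obtain e1 e2 where e: "e1 > 0" "e2 > 0" "ball x e1 \<subseteq> A" "ball y e2 \<subseteq> B"
        using AB by (metis open_contains_ball)
      show ?case
      proof (intro exI[of _ e2] conjI allI impI e(2))
        fix c d assume cd: "c \<le> y \<and> y \<le> d \<and> d - c < e2"
        show "Q c d"
          unfolding Q_def
        proof (intro impI exI[of _ e1] conjI e(1) allI)
          fix a b assume cd1: "0 \<le> c \<and> d \<le> 1" and ab: "0 \<le> a \<and> a \<le> x \<and> x \<le> b \<and> b \<le> 1 \<and> b - a < e1"
          have "{a..b} \<subseteq> ball x e1" "{c..d} \<subseteq> ball y e2"
            using ab cd by (auto simp: dist_real_def)
          then have "{a..b} \<times> {c..d} \<subseteq> A \<times> B"
            using e(3,4) by (intro Sigma_mono) auto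
          then show "solvable k ({a..b} \<times> {c..d})"
            using AB(5) ab cd1 by (intro T(3)) auto
        qed
      qed
    qed
    then obtain \<delta> where "\<delta> > 0" "\<And>a b. 0 \<le> a \<and> a \<le> x \<and> x \<le> b \<and> b \<le> 1 \<and> b - a < \<delta> \<Longrightarrow> solvable k ({a..b} \<times> {0..1})"
      unfolding Q_def by auto
    then show ?case
      unfolding P_def by (intro exI[of _ \<delta>]) auto
  qed
  then show ?thesis by (simp add: P_def)
qed

section \<open>Continuation along paths and loops\<close>

lemma solvable_path:
  fixes p :: "real \<Rightarrow> 'x"
  assumes p: "continuous_on {0..1} p"
  shows "solvable p {0..1}"
  unfolding solvable_def
proof (intro ballI)
  fix r b assume r: "r \<in> {0..1::real}" "b \<in> vals (p r)"
  \<comment> \<open>The path is treated as a square that is constant in the first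
    coordinate.\<close>
  have "continuous_on ({0..1::real} \<times> {0..1::real}) (\<lambda>z. p (snd z))"
    by (rule continuous_on_compose2[OF p]) (auto intro: continuous_intros)
  note s = bspec[OF solvable_square[OF this, unfolded solvable_def], of "(0, r)"]
  have "\<exists>g. sect (\<lambda>z. p (snd z)) ({0..1::real} \<times> {0..1::real}) g \<and> g (0, r) = b"
    using bspec[OF s, of b] r by simp
  then obtain g where g: "sect (\<lambda>z. p (snd z)) ({0..1::real} \<times> {0..1::real}) g" "g (0, r) = b"
    by blast
  have "sect p {0..1} (\<lambda>t. g (0, t))"
    using sect_pullback[OF g(1), of "{0..1}" "\<lambda>t. (0, t)"] by (simp add: continuous_on_Pair)
  then show "\<exists>g. sect p {0..1} g \<and> g r = b" using g(2) by (intro exI) auto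
qed

text \<open>The free homotopy from the loop to a constant one is lifted. The tracks of the two end
  points coincide, and the lifts over this common track agree at time 1, where the loop is constant;
  unique lifting brings the agreement back to time 0.\<close>

lemma trivial_monodromy:
  fixes p :: "real \<Rightarrow> 'x"
  assumes sc: "simply_connected (UNIV :: 'x set)"
    and p: "path p" "pathfinish p = pathstart p" and g: "sect p {0..1} g"
  shows "g 1 = g 0"
proof -
  let ?c = "\<lambda>_::real. pathstart p"
  have "path ?c" by (simp add: path_def)
  then have "homotopic_loops UNIV p ?c"
    using sc p unfolding simply_connected_def by (auto simp: pathstart_def pathfinish_def)
  then obtain h :: "real \<times> real \<Rightarrow> 'x" where h: "continuous_on ({0..1} \<times> {0..1}) h"
    "\<And>t. t \<in> {0..1} \<Longrightarrow> h (0, t) = p t" "\<And>t. t \<in> {0..1} \<Longrightarrow> h (1, t) = pathstart p"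
    "\<And>s. s \<in> {0..1} \<Longrightarrow> h (s, 1) = h (s, 0)"
    unfolding homotopic_loops by (auto simp: pathstart_def pathfinish_def)
  have "g 0 \<in> vals (h (0, 0))" using sect_vals[OF g, of 0] h(2) by simp
  then obtain G where G: "sect h ({0..1} \<times> {0..1}) G" "G (0, 0) = g 0"
    using solvable_square[OF h(1)] unfolding solvable_def by fastforce
  have e1: "sect (\<lambda>t. h (0, t)) {0..1} (\<lambda>t. G (0, t))"
    by (rule sect_pullback[OF G(1)]) (auto intro: continuous_intros)
  have e2: "sect (\<lambda>t. h (1, t)) {0..1} (\<lambda>t. G (1, t))"
    by (rule sect_pullback[OF G(1)]) (auto intro: continuous_intros)
  have e3: "sect (\<lambda>s. h (s, 0)) {0..1} (\<lambda>s. G (s, 0))"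
    by (rule sect_pullback[OF G(1)]) (auto intro: continuous_intros)
  have e4: "sect (\<lambda>s. h (s, 1)) {0..1} (\<lambda>s. G (s, 1))"
    by (rule sect_pullback[OF G(1)]) (auto intro: continuous_intros)
  have "sect (\<lambda>_. pathstart p) {0..1} (\<lambda>t. G (1, t))"
    by (rule sect_cong[OF e2]) (use h(3) in auto)
  then have c: "G (1, 0) = G (1, 1)" by (rule sect_const) auto
  have e4': "sect (\<lambda>s. h (s, 0)) {0..1} (\<lambda>s. G (s, 1))"
    by (rule sect_cong[OF e4]) (use h(4) in auto)
  have "continuous_on {0..1} (\<lambda>s. h (s, 0))"
    by (rule continuous_on_compose2[OF h(1)]) (auto intro: continuous_intros)
  from sect_unique[OF this _ e3 e4' _ c, of 0] have "G (0, 0) = G (0, 1)" by simp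
  moreover have "G (0, t) = g t" if "t \<in> {0..1}" for t
  proof (rule sect_unique[OF _ _ _ g _ _ that])
    show "sect p {0..1} (\<lambda>t. G (0, t))" by (rule sect_cong[OF e1]) (use h(2) in auto)
    show "continuous_on {0..1} p" using p(1) by (simp add: path_def)
    show "G (0, 0) = g 0" by (rule G(2))
  qed auto
  ultimately show ?thesis using G(2) by simp
qed

lemma join_halves:
  assumes "pathfinish p = pathstart q" "t \<in> {0..1::real}"
  shows "(p +++ q) (t / 2) = p t" "(p +++ q) ((1 + t) / 2) = q t"
proof -
  have "2 * ((1 + t) / 2) - 1 = t" by (simp add: field_simps)
  then show "(p +++ q) (t / 2) = p t" "(p +++ q) ((1 + t) / 2) = q t"
    using assms by (auto simp: joinpaths_def pathfinish_def pathstart_def)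
qed

lemma sect_halves:
  assumes "sect (p +++ q) {0..1::real} g" "pathfinish p = pathstart q"
  shows "sect p {0..1} (\<lambda>t. g (t / 2))" "sect q {0..1} (\<lambda>t. g ((1 + t) / 2))"
proof -
  have 1: "sect (\<lambda>t. (p +++ q) (t / 2)) {0..1} (\<lambda>t. g (t / 2))"
    by (rule sect_pullback[OF assms(1)]) (auto intro!: continuous_intros)
  show "sect p {0..1} (\<lambda>t. g (t / 2))"
    by (rule sect_cong[OF 1]) (use join_halves[OF assms(2)] in auto)
  have 2: "sect (\<lambda>t. (p +++ q) ((1 + t) / 2)) {0..1} (\<lambda>t. g ((1 + t) / 2))"
    by (rule sect_pullback[OF assms(1)]) (auto intro!: continuous_intros)
  show "sect q {0..1} (\<lambda>t. g ((1 + t) / 2))"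
    by (rule sect_cong[OF 2]) (use join_halves[OF assms(2)] in auto)
qed

lemma path_sect_unique:
  assumes "path p" "sect p {0..1} g" "sect p {0..1} g'" "r \<in> {0..1::real}" "g r = g' r" "t \<in> {0..1}"
  shows "g t = g' t"
  by (rule sect_unique[OF _ _ assms(2-6)]) (use assms(1) in \<open>auto simp: path_def\<close>)

lemma path_sect_exists:
  assumes "path p" "b \<in> vals (pathstart p)"
  shows "\<exists>g. sect p {0..1} g \<and> g 0 = b"
  using solvable_path[of p] assms unfolding solvable_def path_def pathstart_def by fastforce

text \<open>The value at x is obtained by continuation along a path from \<open>x0\<close>.
  Independence of the path is the trivial monodromy of one path followed by the reverse of another;
  prolonging a path inside a neighbourhood with solutions shows that the result is a local
  solution.\<close>

theorem global_solution:
  assumes sc: "simply_connected (UNIV :: 'x set)" and b0: "b0 \<in> vals x0"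
  shows "\<exists>F. F x0 = b0 \<and> (\<forall>x. \<exists>U f. sol U f \<and> x \<in> U \<and> (\<forall>y\<in>U. F y = f y))"
proof -
  define reach where "reach x b \<longleftrightarrow> (\<exists>p g. path p \<and> pathstart p = x0 \<and> pathfinish p = x \<and>
     sect p {0..1} g \<and> g 0 = b0 \<and> g 1 = b)" for x b
  have ex: "\<exists>b. reach x b" for x
  proof -
    have "path (\<lambda>_::real. x0)" "path (\<lambda>_::real. x)" by (simp_all add: path_def)
    \<comment> \<open>A free homotopy between the constant loops at the two points contains a path
      joining them, the track of the base point.\<close>
    then have "homotopic_loops UNIV (\<lambda>_. x0) (\<lambda>_. x)"
      using sc unfolding simply_connected_def by (auto simp: pathstart_def pathfinish_def)
    then obtain h :: "real \<times> real \<Rightarrow> 'x" where h: "continuous_on ({0..1} \<times> {0..1}) h"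
      "\<And>t. t \<in> {0..1} \<Longrightarrow> h (0, t) = x0" "\<And>t. t \<in> {0..1} \<Longrightarrow> h (1, t) = x"
      unfolding homotopic_loops by auto
    define p where "p s = h (s, 0)" for s
    have "continuous_on {0..1} p"
      unfolding p_def by (rule continuous_on_compose2[OF h(1)]) (auto intro: continuous_intros)
    then have p: "path p" "pathstart p = x0" "pathfinish p = x"
      using h by (auto simp: path_def pathstart_def pathfinish_def p_def)
    with path_sect_exists[OF p(1)] b0 show ?thesis unfolding reach_def by metis
  qed
  have un: "b = b'" if b: "reach x b" and b': "reach x b'" for x b b'
  proof -
    obtain p g where p: "path p" "pathstart p = x0" "pathfinish p = x" "sect p {0..1} g" "g 0 = b0" "g 1 = b"
      using b unfolding reach_def by blast
    obtain q g' where q: "path q" "pathstart q = x0" "pathfinish q = x" "sect q {0..1} g'" "g' 0 = b0" "g' 1 = b'"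
      using b' unfolding reach_def by blast
    let ?l = "p +++ reversepath q"
    have j: "pathfinish p = pathstart (reversepath q)" using p q by simp
    have l: "path ?l" "pathstart ?l = x0" "pathfinish ?l = x0" using p q by auto
    obtain G where G: "sect ?l {0..1} G" "G 0 = b0"
      using path_sect_exists[OF l(1)] l(2) b0 by auto
    have G1: "G 1 = b0" using trivial_monodromy[OF sc l(1) _ G(1)] l G(2) by simp
    note h = sect_halves[OF G(1) j]
    have 1: "G (1/2) = b"
      using path_sect_unique[OF p(1) h(1) p(4), of 0 1] G(2) p(5,6) by simp
    \<comment> \<open>Read backwards, the second half runs along q from the value at the end of the
      loop to the value at its midpoint.\<close>
    have "sect (\<lambda>t. reversepath q (1 - t)) {0..1} (\<lambda>t. G ((1 + (1 - t)) / 2))"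
      by (rule sect_pullback[OF h(2)]) (auto intro!: continuous_intros)
    then have "sect q {0..1} (\<lambda>t. G ((1 + (1 - t)) / 2))"
      by (rule sect_cong) (auto simp: reversepath_def)
    from path_sect_unique[OF q(1) this q(4), of 0 1] have "G (1/2) = b'"
      using G1 q(5,6) by simp
    with 1 show ?thesis by simp
  qed
  define F where "F x = (THE b. reach x b)" for x
  have F: "reach x (F x)" for x
    unfolding F_def using ex[of x] un by (metis the_equality)
  have Feq: "F x = b" if "reach x b" for x b using un[OF F that] .
  have "reach x0 b0"
  proof -
    have "path (\<lambda>_::real. x0)" by (simp add: path_def)
    moreover obtain g where g: "sect (\<lambda>_::real. x0) {0..1} g" "g 0 = b0"
      using path_sect_exists[OF \<open>path (\<lambda>_::real. x0)\<close>, of b0] b0 by (auto simp: pathstart_def)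
    moreover have "g 0 = g 1" by (rule sect_const[OF g(1)]) auto
    ultimately show ?thesis unfolding reach_def
      by (intro exI[of _ "\<lambda>_. x0"] exI[of _ g]) (auto simp: pathstart_def pathfinish_def)
  qed
  then have "F x0 = b0" by (rule Feq)
  moreover have "\<exists>U f. sol U f \<and> x \<in> U \<and> (\<forall>y\<in>U. F y = f y)" for x
  proof -
    obtain p g where p: "path p" "pathstart p = x0" "pathfinish p = x" "sect p {0..1} g" "g 0 = b0" "g 1 = F x"
      using F[of x] unfolding reach_def by blast
    have v: "F x \<in> vals x" using sect_vals[OF p(4), of 1] p by (simp add: pathfinish_def)
    obtain W where W: "open W" "x \<in> W" "path_connected W" "\<forall>y\<in>W. \<forall>b\<in>vals y. \<exists>f. sol W f \<and> f y = b"
      using sol_exists by blast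
    then obtain f where f: "sol W f" "f x = F x" using v by blast
    have "F y = f y" if y: "y \<in> W" for y
    proof (rule Feq)
      obtain r where r: "path r" "path_image r \<subseteq> W" "pathstart r = x" "pathfinish r = y"
        using W(2,3) y unfolding path_connected_def by blast
      let ?l = "p +++ r"
      have j: "pathfinish p = pathstart r" using p r by simp
      have l: "path ?l" "pathstart ?l = x0" "pathfinish ?l = y" using p r by auto
      obtain G where G: "sect ?l {0..1} G" "G 0 = b0"
        using path_sect_exists[OF l(1)] l(2) b0 by auto
      note h = sect_halves[OF G(1) j]
      have 1: "G (1/2) = F x"
        using path_sect_unique[OF p(1) h(1) p(4), of 0 1] G(2) p(5,6) by simp
      have "sect r {0..1} (\<lambda>t. f (r t))"
        by (rule sect_sol[OF f(1)]) (use r in \<open>auto simp: path_def path_image_def\<close>)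
      from path_sect_unique[OF r(1) h(2) this, of 0 1] have "G 1 = f y"
        using 1 f(2) r(3,4) by (simp add: pathstart_def pathfinish_def)
      with l G show "reach y (f y)" unfolding reach_def by blast
    qed
    with f W show ?thesis by blast
  qed
  ultimately show ?thesis by blast
qed

end

section \<open>Parallel forms of a flat metric\<close>

text \<open>The second hypothesis is the Cauchy-Riemann equation.\<close>

lemma has_derivative_complex_linear:
  assumes "(f has_derivative f') (at p)" "f' \<i> = \<i> * f' 1"
  shows "(f has_field_derivative f' 1) (at p)"
proof -
  have lin: "linear f'" using assms(1) has_derivative_linear by blast
  have "f' v = f' 1 * v" for v
  proof -
    have "f' v = f' (Re v *\<^sub>R 1 + Im v *\<^sub>R \<i>)"
      by (rule arg_cong[of _ _ f']) (simp add: complex_eq_iff)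
    also have "\<dots> = Re v *\<^sub>R f' 1 + Im v *\<^sub>R f' \<i>"
      by (simp only: linear_add[OF lin] linear_scale[OF lin])
    also have "\<dots> = f' 1 * v" unfolding assms(2) by (simp add: complex_eq_iff algebra_simps)
    finally show ?thesis .
  qed
  then have "f' = (*) (f' 1)" by blast
  then show ?thesis using assms(1) by (simp add: has_field_derivative_def)
qed

lemma holomorphic_on_local:
  assumes "\<And>p. p \<in> S \<Longrightarrow> \<exists>T. open T \<and> p \<in> T \<and> f holomorphic_on T"
  shows "f holomorphic_on S"
  unfolding holomorphic_on_def
proof
  fix p assume "p \<in> S"
  then obtain T where "open T" "p \<in> T" "f holomorphic_on T" using assms by blast
  then show "f field_differentiable at p within S"
    using holomorphic_on_imp_differentiable_at field_differentiable_at_within by blast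
qed

lemma transition_holomorphic:
  assumes "riemann_surface X" "c \<in> X" "d \<in> X"
  shows "(snd d \<circ> chart_inv c) holomorphic_on snd c ` (fst c \<inter> fst d)"
  using assms by (simp add: riemann_surface_def)

lemma chart_deriv_holomorphic:
  assumes c: "coordinates c" and V: "open V" "x \<in> fst c \<inter> V"
    and h: "(F \<circ> chart_inv c) holomorphic_on snd c ` (fst c \<inter> V)"
  shows "chart_deriv c F x v = deriv (F \<circ> chart_inv c) (snd c x) * v"
    and "((F \<circ> chart_inv c) has_derivative (\<lambda>v. deriv (F \<circ> chart_inv c) (snd c x) * v)) (at (snd c x))"
proof -
  have "((F \<circ> chart_inv c) has_field_derivative deriv (F \<circ> chart_inv c) (snd c x)) (at (snd c x))"
    by (rule holomorphic_derivI[OF h coordinates_open_image[OF c V(1)]]) (use V in auto)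
  then show *: "((F \<circ> chart_inv c) has_derivative (\<lambda>v. deriv (F \<circ> chart_inv c) (snd c x) * v)) (at (snd c x))"
    by (simp add: has_field_derivative_def)
  show "chart_deriv c F x v = deriv (F \<circ> chart_inv c) (snd c x) * v"
    unfolding chart_deriv_def by (rule frechet_derivative_eq[OF *])
qed

lemma transition_deriv:
  assumes X: "riemann_surface X" and c: "c \<in> X" "d \<in> X" "x \<in> fst c" "x \<in> fst d"
  shows "chart_deriv c (snd d) x v = deriv (snd d \<circ> chart_inv c) (snd c x) * v"
proof (rule chart_deriv_holomorphic(1))
  show "open (fst d)" using surface_coordinates[OF X c(2)] by (simp add: coordinates_def)
  show "coordinates c" by (rule surface_coordinates[OF X c(1)])
  show "(snd d \<circ> chart_inv c) holomorphic_on snd c ` (fst c \<inter> fst d)"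
    by (rule transition_holomorphic[OF X c(1,2)])
qed (use c in auto)

lemma holomorphic_change_chart:
  assumes X: "riemann_surface X" and cd: "c \<in> X" "d \<in> X" and V: "open V" "x \<in> fst c \<inter> fst d \<inter> V"
    and h: "(F \<circ> chart_inv d) holomorphic_on snd d ` (fst d \<inter> V)"
  shows "(F \<circ> chart_inv c) holomorphic_on snd c ` (fst c \<inter> fst d \<inter> V)"
    and "deriv (F \<circ> chart_inv c) (snd c x) = deriv (F \<circ> chart_inv d) (snd d x) * deriv (snd d \<circ> chart_inv c) (snd c x)"
proof -
  note cc = surface_coordinates[OF X cd(1)] and cd' = surface_coordinates[OF X cd(2)]
  note ci = coordinates_inverse[OF cc] and di = coordinates_inverse[OF cd']
  let ?S = "snd c ` (fst c \<inter> fst d \<inter> V)"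
  have od: "open (fst d)" using cd' by (simp add: coordinates_def)
  have S: "open ?S"
    using coordinates_open_image[OF cc open_Int[OF od V(1)]] by (simp add: Int_assoc)
  have t: "(snd d \<circ> chart_inv c) holomorphic_on ?S"
    by (rule holomorphic_on_subset[OF transition_holomorphic[OF X cd]]) auto
  have im: "(snd d \<circ> chart_inv c) ` ?S \<subseteq> snd d ` (fst d \<inter> V)" by (auto simp: ci)
  have eq: "((F \<circ> chart_inv d) \<circ> (snd d \<circ> chart_inv c)) p = (F \<circ> chart_inv c) p" if "p \<in> ?S" for p
    using that by (auto simp: ci di)
  have "((F \<circ> chart_inv d) \<circ> (snd d \<circ> chart_inv c)) holomorphic_on ?S"
    by (rule holomorphic_on_compose_gen[OF t h im])
  then show "(F \<circ> chart_inv c) holomorphic_on ?S"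
    by (rule holomorphic_transform) (rule eq)
  have xS: "snd c x \<in> ?S" using V by auto
  have dt: "((snd d \<circ> chart_inv c) has_field_derivative deriv (snd d \<circ> chart_inv c) (snd c x)) (at (snd c x))"
    by (rule holomorphic_derivI[OF t S xS])
  have "((F \<circ> chart_inv d) has_field_derivative deriv (F \<circ> chart_inv d) (snd d x)) (at (snd d x))"
    by (rule holomorphic_derivI[OF h coordinates_open_image[OF cd' V(1)]]) (use V in auto)
  then have "((F \<circ> chart_inv d) has_field_derivative deriv (F \<circ> chart_inv d) (snd d x)) (at ((snd d \<circ> chart_inv c) (snd c x)))"
    using V by (simp add: ci)
  from DERIV_chain[OF this dt] have "((F \<circ> chart_inv d) \<circ> (snd d \<circ> chart_inv c) has_field_derivative
      deriv (F \<circ> chart_inv d) (snd d x) * deriv (snd d \<circ> chart_inv c) (snd c x)) (at (snd c x))" .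
  then have "((F \<circ> chart_inv c) has_field_derivative
      deriv (F \<circ> chart_inv d) (snd d x) * deriv (snd d \<circ> chart_inv c) (snd c x)) (at (snd c x))"
    by (rule has_field_derivative_transform_within_open[OF _ S xS eq])
  then show "deriv (F \<circ> chart_inv c) (snd c x) = deriv (F \<circ> chart_inv d) (snd d x) * deriv (snd d \<circ> chart_inv c) (snd c x)"
    by (rule DERIV_imp_deriv)
qed

section \<open>Euclidean coordinates and their orientation\<close>

lemma coordinates_open_preimage:
  assumes "coordinates e" "open B"
  shows "open {x \<in> fst e. snd e x \<in> B}"
proof -
  have "continuous_on (fst e) (snd e)" "open (fst e)"
    using assms(1) by (auto simp: coordinates_def homeomorphism_def)
  then have "open (fst e \<inter> snd e -` B)"
    using assms(2) by (simp add: continuous_on_open_vimage Int_commute)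
  moreover have "{x \<in> fst e. snd e x \<in> B} = fst e \<inter> snd e -` B" by auto
  ultimately show ?thesis by simp
qed

lemma coordinates_restrict:
  assumes e: "coordinates e" and V: "open V" "V \<subseteq> fst e"
  shows "coordinates (V, snd e)" and "p \<in> snd e ` V \<Longrightarrow> chart_inv (V, snd e) p = chart_inv e p"
proof -
  note ei = coordinates_inverse[OF e]
  have inj: "inj_on (snd e) V" using ei(1) V(2) by (metis inj_onI subsetD)
  show eq: "chart_inv (V, snd e) p = chart_inv e p" if "p \<in> snd e ` V" for p
    using that inj V(2) ei(1) by (auto simp: chart_inv_def[of "(V, snd e)"])
  have h: "homeomorphism (fst e) (snd e ` fst e) (snd e) (chart_inv e)" using e by (simp add: coordinates_def)
  have "homeomorphism V (snd e ` V) (snd e) (chart_inv e)"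
    by (rule homeomorphism_of_subsets[OF h V(2)]) (use V in auto)
  then have "homeomorphism V (snd e ` V) (snd e) (chart_inv (V, snd e))"
    by (rule homeomorphism_cong) (auto simp: eq)
  moreover have "open (snd e ` V)"
    using coordinates_open_image[OF e V(1)] V(2) by (simp add: Int_absorb1)
  ultimately show "coordinates (V, snd e)" using V(1) by (simp add: coordinates_def)
qed

lemma euclidean_restrict:
  assumes X: "riemann_surface X" and e: "euclidean_coordinates X g e" and V: "open V" "V \<subseteq> fst e"
  shows "euclidean_coordinates X g (V, snd e)"
  unfolding euclidean_coordinates_def
proof (intro conjI)
  show "coordinates (V, snd e)"
    using coordinates_restrict(1)[OF _ V] e by (simp add: euclidean_coordinates_def)
  have "smooth_on (snd c ` (fst c \<inter> V)) (snd e \<circ> chart_inv c)" if "c \<in> X" for c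
    by (rule smooth_on_subset[of "snd c ` (fst c \<inter> fst e)"])
      (use e that V coordinates_open_image[OF surface_coordinates[OF X that] V(1)] in \<open>auto simp: euclidean_coordinates_def smooth_map_def\<close>)
  then show "smooth_map X (fst (V, snd e)) (snd (V, snd e))" using V by (simp add: smooth_map_def)
qed (use e V in \<open>auto simp: euclidean_coordinates_def\<close>)

text \<open>Conjugation is an isometry of the plane. It is the correction to apply when a Euclidean
  chart turns out to be antiholomorphic.\<close>

lemma euclidean_cnj:
  assumes X: "riemann_surface X" and e: "euclidean_coordinates X g e"
  shows "euclidean_coordinates X g (fst e, cnj \<circ> snd e)"
  unfolding euclidean_coordinates_def
proof (intro conjI ballI allI)
  have ce: "coordinates e" using e by (simp add: euclidean_coordinates_def)
  note ei = coordinates_inverse[OF ce]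
  have inj: "inj_on (cnj \<circ> snd e) (fst e)"
    by (rule inj_onI) (metis comp_apply complex_cnj_cancel_iff ei(1))
  have inv: "chart_inv (fst e, cnj \<circ> snd e) p = chart_inv e (cnj p)" if "p \<in> (cnj \<circ> snd e) ` fst e" for p
    using that inv_into_f_f[OF inj] ei(1) by (auto simp: chart_inv_def[of "(fst e, cnj \<circ> snd e)"])
  have h: "homeomorphism (fst e) (snd e ` fst e) (snd e) (chart_inv e)" using ce by (simp add: coordinates_def)
  have "homeomorphism (snd e ` fst e) (cnj ` snd e ` fst e) cnj cnj"
    by (auto simp: homeomorphism_def image_image intro!: continuous_intros)
  from homeomorphism_compose[OF h this]
  have "homeomorphism (fst e) ((cnj \<circ> snd e) ` fst e) (cnj \<circ> snd e) (chart_inv e \<circ> cnj)"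
    by (simp add: image_image)
  then have "homeomorphism (fst e) ((cnj \<circ> snd e) ` fst e) (cnj \<circ> snd e) (chart_inv (fst e, cnj \<circ> snd e))"
    by (rule homeomorphism_cong) (auto simp: inv)
  moreover have "open ((cnj \<circ> snd e) ` fst e)"
  proof -
    have "open (cnj -` (snd e ` fst e))"
      by (rule open_vimage) (use ce in \<open>auto simp: coordinates_def intro!: continuous_intros\<close>)
    moreover have "cnj -` (snd e ` fst e) = (cnj \<circ> snd e) ` fst e"
      by (auto simp: image_iff) (metis complex_cnj_cnj)
    ultimately show ?thesis by simp
  qed
  ultimately show "coordinates (fst e, cnj \<circ> snd e)" using ce by (simp add: coordinates_def)
  show "smooth_map X (fst (fst e, cnj \<circ> snd e)) (snd (fst e, cnj \<circ> snd e))"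
    using e smooth_on_cnj by (fastforce simp: euclidean_coordinates_def smooth_map_def o_def)
  fix c x v w assume c: "c \<in> X" and x: "x \<in> fst c \<inter> fst (fst e, cnj \<circ> snd e)"
  have "((snd e \<circ> chart_inv c) has_derivative chart_deriv c (snd e) x) (at (snd c x))"
    by (rule smooth_map_has_derivative[OF X]) (use e c x in \<open>auto simp: euclidean_coordinates_def\<close>)
  from has_derivative_cnj[OF this]
  have "((cnj \<circ> snd e \<circ> chart_inv c) has_derivative (\<lambda>v. cnj (chart_deriv c (snd e) x v))) (at (snd c x))"
    by (simp add: o_def)
  from frechet_derivative_eq[OF this]
  have "chart_deriv c (cnj \<circ> snd e) x v = cnj (chart_deriv c (snd e) x v)" for v
    by (simp add: chart_deriv_def)
  moreover have "cnj a \<bullet> cnj b = a \<bullet> b" for a b by (simp add: inner_complex_def)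
  ultimately show "g c x v w = chart_deriv c (snd (fst e, cnj \<circ> snd e)) x v \<bullet> chart_deriv c (snd (fst e, cnj \<circ> snd e)) x w"
    using e c x by (simp add: euclidean_coordinates_def)
qed

text \<open>Multiplication by i is an isometry, so 1 and i are orthogonal and of equal length, and
  the metric is a multiple of the standard one.\<close>

lemma compatible_metric_conformal:
  assumes g: "compatible_metric X g" and c: "c \<in> X" "x \<in> fst c"
  shows "g c x 1 \<i> = 0" "g c x \<i> \<i> = g c x 1 1" "g c x v v = (cmod v)\<^sup>2 * g c x 1 1" "g c x 1 1 > 0"
proof -
  have b: "bilinear (g c x)" and s: "\<And>v w. g c x v w = g c x w v" and "\<And>v. v \<noteq> 0 \<Longrightarrow> g c x v v > 0"
    using g c unfolding compatible_metric_def riemannian_metric_def by blast+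
  then show pos: "g c x 1 1 > 0" by simp
  have J: "g c x (\<i> * v) (\<i> * w) = g c x v w" for v w
    using g c by (simp add: compatible_metric_def)
  show "g c x \<i> \<i> = g c x 1 1" using J[of 1 1] by simp
  have "g c x \<i> (- 1) = g c x 1 \<i>" using J[of 1 \<i>] by simp
  then have "- g c x \<i> 1 = g c x 1 \<i>" using bilinear_rneg[OF b] by metis
  then show z: "g c x 1 \<i> = 0" using s[of 1 \<i>] by simp
  have "v = Re v *\<^sub>R 1 + Im v *\<^sub>R \<i>" by (simp add: complex_eq_iff)
  then have "g c x v v = g c x (Re v *\<^sub>R 1 + Im v *\<^sub>R \<i>) (Re v *\<^sub>R 1 + Im v *\<^sub>R \<i>)" by metis
  also have "\<dots> = (Re v)\<^sup>2 * g c x 1 1 + (Im v)\<^sup>2 * g c x \<i> \<i>"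
    using z s[of 1 \<i>] by (simp add: bilinear_ladd[OF b] bilinear_radd[OF b] bilinear_lmul[OF b] bilinear_rmul[OF b] power2_eq_square algebra_simps)
  finally show "g c x v v = (cmod v)\<^sup>2 * g c x 1 1"
    using J[of 1 1] by (simp add: cmod_power2 algebra_simps)
qed

lemma orthogonal_complex:
  assumes "a \<bullet> b = 0" "a \<bullet> a = b \<bullet> b" "a \<noteq> 0"
  shows "b = \<i> * a \<or> b = - (\<i> * a)"
proof -
  obtain p q r s where a: "a = Complex p q" and b: "b = Complex r s" by (metis complex.exhaust_sel)
  have 1: "p * r + q * s = 0" and 2: "p * p + q * q = r * r + s * s"
    using assms by (simp_all add: a b inner_complex_def)
  have pq: "p * p + q * q > 0"
    using assms(3) by (auto simp: a complex_eq_iff sum_squares_gt_zero_iff)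
  \<comment> \<open>Lagrange's identity: with vanishing inner product and equal lengths the
    determinant is plus or minus the squared length, and its sign decides between the two
    cases.\<close>
  have "(p * s - q * r)\<^sup>2 + (p * r + q * s)\<^sup>2 = (p * p + q * q) * (r * r + s * s)"
    by (simp add: power2_eq_square algebra_simps)
  then have "(p * s - q * r)\<^sup>2 = (p * p + q * q)\<^sup>2" using 1 2 by (simp add: power2_eq_square)
  then consider "p * s - q * r = p * p + q * q" | "p * s - q * r = - (p * p + q * q)"
    by (auto simp: power2_eq_iff)
  then show ?thesis
  proof cases
    case 1
    have "(p * p + q * q) * (s - p) = 0" "(p * p + q * q) * (r + q) = 0"
      using \<open>p * r + q * s = 0\<close> 1 by algebra+
    then have "s = p" "r = - q" using pq by auto
    then show ?thesis by (simp add: a b complex_eq_iff)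
  next
    case 2
    have "(p * p + q * q) * (s + p) = 0" "(p * p + q * q) * (r - q) = 0"
      using \<open>p * r + q * s = 0\<close> 2 by algebra+
    then have "s = - p" "r = q" using pq by auto
    then show ?thesis by (simp add: a b complex_eq_iff)
  qed
qed

text \<open>\<open>flat_metric\<close> supplies Euclidean coordinates of either orientation;
  \<open>dz\<close> is of type (1,0) only for holomorphic ones.\<close>

definition oriented_euclidean :: "'x::t2_space chart set \<Rightarrow> 'x metric \<Rightarrow> 'x chart \<Rightarrow> bool" where
  "oriented_euclidean X g e \<longleftrightarrow> euclidean_coordinates X g e \<and>
     (\<forall>c\<in>X. (snd e \<circ> chart_inv c) holomorphic_on (snd c ` (fst c \<inter> fst e)))"

text \<open>The differential of a Euclidean chart maps 1 and i to orthogonal vectors of equal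
  length, so at each point it is complex linear or antilinear. Which of the two occurs is constant
  on a connected domain, and conjugation repairs the antilinear case.\<close>

lemma oriented_euclidean_exists:
  fixes X :: "'x::t2_space chart set"
  assumes X: "riemann_surface X" and g: "compatible_metric X g" "flat_metric X g"
    and N: "open N" "x \<in> N"
  shows "\<exists>e r. oriented_euclidean X g e \<and> x \<in> fst e \<and> fst e \<subseteq> N \<and> r > 0 \<and> snd e ` fst e = ball (snd e x) r"
proof -
  obtain c where c: "c \<in> X" "x \<in> fst c" using surface_chart_exists[OF X] by blast
  note cc = surface_coordinates[OF X c(1)]
  note ci = coordinates_inverse[OF cc]
  obtain e1 where e1: "euclidean_coordinates X g e1" "x \<in> fst e1" using g(2) unfolding flat_metric_def by blast
  have ce1: "coordinates e1" using e1 by (simp add: euclidean_coordinates_def)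
  note ei = coordinates_inverse[OF ce1]
  have "open (snd e1 ` (fst e1 \<inter> (fst c \<inter> N)))"
    by (rule coordinates_open_image[OF ce1]) (use cc N in \<open>auto simp: coordinates_def\<close>)
  moreover have "snd e1 x \<in> snd e1 ` (fst e1 \<inter> (fst c \<inter> N))" using e1 c N by auto
  ultimately obtain r where r: "r > 0" "ball (snd e1 x) r \<subseteq> snd e1 ` (fst e1 \<inter> (fst c \<inter> N))"
    by (meson openE)
  \<comment> \<open>The preimage of a disc is connected, and the injectivity of the chart keeps it
    inside both \<open>fst c\<close> and N.\<close>
  define V where "V = {y \<in> fst e1. snd e1 y \<in> ball (snd e1 x) r}"
  have V: "open V" "V \<subseteq> fst e1" "x \<in> V"
    unfolding V_def using coordinates_open_preimage[OF ce1 open_ball] e1(2) r(1) by auto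
  have VN: "V \<subseteq> fst c" "V \<subseteq> N" and Vim: "snd e1 ` V = ball (snd e1 x) r"
  proof -
    have "y \<in> fst c \<inter> N" if y: "y \<in> V" for y
    proof -
      have "snd e1 y \<in> snd e1 ` (fst e1 \<inter> (fst c \<inter> N))" using r(2) y by (auto simp: V_def)
      then obtain y' where y': "y' \<in> fst e1 \<inter> (fst c \<inter> N)" "snd e1 y = snd e1 y'" by blast
      then have "y' = y" using ei(1)[of y'] ei(1)[of y] y V(2) by auto
      with y'(1) show ?thesis by simp
    qed
    then show "V \<subseteq> fst c" "V \<subseteq> N" by auto
    show "snd e1 ` V = ball (snd e1 x) r"
      using r(2) by (auto simp: V_def)
  qed
  define e2 where "e2 = (V, snd e1)"
  have e2: "euclidean_coordinates X g e2" unfolding e2_def by (rule euclidean_restrict[OF X e1(1) V(1,2)])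
  have e2s: "fst e2 = V" "snd e2 = snd e1" by (simp_all add: e2_def)
  have "V = chart_inv e1 ` ball (snd e1 x) r"
    unfolding Vim[symmetric] image_image using ei(1) V(2) by force
  moreover have "continuous_on (ball (snd e1 x) r) (chart_inv e1)"
    using ce1 r(2) by (auto simp: coordinates_def homeomorphism_def elim!: continuous_on_subset)
  ultimately have Vc: "connected V" using connected_continuous_image connected_ball by metis
  define T where "T = snd e1 \<circ> chart_inv c"
  define S where "S = snd c ` V"
  have S: "open S" using coordinates_open_image[OF cc V(1)] VN by (simp add: S_def Int_absorb1)
  have "continuous_on V (snd c)"
    using cc VN(1) by (auto simp: coordinates_def homeomorphism_def elim!: continuous_on_subset)
  then have Sc: "connected S" unfolding S_def using Vc connected_continuous_image by blast
  have cV: "fst c \<inter> V = V" using VN by auto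
  have "\<forall>c\<in>X. smooth_on (snd c ` (fst c \<inter> V)) (snd e1 \<circ> chart_inv c)"
    using e2 by (simp add: euclidean_coordinates_def smooth_map_def e2s)
  from bspec[OF this c(1)] have smT: "smooth_on S T" by (simp add: T_def S_def cV)
  define T' where "T' p = frechet_derivative T (at p)" for p
  have T': "(T has_derivative T' p) (at p)" if "p \<in> S" for p
    unfolding T'_def by (rule smooth_on_has_derivative[OF smT that])
  have J: "T' p 1 \<noteq> 0 \<and> (T' p \<i> = \<i> * T' p 1 \<or> T' p \<i> = - (\<i> * T' p 1))" if p: "p \<in> S" for p
  proof -
    obtain y where y: "y \<in> V" "p = snd c y" using p by (auto simp: S_def)
    then have yc: "y \<in> fst c" using VN by auto
    have gT: "g c y v w = T' p v \<bullet> T' p w" for v w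
      using e2 c(1) y yc by (simp add: euclidean_coordinates_def e2s chart_deriv_def T'_def T_def)
    have i: "T' p 1 \<bullet> T' p \<i> = 0" "T' p 1 \<bullet> T' p 1 = T' p \<i> \<bullet> T' p \<i>" "T' p 1 \<bullet> T' p 1 > 0"
      using compatible_metric_conformal(1,2,4)[OF g(1) c(1) yc] unfolding gT by (simp_all only:)
    then have "T' p 1 \<noteq> 0" by auto
    with orthogonal_complex[OF i(1,2)] show ?thesis by blast
  qed
  \<comment> \<open>The quotient takes only the values i and -i, so continuity on a connected set
    makes it constant.\<close>
  have "(\<lambda>p. T' p \<i> / T' p 1) constant_on S"
  proof (rule continuous_finite_range_constant[OF Sc])
    have "continuous_on S (\<lambda>p. T' p v)" for v
      unfolding T'_def by (rule smooth_on_imp_continuous_on[OF smooth_on_derivative[OF smT]])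
    then show "continuous_on S (\<lambda>p. T' p \<i> / T' p 1)"
      by (intro continuous_on_divide) (use J in auto)
    have "(\<lambda>p. T' p \<i> / T' p 1) ` S \<subseteq> {\<i>, - \<i>}" using J by fastforce
    then show "finite ((\<lambda>p. T' p \<i> / T' p 1) ` S)" by (rule finite_subset) simp
  qed
  then obtain k where k: "\<And>p. p \<in> S \<Longrightarrow> T' p \<i> / T' p 1 = k" by (auto simp: constant_on_def)
  have "\<exists>e. euclidean_coordinates X g e \<and> fst e = V \<and> snd e ` V = ball (snd e x) r \<and> (snd e \<circ> chart_inv c) holomorphic_on S"
  proof (cases "k = \<i>")
    case True
    have "T holomorphic_on S"
      unfolding holomorphic_on_open[OF S]
    proof
      fix p assume p: "p \<in> S"
      have "T' p \<i> = \<i> * T' p 1" using k[OF p] J[OF p] True by (simp add: divide_eq_eq)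
      then show "\<exists>f'. (T has_field_derivative f') (at p)"
        using has_derivative_complex_linear[OF T'[OF p]] by blast
    qed
    then show ?thesis
      using e2 e2s Vim by (intro exI[of _ e2]) (simp add: T_def)
  next
    case False
    have "(\<lambda>p. cnj (T p)) holomorphic_on S"
      unfolding holomorphic_on_open[OF S]
    proof
      fix p assume p: "p \<in> S"
      have "T' p \<i> \<noteq> \<i> * T' p 1" using k[OF p] J[OF p] False by auto
      then have "cnj (T' p \<i>) = \<i> * cnj (T' p 1)" using J[OF p] by auto
      then show "\<exists>f'. ((\<lambda>p. cnj (T p)) has_field_derivative f') (at p)"
        using has_derivative_complex_linear[OF has_derivative_cnj[OF T'[OF p]]] by blast
    qed
    moreover have "(cnj \<circ> snd e1) ` V = ball ((cnj \<circ> snd e1) x) r"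
    proof -
      have "cnj ` ball a r = ball (cnj a) r" for a
      proof (intro set_eqI iffI)
        fix z assume "z \<in> ball (cnj a) r"
        then have "cnj z \<in> ball a r" by (metis complex_cnj_cnj complex_cnj_diff complex_mod_cnj dist_norm mem_ball)
        then show "z \<in> cnj ` ball a r" by (metis complex_cnj_cnj image_eqI)
      qed (auto simp: dist_norm simp flip: complex_cnj_diff)
      then show ?thesis by (simp only: image_comp[symmetric] Vim o_apply)
    qed
    ultimately show ?thesis
      using euclidean_cnj[OF X e2] by (intro exI[of _ "(V, cnj \<circ> snd e1)"]) (simp add: e2s T_def o_def)
  qed
  then obtain e where e: "euclidean_coordinates X g e" "fst e = V" "snd e ` V = ball (snd e x) r"
      "(snd e \<circ> chart_inv c) holomorphic_on S" by blast
  have "(snd e \<circ> chart_inv d) holomorphic_on (snd d ` (fst d \<inter> V))" if d: "d \<in> X" for d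
  proof (cases "fst d \<inter> V = {}")
    case True
    show ?thesis unfolding True by (simp add: holomorphic_on_def)
  next
    case False
    then obtain y where y: "y \<in> fst d \<inter> V" by blast
    have "(snd e \<circ> chart_inv d) holomorphic_on (snd d ` (fst d \<inter> fst c \<inter> V))"
      by (rule holomorphic_change_chart(1)[OF X d c(1) V(1), of y])
        (use y VN e(4) in \<open>auto simp: S_def Int_absorb1\<close>)
    moreover have "fst d \<inter> fst c \<inter> V = fst d \<inter> V" using VN by auto
    ultimately show ?thesis by simp
  qed
  then have "oriented_euclidean X g e" using e by (simp add: oriented_euclidean_def)
  with e r(1) V(3) VN show ?thesis by blast
qed

text \<open>A form \<open>\<beta>\<close> of type (1,0) is recorded by its coefficients \<open>f x c = \<beta> c x 1\<close>. The parallel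
  unitary ones are, locally, the multiples \<open>u dz\<close> with \<open>cmod u = 1\<close> in oriented Euclidean coordinates \<open>z\<close>.\<close>

definition parallel_at :: "'x::t2_space chart set \<Rightarrow> 'x metric \<Rightarrow> 'x \<Rightarrow> ('x chart \<Rightarrow> complex) set" where
  "parallel_at X g x = {b. (\<forall>c. \<not> (c \<in> X \<and> x \<in> fst c) \<longrightarrow> b c = 0) \<and>
     (\<forall>c\<in>X. x \<in> fst c \<longrightarrow> (cmod (b c))\<^sup>2 = g c x 1 1) \<and>
     (\<forall>c\<in>X. \<forall>d\<in>X. x \<in> fst c \<inter> fst d \<longrightarrow> b c = b d * deriv (snd d \<circ> chart_inv c) (snd c x))}"

definition parallel_form :: "'x::t2_space chart set \<Rightarrow> 'x metric \<Rightarrow> 'x set \<Rightarrow> ('x \<Rightarrow> 'x chart \<Rightarrow> complex) \<Rightarrow> bool" where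
  "parallel_form X g U f \<longleftrightarrow> open U \<and> (\<forall>x\<in>U. f x \<in> parallel_at X g x) \<and>
     (\<forall>c\<in>X. (\<lambda>p. f (chart_inv c p) c) holomorphic_on snd c ` (fst c \<inter> U))"

section \<open>Unitary holomorphic forms and their ratios\<close>

lemma parallel_atI:
  assumes "\<And>c. \<not> (c \<in> X \<and> x \<in> fst c) \<Longrightarrow> b c = 0"
    and "\<And>c. c \<in> X \<Longrightarrow> x \<in> fst c \<Longrightarrow> (cmod (b c))\<^sup>2 = g c x 1 1"
    and "\<And>c d. c \<in> X \<Longrightarrow> d \<in> X \<Longrightarrow> x \<in> fst c \<Longrightarrow> x \<in> fst d \<Longrightarrow>
      b c = b d * deriv (snd d \<circ> chart_inv c) (snd c x)"
  shows "b \<in> parallel_at X g x"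
  unfolding parallel_at_def
proof (intro CollectI conjI allI ballI impI)
  show "b c = 0" if "\<not> (c \<in> X \<and> x \<in> fst c)" for c by (rule assms(1)[OF that])
  show "(cmod (b c))\<^sup>2 = g c x 1 1" if "c \<in> X" "x \<in> fst c" for c by (rule assms(2)[OF that])
  show "b c = b d * deriv (snd d \<circ> chart_inv c) (snd c x)"
    if "c \<in> X" "d \<in> X" "x \<in> fst c \<inter> fst d" for c d
    by (rule assms(3)) (use that in auto)
qed

lemma parallel_atD:
  assumes "b \<in> parallel_at X g x"
  shows "\<not> (c \<in> X \<and> x \<in> fst c) \<Longrightarrow> b c = 0"
    and "c \<in> X \<Longrightarrow> x \<in> fst c \<Longrightarrow> (cmod (b c))\<^sup>2 = g c x 1 1"
    and "c \<in> X \<Longrightarrow> d \<in> X \<Longrightarrow> x \<in> fst c \<Longrightarrow> x \<in> fst d \<Longrightarrow>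
      b c = b d * deriv (snd d \<circ> chart_inv c) (snd c x)"
  using assms unfolding parallel_at_def by blast+

lemma parallel_at_nonzero:
  assumes "compatible_metric X g" "b \<in> parallel_at X g x" "c \<in> X" "x \<in> fst c"
  shows "b c \<noteq> 0"
proof -
  have "(cmod (b c))\<^sup>2 = g c x 1 1" using assms(2-4) unfolding parallel_at_def by blast
  then show ?thesis using compatible_metric_conformal(4)[OF assms(1,3,4)] by auto
qed

text \<open>The transition law transports the ratio from one chart at x to all others, and both
  families are 0 at the remaining charts. Stalk values that agree at one chart are therefore equal
  as functions, as the local system requires.\<close>

lemma parallel_at_ratio:
  assumes "compatible_metric X g" "b \<in> parallel_at X g x" "b' \<in> parallel_at X g x" "c \<in> X" "x \<in> fst c"
    and u: "b' c = u * b c"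
  shows "cmod u = 1" "b' d = u * b d"
proof -
  have "(cmod (b c))\<^sup>2 = g c x 1 1" "(cmod (b' c))\<^sup>2 = g c x 1 1"
    using assms(2-5) unfolding parallel_at_def by blast+
  then have "(cmod (b' c))\<^sup>2 = (cmod (b c))\<^sup>2" by simp
  then have "cmod u * cmod (b c) = cmod (b c)" by (simp add: u norm_mult)
  then show "cmod u = 1" using parallel_at_nonzero[OF assms(1,2,4,5)] by simp
  show "b' d = u * b d"
  proof (cases "d \<in> X \<and> x \<in> fst d")
    case True
    then have "b d = b c * deriv (snd c \<circ> chart_inv d) (snd d x)" "b' d = b' c * deriv (snd c \<circ> chart_inv d) (snd d x)"
      using assms(2-5) unfolding parallel_at_def by blast+
    then show ?thesis using u by simp
  next
    case False
    then have "b d = 0" "b' d = 0" using assms(2,3) unfolding parallel_at_def by blast+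
    then show ?thesis by simp
  qed
qed

lemma parallel_at_mult:
  assumes "b \<in> parallel_at X g x" "cmod u = 1"
  shows "(\<lambda>c. u * b c) \<in> parallel_at X g x"
proof (rule parallel_atI)
  note b = parallel_atD[OF assms(1)]
  show "u * b c = 0" if "\<not> (c \<in> X \<and> x \<in> fst c)" for c using b(1)[OF that] by simp
  show "(cmod (u * b c))\<^sup>2 = g c x 1 1" if "c \<in> X" "x \<in> fst c" for c
    using b(2)[OF that] assms(2) by (simp add: norm_mult)
  show "u * b c = u * b d * deriv (snd d \<circ> chart_inv c) (snd c x)"
    if "c \<in> X" "d \<in> X" "x \<in> fst c" "x \<in> fst d" for c d
    using arg_cong[OF b(3)[OF that], of "(*) u"] by (simp add: mult.assoc)
qed

lemma parallel_form_mult: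
  assumes "parallel_form X g U f" "cmod u = 1"
  shows "parallel_form X g U (\<lambda>x c. u * f x c)"
  unfolding parallel_form_def
proof (intro conjI ballI)
  show "open U" using assms(1) by (simp add: parallel_form_def)
  show "(\<lambda>c. u * f x c) \<in> parallel_at X g x" if "x \<in> U" for x
    by (rule parallel_at_mult[OF _ assms(2)]) (use assms(1) that in \<open>simp add: parallel_form_def\<close>)
  show "(\<lambda>p. u * f (chart_inv c p) c) holomorphic_on snd c ` (fst c \<inter> U)" if "c \<in> X" for c
    by (intro holomorphic_intros) (use assms(1) that in \<open>simp add: parallel_form_def\<close>)
qed

text \<open>These are the coefficients of \<open>dz\<close> for the Euclidean coordinate z.\<close>

lemma parallel_form_euclidean:
  assumes X: "riemann_surface X" and e: "oriented_euclidean X g e"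
  shows "parallel_form X g (fst e) (\<lambda>x c. if c \<in> X \<and> x \<in> fst c then deriv (snd e \<circ> chart_inv c) (snd c x) else 0)"
  unfolding parallel_form_def
proof (intro conjI ballI)
  have ee: "euclidean_coordinates X g e" and h: "\<And>c. c \<in> X \<Longrightarrow> (snd e \<circ> chart_inv c) holomorphic_on (snd c ` (fst c \<inter> fst e))"
    using e by (auto simp: oriented_euclidean_def)
  show o: "open (fst e)" using ee by (simp add: euclidean_coordinates_def coordinates_def)
  fix x assume x: "x \<in> fst e"
  show "(\<lambda>c. if c \<in> X \<and> x \<in> fst c then deriv (snd e \<circ> chart_inv c) (snd c x) else 0) \<in> parallel_at X g x"
  proof (rule parallel_atI)
    fix c d assume cd: "c \<in> X" "d \<in> X" "x \<in> fst c" "x \<in> fst d"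
    have "deriv (snd e \<circ> chart_inv c) (snd c x) = deriv (snd e \<circ> chart_inv d) (snd d x) * deriv (snd d \<circ> chart_inv c) (snd c x)"
      by (rule holomorphic_change_chart(2)[OF X cd(1,2) o _ h[OF cd(2)]]) (use cd x in auto)
    then show "(if c \<in> X \<and> x \<in> fst c then deriv (snd e \<circ> chart_inv c) (snd c x) else 0) =
        (if d \<in> X \<and> x \<in> fst d then deriv (snd e \<circ> chart_inv d) (snd d x) else 0) * deriv (snd d \<circ> chart_inv c) (snd c x)"
      by (simp only: cd if_True conj_absorb simp_thms)
  next
    fix c assume that: "c \<in> X" "x \<in> fst c"
    have "(cmod (deriv (snd e \<circ> chart_inv c) (snd c x)))\<^sup>2 = g c x 1 1"
      using chart_deriv_holomorphic(1)[OF surface_coordinates[OF X that(1)] o _ h[OF that(1)], of x 1] ee that x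
      by (simp add: euclidean_coordinates_def dot_square_norm)
    then show "(cmod (if c \<in> X \<and> x \<in> fst c then deriv (snd e \<circ> chart_inv c) (snd c x) else 0))\<^sup>2 = g c x 1 1"
      by (simp add: that)
  qed auto
next
  fix c assume c: "c \<in> X"
  have ee: "euclidean_coordinates X g e" and h: "(snd e \<circ> chart_inv c) holomorphic_on (snd c ` (fst c \<inter> fst e))"
    using e c by (auto simp: oriented_euclidean_def)
  have "open (snd c ` (fst c \<inter> fst e))"
    by (rule coordinates_open_image[OF surface_coordinates[OF X c]]) (use ee in \<open>auto simp: euclidean_coordinates_def coordinates_def\<close>)
  then have "deriv (snd e \<circ> chart_inv c) holomorphic_on (snd c ` (fst c \<inter> fst e))"
    using h holomorphic_deriv by blast
  then show "(\<lambda>p. if c \<in> X \<and> chart_inv c p \<in> fst c then deriv (snd e \<circ> chart_inv c) (snd c (chart_inv c p)) else 0)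
      holomorphic_on snd c ` (fst c \<inter> fst e)"
    by (rule holomorphic_transform) (use c coordinates_inverse[OF surface_coordinates[OF X c]] in auto)
qed

text \<open>The quotient of two such forms is holomorphic of modulus 1, hence constant by the
  maximum modulus principle. Thus holomorphic of unit length already means parallel, and no
  connection has to be introduced.\<close>

lemma parallel_form_ratio:
  fixes X :: "'x::t2_space chart set"
  assumes X: "riemann_surface X" and g: "compatible_metric X g"
    and f: "parallel_form X g U f" "parallel_form X g V f'" and x: "x \<in> U" "x \<in> V"
  shows "\<exists>u W. cmod u = 1 \<and> open W \<and> x \<in> W \<and> W \<subseteq> U \<inter> V \<and> (\<forall>y\<in>W. \<forall>c. f' y c = u * f y c)"
proof -
  obtain c where c: "c \<in> X" "x \<in> fst c" using surface_chart_exists[OF X] by blast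
  note cc = surface_coordinates[OF X c(1)]
  note ci = coordinates_inverse[OF cc]
  let ?S = "snd c ` (fst c \<inter> (U \<inter> V))"
  have UV: "open (U \<inter> V)" using f by (auto simp: parallel_form_def)
  then have "open ?S" by (rule coordinates_open_image[OF cc])
  moreover have "snd c x \<in> ?S" using x c by auto
  ultimately obtain r where r: "r > 0" "ball (snd c x) r \<subseteq> ?S" by (meson openE)
  let ?B = "ball (snd c x) r"
  define h where "h p = f' (chart_inv c p) c / f (chart_inv c p) c" for p
  have mem: "chart_inv c p \<in> fst c \<inter> (U \<inter> V)" if "p \<in> ?B" for p
    using that r(2) coordinates_image[OF cc] ci(3) by auto
  have nz: "f (chart_inv c p) c \<noteq> 0" if "p \<in> ?B" for p
    using parallel_at_nonzero[OF g _ c(1)] mem[OF that] f(1) by (auto simp: parallel_form_def)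
  have pa: "f y \<in> parallel_at X g y" "f' y \<in> parallel_at X g y" if "y \<in> U \<inter> V" for y
    using f that by (auto simp: parallel_form_def)
  have "(\<lambda>p. f (chart_inv c p) c) holomorphic_on ?B" "(\<lambda>p. f' (chart_inv c p) c) holomorphic_on ?B"
    by (rule holomorphic_on_subset[of _ "snd c ` (fst c \<inter> U)"], use f c(1) r(2) in \<open>auto simp: parallel_form_def\<close>)
      (rule holomorphic_on_subset[of _ "snd c ` (fst c \<inter> V)"], use f c(1) r(2) in \<open>auto simp: parallel_form_def\<close>)
  then have hol: "h holomorphic_on ?B"
    unfolding h_def by (intro holomorphic_on_divide nz)
  have h1: "cmod (h p) = 1" "\<And>d. f' (chart_inv c p) d = h p * f (chart_inv c p) d" if "p \<in> ?B" for p
  proof -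
    have y: "chart_inv c p \<in> U \<inter> V" "chart_inv c p \<in> fst c" using mem[OF that] by auto
    have "f' (chart_inv c p) c = h p * f (chart_inv c p) c" using nz[OF that] by (simp add: h_def)
    from parallel_at_ratio[OF g pa[OF y(1)] c(1) y(2) this]
    show "cmod (h p) = 1" "\<And>d. f' (chart_inv c p) d = h p * f (chart_inv c p) d" by blast+
  qed
  have "h constant_on ?B"
    by (rule maximum_modulus_principle[OF hol open_ball connected_ball open_ball order_refl, of "snd c x"])
      (use h1 r(1) in auto)
  then obtain u where u: "\<And>p. p \<in> ?B \<Longrightarrow> h p = u" by (auto simp: constant_on_def)
  define W where "W = {y \<in> fst c. snd c y \<in> ?B}"
  show ?thesis
  proof (intro exI conjI)
    show "cmod u = 1" using h1(1)[of "snd c x"] u[of "snd c x"] r(1) by simp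
    show "open W" unfolding W_def by (rule coordinates_open_preimage[OF cc open_ball])
    show "x \<in> W" using c r(1) by (simp add: W_def)
    have eq: "chart_inv c (snd c y) = y" if "y \<in> W" for y using that ci by (simp add: W_def)
    show "W \<subseteq> U \<inter> V" using mem eq by (fastforce simp: W_def)
    show "\<forall>y\<in>W. \<forall>d. f' y d = u * f y d"
      using h1(2) u eq by (fastforce simp: W_def)
  qed
qed

text \<open>The stalk is a circle, the unit multiples of the coefficients of \<open>dz\<close>. Two
  local solutions have a locally constant ratio u and nonzero coefficients, so near the point they
  agree everywhere or nowhere, according to whether \<open>u = 1\<close>.\<close>

lemma parallel_local_system:
  fixes X :: "'x::t2_space chart set"
  assumes X: "riemann_surface X" and g: "compatible_metric X g" "flat_metric X g"
  shows "local_system (parallel_form X g) (parallel_at X g)"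
proof
  show "open U" if "parallel_form X g U f" for U f using that by (simp add: parallel_form_def)
  show "f x \<in> parallel_at X g x" if "parallel_form X g U f" "x \<in> U" for U f x
    using that by (simp add: parallel_form_def)
next
  fix x :: 'x
  obtain e r where e: "oriented_euclidean X g e" "x \<in> fst e" and r: "r > 0" "snd e ` fst e = ball (snd e x) r"
    using oriented_euclidean_exists[OF X g open_UNIV UNIV_I] by blast
  have ce: "coordinates e" using e by (simp add: oriented_euclidean_def euclidean_coordinates_def)
  define f where "f = (\<lambda>x c. if c \<in> X \<and> x \<in> fst c then deriv (snd e \<circ> chart_inv c) (snd c x) else 0)"
  have f: "parallel_form X g (fst e) f" unfolding f_def by (rule parallel_form_euclidean[OF X e(1)])
  show "\<exists>W. open W \<and> x \<in> W \<and> path_connected W \<and>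
      (\<forall>y\<in>W. \<forall>b\<in>parallel_at X g y. \<exists>f. parallel_form X g W f \<and> f y = b)"
  proof (intro exI[of _ "fst e"] conjI ballI e(2))
    show "open (fst e)" using ce by (simp add: coordinates_def)
    have h: "homeomorphism (fst e) (ball (snd e x) r) (snd e) (chart_inv e)"
      using ce r by (simp add: coordinates_def)
    then have "fst e = chart_inv e ` ball (snd e x) r" "continuous_on (ball (snd e x) r) (chart_inv e)"
      by (auto simp: homeomorphism_def)
    then show "path_connected (fst e)"
      using path_connected_continuous_image convex_imp_path_connected convex_ball by metis
    fix y b assume y: "y \<in> fst e" and b: "b \<in> parallel_at X g y"
    have fy: "f y \<in> parallel_at X g y" using f y by (simp add: parallel_form_def)
    obtain c where c: "c \<in> X" "y \<in> fst c" using surface_chart_exists[OF X] by blast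
    define u where "u = b c / f y c"
    have "b c = u * f y c" using parallel_at_nonzero[OF g(1) fy c] by (simp add: u_def)
    note u = parallel_at_ratio[OF g(1) fy b c this]
    show "\<exists>f. parallel_form X g (fst e) f \<and> f y = b"
      using parallel_form_mult[OF f u(1)] u(2) by (intro exI[of _ "\<lambda>x c. u * f x c"]) auto
  qed
next
  fix U f V f' x assume f: "parallel_form X g U f" "parallel_form X g V f'" and x: "x \<in> U" "x \<in> V"
  obtain u W where W: "open W" "x \<in> W" "W \<subseteq> U \<inter> V" "\<And>y c. y \<in> W \<Longrightarrow> f' y c = u * f y c"
    using parallel_form_ratio[OF X g(1) f x] by blast
  have "f y = f' y" if "u = 1" "y \<in> W" for y using W(4) that by auto
  moreover have "f y \<noteq> f' y" if "u \<noteq> 1" "y \<in> W" for y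
  proof -
    obtain c where c: "c \<in> X" "y \<in> fst c" using surface_chart_exists[OF X] by blast
    have "f y c \<noteq> 0"
      using parallel_at_nonzero[OF g(1) _ c] f(1) that W(3) by (auto simp: parallel_form_def)
    then have "f y c \<noteq> f' y c" using W(4)[OF that(2)] that(1) by simp
    then show ?thesis by metis
  qed
  ultimately show "\<exists>W. open W \<and> x \<in> W \<and> ((\<forall>y\<in>W. f y = f' y) \<or> (\<forall>y\<in>W. f y \<noteq> f' y))"
    using W by blast
qed

text \<open>Simple connectedness enters through \<open>global_solution\<close>; the coefficients of
  a local \<open>dz\<close> supply the initial value.\<close>

lemma parallel_form_exists:
  fixes X :: "'x::t2_space chart set"
  assumes X: "riemann_surface X" and sc: "simply_connected (UNIV :: 'x set)"
    and g: "compatible_metric X g" "flat_metric X g"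
  shows "\<exists>f. parallel_form X g UNIV f"
proof -
  interpret local_system "parallel_form X g" "parallel_at X g" by (rule parallel_local_system[OF X g])
  fix x0 :: 'x
  obtain e where e: "oriented_euclidean X g e" "x0 \<in> fst e"
    using oriented_euclidean_exists[OF X g open_UNIV UNIV_I] by blast
  from parallel_form_euclidean[OF X e(1)] e(2) obtain b where "b \<in> parallel_at X g x0"
    by (auto simp: parallel_form_def)
  from global_solution[OF sc this] obtain F where
    F: "\<And>x. \<exists>U f. parallel_form X g U f \<and> x \<in> U \<and> (\<forall>y\<in>U. F y = f y)" by blast
  have "parallel_form X g UNIV F"
    unfolding parallel_form_def
  proof (intro conjI ballI)
    show "F x \<in> parallel_at X g x" for x using F[of x] by (auto simp: parallel_form_def)
    fix c assume c: "c \<in> X"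
    note cc = surface_coordinates[OF X c]
    show "(\<lambda>p. F (chart_inv c p) c) holomorphic_on snd c ` (fst c \<inter> UNIV)"
    proof (rule holomorphic_on_local)
      fix p assume p: "p \<in> snd c ` (fst c \<inter> UNIV)"
      obtain U f where U: "parallel_form X g U f" "chart_inv c p \<in> U" "\<forall>y\<in>U. F y = f y" using F by blast
      have "(\<lambda>p. F (chart_inv c p) c) holomorphic_on snd c ` (fst c \<inter> U)"
        by (rule holomorphic_transform[of "\<lambda>p. f (chart_inv c p) c"])
          (use U c coordinates_image[OF cc] in \<open>auto simp: parallel_form_def\<close>)
      moreover have "open (snd c ` (fst c \<inter> U))" using U coordinates_open_image[OF cc] by (simp add: parallel_form_def)
      moreover have "p \<in> snd c ` (fst c \<inter> U)" using p U coordinates_image[OF cc] by auto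
      ultimately show "\<exists>T. open T \<and> p \<in> T \<and> (\<lambda>p. F (chart_inv c p) c) holomorphic_on T" by blast
    qed
  qed simp
  then show ?thesis by blast
qed

section \<open>Admissible forms\<close>

lemma smooth_map_chart:
  "smooth_map X UNIV F \<Longrightarrow> c \<in> X \<Longrightarrow> smooth_on (snd c ` fst c) (\<lambda>p. F (chart_inv c p))"
  by (simp add: smooth_map_def o_def)

lemma gamma_fun_pos: "\<alpha>m x > 0 \<Longrightarrow> \<alpha>p x > 0 \<Longrightarrow> gamma_fun \<alpha>m \<alpha>p x > 0"
  by (simp add: gamma_fun_def)

lemma smooth_on_gamma:
  assumes "smooth_on S (\<lambda>p. \<alpha>m (k p))" "smooth_on S (\<lambda>p. \<alpha>p (k p))" "\<And>x. \<alpha>m x > 0" "\<And>x. \<alpha>p x > 0"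
  shows "smooth_on S (\<lambda>p. gamma_fun \<alpha>m \<alpha>p (k p))"
  unfolding gamma_fun_def
  by (rule smooth_on_compose[OF smooth_on_mult[OF assms(1,2)] smooth_on_powr]) (use assms(3,4) in auto)

lemma chart_deriv_cong:
  assumes c: "coordinates c" "x \<in> fst c" and eq: "\<And>y. y \<in> fst c \<Longrightarrow> F y = G y"
  shows "chart_deriv c F x v = chart_deriv c G x v"
proof -
  have S: "open (snd c ` fst c)" using c by (simp add: coordinates_def)
  note ci = coordinates_inverse[OF c(1)]
  have 1: "((G \<circ> chart_inv c) has_derivative D) (at (snd c x))"
    if "((F \<circ> chart_inv c) has_derivative D) (at (snd c x))" for D
    by (rule has_derivative_transform_within_open[OF that S]) (use c eq ci in auto)
  have 2: "((F \<circ> chart_inv c) has_derivative D) (at (snd c x))"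
    if "((G \<circ> chart_inv c) has_derivative D) (at (snd c x))" for D
    by (rule has_derivative_transform_within_open[OF that S]) (use c eq ci in auto)
  \<comment> \<open>\<open>frechet_derivative\<close> is a choice among derivatives, so the two
    values agree because the predicates do.\<close>
  have "(\<lambda>D. ((F \<circ> chart_inv c) has_derivative D) (at (snd c x))) = (\<lambda>D. ((G \<circ> chart_inv c) has_derivative D) (at (snd c x)))"
    using 1 2 by blast
  then show ?thesis by (simp add: chart_deriv_def frechet_derivative_def)
qed

lemma type_1_0_linear:
  fixes L :: "complex \<Rightarrow> complex"
  assumes "linear L" "L \<i> = \<i> * L 1"
  shows "L v = L 1 * v"
proof -
  have "L v = L (Re v *\<^sub>R 1 + Im v *\<^sub>R \<i>)"
    by (rule arg_cong[of _ _ L]) (simp add: complex_eq_iff)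
  also have "\<dots> = Re v *\<^sub>R L 1 + Im v *\<^sub>R L \<i>"
    by (simp only: linear_add[OF assms(1)] linear_scale[OF assms(1)])
  also have "\<dots> = L 1 * v" unfolding assms(2) by (simp add: complex_eq_iff algebra_simps)
  finally show ?thesis .
qed

text \<open>Division by \<open>lam * \<gamma>\<close> turns the norm condition into unit length for
  \<open>g0\<close>. For a form \<open>h dz\<close> of type (1,0), closedness is the Cauchy-Riemann
  equation for h, so the quotient is holomorphic.\<close>

lemma admissible_iff_parallel:
  fixes X :: "'x::t2_space chart set"
  assumes X: "riemann_surface X" and g: "compatible_metric X g0"
    and sm: "smooth_map X UNIV \<alpha>m" "smooth_map X UNIV \<alpha>p"
    and pos: "\<And>x. \<alpha>m x > 0" "\<And>x. \<alpha>p x > 0" and lam: "lam > 0"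
  shows "admissible_form X g0 \<alpha>m \<alpha>p lam \<omega> \<longleftrightarrow> (\<exists>f. parallel_form X g0 UNIV f \<and>
    (\<forall>c\<in>X. \<forall>x\<in>fst c. \<forall>v. \<omega> c x v = complex_of_real (lam * gamma_fun \<alpha>m \<alpha>p x) * f x c * v))"
proof
  let ?\<gamma> = "gamma_fun \<alpha>m \<alpha>p"
  have \<gamma>0: "?\<gamma> x > 0" for x by (simp add: gamma_fun_pos pos)
  {
    assume "\<exists>f. parallel_form X g0 UNIV f \<and> (\<forall>c\<in>X. \<forall>x\<in>fst c. \<forall>v. \<omega> c x v = complex_of_real (lam * ?\<gamma> x) * f x c * v)"
    then obtain f where f: "parallel_form X g0 UNIV f"
      and \<omega>: "\<And>c x v. c \<in> X \<Longrightarrow> x \<in> fst c \<Longrightarrow> \<omega> c x v = complex_of_real (lam * ?\<gamma> x) * f x c * v" by blast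
    have pa: "f x \<in> parallel_at X g0 x" for x using f by (simp add: parallel_form_def)
    have hol: "(\<lambda>p. f (chart_inv c p) c) holomorphic_on snd c ` fst c" if "c \<in> X" for c
      using f that by (simp add: parallel_form_def)
    show "admissible_form X g0 \<alpha>m \<alpha>p lam \<omega>"
      unfolding admissible_form_def smooth_form_def type_1_0_def closed_form_def
    proof (intro conjI ballI allI)
      fix c x assume c: "c \<in> X" "x \<in> fst c"
      have "\<omega> c x = (\<lambda>v. complex_of_real (lam * ?\<gamma> x) * f x c * v)" using \<omega>[OF c] by blast
      then show "linear (\<omega> c x)" by (auto intro!: linearI simp: algebra_simps)
    next
      fix c v assume c: "c \<in> X"
      note cc = surface_coordinates[OF X c]
      have S: "open (snd c ` fst c)" using cc by (simp add: coordinates_def)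
      have "smooth_on (snd c ` fst c) (\<lambda>p. complex_of_real (lam * ?\<gamma> (chart_inv c p)) * f (chart_inv c p) c * v)"
        by (intro smooth_on_mult smooth_on_of_real smooth_on_const smooth_on_holomorphic pos c S hol
            smooth_on_gamma smooth_map_chart[OF sm(1) c] smooth_map_chart[OF sm(2) c])
      then show "smooth_on (snd c ` fst c) (\<lambda>p. \<omega> c (chart_inv c p) v)"
        by (rule smooth_on_cong) (use \<omega>[OF c] coordinates_inverse(3)[OF cc] in auto)
    next
      fix c d x v assume cd: "c \<in> X" "d \<in> X" "x \<in> fst c \<inter> fst d"
      then have "f x c = f x d * deriv (snd d \<circ> chart_inv c) (snd c x)"
        using parallel_atD(3)[OF pa] by blast
      then have "f x c * v = f x d * (deriv (snd d \<circ> chart_inv c) (snd c x) * v)"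
        using arg_cong[of "f x c" _ "\<lambda>t. t * v"] by (simp add: mult.assoc)
      moreover have "chart_deriv c (snd d) x v = deriv (snd d \<circ> chart_inv c) (snd c x) * v"
        by (rule transition_deriv[OF X cd(1,2)]) (use cd in auto)
      ultimately show "\<omega> c x v = \<omega> d x (chart_deriv c (snd d) x v)"
        using \<omega>[of c x] \<omega>[of d x] cd by (simp add: mult.assoc)
    next
      fix c x v assume c: "c \<in> X" "x \<in> fst c"
      show "\<omega> c x (\<i> * v) = \<i> * \<omega> c x v" using \<omega>[OF c] by simp
      have "(cmod (f x c))\<^sup>2 = g0 c x 1 1" by (rule parallel_atD(2)[OF pa c])
      then have "g0 c x v v = (cmod v)\<^sup>2 * (cmod (f x c))\<^sup>2"
        using compatible_metric_conformal(3)[OF g c, of v] by (simp only:)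
      then show "(cmod (\<omega> c x v))\<^sup>2 = lam\<^sup>2 * (?\<gamma> x)\<^sup>2 * g0 c x v v"
        by (simp add: \<omega>[OF c] norm_mult power_mult_distrib abs_mult)
    next
      fix c x assume c: "c \<in> X" "x \<in> fst c"
      note cc = surface_coordinates[OF X c(1)]
      have eq: "chart_deriv c (\<lambda>y. \<omega> c y v / ?\<gamma> y) x w = chart_deriv c (\<lambda>y. complex_of_real lam * f y c * v) x w" for v w
        by (rule chart_deriv_cong[OF cc c(2)]) (use \<gamma>0 in \<open>auto simp: \<omega>[OF c(1)] less_imp_neq[OF \<gamma>0, symmetric]\<close>)
      have "((\<lambda>p. f (chart_inv c p) c) has_field_derivative deriv (\<lambda>p. f (chart_inv c p) c) (snd c x)) (at (snd c x))"
        by (rule holomorphic_derivI[OF hol[OF c(1)]]) (use cc c in \<open>auto simp: coordinates_def\<close>)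
      then have d: "((\<lambda>p. complex_of_real lam * f (chart_inv c p) c * v) has_derivative
          (\<lambda>w. complex_of_real lam * deriv (\<lambda>p. f (chart_inv c p) c) (snd c x) * v * w)) (at (snd c x))" for v
        unfolding has_field_derivative_def by (auto intro!: derivative_eq_intros)
      have eq2: "chart_deriv c (\<lambda>y. complex_of_real lam * f y c * v) x w = complex_of_real lam * deriv (\<lambda>p. f (chart_inv c p) c) (snd c x) * v * w" for v w
        unfolding chart_deriv_def by (rule frechet_derivative_eq) (use d in \<open>simp add: o_def\<close>)
      show "chart_deriv c (\<lambda>y. \<omega> c y \<i> / ?\<gamma> y) x 1 = chart_deriv c (\<lambda>y. \<omega> c y 1 / ?\<gamma> y) x \<i>"
        unfolding eq eq2 by simp
    qed
  }
  assume ad: "admissible_form X g0 \<alpha>m \<alpha>p lam \<omega>"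
  have lin: "linear (\<omega> c x)" if "c \<in> X" "x \<in> fst c" for c x
    using ad that unfolding admissible_form_def smooth_form_def by blast
  have smo: "smooth_on (snd c ` fst c) (\<lambda>p. \<omega> c (chart_inv c p) v)" if "c \<in> X" for c v
    using ad that unfolding admissible_form_def smooth_form_def by blast
  have tr: "\<omega> c x v = \<omega> d x (chart_deriv c (snd d) x v)" if "c \<in> X" "d \<in> X" "x \<in> fst c" "x \<in> fst d" for c d x v
    using ad that unfolding admissible_form_def smooth_form_def by blast
  have J: "\<omega> c x (\<i> * v) = \<i> * \<omega> c x v" if "c \<in> X" "x \<in> fst c" for c x v
    using ad that unfolding admissible_form_def type_1_0_def by blast
  have nrm: "(cmod (\<omega> c x v))\<^sup>2 = lam\<^sup>2 * (?\<gamma> x)\<^sup>2 * g0 c x v v" if "c \<in> X" "x \<in> fst c" for c x v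
    using ad that unfolding admissible_form_def by blast
  have cl: "chart_deriv c (\<lambda>y. \<omega> c y \<i> / ?\<gamma> y) x 1 = chart_deriv c (\<lambda>y. \<omega> c y 1 / ?\<gamma> y) x \<i>" if "c \<in> X" "x \<in> fst c" for c x
    using ad that unfolding admissible_form_def closed_form_def by blast
  have cx: "\<omega> c x v = \<omega> c x 1 * v" if "c \<in> X" "x \<in> fst c" for c x v
    by (rule type_1_0_linear[OF lin[OF that]]) (use J[OF that, of 1] in simp)
  define f where "f x c = (if c \<in> X \<and> x \<in> fst c then \<omega> c x 1 / complex_of_real (lam * ?\<gamma> x) else 0)" for x c
  have fe: "f x c = \<omega> c x 1 / complex_of_real (lam * ?\<gamma> x)" if "c \<in> X" "x \<in> fst c" for c x
    using that by (simp add: f_def)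
  have "parallel_form X g0 UNIV f"
    unfolding parallel_form_def
  proof (intro conjI ballI open_UNIV)
    fix x
    show "f x \<in> parallel_at X g0 x"
    proof (rule parallel_atI)
      show "f x c = 0" if "\<not> (c \<in> X \<and> x \<in> fst c)" for c unfolding f_def using that by (simp only: if_False)
      show "(cmod (f x c))\<^sup>2 = g0 c x 1 1" if "c \<in> X" "x \<in> fst c" for c
      proof -
        have "(cmod (f x c))\<^sup>2 = (cmod (\<omega> c x 1))\<^sup>2 / (lam * ?\<gamma> x)\<^sup>2"
          by (simp add: fe[OF that] norm_divide power_divide norm_mult power_mult_distrib)
        then show ?thesis using nrm[OF that, of 1] lam \<gamma>0[of x] by (simp add: power_mult_distrib)
      qed
      show "f x c = f x d * deriv (snd d \<circ> chart_inv c) (snd c x)"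
        if "c \<in> X" "d \<in> X" "x \<in> fst c" "x \<in> fst d" for c d
        using tr[OF that, of 1] cx[OF that(2,4), of "deriv (snd d \<circ> chart_inv c) (snd c x)"]
        by (simp add: fe that transition_deriv[OF X that])
    qed
  next
    fix c assume c: "c \<in> X"
    note cc = surface_coordinates[OF X c]
    note ci = coordinates_inverse[OF cc]
    let ?S = "snd c ` fst c"
    have S: "open ?S" using cc by (simp add: coordinates_def)
    define h where "h p = \<omega> c (chart_inv c p) 1 * complex_of_real (?\<gamma> (chart_inv c p) powr (-1))" for p
    have sg: "smooth_on ?S (\<lambda>p. ?\<gamma> (chart_inv c p))"
      by (intro smooth_on_gamma smooth_map_chart[OF sm(1) c] smooth_map_chart[OF sm(2) c] pos)
    have smh: "smooth_on ?S h"
      unfolding h_def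
      by (intro smooth_on_mult smo c smooth_on_of_real)
        (rule smooth_on_compose[OF sg smooth_on_powr], insert \<gamma>0, auto)
    have h': "(h has_field_derivative frechet_derivative h (at p) 1) (at p)" if p: "p \<in> ?S" for p
    proof -
      note d = smooth_on_has_derivative[OF smh p]
      obtain x where x: "x \<in> fst c" "p = snd c x" using p by blast
      have g1: "z / complex_of_real (?\<gamma> y) = z * complex_of_real (?\<gamma> y powr - 1)" for z y
        using \<gamma>0[of y] by (simp add: powr_minus divide_inverse)
      \<comment> \<open>Closedness exchanges the two directions and the type (1,0) extracts the
        factor i; together they give the Cauchy-Riemann equation for h.\<close>
      have "frechet_derivative h (at p) \<i> = chart_deriv c (\<lambda>y. \<omega> c y 1 / ?\<gamma> y) x \<i>"
        unfolding chart_deriv_def x(2) by (simp add: o_def h_def[abs_def] g1)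
      also have "\<dots> = chart_deriv c (\<lambda>y. \<omega> c y \<i> / ?\<gamma> y) x 1" using cl[OF c x(1)] by simp
      also have "\<dots> = chart_deriv c (\<lambda>y. \<i> * (\<omega> c y 1 / ?\<gamma> y)) x 1"
        by (rule chart_deriv_cong[OF cc x(1)]) (use J[OF c, of _ 1] in simp)
      also have "\<dots> = frechet_derivative (\<lambda>q. \<i> * h q) (at p) 1"
        unfolding chart_deriv_def x(2) by (simp add: o_def h_def[abs_def] g1)
      also have "\<dots> = \<i> * frechet_derivative h (at p) 1"
        by (rule frechet_derivative_eq[OF has_derivative_mult_right[OF d]])
      finally show ?thesis by (rule has_derivative_complex_linear[OF d])
    qed
    then have "h holomorphic_on ?S"
      unfolding holomorphic_on_open[OF S] by blast
    then have "(\<lambda>p. h p / complex_of_real lam) holomorphic_on ?S"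
      using lam by (intro holomorphic_intros) auto
    then show "(\<lambda>p. f (chart_inv c p) c) holomorphic_on snd c ` (fst c \<inter> UNIV)"
    proof (simp only: Int_UNIV_right, rule holomorphic_transform)
      fix p assume "p \<in> ?S"
      then show "h p / complex_of_real lam = f (chart_inv c p) c"
        using fe[OF c] ci(3) \<gamma>0[of "chart_inv c p"] by (simp add: h_def powr_minus divide_inverse)
    qed
  qed
  moreover have "\<omega> c x v = complex_of_real (lam * ?\<gamma> x) * f x c * v" if "c \<in> X" "x \<in> fst c" for c x v
    using cx[OF that, of v] lam less_imp_neq[OF \<gamma>0[of x]] by (simp add: fe[OF that])
  ultimately show "\<exists>f. parallel_form X g0 UNIV f \<and>
      (\<forall>c\<in>X. \<forall>x\<in>fst c. \<forall>v. \<omega> c x v = complex_of_real (lam * ?\<gamma> x) * f x c * v)" by blast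
qed

text \<open>The ratio is locally constant, so having the ratio \<open>u0\<close> is an open
  condition with open complement, and U is connected.\<close>

lemma parallel_form_global_ratio:
  fixes X :: "'x::t2_space chart set"
  assumes X: "riemann_surface X" and g: "compatible_metric X g"
    and U: "connected U" and f: "parallel_form X g U f" "parallel_form X g U f'"
  shows "\<exists>u. cmod u = 1 \<and> (\<forall>x\<in>U. \<forall>c. f' x c = u * f x c)"
proof (cases "U = {}")
  case True
  then show ?thesis by (intro exI[of _ 1]) simp
next
  case False
  then obtain x0 where x0: "x0 \<in> U" by blast
  obtain u0 W0 where u0: "cmod u0 = 1" "x0 \<in> W0" "\<forall>y\<in>W0. \<forall>c. f' y c = u0 * f y c"
    using parallel_form_ratio[OF X g f x0 x0] by blast
  define P where "P x \<longleftrightarrow> (\<forall>c. f' x c = u0 * f x c)" for x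
  have "P x0" using u0 unfolding P_def by blast
  have "P x" if x: "x \<in> U" for x
  proof -
    have "P x0 = P x"
    proof (rule connected_local_const[OF U x0 x], rule ballI)
      fix a assume a: "a \<in> U"
      obtain u W where W: "open W" "a \<in> W" "W \<subseteq> U \<inter> U" "\<And>y c. y \<in> W \<Longrightarrow> f' y c = u * f y c"
        using parallel_form_ratio[OF X g f a a] by blast
      have "P y \<longleftrightarrow> u = u0" if y: "y \<in> W" for y
      proof
        assume "P y"
        obtain c where c: "c \<in> X" "y \<in> fst c" using surface_chart_exists[OF X] by blast
        have "f y \<in> parallel_at X g y" using f(1) y W(3) by (auto simp: parallel_form_def)
        then have "f y c \<noteq> 0" by (rule parallel_at_nonzero[OF g _ c])
        moreover have "f' y c = u0 * f y c" using \<open>P y\<close> unfolding P_def by blast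
        ultimately show "u = u0" using W(4)[OF y, of c] by simp
      qed (use W(4)[OF y] P_def in simp)
      then have "P a = P y" if "y \<in> W" for y using that W(2) by simp
      then show "\<forall>\<^sub>F b in at a within U. P a = P b"
        unfolding eventually_at_topological using W(1,2) by blast
    qed
    with \<open>P x0\<close> show ?thesis by simp
  qed
  with u0(1) show ?thesis unfolding P_def by blast
qed

text \<open>A global parallel form supplies the reference \<open>\<omega>0\<close>; every other one
  is a constant unit multiple of it.\<close>

lemma admissible_forms_circle:
  fixes X :: "'x::t2_space chart set"
  assumes X: "riemann_surface X" and sc: "simply_connected (UNIV :: 'x set)"
    and g: "compatible_metric X g0" "flat_metric X g0"
    and sm: "smooth_map X UNIV \<alpha>m" "smooth_map X UNIV \<alpha>p"
    and pos: "\<And>x. \<alpha>m x > 0" "\<And>x. \<alpha>p x > 0" and lam: "lam > 0"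
  shows "\<exists>\<omega>0. \<forall>\<omega>. admissible_form X g0 \<alpha>m \<alpha>p lam \<omega> \<longleftrightarrow> (\<exists>u. cmod u = 1 \<and> form_multiple X u \<omega>0 \<omega>)"
proof -
  obtain f where f: "parallel_form X g0 UNIV f" using parallel_form_exists[OF X sc g] by blast
  let ?t = "\<lambda>x. complex_of_real (lam * gamma_fun \<alpha>m \<alpha>p x)"
  define \<omega>0 where "\<omega>0 c x v = ?t x * f x c * v" for c x v
  note iff = admissible_iff_parallel[OF X g(1) sm pos lam]
  have conn: "connected (UNIV :: 'x set)" using X by (simp add: riemann_surface_def)
  show ?thesis
  proof (intro exI[of _ \<omega>0] allI iffI)
    fix \<omega> assume "admissible_form X g0 \<alpha>m \<alpha>p lam \<omega>"
    then obtain f' where f': "parallel_form X g0 UNIV f'"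
      "\<forall>c\<in>X. \<forall>x\<in>fst c. \<forall>v. \<omega> c x v = ?t x * f' x c * v" using iff by blast
    obtain u where u: "cmod u = 1" "\<And>x c. f' x c = u * f x c"
      using parallel_form_global_ratio[OF X g(1) conn f f'(1)] by blast
    show "\<exists>u. cmod u = 1 \<and> form_multiple X u \<omega>0 \<omega>"
      unfolding form_multiple_def by (intro exI[of _ u] conjI ballI allI u(1)) (use f'(2) in \<open>simp add: \<omega>0_def u(2)\<close>)
  next
    fix \<omega> assume "\<exists>u. cmod u = 1 \<and> form_multiple X u \<omega>0 \<omega>"
    then obtain u where u: "cmod u = 1" "form_multiple X u \<omega>0 \<omega>" by blast
    have "\<omega> c x v = ?t x * (u * f x c) * v" if "c \<in> X" "x \<in> fst c" for c x v
      using u(2) that unfolding form_multiple_def \<omega>0_def by simp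
    then show "admissible_form X g0 \<alpha>m \<alpha>p lam \<omega>"
      unfolding iff using parallel_form_mult[OF f u(1)] by blast
  qed
qed

section \<open>Flat connections in the plane\<close>

lemma norm_diff_le_vector_derivative:
  fixes f :: "real \<Rightarrow> 'a::real_normed_vector"
  assumes "convex S" "\<And>x. x \<in> S \<Longrightarrow> (f has_vector_derivative f' x) (at x within S)"
    and "\<And>x. x \<in> S \<Longrightarrow> norm (f' x) \<le> K" "a \<in> S" "b \<in> S"
  shows "norm (f b - f a) \<le> K * \<bar>b - a\<bar>"
proof -
  have "norm (f b - f a) \<le> K * norm (b - a)"
  proof (rule differentiable_bound[OF assms(1) _ _ assms(5,4)])
    fix x assume x: "x \<in> S"
    show "(f has_derivative (\<lambda>h. h *\<^sub>R f' x)) (at x within S)"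
      using assms(2)[OF x] by (simp add: has_vector_derivative_def)
    show "onorm (\<lambda>h. h *\<^sub>R f' x) \<le> K"
      by (rule onorm_le) (use mult_right_mono[OF assms(3)[OF x], of "\<bar>_\<bar>"] in \<open>simp add: mult.commute\<close>)
  qed
  then show ?thesis by simp
qed

text \<open>The interval is short enough for the integral operator to contract the supremum norm by
  1/2, so Banach's fixed point theorem gives the solution.\<close>

lemma linear_ode_exists:
  fixes B :: "real \<Rightarrow> quat^2^2" and C :: "quat^2^2"
  assumes r: "0 < r" and B: "continuous_on {0..r} B"
    and M: "\<And>t Y. t \<in> {0..r} \<Longrightarrow> norm (Y \<odot> B t) \<le> M * norm Y" "0 \<le> M" "M * r \<le> 1/2"
  shows "\<exists>U. U 0 = C \<and> (\<forall>t\<in>{0..r}. (U has_vector_derivative U t \<odot> B t) (at t within {0..r}))"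
proof -
  \<comment> \<open>Clamping the time to \<open>{0..r}\<close> lets the operator act on the bounded
    continuous functions of the whole line, a complete space.\<close>
  define cl where "cl t = max 0 (min r t)" for t
  have cl: "cl t \<in> {0..r}" for t using r by (auto simp: cl_def)
  have cl_id: "cl t = t" if "t \<in> {0..r}" for t using that by (auto simp: cl_def)
  have cont: "continuous_on {0..r} (\<lambda>s. apply_bcontfun u s \<odot> B s)" for u :: "real \<Rightarrow>\<^sub>C (quat^2^2)"
    by (intro qmat_mult.continuous_on B continuous_on_apply_bcontfun)
  define G where "G u t = C + integral {0..cl t} (\<lambda>s. apply_bcontfun u s \<odot> B s)" for u t
  have ib: "norm (integral {0..cl t} f) \<le> K * r" if "continuous_on {0..r} f" "\<And>s. s \<in> {0..r} \<Longrightarrow> norm (f s) \<le> K" "0 \<le> K"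
    for f :: "real \<Rightarrow> quat^2^2" and K t
  proof -
    have "norm (integral {0..cl t} f) \<le> K * (cl t - 0)"
      by (rule integral_bound) (use cl[of t] that in \<open>auto elim: continuous_on_subset\<close>)
    also have "\<dots> \<le> K * r" using cl[of t] that(3) by (intro mult_left_mono) auto
    finally show ?thesis .
  qed
  have nrm: "norm (apply_bcontfun u s \<odot> B s) \<le> M * norm u" if "s \<in> {0..r}" for u s
    by (rule order_trans[OF M(1)[OF that]]) (intro mult_left_mono norm_bounded M(2))
  have G: "G u \<in> bcontfun" for u
  proof (rule bcontfun_normI)
    have "continuous_on {0..r} (\<lambda>x. integral {0..x} (\<lambda>s. apply_bcontfun u s \<odot> B s))"
      by (intro indefinite_integral_continuous_1 integrable_continuous_real cont)
    then have "continuous_on UNIV (\<lambda>t. integral {0..cl t} (\<lambda>s. apply_bcontfun u s \<odot> B s))"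
      by (rule continuous_on_compose2) (use cl in \<open>auto simp: cl_def[abs_def] intro!: continuous_intros\<close>)
    then show "continuous_on UNIV (G u)" unfolding G_def[abs_def] by (intro continuous_intros)
    show "norm (G u t) \<le> norm C + M * norm u * r" for t
      unfolding G_def by (rule norm_triangle_le, rule add_left_mono, rule ib[OF cont]) (use nrm M(2) in auto)
  qed
  define F where "F u = Bcontfun (G u)" for u
  have F: "apply_bcontfun (F u) t = G u t" for u t
    using G by (simp add: F_def Bcontfun_inverse)
  have "\<exists>!u. F u = u"
  proof (rule banach_fix_type[of "1/2"])
    show "\<forall>u v. dist (F u) (F v) \<le> 1/2 * dist u v"
    proof (intro allI dist_bound)
      fix u v t
      have int: "(\<lambda>s. apply_bcontfun w s \<odot> B s) integrable_on {0..cl t}" for w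
        by (rule integrable_continuous_real) (rule continuous_on_subset[OF cont], use cl[of t] in auto)
      have "apply_bcontfun (F u) t - apply_bcontfun (F v) t =
          integral {0..cl t} (\<lambda>s. apply_bcontfun u s \<odot> B s - apply_bcontfun v s \<odot> B s)"
        unfolding F G_def by (simp add: integral_diff[OF int int])
      also have "\<dots> = integral {0..cl t} (\<lambda>s. apply_bcontfun (u - v) s \<odot> B s)"
        by (simp add: qmat_mult.diff_left)
      finally have "dist (apply_bcontfun (F u) t) (apply_bcontfun (F v) t) = norm \<dots>"
        by (simp add: dist_norm)
      also have "\<dots> \<le> M * norm (u - v) * r"
        by (rule ib[OF cont nrm]) (use M(2) in auto)
      also have "\<dots> = (M * r) * norm (u - v)" by simp
      also have "\<dots> \<le> 1/2 * norm (u - v)" by (rule mult_right_mono[OF M(3)]) simp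
      finally show "dist (apply_bcontfun (F u) t) (apply_bcontfun (F v) t) \<le> 1/2 * dist u v"
        by (simp add: dist_norm)
    qed
  qed auto
  then obtain u where u: "F u = u" by blast
  define U where "U = apply_bcontfun u"
  have U: "U t = C + integral {0..t} (\<lambda>s. U s \<odot> B s)" if "t \<in> {0..r}" for t
    using F[of u t] unfolding u U_def G_def cl_id[OF that] .
  show ?thesis
  proof (intro exI[of _ U] conjI ballI)
    show "U 0 = C" using U[of 0] r by simp
    fix t assume t: "t \<in> {0..r}"
    have "((\<lambda>t. C + integral {0..t} (\<lambda>s. U s \<odot> B s)) has_vector_derivative 0 + U t \<odot> B t) (at t within {0..r})"
      by (intro has_vector_derivative_add has_vector_derivative_const integral_has_vector_derivative t)
        (use cont[of u] in \<open>simp add: U_def\<close>)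
    then show "(U has_vector_derivative U t \<odot> B t) (at t within {0..r})"
      by (simp only: add_0_left) (rule has_vector_derivative_transform[OF t U], assumption+)
  qed
qed

text \<open>A substitute for Gronwall's inequality on short intervals: at the maximum m of
  \<open>norm (D t)\<close> the term \<open>M * r * norm (D m)\<close> is at most half of the
  maximum and is absorbed, which leaves \<open>2 * (e + e)\<close>.\<close>

lemma linear_ode_bound:
  fixes B E D :: "real \<Rightarrow> quat^2^2"
  assumes r: "0 < r" "r \<le> 1"
    and M: "\<And>t Y. t \<in> {0..r} \<Longrightarrow> norm (Y \<odot> B t) \<le> M * norm Y" "0 \<le> M" "M * r \<le> 1/2"
    and D: "\<And>t. t \<in> {0..r} \<Longrightarrow> (D has_vector_derivative D t \<odot> B t + E t) (at t within {0..r})"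
    and E: "norm (D 0) \<le> e" "\<And>t. t \<in> {0..r} \<Longrightarrow> norm (E t) \<le> e" and t: "t \<in> {0..r}"
  shows "norm (D t) \<le> 4 * e"
proof -
  have "continuous_on {0..r} (\<lambda>t. norm (D t))"
    by (intro continuous_on_norm continuous_on_vector_derivative) (use D in auto)
  then obtain m where m: "m \<in> {0..r}" "\<And>t. t \<in> {0..r} \<Longrightarrow> norm (D t) \<le> norm (D m)"
    using continuous_attains_sup[of "{0..r}" "\<lambda>t. norm (D t)"] r by auto
  have e0: "0 \<le> e" using E(1) norm_ge_zero order_trans by blast
  have "norm (D m - D 0) \<le> (M * norm (D m) + e) * \<bar>m - 0\<bar>"
  proof (rule norm_diff_le_vector_derivative[OF _ D])
    fix t assume t: "t \<in> {0..r}"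
    have "norm (D t \<odot> B t) \<le> M * norm (D m)"
      by (rule order_trans[OF M(1)[OF t]]) (intro mult_left_mono m(2) t M(2))
    then show "norm (D t \<odot> B t + E t) \<le> M * norm (D m) + e"
      using E(2)[OF t] norm_triangle_ineq[of "D t \<odot> B t" "E t"] by linarith
  qed (use m r in auto)
  also have "\<dots> \<le> (M * norm (D m) + e) * r"
    using m(1) M(2) e0 by (intro mult_left_mono) auto
  also have "\<dots> = (M * r) * norm (D m) + e * r" by (simp add: algebra_simps)
  also have "\<dots> \<le> 1/2 * norm (D m) + e * 1"
    using M(3) r(2) e0 by (intro add_mono mult_right_mono mult_left_mono) auto
  finally have "norm (D m) \<le> norm (D 0) + 1/2 * norm (D m) + e"
    using norm_triangle_sub[of "D m" "D 0"] by linarith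
  then show ?thesis using m(2)[OF t] E(1) by linarith
qed

text \<open>The equation is solved along the bottom edge and from there up each vertical line, so
  the y-equation holds by construction. For the x-equation, the error of the expected linearisation
  in x satisfies, by flatness, the linear equation in y with a source of order \<open>h * d\<close>.
  The bound for such equations replaces a general theorem on dependence on parameters.\<close>

lemma frobenius_square:
  fixes P Q Py Qx :: "real \<Rightarrow> real \<Rightarrow> quat^2^2" and C :: "quat^2^2"
  assumes r: "0 < r" "r \<le> 1" and M: "0 \<le> M" "M * r \<le> 1/2"
    and MP: "\<And>x y Y. x \<in> {0..r} \<Longrightarrow> y \<in> {0..r} \<Longrightarrow> norm (Y \<odot> P x y) \<le> M * norm Y"
    and MQ: "\<And>x y Y. x \<in> {0..r} \<Longrightarrow> y \<in> {0..r} \<Longrightarrow> norm (Y \<odot> Q x y) \<le> M * norm Y"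
    and cP: "continuous_on ({0..r} \<times> {0..r}) (\<lambda>(x, y). P x y)"
    and cQ: "continuous_on ({0..r} \<times> {0..r}) (\<lambda>(x, y). Q x y)"
    and cQx: "continuous_on ({0..r} \<times> {0..r}) (\<lambda>(x, y). Qx x y)"
    and dP: "\<And>x y. x \<in> {0..r} \<Longrightarrow> y \<in> {0..r} \<Longrightarrow> ((\<lambda>y. P x y) has_vector_derivative Py x y) (at y within {0..r})"
    and dQ: "\<And>x y. x \<in> {0..r} \<Longrightarrow> y \<in> {0..r} \<Longrightarrow> ((\<lambda>x. Q x y) has_vector_derivative Qx x y) (at x within {0..r})"
    and flat: "\<And>x y. x \<in> {0..r} \<Longrightarrow> y \<in> {0..r} \<Longrightarrow> Q x y \<odot> P x y + Py x y = P x y \<odot> Q x y + Qx x y"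
  shows "\<exists>U. U 0 0 = C \<and> (\<forall>x\<in>{0..r}. \<forall>y\<in>{0..r}.
     ((\<lambda>x. U x y) has_vector_derivative U x y \<odot> P x y) (at x within {0..r}) \<and>
     ((\<lambda>y. U x y) has_vector_derivative U x y \<odot> Q x y) (at y within {0..r}))"
proof -
  let ?I = "{0..r}"
  have z: "0 \<in> ?I" using r by simp
  have "continuous_on ?I (\<lambda>x. (\<lambda>(x, y). P x y) (x, 0))"
    by (rule continuous_on_compose2[OF cP]) (use z in \<open>auto intro!: continuous_intros\<close>)
  then have cP0: "continuous_on ?I (\<lambda>x. P x 0)" by simp
  have cQ1: "continuous_on ?I (\<lambda>y. Q x y)" if "x \<in> ?I" for x
  proof -
    have "continuous_on ?I (\<lambda>y. (\<lambda>(x, y). Q x y) (x, y))"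
      by (rule continuous_on_compose2[OF cQ]) (use that in \<open>auto intro!: continuous_intros\<close>)
    then show ?thesis by simp
  qed
  obtain V where V: "V 0 = C" "\<And>x. x \<in> ?I \<Longrightarrow> (V has_vector_derivative V x \<odot> P x 0) (at x within ?I)"
    using linear_ode_exists[OF r(1) cP0 MP M] z by blast
  have "\<forall>x\<in>?I. \<exists>u. u 0 = V x \<and> (\<forall>y\<in>?I. (u has_vector_derivative u y \<odot> Q x y) (at y within ?I))"
    using linear_ode_exists[OF r(1) cQ1 MQ M] by blast
  then obtain U where U0: "\<And>x. x \<in> ?I \<Longrightarrow> U x 0 = V x"
    and Uy: "\<And>x y. x \<in> ?I \<Longrightarrow> y \<in> ?I \<Longrightarrow> (U x has_vector_derivative U x y \<odot> Q x y) (at y within ?I)"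
    by metis
  obtain k where k: "k > 0" "\<And>A B. norm (A \<odot> B) \<le> norm A * norm B * k"
    using qmat_mult.pos_bounded by blast
  have "((\<lambda>x. U x y) has_vector_derivative U x y \<odot> P x y) (at x within ?I)" if x: "x \<in> ?I" and y: "y \<in> ?I" for x y
    unfolding has_vector_derivative_def has_derivative_within_alt
  proof (intro conjI allI impI)
    show "bounded_linear (\<lambda>h. h *\<^sub>R (U x y \<odot> P x y))" by (rule bounded_linear_scaleR_left)
    fix e :: real assume e: "0 < e"
    define K where "K = 4 * norm (V x)"
    have K0: "0 \<le> K" by (simp add: K_def)
    have UK: "norm (U x t) \<le> K" if "t \<in> ?I" for t
      unfolding K_def
      by (rule linear_ode_bound[where B = "\<lambda>t. Q x t" and E = "\<lambda>_. 0", OF r MQ[OF x] M _ _ _ that])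
        (use Uy[OF x] U0[OF x] in auto)
    \<comment> \<open>The outer 4 is the factor of \<open>linear_ode_bound\<close>. The bracket
      bounds both the source and the initial value of the error in units of \<open>h * d\<close>;
      its summand 1 covers the initial value.\<close>
    define L where "L = 4 * (k * K * (1 + M) + 1)"
    have L: "L > 0" using k(1) K0 M(1) by (simp add: L_def add_nonneg_pos)
    define d where "d = e / L"
    have d: "d > 0" using e L by (simp add: d_def)
    have uc: "uniformly_continuous_on (?I \<times> ?I) (\<lambda>(x, y). Q x y)" "uniformly_continuous_on (?I \<times> ?I) (\<lambda>(x, y). Qx x y)"
      by (intro compact_uniformly_continuous cQ cQx compact_Times compact_Icc)+
    obtain \<delta>1 where \<delta>1: "\<delta>1 > 0"
      "\<forall>z\<in>?I \<times> ?I. \<forall>z'\<in>?I \<times> ?I. dist z' z < \<delta>1 \<longrightarrow> dist ((\<lambda>(x, y). Q x y) z') ((\<lambda>(x, y). Q x y) z) < d"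
      using spec[OF uc(1)[unfolded uniformly_continuous_on_def], of d] d by (elim impE exE conjE)
    obtain \<delta>2 where \<delta>2: "\<delta>2 > 0"
      "\<forall>z\<in>?I \<times> ?I. \<forall>z'\<in>?I \<times> ?I. dist z' z < \<delta>2 \<longrightarrow> dist ((\<lambda>(x, y). Qx x y) z') ((\<lambda>(x, y). Qx x y) z) < d"
      using spec[OF uc(2)[unfolded uniformly_continuous_on_def], of d] d by (elim impE exE conjE)
    note \<delta> = \<delta>1(1) \<delta>2(1) \<delta>1(2)[rule_format] \<delta>2(2)[rule_format]
    have q1: "norm (Q x' t - Q x t) \<le> d" if "x' \<in> ?I" "t \<in> ?I" "\<bar>x' - x\<bar> < \<delta>1" for x' t
      using \<delta>(3)[of "(x, t)" "(x', t)"] that x by (simp add: dist_Pair_Pair dist_norm)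
    have q2: "norm (Qx x' t - Qx x t) \<le> d" if "x' \<in> ?I" "t \<in> ?I" "\<bar>x' - x\<bar> < \<delta>2" for x' t
      using \<delta>(4)[of "(x, t)" "(x', t)"] that x by (simp add: dist_Pair_Pair dist_norm)
    obtain \<delta>3 where \<delta>3: "\<delta>3 > 0" "\<And>x'. x' \<in> ?I \<Longrightarrow> norm (x' - x) < \<delta>3 \<Longrightarrow>
        norm (V x' - V x - (x' - x) *\<^sub>R (V x \<odot> P x 0)) \<le> d * norm (x' - x)"
      using V(2)[OF x] d unfolding has_vector_derivative_def has_derivative_within_alt by blast
    show "\<exists>d>0. \<forall>x'\<in>?I. norm (x' - x) < d \<longrightarrow>
        norm (U x' y - U x y - (x' - x) *\<^sub>R (U x y \<odot> P x y)) \<le> e * norm (x' - x)"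
    proof (intro exI[of _ "min \<delta>1 (min \<delta>2 \<delta>3)"] conjI ballI impI)
      show "min \<delta>1 (min \<delta>2 \<delta>3) > 0" using \<delta> \<delta>3 by simp
      fix x' assume x': "x' \<in> ?I" and near: "norm (x' - x) < min \<delta>1 (min \<delta>2 \<delta>3)"
      define h where "h = x' - x"
      define D where "D t = U x' t - U x t - h *\<^sub>R (U x t \<odot> P x t)" for t
      \<comment> \<open>Two errors: the linearisation of Q in x, and the use of the coefficient at
        x' instead of x in the first-order correction.\<close>
      define E where "E t = U x t \<odot> (Q x' t - Q x t - h *\<^sub>R Qx x t) + h *\<^sub>R ((U x t \<odot> P x t) \<odot> (Q x' t - Q x t))" for t
      have dD: "(D has_vector_derivative D t \<odot> Q x' t + E t) (at t within ?I)" if t: "t \<in> ?I" for t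
      proof -
        have dUP: "((\<lambda>t. U x t \<odot> P x t) has_vector_derivative U x t \<odot> Py x t + (U x t \<odot> Q x t) \<odot> P x t) (at t within ?I)"
          using qmat_mult.has_vector_derivative[OF Uy[OF x t] dP[OF x t]] .
        have dD': "(D has_vector_derivative U x' t \<odot> Q x' t - U x t \<odot> Q x t -
            h *\<^sub>R (U x t \<odot> Py x t + (U x t \<odot> Q x t) \<odot> P x t)) (at t within ?I)"
          unfolding D_def
          by (intro has_vector_derivative_diff Uy x x' t bounded_linear.has_vector_derivative[OF bounded_linear_scaleR_right dUP])
        \<comment> \<open>Here flatness exchanges the two directions, so that what is left of the
          first-order terms is contained in E.\<close>
        have "U x t \<odot> Py x t + (U x t \<odot> Q x t) \<odot> P x t = U x t \<odot> (Q x t \<odot> P x t + Py x t)"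
          by (simp add: qmat_mult.add_right qmat_mult_assoc add.commute)
        also have "\<dots> = (U x t \<odot> P x t) \<odot> Q x t + U x t \<odot> Qx x t"
          unfolding flat[OF x t] by (simp add: qmat_mult.add_right qmat_mult_assoc)
        finally have "U x' t \<odot> Q x' t - U x t \<odot> Q x t - h *\<^sub>R (U x t \<odot> Py x t + (U x t \<odot> Q x t) \<odot> P x t) = D t \<odot> Q x' t + E t"
          by (simp add: D_def E_def qmat_mult.diff_left qmat_mult.diff_right qmat_mult.add_left qmat_mult.add_right
              qmat_mult.scaleR_left qmat_mult.scaleR_right algebra_simps)
        with dD' show ?thesis by simp
      qed
      have "norm (D y) \<le> 4 * (\<bar>h\<bar> * d * (k * K * (1 + M) + 1))"
      proof (rule linear_ode_bound[OF r MQ[OF x'] M dD _ _ y])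
        have "norm (D 0) \<le> d * \<bar>h\<bar>"
          using \<delta>3(2)[OF x'] near U0[OF x] U0[OF x'] by (simp add: D_def h_def)
        also have "\<dots> \<le> \<bar>h\<bar> * d * (k * K * (1 + M) + 1)"
        proof -
          have "0 \<le> k * K * (1 + M)" using k(1) K0 M(1) by simp
          then have "\<bar>h\<bar> * d * 1 \<le> \<bar>h\<bar> * d * (k * K * (1 + M) + 1)"
            using d by (intro mult_left_mono) auto
          then show ?thesis by (simp add: mult.commute)
        qed
        finally show "norm (D 0) \<le> \<bar>h\<bar> * d * (k * K * (1 + M) + 1)" .
        fix t assume t: "t \<in> ?I"
        let ?S = "closed_segment x x'"
        have S: "?S \<subseteq> ?I" using x x' by (simp add: closed_segment_subset)
        have near': "\<bar>s - x\<bar> < \<delta>2" if "s \<in> ?S" for s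
          using segment_bound1[OF that] near by simp
        have "norm (Q x' t - Q x t - (x' - x) *\<^sub>R Qx x t) \<le> norm (x' - x) * d"
        proof (rule vector_differentiable_bound_linearization[where S = ?S and f = "\<lambda>x. Q x t" and f' = "\<lambda>x. Qx x t"])
          show "((\<lambda>x. Q x t) has_vector_derivative Qx s t) (at s within ?S)" if "s \<in> ?S" for s
            using has_vector_derivative_within_subset[OF dQ S] that S t by blast
          show "norm (Qx s t - Qx x t) \<le> d" if "s \<in> ?S" for s
            using q2[OF _ t near'[OF that]] that S by blast
        qed auto
        then have a1: "norm (Q x' t - Q x t - h *\<^sub>R Qx x t) \<le> \<bar>h\<bar> * d" by (simp add: h_def)
        have a2: "norm (Q x' t - Q x t) \<le> d" using q1[OF x' t] near by simp
        have "norm (U x t \<odot> (Q x' t - Q x t - h *\<^sub>R Qx x t)) \<le> norm (U x t) * norm (Q x' t - Q x t - h *\<^sub>R Qx x t) * k"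
          by (rule k(2))
        also have "\<dots> \<le> K * (\<bar>h\<bar> * d) * k"
          using k(1) K0 by (intro mult_right_mono mult_mono UK t a1) auto
        finally have b1: "norm (U x t \<odot> (Q x' t - Q x t - h *\<^sub>R Qx x t)) \<le> K * (\<bar>h\<bar> * d) * k" .
        have UP: "norm (U x t \<odot> P x t) \<le> M * K"
          by (rule order_trans[OF MP[OF x t]]) (intro mult_left_mono UK t M(1))
        have "norm ((U x t \<odot> P x t) \<odot> (Q x' t - Q x t)) \<le> norm (U x t \<odot> P x t) * norm (Q x' t - Q x t) * k"
          by (rule k(2))
        also have "\<dots> \<le> (M * K) * d * k"
          using k(1) K0 M(1) by (intro mult_right_mono mult_mono UP a2) auto
        finally have "norm (h *\<^sub>R ((U x t \<odot> P x t) \<odot> (Q x' t - Q x t))) \<le> \<bar>h\<bar> * ((M * K) * d * k)"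
          by (simp add: mult_left_mono)
        with b1 have "norm (E t) \<le> K * (\<bar>h\<bar> * d) * k + \<bar>h\<bar> * ((M * K) * d * k)"
          unfolding E_def by (meson norm_triangle_le add_mono)
        also have "\<dots> = \<bar>h\<bar> * d * (k * K * (1 + M))" by (simp add: algebra_simps)
        also have "\<dots> \<le> \<bar>h\<bar> * d * (k * K * (1 + M) + 1)" using d by (intro mult_left_mono) auto
        finally show "norm (E t) \<le> \<bar>h\<bar> * d * (k * K * (1 + M) + 1)" .
      qed
      also have "\<dots> = d * L * \<bar>h\<bar>" by (simp add: L_def algebra_simps)
      also have "\<dots> = e * \<bar>h\<bar>" using L by (simp add: d_def)
      finally show "norm (U x' y - U x y - (x' - x) *\<^sub>R (U x y \<odot> P x y)) \<le> e * norm (x' - x)"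
        by (simp add: D_def h_def)
    qed
  qed
  moreover have "U 0 0 = C" using U0[OF z] V(1) by simp
  ultimately show ?thesis using Uy by (intro exI[of _ U]) blast
qed

text \<open>The derivative of \<open>u \<odot> qadjoint u\<close> is
  \<open>u \<odot> (B + qadjoint B) \<odot> qadjoint u\<close>, which vanishes for skew B.\<close>

lemma unitary_ode:
  assumes "\<And>t. t \<in> {0..r} \<Longrightarrow> (u has_vector_derivative u t \<odot> B t) (at t within {0..r})"
    and "\<And>t. t \<in> {0..r} \<Longrightarrow> qadjoint (B t) = - B t" and "u 0 \<in> Sp2" and t: "t \<in> {0..r}"
  shows "u t \<in> Sp2"
proof -
  have d: "((\<lambda>t. u t \<odot> qadjoint (u t)) has_vector_derivative 0) (at t within {0..r})" if t: "t \<in> {0..r}" for t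
  proof -
    have "((\<lambda>t. qadjoint (u t)) has_vector_derivative qadjoint (u t \<odot> B t)) (at t within {0..r})"
      by (rule bounded_linear.has_vector_derivative[OF bounded_linear_qadjoint assms(1)[OF t]])
    from qmat_mult.has_vector_derivative[OF assms(1)[OF t] this] show ?thesis
      by (simp add: qadjoint_mult assms(2)[OF t] qmat_mult.minus_left qmat_mult.minus_right qmat_mult_assoc)
  qed
  obtain c where c: "\<And>t. t \<in> {0..r} \<Longrightarrow> u t \<odot> qadjoint (u t) = c"
    using has_vector_derivative_zero_constant[OF convex_real_interval(5) d] by blast
  have "0 \<in> {0..r}" using t by auto
  then have "u t \<odot> qadjoint (u t) = qid"
    using c[OF t] c[of 0] Sp2_right[OF assms(3)] by simp
  then have "qadjoint (u t) \<in> Sp2" by (simp add: Sp2_iff)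
  then show ?thesis using Sp2_qadjoint by fastforce
qed

text \<open>The components of the connection in the directions 1 and i are the coefficients P and Q
  on a square. Unitarity spreads from the corner along the bottom edge and up each vertical line,
  and the two partial derivatives are assembled into a total one.\<close>

lemma frobenius_plane:
  fixes A :: "complex \<Rightarrow> complex \<Rightarrow> quat^2^2"
  assumes S: "open S" "p \<in> S"
    and sm: "smooth_on S (\<lambda>z. A z 1)" "smooth_on S (\<lambda>z. A z \<i>)"
    and lin: "\<And>z. z \<in> S \<Longrightarrow> linear (A z)"
    and flat: "\<And>z. z \<in> S \<Longrightarrow> frechet_derivative (\<lambda>z. A z \<i>) (at z) 1 - frechet_derivative (\<lambda>z. A z 1) (at z) \<i>
      = A z \<i> \<odot> A z 1 - A z 1 \<odot> A z \<i>"
    and skew: "\<And>z v. z \<in> S \<Longrightarrow> qadjoint (A z v) = - A z v"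
  shows "\<exists>W \<Phi>. open W \<and> p \<in> W \<and> W \<subseteq> S \<and> convex W \<and>
    (\<forall>z\<in>W. \<Phi> z \<in> Sp2 \<and> (\<Phi> has_derivative (\<lambda>v. \<Phi> z \<odot> A z v)) (at z))"
proof -
  obtain \<rho> where \<rho>: "\<rho> > 0" "cball p \<rho> \<subseteq> S" using S by (meson open_contains_cball)
  obtain k where k: "k > 0" "\<And>A B. norm (A \<odot> B) \<le> norm A * norm B * k"
    using qmat_mult.pos_bounded by blast
  have bd: "\<exists>N>0. \<forall>z\<in>cball p \<rho>. norm (f z) \<le> N" if "smooth_on S f" for f :: "complex \<Rightarrow> quat^2^2"
  proof -
    have "continuous_on (cball p \<rho>) f"
      using smooth_on_imp_continuous_on[OF that] \<rho>(2) continuous_on_subset by blast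
    then have "bounded (f ` cball p \<rho>)" using compact_continuous_image compact_imp_bounded compact_cball by blast
    then show ?thesis unfolding bounded_pos by simp
  qed
  obtain N1 N2 where N: "N1 > 0" "N2 > 0" "\<And>z. z \<in> cball p \<rho> \<Longrightarrow> norm (A z 1) \<le> N1" "\<And>z. z \<in> cball p \<rho> \<Longrightarrow> norm (A z \<i>) \<le> N2"
    using bd[OF sm(1)] bd[OF sm(2)] by blast
  define M where "M = (N1 + N2) * k"
  have M: "M > 0" using N k by (simp add: M_def)
  have Mb: "norm (Y \<odot> A z v) \<le> M * norm Y" if "z \<in> cball p \<rho>" "v \<in> {1, \<i>}" for z v Y
  proof -
    have "norm (A z v) \<le> N1 + N2" using N(1,2) N(3,4)[OF that(1)] that(2) by auto
    then have "norm Y * norm (A z v) * k \<le> norm Y * (N1 + N2) * k"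
      using k(1) by (intro mult_right_mono mult_left_mono) auto
    then show ?thesis using k(2)[of Y "A z v"] by (simp add: M_def mult_ac)
  qed
  \<comment> \<open>The bounds 1 and \<open>1 / (2 * M)\<close> serve the estimates for linear
    equations; \<rho> keeps the square inside the disc on which the coefficients are
    bounded.\<close>
  define r where "r = min 1 (min \<rho> (1 / (2 * M)))"
  have r: "0 < r" "r \<le> 1" "r \<le> \<rho>" using M \<rho> by (auto simp: r_def)
  have Mr: "M * r \<le> 1/2"
  proof -
    have "M * r \<le> M * (1 / (2 * M))" using M by (intro mult_left_mono) (auto simp: r_def)
    then show ?thesis using M by simp
  qed
  \<comment> \<open>The initial value sits at the lower left corner, which is placed so that p is
    the centre of the square and W is a neighbourhood of p.\<close>
  define p0 where "p0 = p - Complex (r/2) (r/2)"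
  define zz where "zz x y = p0 + of_real x + \<i> * of_real y" for x y
  let ?I = "{0..r}"
  have zz: "zz x y \<in> cball p \<rho>" if "x \<in> ?I" "y \<in> ?I" for x y
  proof -
    have "p - zz x y = Complex (r/2 - x) (r/2 - y)" by (simp add: zz_def p0_def complex_eq_iff)
    then have "dist p (zz x y) \<le> \<bar>r/2 - x\<bar> + \<bar>r/2 - y\<bar>"
      using cmod_le[of "p - zz x y"] by (simp add: dist_norm)
    then show ?thesis using that r(3) by (auto simp: abs_if split: if_splits)
  qed
  have zzS: "zz x y \<in> S" if "x \<in> ?I" "y \<in> ?I" for x y using zz[OF that] \<rho>(2) by blast
  have czz: "continuous_on (?I \<times> ?I) (\<lambda>(x, y). f (zz x y))" if "smooth_on S f" for f :: "complex \<Rightarrow> quat^2^2"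
    unfolding case_prod_beta
    by (rule continuous_on_compose2[OF smooth_on_imp_continuous_on[OF that]])
      (use zzS in \<open>auto simp: zz_def intro!: continuous_intros\<close>)
  have dzz: "((\<lambda>y. f (zz x y)) has_vector_derivative frechet_derivative f (at (zz x y)) \<i>) (at y within ?I)"
    "((\<lambda>x. f (zz x y)) has_vector_derivative frechet_derivative f (at (zz x y)) 1) (at x within ?I)"
    if f: "smooth_on S f" and xy: "x \<in> ?I" "y \<in> ?I" for f :: "complex \<Rightarrow> quat^2^2" and x y
  proof -
    note d = smooth_on_has_derivative[OF f zzS[OF xy]]
    note lin = linear_scale[OF has_derivative_linear[OF d]]
    have "((\<lambda>y. zz x y) has_derivative (\<lambda>h. h *\<^sub>R \<i>)) (at y within ?I)"
      unfolding zz_def by (auto intro!: derivative_eq_intros simp: scaleR_conv_of_real)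
    from has_derivative_compose[OF this d]
    show "((\<lambda>y. f (zz x y)) has_vector_derivative frechet_derivative f (at (zz x y)) \<i>) (at y within ?I)"
      by (simp add: has_vector_derivative_def lin)
    have "((\<lambda>x. zz x y) has_derivative (\<lambda>h. h *\<^sub>R 1)) (at x within ?I)"
      unfolding zz_def by (auto intro!: derivative_eq_intros simp: scaleR_conv_of_real)
    from has_derivative_compose[OF this d]
    show "((\<lambda>x. f (zz x y)) has_vector_derivative frechet_derivative f (at (zz x y)) 1) (at x within ?I)"
      by (simp only: has_vector_derivative_def lin)
  qed
  have "\<exists>U. U 0 0 = qid \<and> (\<forall>x\<in>{0..r}. \<forall>y\<in>{0..r}.
     ((\<lambda>x. U x y) has_vector_derivative U x y \<odot> A (zz x y) 1) (at x within {0..r}) \<and>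
     ((\<lambda>y. U x y) has_vector_derivative U x y \<odot> A (zz x y) \<i>) (at y within {0..r}))"
  proof (rule frobenius_square[where P = "\<lambda>x y. A (zz x y) 1" and Q = "\<lambda>x y. A (zz x y) \<i>",
        OF r(1,2) less_imp_le[OF M] Mr _ _ czz[OF sm(1)] czz[OF sm(2)] czz[OF smooth_on_derivative[OF sm(2), of 1]]
        dzz(1)[OF sm(1)] dzz(2)[OF sm(2)]])
    fix x y assume xy: "x \<in> ?I" "y \<in> ?I"
    show "norm (Y \<odot> A (zz x y) 1) \<le> M * norm Y" "norm (Y \<odot> A (zz x y) \<i>) \<le> M * norm Y" for Y
      using Mb[OF zz[OF xy]] by auto
    show "A (zz x y) \<i> \<odot> A (zz x y) 1 + frechet_derivative (\<lambda>z. A z 1) (at (zz x y)) \<i> =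
        A (zz x y) 1 \<odot> A (zz x y) \<i> + frechet_derivative (\<lambda>z. A z \<i>) (at (zz x y)) 1"
      using flat[OF zzS[OF xy]] by (simp add: algebra_simps)
  qed assumption+
  then obtain U where U0: "U 0 0 = qid"
    and Ux: "\<And>x y. x \<in> ?I \<Longrightarrow> y \<in> ?I \<Longrightarrow> ((\<lambda>x. U x y) has_vector_derivative U x y \<odot> A (zz x y) 1) (at x within ?I)"
    and Uy: "\<And>x y. x \<in> ?I \<Longrightarrow> y \<in> ?I \<Longrightarrow> ((\<lambda>y. U x y) has_vector_derivative U x y \<odot> A (zz x y) \<i>) (at y within ?I)"
    by blast
  have z: "0 \<in> ?I" using r by simp
  have UxS: "U x 0 \<in> Sp2" if "x \<in> ?I" for x
    by (rule unitary_ode[where u = "\<lambda>x. U x 0" and B = "\<lambda>x. A (zz x 0) 1", OF Ux _ _ that])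
      (use skew zzS z U0 in auto)
  have US: "U x y \<in> Sp2" if "x \<in> ?I" "y \<in> ?I" for x y
    by (rule unitary_ode[where u = "\<lambda>y. U x y" and B = "\<lambda>y. A (zz x y) \<i>", OF Uy _ _ that(2)])
      (use skew zzS z UxS that in auto)
  \<comment> \<open>Two applications of \<open>linear_ode_bound\<close>, one in each direction, each
    with the factor 4.\<close>
  define K where "K = 16 * norm (qid :: quat^2^2)"
  have UK: "norm (U x y) \<le> K" if xy: "x \<in> ?I" "y \<in> ?I" for x y
  proof -
    have "norm (U x 0) \<le> 4 * norm (U 0 0)"
      by (rule linear_ode_bound[where D = "\<lambda>x. U x 0" and B = "\<lambda>x. A (zz x 0) 1" and E = "\<lambda>_. 0" and M = M, OF r(1,2) Mb])
        (use zz z xy M Mr Ux in auto)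
    moreover have "norm (U x y) \<le> 4 * norm (U x 0)"
      by (rule linear_ode_bound[where D = "\<lambda>y. U x y" and B = "\<lambda>y. A (zz x y) \<i>" and E = "\<lambda>_. 0" and M = M, OF r(1,2) Mb])
        (use zz z xy M Mr Uy in auto)
    ultimately show ?thesis by (simp add: K_def U0)
  qed
  have UAK: "norm (U x y \<odot> A (zz x y) v) \<le> M * K" if "x \<in> ?I" "y \<in> ?I" "v \<in> {1, \<i>}" for x y v
    by (rule order_trans[OF Mb[OF zz[OF that(1,2)] that(3)]]) (use UK[OF that(1,2)] M in auto)
  \<comment> \<open>Both partial derivatives are bounded by \<open>M * K\<close>, so U is Lipschitz;
    this makes the partial derivatives jointly continuous.\<close>
  have cU: "continuous_on (?I \<times> ?I) (\<lambda>(x, y). U x y)"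
  proof (rule lipschitz_on_continuous_on[where L = "2 * (M * K)"], rule lipschitz_onI)
    fix a b assume "a \<in> ?I \<times> ?I" "b \<in> ?I \<times> ?I"
    then obtain x y x' y' where ab: "a = (x, y)" "b = (x', y')" "x \<in> ?I" "y \<in> ?I" "x' \<in> ?I" "y' \<in> ?I" by auto
    have 1: "norm (U x y - U x' y) \<le> M * K * \<bar>x - x'\<bar>"
      by (rule norm_diff_le_vector_derivative[where f = "\<lambda>x. U x y", OF convex_real_interval(5) Ux UAK]) (use ab in auto)
    have 2: "norm (U x' y - U x' y') \<le> M * K * \<bar>y - y'\<bar>"
      by (rule norm_diff_le_vector_derivative[where f = "\<lambda>y. U x' y", OF convex_real_interval(5) Uy UAK]) (use ab in auto)
    have MK: "0 \<le> M * K" using M by (simp add: K_def)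
    have "\<bar>x - x'\<bar> \<le> dist a b" "\<bar>y - y'\<bar> \<le> dist a b"
      using dist_fst_le[of a b] dist_snd_le[of a b] by (simp_all add: ab dist_real_def)
    then have "M * K * \<bar>x - x'\<bar> + M * K * \<bar>y - y'\<bar> \<le> M * K * dist a b + M * K * dist a b"
      using MK by (intro add_mono mult_left_mono) auto
    moreover have "norm (U x y - U x' y') \<le> norm (U x y - U x' y) + norm (U x' y - U x' y')"
      using norm_triangle_ineq[of "U x y - U x' y" "U x' y - U x' y'"] by simp
    ultimately have "norm (U x y - U x' y') \<le> 2 * (M * K) * dist a b"
      using 1 2 by linarith
    then show "dist ((\<lambda>(x, y). U x y) a) ((\<lambda>(x, y). U x y) b) \<le> 2 * (M * K) * dist a b"
      unfolding ab prod.case dist_norm[of "U x y"] .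
  qed (use M in \<open>simp add: K_def\<close>)
  define W where "W = box p0 (p0 + Complex r r)"
  define \<Phi> where "\<Phi> z = (\<lambda>(x, y). U x y) (Re (z - p0), Im (z - p0))" for z
  have W: "Re (z - p0) \<in> {0<..<r}" "Im (z - p0) \<in> {0<..<r}" if "z \<in> W" for z
    using that by (auto simp: W_def in_box_complex_iff)
  have zzid: "zz (Re (z - p0)) (Im (z - p0)) = z" for z by (simp add: zz_def complex_eq_iff)
  have "\<Phi> z \<in> Sp2 \<and> (\<Phi> has_derivative (\<lambda>v. \<Phi> z \<odot> A z v)) (at z)" if zW: "z \<in> W" for z
  proof
    let ?x = "Re (z - p0)" and ?y = "Im (z - p0)"
    have xy: "?x \<in> {0<..<r}" "?y \<in> {0<..<r}" by (rule W[OF zW])+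
    then have xy': "?x \<in> ?I" "?y \<in> ?I" by auto
    then show "\<Phi> z \<in> Sp2" using US by (simp add: \<Phi>_def)
    have "((\<lambda>(x, y). U x y) has_derivative (\<lambda>(tx, ty). tx *\<^sub>R (U ?x ?y \<odot> A (zz ?x ?y) 1) +
        blinfun_apply (blinfun_scaleR_left (U ?x ?y \<odot> A (zz ?x ?y) \<i>)) ty)) (at (?x, ?y) within ?I \<times> ?I)"
    \<comment> \<open>Total differentiability follows from the partial derivatives once the one in y
      is jointly continuous.\<close>
    proof (rule has_derivative_partialsI)
      show "((\<lambda>x. U x ?y) has_derivative (\<lambda>tx. tx *\<^sub>R (U ?x ?y \<odot> A (zz ?x ?y) 1))) (at ?x within ?I)"
        using Ux[OF xy'] by (simp add: has_vector_derivative_def)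
      show "((\<lambda>y. U x y) has_derivative blinfun_apply (blinfun_scaleR_left (U x y \<odot> A (zz x y) \<i>))) (at y within ?I)"
        if "x \<in> ?I" "y \<in> ?I" for x y
        using Uy[OF that] by (simp add: has_vector_derivative_def blinfun_scaleR_left.rep_eq)
      have "continuous_on (?I \<times> ?I) (\<lambda>z. (\<lambda>(x, y). U x y) z \<odot> (\<lambda>(x, y). A (zz x y) \<i>) z)"
        by (intro qmat_mult.continuous_on cU czz[OF sm(2)])
      from bounded_linear.continuous_on[OF bounded_linear_blinfun_scaleR_left this]
      have "continuous_on (?I \<times> ?I) (\<lambda>(x, y). blinfun_scaleR_left (U x y \<odot> A (zz x y) \<i>))"
        by (simp add: case_prod_beta)
      then show "continuous (at (?x, ?y) within ?I \<times> ?I) (\<lambda>(x, y). blinfun_scaleR_left (U x y \<odot> A (zz x y) \<i>))"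
        using xy' by (simp add: continuous_on_eq_continuous_within)
    qed (use xy' in auto)
    moreover have "at (?x, ?y) within ?I \<times> ?I = at (?x, ?y)"
      by (rule at_within_open_subset[of _ "{0<..<r} \<times> {0<..<r}"]) (use xy in \<open>auto intro: open_Times\<close>)
    ultimately have d: "((\<lambda>(x, y). U x y) has_derivative (\<lambda>(tx, ty). tx *\<^sub>R (U ?x ?y \<odot> A z 1) + ty *\<^sub>R (U ?x ?y \<odot> A z \<i>))) (at (?x, ?y))"
      by (simp only: zzid blinfun_scaleR_left.rep_eq)
    have "((\<lambda>z. (Re (z - p0), Im (z - p0))) has_derivative (\<lambda>v. (Re v, Im v))) (at z)"
      by (auto intro!: derivative_eq_intros)
    from has_derivative_compose[OF this d]
    have "(\<Phi> has_derivative (\<lambda>v. Re v *\<^sub>R (U ?x ?y \<odot> A z 1) + Im v *\<^sub>R (U ?x ?y \<odot> A z \<i>))) (at z)"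
      by (simp add: \<Phi>_def[abs_def])
    moreover have "Re v *\<^sub>R (U ?x ?y \<odot> A z 1) + Im v *\<^sub>R (U ?x ?y \<odot> A z \<i>) = \<Phi> z \<odot> A z v" for v
    proof -
      have "z \<in> S" using zzS[OF xy'] by (simp only: zzid)
      have "v = Re v *\<^sub>R 1 + Im v *\<^sub>R \<i>" by (simp add: complex_eq_iff)
      then have "A z v = A z (Re v *\<^sub>R 1 + Im v *\<^sub>R \<i>)" by (rule arg_cong)
      then have "A z v = Re v *\<^sub>R A z 1 + Im v *\<^sub>R A z \<i>"
        by (simp only: linear_add[OF lin[OF \<open>z \<in> S\<close>]] linear_scale[OF lin[OF \<open>z \<in> S\<close>]])
      then show ?thesis by (simp add: \<Phi>_def qmat_mult.add_right qmat_mult.scaleR_right)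
    qed
    ultimately show "(\<Phi> has_derivative (\<lambda>v. \<Phi> z \<odot> A z v)) (at z)" by simp
  qed
  moreover have "p \<in> W" using r by (simp add: W_def in_box_complex_iff p0_def)
  moreover have "W \<subseteq> S"
  proof
    fix z assume "z \<in> W"
    then have "zz (Re (z - p0)) (Im (z - p0)) \<in> S" using W[of z] by (intro zzS) auto
    then show "z \<in> S" by (simp only: zzid)
  qed
  ultimately show ?thesis
    by (intro exI[of _ W] exI[of _ \<Phi>]) (auto simp: W_def open_box convex_box)
qed

section \<open>The connection of a curve\<close>

text \<open>The Maurer--Cartan form of a lift with \<open>\<omega>\<^sub>1 = w\<close>, \<open>\<omega>\<^sub>2 = 0\<close>, \<open>\<omega>\<^sub>3 = a w\<close>, \<open>\<tau> = b w\<close>,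
  \<open>\<rho>\<^sub>1 = r1\<close> and \<open>\<rho>\<^sub>2 = r2\<close>.\<close>

definition mc_matrix :: "real \<Rightarrow> real \<Rightarrow> real \<Rightarrow> real \<Rightarrow> complex \<Rightarrow> quat^2^2" where
  "mc_matrix a b r1 r2 w =
    qmat (\<i> * of_real r1, of_real a * cnj w) (- (cnj w / of_real (sqrt 2)), 0)
         (w / of_real (sqrt 2), 0) (\<i> * of_real r2, of_real b * w)"

lemma qadjoint_mc_matrix: "qadjoint (mc_matrix a b r1 r2 w) = - mc_matrix a b r1 r2 w"
  by (simp add: qmat_eq_iff mc_matrix_def qcnj_def)

lemma linear_mc_matrix:
  assumes "linear r1" "linear r2" "linear w"
  shows "linear (\<lambda>v. mc_matrix a b (r1 v) (r2 v) (w v))"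
proof (rule linearI)
  note add = assms[THEN linear_add] and sc = assms[THEN linear_scale]
  show "mc_matrix a b (r1 (v + v')) (r2 (v + v')) (w (v + v')) =
      mc_matrix a b (r1 v) (r2 v) (w v) + mc_matrix a b (r1 v') (r2 v') (w v')" for v v'
    by (simp add: add mc_matrix_def qmat_add algebra_simps add_divide_distrib)
  show "mc_matrix a b (r1 (x *\<^sub>R v)) (r2 (x *\<^sub>R v)) (w (x *\<^sub>R v)) = x *\<^sub>R mc_matrix a b (r1 v) (r2 v) (w v)" for x v
    by (simp add: sc mc_matrix_def qmat_eq_iff scaleR_conv_of_real)
qed

text \<open>\<open>star_d L p\<close> is the Hodge dual \<open>*dL = L\<^sub>x dy - L\<^sub>y dx\<close> at \<open>p\<close>.\<close>

definition star_d :: "(complex \<Rightarrow> real) \<Rightarrow> complex \<Rightarrow> complex \<Rightarrow> real" where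
  "star_d L p v = frechet_derivative L (at p) 1 * Im v - frechet_derivative L (at p) \<i> * Re v"

lemma linear_star_d: "linear (star_d L p)"
  by (rule linearI) (simp_all add: star_d_def algebra_simps)

text \<open>The Hodge star on 1-forms depends only on the conformal structure, so it commutes with
  pullback by a holomorphic map.\<close>

lemma star_d_holomorphic:
  assumes L: "(L has_derivative L') (at (T p))" and T: "(T has_field_derivative t) (at p)"
  shows "star_d (\<lambda>p. L (T p)) p v = star_d L (T p) (t * v)"
proof -
  have lin: "linear L'" using L has_derivative_linear by blast
  have "((\<lambda>p. L (T p)) has_derivative (\<lambda>v. L' (t * v))) (at p)"
    using has_derivative_compose[OF T[unfolded has_field_derivative_def] L] by simp
  then have 1: "frechet_derivative (\<lambda>p. L (T p)) (at p) v = L' (t * v)" for v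
    by (rule frechet_derivative_eq)
  have 2: "frechet_derivative L (at (T p)) v = L' v" for v by (rule frechet_derivative_eq[OF L])
  have 3: "L' z = Re z * L' 1 + Im z * L' \<i>" for z
  proof -
    have "L' z = L' (Re z *\<^sub>R 1 + Im z *\<^sub>R \<i>)" by (rule arg_cong[of _ _ L']) (simp add: complex_eq_iff)
    then show ?thesis by (simp only: linear_add[OF lin] linear_scale[OF lin] real_scaleR_def)
  qed
  show ?thesis
    unfolding star_d_def 1 2 3[of "t * 1"] 3[of "t * \<i>"] by (simp add: algebra_simps)
qed

text \<open>\<open>L1\<close> and \<open>L2\<close> stand for the logarithms of the squared angle
  functions, whence \<open>exp (L1 p / 2)\<close> and the denominator 16 = 2 * 8; \<open>w\<close>
  is the coefficient of \<omega>1. The diagonal entries solve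
  \<open>3 \<rho>1 - \<rho>2 = star_d (ln \<alpha>m)\<close> and
  \<open>\<rho>1 - 3 \<rho>2 = star_d (ln \<alpha>p)\<close>.\<close>

definition curve_connection :: "(complex \<Rightarrow> real) \<Rightarrow> (complex \<Rightarrow> real) \<Rightarrow> complex \<Rightarrow> complex \<Rightarrow> complex \<Rightarrow> quat^2^2" where
  "curve_connection L1 L2 p w v = mc_matrix (exp (L1 p / 2)) (exp (L2 p / 2))
     ((3 * star_d L1 p v - star_d L2 p v) / 16) ((star_d L1 p v - 3 * star_d L2 p v) / 16) (w * v)"

lemma linear_curve_connection: "linear (curve_connection L1 L2 p w)"
  unfolding curve_connection_def
  by (rule linear_mc_matrix; rule linearI)
    (simp_all add: linear_add[OF linear_star_d] linear_scale[OF linear_star_d] field_simps)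

lemma qadjoint_curve_connection: "qadjoint (curve_connection L1 L2 p w v) = - curve_connection L1 L2 p w v"
  by (simp add: curve_connection_def qadjoint_mc_matrix)

lemma smooth_on_mc_matrix:
  fixes w :: "complex \<Rightarrow> complex"
  assumes "smooth_on S a" "smooth_on S b" "smooth_on S r1" "smooth_on S r2" "smooth_on S w"
  shows "smooth_on S (\<lambda>p. mc_matrix (a p) (b p) (r1 p) (r2 p) (w p))"
proof -
  have o: "open S" using assms(1) by (rule smooth_on_open)
  have c: "smooth_on S (\<lambda>p. c)" for c :: complex using o by (rule smooth_on_const)
  have d: "smooth_on S (\<lambda>p. f p / k)" if "smooth_on S f" for f :: "complex \<Rightarrow> complex" and k
    unfolding divide_inverse by (intro smooth_on_mult that c)
  have "smooth_on S (\<lambda>p. (\<lambda>(a, b, c, d). qmat a b c d) ((\<i> * of_real (r1 p), of_real (a p) * cnj (w p)),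
      (- (cnj (w p) / of_real (sqrt 2)), 0), (w p / of_real (sqrt 2), 0), (\<i> * of_real (r2 p), of_real (b p) * w p)))"
    by (rule smooth_on_bounded_linear[OF _ bounded_linear_qmat])
      (intro smooth_on_Pair smooth_on_mult smooth_on_of_real smooth_on_cnj smooth_on_minus d c assms)
  then show ?thesis by (simp add: mc_matrix_def)
qed

lemma smooth_on_exp: "smooth_on UNIV (exp :: real \<Rightarrow> real)"
proof -
  have "Ck_on k UNIV (exp :: real \<Rightarrow> real)" for k
  proof (induction k)
    case 0
    then show ?case by (auto intro: continuous_intros)
  next
    case (Suc k)
    have d: "(exp has_derivative (\<lambda>v. exp p * v)) (at p)" for p :: real
      using DERIV_exp[of p] by (simp add: has_field_derivative_def)
    show ?case
      by (rule Ck_onI[OF open_UNIV d]) (rule Ck_on_bounded_linear[OF open_UNIV bounded_linear_mult_left Suc])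
  qed
  then show ?thesis by (simp add: smooth_on_def)
qed

lemma smooth_on_real_scale: "smooth_on S f \<Longrightarrow> smooth_on S (\<lambda>p. f p * (c::real))"
  by (rule smooth_on_bounded_linear[OF _ bounded_linear_mult_left])

lemma smooth_on_curve_connection:
  assumes L: "smooth_on S L1" "smooth_on S L2" and w: "smooth_on S w"
  shows "smooth_on S (\<lambda>p. curve_connection L1 L2 p (w p) v)"
proof -
  have e: "smooth_on S (\<lambda>p. exp (L p / 2))" if "smooth_on S L" for L :: "complex \<Rightarrow> real"
    using smooth_on_compose[OF smooth_on_real_scale[OF that, of "1/2"] smooth_on_exp] by simp
  have st: "smooth_on S (\<lambda>p. star_d L p v)" if "smooth_on S L" for L
    unfolding star_d_def by (intro smooth_on_diff smooth_on_real_scale smooth_on_derivative that)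
  have r: "smooth_on S (\<lambda>p. (3 * star_d L1 p v - star_d L2 p v) * (1/16))"
    "smooth_on S (\<lambda>p. (star_d L1 p v - 3 * star_d L2 p v) * (1/16))"
    unfolding mult.commute[of 3] by (intro smooth_on_real_scale smooth_on_diff st L)+
  have "smooth_on S (\<lambda>p. w p * v)"
    by (intro smooth_on_mult w smooth_on_const smooth_on_open[OF w])
  then show ?thesis
    unfolding curve_connection_def by (intro smooth_on_mc_matrix e L) (use r in simp_all)
qed

lemma has_derivative_qmat:
  assumes "(a has_derivative a') (at z)" "(b has_derivative b') (at z)" "(c has_derivative c') (at z)" "(d has_derivative d') (at z)"
  shows "((\<lambda>p. qmat (a p) (b p) (c p) (d p)) has_derivative (\<lambda>v. qmat (a' v) (b' v) (c' v) (d' v))) (at z)"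
  using bounded_linear.has_derivative[OF bounded_linear_qmat has_derivative_Pair[OF assms(1) has_derivative_Pair[OF assms(2) has_derivative_Pair[OF assms(3,4)]]]]
  by simp

text \<open>Written out in entries, the equations other than the complex parts of the diagonal hold
  identically in \<open>L1\<close> and \<open>L2\<close>. Those two parts are the equations for
  \<open>d\<rho>1\<close> and \<open>d\<rho>2\<close>, where the Laplace equations enter.\<close>

lemma curve_connection_flat:
  assumes L: "smooth_on S L1" "smooth_on S L2" and z: "z \<in> S" and u: "cmod u = 1"
  defines "\<gamma> \<equiv> \<lambda>p. exp (- (L1 p + L2 p) / 8)"
  defines "\<alpha> \<equiv> exp (L1 z / 2)" and "\<beta> \<equiv> exp (L2 z / 2)"
  assumes lap: "laplacian L1 z = - 4 * (3 * \<alpha>\<^sup>2 + \<beta>\<^sup>2 - 2) * (\<gamma> z)\<^sup>2"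
    "laplacian L2 z = - 4 * (3 * \<beta>\<^sup>2 + \<alpha>\<^sup>2 - 2) * (\<gamma> z)\<^sup>2"
  defines "A \<equiv> \<lambda>p. curve_connection L1 L2 p (u * of_real (\<gamma> p))"
  shows "frechet_derivative (\<lambda>p. A p \<i>) (at z) 1 - frechet_derivative (\<lambda>p. A p 1) (at z) \<i>
      = A z \<i> \<odot> A z 1 - A z 1 \<odot> A z \<i>"
proof -
  let ?D = "\<lambda>L v. frechet_derivative L (at z) v"
  let ?DD = "\<lambda>L v w. frechet_derivative (\<lambda>p. frechet_derivative L (at p) v) (at z) w"
  note d1 = smooth_on_has_derivative[OF L(1) z] and d2 = smooth_on_has_derivative[OF L(2) z]
  note dd1 = smooth_on_has_derivative[OF smooth_on_derivative[OF L(1)] z]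
    and dd2 = smooth_on_has_derivative[OF smooth_on_derivative[OF L(2)] z]
  \<comment> \<open>\<open>s\<close>, \<open>t\<close> and \<open>g\<close> are the logarithmic
    derivatives of \<open>\<alpha> * \<gamma>\<close>, \<open>\<beta> * \<gamma>\<close> and
    \<gamma>; the weight 3/8 is 1/2 - 1/8.\<close>
  define s where "s v = 3/8 * ?D L1 v - 1/8 * ?D L2 v" for v
  define t where "t v = 3/8 * ?D L2 v - 1/8 * ?D L1 v" for v
  define g where "g v = (- 1/8) * ?D L1 v - 1/8 * ?D L2 v" for v
  have ag_eq: "exp (L1 p / 2) * \<gamma> p = exp (3/8 * L1 p - 1/8 * L2 p)"
    and bg_eq: "exp (L2 p / 2) * \<gamma> p = exp (3/8 * L2 p - 1/8 * L1 p)"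
    and gg_eq: "\<gamma> p = exp ((- 1/8) * L1 p - 1/8 * L2 p)" for p
    unfolding \<gamma>_def by (simp_all add: exp_add[symmetric] field_simps)
  have E: "((\<lambda>p. exp (f p)) has_derivative (\<lambda>v. exp (f z) * f' v)) (at z)"
    if "(f has_derivative f') (at z)" for f :: "complex \<Rightarrow> real" and f'
    using has_derivative_exp[OF that] by (simp add: mult.commute)
  have ag: "((\<lambda>p. exp (L1 p / 2) * \<gamma> p) has_derivative (\<lambda>v. \<alpha> * \<gamma> z * s v)) (at z)"
    unfolding \<alpha>_def ag_eq s_def
    by (intro E has_derivative_diff has_derivative_mult_right d1 d2)
  have bg: "((\<lambda>p. exp (L2 p / 2) * \<gamma> p) has_derivative (\<lambda>v. \<beta> * \<gamma> z * t v)) (at z)"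
    unfolding \<beta>_def bg_eq t_def
    by (intro E has_derivative_diff has_derivative_mult_right d1 d2)
  have gg: "(\<gamma> has_derivative (\<lambda>v. \<gamma> z * g v)) (at z)"
    unfolding gg_eq[abs_def] g_def
    by (intro E has_derivative_diff has_derivative_mult_right d1 d2)
  define R1 where "R1 v h = 3/16 * (?DD L1 1 h * Im v - ?DD L1 \<i> h * Re v) - 1/16 * (?DD L2 1 h * Im v - ?DD L2 \<i> h * Re v)" for v h
  define R2 where "R2 v h = 1/16 * (?DD L1 1 h * Im v - ?DD L1 \<i> h * Re v) - 3/16 * (?DD L2 1 h * Im v - ?DD L2 \<i> h * Re v)" for v h
  have r_eq: "(3 * star_d L1 p v - star_d L2 p v) / 16 = 3/16 * star_d L1 p v - 1/16 * star_d L2 p v"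
    "(star_d L1 p v - 3 * star_d L2 p v) / 16 = 1/16 * star_d L1 p v - 3/16 * star_d L2 p v" for p v
    by (simp_all add: field_simps)
  have r1: "((\<lambda>p. (3 * star_d L1 p v - star_d L2 p v) / 16) has_derivative R1 v) (at z)" for v
    unfolding r_eq unfolding star_d_def R1_def[abs_def]
    by (intro has_derivative_diff has_derivative_mult_right has_derivative_mult_left dd1 dd2)
  have r2: "((\<lambda>p. (star_d L1 p v - 3 * star_d L2 p v) / 16) has_derivative R2 v) (at z)" for v
    unfolding r_eq unfolding star_d_def R2_def[abs_def]
    by (intro has_derivative_diff has_derivative_mult_right has_derivative_mult_left dd1 dd2)
  have dA: "((\<lambda>p. A p v) has_derivative (\<lambda>h. qmat
      (\<i> * of_real (R1 v h), of_real (\<alpha> * \<gamma> z * s h) * cnj (u * v))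
      (- (of_real (\<gamma> z * g h) * cnj (u * v) / of_real (sqrt 2)), 0)
      (of_real (\<gamma> z * g h) * (u * v) / of_real (sqrt 2), 0)
      (\<i> * of_real (R2 v h), of_real (\<beta> * \<gamma> z * t h) * (u * v)))) (at z)" for v
  proof -
    have eq: "A p v = qmat
      (\<i> * of_real ((3 * star_d L1 p v - star_d L2 p v) / 16), of_real (exp (L1 p / 2) * \<gamma> p) * cnj (u * v))
      (- (of_real (\<gamma> p) * cnj (u * v) / of_real (sqrt 2)), 0)
      (of_real (\<gamma> p) * (u * v) / of_real (sqrt 2), 0)
      (\<i> * of_real ((star_d L1 p v - 3 * star_d L2 p v) / 16), of_real (exp (L2 p / 2) * \<gamma> p) * (u * v))" for p
      unfolding A_def curve_connection_def mc_matrix_def by (simp add: mult_ac)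
    have dv: "((\<lambda>p. f p / k) has_derivative (\<lambda>h. f' h / k)) (at z)"
      if "(f has_derivative f') (at z)" for f f' :: "complex \<Rightarrow> complex" and k
      unfolding divide_inverse by (rule has_derivative_mult_left[OF that])
    show ?thesis
      unfolding eq
      by (intro has_derivative_qmat has_derivative_Pair has_derivative_mult_right has_derivative_mult_left
          dv has_derivative_minus has_derivative_of_real has_derivative_const r1 r2 ag bg gg)
  qed
  have l1: "?DD L1 1 1 + ?DD L1 \<i> \<i> = - 4 * (3 * \<alpha>\<^sup>2 + \<beta>\<^sup>2 - 2) * (\<gamma> z)\<^sup>2"
    and l2: "?DD L2 1 1 + ?DD L2 \<i> \<i> = - 4 * (3 * \<beta>\<^sup>2 + \<alpha>\<^sup>2 - 2) * (\<gamma> z)\<^sup>2"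
    using lap by (simp_all add: laplacian_def partial_def[abs_def])
  \<comment> \<open>The exterior derivative of a Hodge dual is a Laplacian, here that of
    \<open>(3 * L1 - L2) / 16\<close>, and in this combination \<open>\<beta>\<^sup>2\<close>
    cancels.\<close>
  have R1: "R1 \<i> 1 - R1 1 \<i> = - (2 * \<alpha>\<^sup>2 - 1) * (\<gamma> z)\<^sup>2"
  proof -
    have "R1 \<i> 1 - R1 1 \<i> = (3 * (?DD L1 1 1 + ?DD L1 \<i> \<i>) - (?DD L2 1 1 + ?DD L2 \<i> \<i>)) / 16"
      by (simp add: R1_def field_simps)
    then show ?thesis unfolding l1 l2 by (simp add: field_simps)
  qed
  \<comment> \<open>In the combination for \<open>d\<rho>2\<close> it is
    \<open>\<alpha>\<^sup>2\<close> that cancels.\<close>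
  have R2: "R2 \<i> 1 - R2 1 \<i> = (2 * \<beta>\<^sup>2 - 1) * (\<gamma> z)\<^sup>2"
  proof -
    have "R2 \<i> 1 - R2 1 \<i> = ((?DD L1 1 1 + ?DD L1 \<i> \<i>) - 3 * (?DD L2 1 1 + ?DD L2 \<i> \<i>)) / 16"
      by (simp add: R2_def field_simps)
    then show ?thesis unfolding l1 l2 by (simp add: field_simps)
  qed
  define x1 y1 x2 y2 where "x1 = ?D L1 1" and "y1 = ?D L1 \<i>" and "x2 = ?D L2 1" and "y2 = ?D L2 \<i>"
  define G where "G = \<gamma> z"
  have A1: "A z 1 = mc_matrix \<alpha> \<beta> ((y2 - 3 * y1) / 16) ((3 * y2 - y1) / 16) (u * of_real G)"
    and Ai: "A z \<i> = mc_matrix \<alpha> \<beta> ((3 * x1 - x2) / 16) ((x1 - 3 * x2) / 16) (u * of_real G * \<i>)"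
    by (simp_all add: A_def curve_connection_def star_d_def \<alpha>_def \<beta>_def x1_def x2_def y1_def y2_def G_def)
  have sv: "s 1 = (3 * x1 - x2) / 8" "s \<i> = (3 * y1 - y2) / 8" "t 1 = (3 * x2 - x1) / 8" "t \<i> = (3 * y2 - y1) / 8"
    "g 1 = - (x1 + x2) / 8" "g \<i> = - (y1 + y2) / 8"
    by (simp_all add: s_def t_def g_def x1_def x2_def y1_def y2_def field_simps)
  have uu: "u * cnj u = 1" using u by (simp add: complex_norm_square[symmetric])
  have lhs: "frechet_derivative (\<lambda>p. A p \<i>) (at z) 1 - frechet_derivative (\<lambda>p. A p 1) (at z) \<i> =
     qmat (\<i> * of_real (R1 \<i> 1 - R1 1 \<i>), of_real (\<alpha> * G) * (of_real (s 1) * cnj (u * \<i>) - of_real (s \<i>) * cnj u))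
       (- (of_real G * (of_real (g 1) * cnj (u * \<i>) - of_real (g \<i>) * cnj u) / of_real (sqrt 2)), 0)
       (of_real G * (of_real (g 1) * (u * \<i>) - of_real (g \<i>) * u) / of_real (sqrt 2), 0)
       (\<i> * of_real (R2 \<i> 1 - R2 1 \<i>), of_real (\<beta> * G) * (of_real (t 1) * (u * \<i>) - of_real (t \<i>) * u))"
    unfolding frechet_derivative_eq[OF dA] qmat_diff G_def[symmetric]
    by (simp add: qmat_eq_iff algebra_simps diff_divide_distrib)
  \<comment> \<open>\<open>1 / sqrt 2\<close> and \<open>cnj u\<close> become indeterminates subject
    to \<open>q * q = 1/2\<close> and \<open>u * \<mu> = 1\<close>, which reduces the entries to
    polynomial identities.\<close>
  define q where "q = complex_of_real (1 / sqrt 2)"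
  have q2: "q * q = 1/2" unfolding q_def of_real_mult[symmetric] by simp
  have dq: "w / complex_of_real (sqrt 2) = w * q" for w by (simp add: q_def)
  define \<mu> where "\<mu> = cnj u"
  have um: "u * \<mu> = 1" using uu by (simp add: \<mu>_def)
  have cq: "cnj q = q" by (simp add: q_def)
  have cmu: "cnj \<mu> = u" by (simp add: \<mu>_def)
  show ?thesis
    unfolding lhs R1 R2 A1 Ai qmat_eq_iff G_def[symmetric]
  proof (intro conjI)
    note unf = mc_matrix_def qmat_mult_nth qmult_def dq sv power2_eq_square prod_eq_iff
    let ?R = "mc_matrix \<alpha> \<beta> ((3 * x1 - x2) / 16) ((x1 - 3 * x2) / 16) (u * complex_of_real G * \<i>)"
    let ?Q = "mc_matrix \<alpha> \<beta> ((y2 - 3 * y1) / 16) ((3 * y2 - y1) / 16) (u * complex_of_real G)"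
    let ?X = "?R \<odot> ?Q - ?Q \<odot> ?R"
    let ?L = "qmat (\<i> * of_real (- (2 * \<alpha>\<^sup>2 - 1) * G\<^sup>2), of_real (\<alpha> * G) * (of_real (s 1) * cnj (u * \<i>) - of_real (s \<i>) * cnj u))
       (- (of_real G * (of_real (g 1) * cnj (u * \<i>) - of_real (g \<i>) * cnj u) / of_real (sqrt 2)), 0)
       (of_real G * (of_real (g 1) * (u * \<i>) - of_real (g \<i>) * u) / of_real (sqrt 2), 0)
       (\<i> * of_real ((2 * \<beta>\<^sup>2 - 1) * G\<^sup>2), of_real (\<beta> * G) * (of_real (t 1) * (u * \<i>) - of_real (t \<i>) * u))"
    show "?L $ 1 $ 1 = ?X $ 1 $ 1"
      apply (simp add: unf cq cmu flip: \<mu>_def)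
      using um q2 apply (simp add: field_simps)
      apply algebra
      done
    show "?L $ 1 $ 2 = ?X $ 1 $ 2"
      apply (simp add: unf cq cmu flip: \<mu>_def)
      using um q2 apply (simp add: field_simps)
      done
    show "?L $ 2 $ 1 = ?X $ 2 $ 1"
      apply (simp add: unf cq cmu flip: \<mu>_def)
      using um q2 apply (simp add: field_simps)
      done
    show "?L $ 2 $ 2 = ?X $ 2 $ 2"
      apply (simp add: unf cq cmu flip: \<mu>_def)
      using um q2 apply (simp add: field_simps)
      apply algebra
      done
  qed
qed

section \<open>Existence of the lift\<close>

text \<open>An oriented Euclidean chart need not belong to the atlas. Its transition map from an
  atlas chart is holomorphic and injective, so the inverse is holomorphic too, and smoothness
  carries over.\<close>

lemma smooth_oriented:
  fixes X :: "'x::t2_space chart set"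
  assumes X: "riemann_surface X" and e: "oriented_euclidean X g e" and F: "smooth_map X UNIV F"
  shows "smooth_on (snd e ` fst e) (\<lambda>q. F (chart_inv e q))"
proof (rule smooth_on_local)
  have ce: "coordinates e" and hol: "\<And>c. c \<in> X \<Longrightarrow> (snd e \<circ> chart_inv c) holomorphic_on (snd c ` (fst c \<inter> fst e))"
    using e by (simp_all add: oriented_euclidean_def euclidean_coordinates_def)
  note ei = coordinates_inverse[OF ce]
  show "open (snd e ` fst e)" using ce by (simp add: coordinates_def)
  fix q assume "q \<in> snd e ` fst e"
  then obtain y where y: "y \<in> fst e" "q = snd e y" by blast
  obtain c where c: "c \<in> X" "y \<in> fst c" using surface_chart_exists[OF X] by blast
  note cc = surface_coordinates[OF X c(1)]
  note ci = coordinates_inverse[OF cc]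
  define T where "T = snd e \<circ> chart_inv c"
  define S where "S = snd c ` (fst c \<inter> fst e)"
  have S: "open S" unfolding S_def using coordinates_open_image[OF cc] ce by (simp add: coordinates_def)
  have T: "T (snd c y') = snd e y'" if "y' \<in> fst c" for y' using ci(1)[OF that] by (simp add: T_def)
  have inj: "inj_on T S"
  proof (rule inj_onI)
    fix p p' assume "p \<in> S" "p' \<in> S" "T p = T p'"
    then obtain a b where ab: "a \<in> fst e" "b \<in> fst e" "p = snd c a" "p' = snd c b" "snd e a = snd e b"
      using T unfolding S_def by fastforce
    have "a = chart_inv e (snd e b)" unfolding ab(5)[symmetric] by (rule ei(1)[OF ab(1), symmetric])
    also have "\<dots> = b" by (rule ei(1)[OF ab(2)])
    finally show "p = p'" unfolding ab(3,4) by simp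
  qed
  have Th: "T holomorphic_on S" unfolding T_def S_def by (rule hol[OF c(1)])
  obtain h where h: "h holomorphic_on (T ` S)" "\<And>z. z \<in> S \<Longrightarrow> h (T z) = z"
    using holomorphic_has_inverse[OF Th S inj] by metis
  have TS: "T ` S = snd e ` (fst e \<inter> fst c)" unfolding S_def image_image using T by (force simp: image_iff)
  have oT: "open (T ` S)" unfolding TS using coordinates_open_image[OF ce] cc by (simp add: coordinates_def)
  have hS: "h r \<in> snd c ` fst c" if "r \<in> T ` S" for r using that h(2) by (auto simp: S_def)
  have "smooth_on (T ` S) (\<lambda>r. F (chart_inv c (h r)))"
    by (rule smooth_on_compose[OF smooth_on_holomorphic[OF oT h(1)] smooth_map_chart[OF F c(1)] hS])
  then have "smooth_on (T ` S) (\<lambda>r. F (chart_inv e r))"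
  proof (rule smooth_on_cong)
    fix r assume "r \<in> T ` S"
    then obtain a where a: "a \<in> fst c" "a \<in> fst e" "r = T (snd c a)" by (auto simp: S_def)
    then have "h r = snd c a" using h(2) by (simp add: S_def)
    moreover have "r = snd e a" using a T by simp
    ultimately show "F (chart_inv c (h r)) = F (chart_inv e r)" using ci(1)[OF a(1)] ei(1)[OF a(2)] by simp
  qed
  moreover have "q \<in> T ` S" unfolding TS using y c by blast
  ultimately show "\<exists>T. q \<in> T \<and> smooth_on T (\<lambda>q. F (chart_inv e q))" by blast
qed

text \<open>One formula for every chart of the atlas, although the Laplace equations are stated in
  Euclidean coordinates only; the conformal invariance of \<open>star_d\<close> reconciles the
  two.\<close>

definition surface_connection ::
    "('x \<Rightarrow> real) \<Rightarrow> ('x \<Rightarrow> real) \<Rightarrow> 'x form \<Rightarrow> 'x chart \<Rightarrow> 'x \<Rightarrow> complex \<Rightarrow> quat^2^2" where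
  "surface_connection \<alpha>m \<alpha>p \<omega> c x v = curve_connection (\<lambda>p. ln ((\<alpha>m (chart_inv c p))\<^sup>2))
     (\<lambda>p. ln ((\<alpha>p (chart_inv c p))\<^sup>2)) (snd c x) (\<omega> c x 1) v"

definition parallel_frame ::
    "'x::t2_space chart set \<Rightarrow> ('x \<Rightarrow> real) \<Rightarrow> ('x \<Rightarrow> real) \<Rightarrow> 'x form \<Rightarrow> 'x set \<Rightarrow> ('x \<Rightarrow> quat^2^2) \<Rightarrow> bool" where
  "parallel_frame X \<alpha>m \<alpha>p \<omega> U F \<longleftrightarrow> open U \<and> (\<forall>x\<in>U. F x \<in> Sp2) \<and>
     (\<forall>c\<in>X. \<forall>x\<in>fst c \<inter> U. ((F \<circ> chart_inv c) has_derivative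
        (\<lambda>v. F x \<odot> surface_connection \<alpha>m \<alpha>p \<omega> c x v)) (at (snd c x)))"

text \<open>For skew N the derivative of \<open>F p \<odot> qadjoint (G p)\<close> vanishes.\<close>

lemma Sp2_ratio_constant:
  fixes F G :: "complex \<Rightarrow> quat^2^2"
  assumes S: "open S" "connected S"
    and F: "\<And>p. p \<in> S \<Longrightarrow> (F has_derivative (\<lambda>v. F p \<odot> N p v)) (at p)"
    and G: "\<And>p. p \<in> S \<Longrightarrow> (G has_derivative (\<lambda>v. G p \<odot> N p v)) (at p)" "\<And>p. p \<in> S \<Longrightarrow> G p \<in> Sp2"
    and N: "\<And>p v. p \<in> S \<Longrightarrow> qadjoint (N p v) = - N p v"
  shows "\<exists>C. \<forall>p\<in>S. F p = C \<odot> G p"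
proof -
  have d: "((\<lambda>p. F p \<odot> qadjoint (G p)) has_derivative (\<lambda>v. 0)) (at p within S)" if p: "p \<in> S" for p
  proof -
    have "((\<lambda>p. F p \<odot> qadjoint (G p)) has_derivative
        (\<lambda>v. F p \<odot> qadjoint (G p \<odot> N p v) + (F p \<odot> N p v) \<odot> qadjoint (G p))) (at p)"
      by (rule qmat_mult.FDERIV[OF F[OF p] bounded_linear.has_derivative[OF bounded_linear_qadjoint G(1)[OF p]]])
    moreover have "F p \<odot> qadjoint (G p \<odot> N p v) + (F p \<odot> N p v) \<odot> qadjoint (G p) = 0" for v
      by (simp add: qadjoint_mult N[OF p] qmat_mult.minus_left qmat_mult.minus_right qmat_mult_assoc)
    ultimately show ?thesis by (simp add: has_derivative_at_withinI)
  qed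
  have "(\<lambda>p. F p \<odot> qadjoint (G p)) constant_on S"
    by (rule has_derivative_zero_connected_constant_on[OF S(2,1) finite.emptyI has_derivative_continuous_on[OF d]])
      (use d in auto)
  then obtain C where "\<And>p. p \<in> S \<Longrightarrow> F p \<odot> qadjoint (G p) = C" by (auto simp: constant_on_def)
  then show ?thesis using Sp2_cancel(4)[OF G(2)] by metis
qed

lemma qadjoint_surface_connection:
  "qadjoint (surface_connection \<alpha>m \<alpha>p \<omega> c x v) = - surface_connection \<alpha>m \<alpha>p \<omega> c x v"
  by (simp add: surface_connection_def qadjoint_curve_connection)

lemma parallel_frame_ratio:
  fixes X :: "'x::t2_space chart set"
  assumes X: "riemann_surface X"
    and F: "parallel_frame X \<alpha>m \<alpha>p \<omega> U F" "parallel_frame X \<alpha>m \<alpha>p \<omega> V G" and x: "x \<in> U" "x \<in> V"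
  shows "\<exists>W C. open W \<and> x \<in> W \<and> W \<subseteq> U \<inter> V \<and> (\<forall>y\<in>W. F y = C \<odot> G y)"
proof -
  obtain c where c: "c \<in> X" "x \<in> fst c" using surface_chart_exists[OF X] by blast
  note cc = surface_coordinates[OF X c(1)]
  note ci = coordinates_inverse[OF cc]
  let ?S = "snd c ` (fst c \<inter> (U \<inter> V))"
  have "open (U \<inter> V)" using F by (auto simp: parallel_frame_def)
  then have "open ?S" by (rule coordinates_open_image[OF cc])
  moreover have "snd c x \<in> ?S" using x c by auto
  ultimately obtain r where r: "r > 0" "ball (snd c x) r \<subseteq> ?S" by (meson openE)
  let ?B = "ball (snd c x) r"
  have mem: "chart_inv c p \<in> fst c \<inter> (U \<inter> V)" "snd c (chart_inv c p) = p" if "p \<in> ?B" for p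
    using that r(2) coordinates_image[OF cc] ci(2,3) by auto
  have "\<exists>C. \<forall>p\<in>?B. (F \<circ> chart_inv c) p = C \<odot> (G \<circ> chart_inv c) p"
  proof (rule Sp2_ratio_constant[where N = "\<lambda>p. surface_connection \<alpha>m \<alpha>p \<omega> c (chart_inv c p)"])
    fix p assume p: "p \<in> ?B"
    let ?y = "chart_inv c p"
    have y: "?y \<in> fst c \<inter> U" "?y \<in> fst c \<inter> V" using mem(1)[OF p] by auto
    have "((F \<circ> chart_inv c) has_derivative (\<lambda>v. F ?y \<odot> surface_connection \<alpha>m \<alpha>p \<omega> c ?y v)) (at (snd c ?y))"
      using F(1) c(1) y(1) unfolding parallel_frame_def by blast
    then show "((F \<circ> chart_inv c) has_derivative (\<lambda>v. (F \<circ> chart_inv c) p \<odot> surface_connection \<alpha>m \<alpha>p \<omega> c ?y v)) (at p)"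
      by (simp add: mem(2)[OF p])
    have "((G \<circ> chart_inv c) has_derivative (\<lambda>v. G ?y \<odot> surface_connection \<alpha>m \<alpha>p \<omega> c ?y v)) (at (snd c ?y))"
      using F(2) c(1) y(2) unfolding parallel_frame_def by blast
    then show "((G \<circ> chart_inv c) has_derivative (\<lambda>v. (G \<circ> chart_inv c) p \<odot> surface_connection \<alpha>m \<alpha>p \<omega> c ?y v)) (at p)"
      by (simp add: mem(2)[OF p])
    show "(G \<circ> chart_inv c) p \<in> Sp2" using F(2) y(2) by (simp add: parallel_frame_def)
  qed (simp_all add: qadjoint_surface_connection)
  then obtain C where C: "\<And>p. p \<in> ?B \<Longrightarrow> F (chart_inv c p) = C \<odot> G (chart_inv c p)" by auto
  define W where "W = {y \<in> fst c. snd c y \<in> ?B}"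
  have eq: "chart_inv c (snd c y) = y" if "y \<in> W" for y using that ci by (simp add: W_def)
  show ?thesis
  proof (intro exI conjI)
    show "open W" unfolding W_def by (rule coordinates_open_preimage[OF cc open_ball])
    show "x \<in> W" using c r(1) by (simp add: W_def)
    show "W \<subseteq> U \<inter> V" using mem(1) eq by (fastforce simp: W_def)
    show "\<forall>y\<in>W. F y = C \<odot> G y" using C eq by (fastforce simp: W_def)
  qed
qed

lemma smooth_on_ln_sq:
  fixes \<alpha> :: "'a::real_normed_vector \<Rightarrow> real"
  assumes "smooth_on S \<alpha>" "\<And>p. p \<in> S \<Longrightarrow> \<alpha> p > 0"
  shows "smooth_on S (\<lambda>p. ln ((\<alpha> p)\<^sup>2))"
  unfolding power2_eq_square
  by (rule smooth_on_compose[OF smooth_on_mult[OF assms(1) assms(1)] smooth_on_ln]) (use assms(2) in auto)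

lemma parallel_frame_mult:
  assumes F: "parallel_frame X \<alpha>m \<alpha>p \<omega> U F" and B: "B \<in> Sp2"
  shows "parallel_frame X \<alpha>m \<alpha>p \<omega> U (\<lambda>x. B \<odot> F x)"
  unfolding parallel_frame_def
proof (intro conjI ballI)
  show "open U" using F by (simp add: parallel_frame_def)
  show "B \<odot> F x \<in> Sp2" if "x \<in> U" for x using F B that Sp2_mult by (simp add: parallel_frame_def)
  fix c x assume "c \<in> X" "x \<in> fst c \<inter> U"
  then have "((F \<circ> chart_inv c) has_derivative (\<lambda>v. F x \<odot> surface_connection \<alpha>m \<alpha>p \<omega> c x v)) (at (snd c x))"
    using F unfolding parallel_frame_def by blast
  from bounded_linear.has_derivative[OF qmat_mult.bounded_linear_right this, of B]
  show "((\<lambda>x. B \<odot> F x) \<circ> chart_inv c has_derivative (\<lambda>v. B \<odot> F x \<odot> surface_connection \<alpha>m \<alpha>p \<omega> c x v)) (at (snd c x))"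
    by (simp add: o_def qmat_mult_assoc)
qed

lemma has_laplacianD:
  "has_laplacian X g f h \<Longrightarrow> euclidean_coordinates X g e \<Longrightarrow> y \<in> fst e \<Longrightarrow>
    laplacian (f \<circ> chart_inv e) (snd e y) = h y"
  unfolding has_laplacian_def by blast

text \<open>In oriented Euclidean coordinates the form is \<open>u * \<gamma> dz\<close> with a
  constant unit u, and \<open>curve_connection_flat\<close> provides the hypothesis of
  \<open>frobenius_plane\<close>. The solution is carried to the charts of the atlas by the chain
  rule.\<close>

lemma parallel_frame_local:
  fixes X :: "'x::t2_space chart set"
  assumes X: "riemann_surface X" and g: "compatible_metric X g0" "flat_metric X g0"
    and sm: "smooth_map X UNIV \<alpha>m" "smooth_map X UNIV \<alpha>p"
    and pos: "\<And>x. \<alpha>m x > 0" "\<And>x. \<alpha>p x > 0"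
    and lap: "has_laplacian X g0 (\<lambda>x. ln ((\<alpha>m x)\<^sup>2))
           (\<lambda>x. - 4 * (3 * (\<alpha>m x)\<^sup>2 + (\<alpha>p x)\<^sup>2 - 2) * (gamma_fun \<alpha>m \<alpha>p x)\<^sup>2)"
      "has_laplacian X g0 (\<lambda>x. ln ((\<alpha>p x)\<^sup>2))
           (\<lambda>x. - 4 * (3 * (\<alpha>p x)\<^sup>2 + (\<alpha>m x)\<^sup>2 - 2) * (gamma_fun \<alpha>m \<alpha>p x)\<^sup>2)"
    and f: "parallel_form X g0 UNIV f"
    and \<omega>: "\<And>c x v. c \<in> X \<Longrightarrow> x \<in> fst c \<Longrightarrow> \<omega> c x v = complex_of_real (gamma_fun \<alpha>m \<alpha>p x) * f x c * v"
  shows "\<exists>W F. x0 \<in> W \<and> path_connected W \<and> parallel_frame X \<alpha>m \<alpha>p \<omega> W F"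
proof -
  let ?\<gamma> = "gamma_fun \<alpha>m \<alpha>p"
  obtain e r where e: "oriented_euclidean X g0 e" "x0 \<in> fst e" and r: "r > 0" "snd e ` fst e = ball (snd e x0) r"
    using oriented_euclidean_exists[OF X g open_UNIV UNIV_I] by blast
  have ee: "euclidean_coordinates X g0 e" and ce: "coordinates e"
    and hol: "\<And>c. c \<in> X \<Longrightarrow> (snd e \<circ> chart_inv c) holomorphic_on (snd c ` (fst c \<inter> fst e))"
    using e by (simp_all add: oriented_euclidean_def euclidean_coordinates_def)
  note ei = coordinates_inverse[OF ce]
  have oe: "open (fst e)" using ce by (simp add: coordinates_def)
  have he: "homeomorphism (fst e) (snd e ` fst e) (snd e) (chart_inv e)" using ce by (simp add: coordinates_def)
  define fe where "fe = (\<lambda>x c. if c \<in> X \<and> x \<in> fst c then deriv (snd e \<circ> chart_inv c) (snd c x) else 0)"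
  have fe: "parallel_form X g0 (fst e) fe" unfolding fe_def by (rule parallel_form_euclidean[OF X e(1)])
  have fe': "parallel_form X g0 (fst e) f"
    unfolding parallel_form_def
  proof (intro conjI ballI oe)
    show "f x \<in> parallel_at X g0 x" for x using f by (simp add: parallel_form_def)
    show "(\<lambda>p. f (chart_inv c p) c) holomorphic_on snd c ` (fst c \<inter> fst e)" if "c \<in> X" for c
      by (rule holomorphic_on_subset[of _ "snd c ` (fst c \<inter> UNIV)"]) (use f that in \<open>auto simp: parallel_form_def\<close>)
  qed
  have "fst e = chart_inv e ` (ball (snd e x0) r)" "continuous_on (ball (snd e x0) r) (chart_inv e)"
    using he r(2) by (auto simp: homeomorphism_def)
  then have "connected (fst e)" using connected_continuous_image connected_ball by metis
  \<comment> \<open>On this domain the global parallel form is a constant multiple of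
    \<open>dz\<close>; the constant enters the connection below.\<close>
  then obtain u where u: "cmod u = 1" "\<And>x c. x \<in> fst e \<Longrightarrow> f x c = u * fe x c"
    using parallel_form_global_ratio[OF X g(1) _ fe fe'] by blast
  define S where "S = snd e ` fst e"
  have S: "open S" using ce by (simp add: S_def coordinates_def)
  define L1 where "L1 q = ln ((\<alpha>m (chart_inv e q))\<^sup>2)" for q
  define L2 where "L2 q = ln ((\<alpha>p (chart_inv e q))\<^sup>2)" for q
  have L: "smooth_on S L1" "smooth_on S L2"
    unfolding L1_def[abs_def] L2_def[abs_def] S_def
    by (intro smooth_on_ln_sq smooth_oriented[OF X e(1) sm(1)] smooth_oriented[OF X e(1) sm(2)] pos)+
  have exps: "exp (L1 q / 2) = \<alpha>m (chart_inv e q)" "exp (L2 q / 2) = \<alpha>p (chart_inv e q)"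
    "exp (- (L1 q + L2 q) / 8) = ?\<gamma> (chart_inv e q)" for q
  proof -
    have l: "L1 q = 2 * ln (\<alpha>m (chart_inv e q))" "L2 q = 2 * ln (\<alpha>p (chart_inv e q))"
      using pos[of "chart_inv e q"] by (simp_all add: L1_def L2_def ln_realpow)
    show "exp (L1 q / 2) = \<alpha>m (chart_inv e q)" "exp (L2 q / 2) = \<alpha>p (chart_inv e q)"
      using pos[of "chart_inv e q"] by (simp_all add: l)
    show "exp (- (L1 q + L2 q) / 8) = ?\<gamma> (chart_inv e q)"
      using pos[of "chart_inv e q"] by (simp add: l gamma_fun_def powr_def ln_mult) (simp add: field_simps)
  qed
  define A where "A q = curve_connection L1 L2 q (u * of_real (exp (- (L1 q + L2 q) / 8)))" for q
  have smw: "smooth_on S (\<lambda>q. u * of_real (exp (- (L1 q + L2 q) / 8)))"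
  proof -
    have "smooth_on S (\<lambda>q. exp ((L1 q + L2 q) * (- 1/8)))"
      by (rule smooth_on_compose[OF smooth_on_real_scale[OF smooth_on_add[OF L]] smooth_on_exp]) simp
    moreover have "x * (- 1/8) = - x / 8" for x :: real by simp
    ultimately have "smooth_on S (\<lambda>q. exp (- (L1 q + L2 q) / 8))" by (simp only:)
    then show ?thesis by (intro smooth_on_mult smooth_on_of_real smooth_on_const S)
  qed
  have "\<exists>W \<Phi>. open W \<and> snd e x0 \<in> W \<and> W \<subseteq> S \<and> convex W \<and>
    (\<forall>z\<in>W. \<Phi> z \<in> Sp2 \<and> (\<Phi> has_derivative (\<lambda>v. \<Phi> z \<odot> A z v)) (at z))"
  proof (rule frobenius_plane[OF S])
    show "snd e x0 \<in> S" using e(2) by (simp add: S_def)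
    show "smooth_on S (\<lambda>z. A z 1)" "smooth_on S (\<lambda>z. A z \<i>)"
      unfolding A_def by (intro smooth_on_curve_connection L smw)+
    fix z assume z: "z \<in> S"
    show "linear (A z)" unfolding A_def by (rule linear_curve_connection)
    show "qadjoint (A z v) = - A z v" for v unfolding A_def by (rule qadjoint_curve_connection)
    obtain y where y: "y \<in> fst e" "z = snd e y" using z by (auto simp: S_def)
    have yi: "chart_inv e z = y" using y ei by simp
    have "laplacian L1 z = - 4 * (3 * (\<alpha>m y)\<^sup>2 + (\<alpha>p y)\<^sup>2 - 2) * (?\<gamma> y)\<^sup>2"
      using has_laplacianD[OF lap(1) ee y(1)] unfolding y(2) L1_def[abs_def] o_def .
    moreover have "laplacian L2 z = - 4 * (3 * (\<alpha>p y)\<^sup>2 + (\<alpha>m y)\<^sup>2 - 2) * (?\<gamma> y)\<^sup>2"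
      using has_laplacianD[OF lap(2) ee y(1)] unfolding y(2) L2_def[abs_def] o_def .
    ultimately show "frechet_derivative (\<lambda>z. A z \<i>) (at z) 1 - frechet_derivative (\<lambda>z. A z 1) (at z) \<i> =
        A z \<i> \<odot> A z 1 - A z 1 \<odot> A z \<i>"
      unfolding A_def by (intro curve_connection_flat[OF L z u(1)]) (simp_all only: exps yi)
  qed
  then obtain W0 \<Psi> where W0: "open W0" "snd e x0 \<in> W0" "W0 \<subseteq> S" "convex W0"
    and \<Psi>: "\<And>z. z \<in> W0 \<Longrightarrow> \<Psi> z \<in> Sp2" "\<And>z. z \<in> W0 \<Longrightarrow> (\<Psi> has_derivative (\<lambda>v. \<Psi> z \<odot> A z v)) (at z)"
    by blast
  define W where "W = {y \<in> fst e. snd e y \<in> W0}"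
  define F where "F y = \<Psi> (snd e y)" for y
  have oW: "open W" unfolding W_def by (rule coordinates_open_preimage[OF ce W0(1)])
  have "W = chart_inv e ` W0"
    using W0(3) ei unfolding W_def S_def by force
  moreover have "continuous_on W0 (chart_inv e)"
    using he W0(3) by (auto simp: homeomorphism_def S_def elim: continuous_on_subset)
  ultimately have "path_connected W"
    using path_connected_continuous_image convex_imp_path_connected[OF W0(4)] by metis
  moreover have "x0 \<in> W" using e(2) W0(2) by (simp add: W_def)
  moreover have "parallel_frame X \<alpha>m \<alpha>p \<omega> W F"
    unfolding parallel_frame_def
  proof (intro conjI ballI oW)
    show "F y \<in> Sp2" if "y \<in> W" for y using that \<Psi>(1) by (simp add: F_def W_def)
    fix c y assume c: "c \<in> X" and y: "y \<in> fst c \<inter> W"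
    note cc = surface_coordinates[OF X c]
    note ci = coordinates_inverse[OF cc]
    define T where "T = snd e \<circ> chart_inv c"
    define t where "t = deriv T (snd c y)"
    have ye: "y \<in> fst e" "y \<in> fst c" "snd e y \<in> W0" using y by (auto simp: W_def)
    have Ty: "T (snd c y) = snd e y" using ci ye by (simp add: T_def)
    have dT: "(T has_derivative (\<lambda>v. t * v)) (at (snd c y))"
      unfolding T_def t_def by (rule chart_deriv_holomorphic(2)[OF cc oe _ hol[OF c]]) (use ye in auto)
    let ?S = "snd c ` (fst c \<inter> W)"
    have S': "open ?S" "snd c y \<in> ?S" using coordinates_open_image[OF cc oW] y by auto
    have Teq: "T p = snd e (chart_inv c p)" "chart_inv e (T p) = chart_inv c p" if "p \<in> ?S" for p
      using that ci ei by (auto simp: T_def W_def)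
    have "((\<lambda>p. \<Psi> (T p)) has_derivative (\<lambda>v. \<Psi> (T (snd c y)) \<odot> A (T (snd c y)) (t * v))) (at (snd c y))"
      by (rule has_derivative_compose[OF dT]) (use \<Psi>(2) ye Ty in simp)
    then have "((F \<circ> chart_inv c) has_derivative (\<lambda>v. F y \<odot> A (snd e y) (t * v))) (at (snd c y))"
      unfolding Ty F_def[symmetric]
      by (rule has_derivative_transform_within_open[OF _ S']) (simp add: Teq F_def)
    \<comment> \<open>The Hodge duals and the coefficient of \<omega> both transform by t, the
      derivative of the transition map.\<close>
    moreover have "A (snd e y) (t * v) = surface_connection \<alpha>m \<alpha>p \<omega> c y v" for v
    proof -
      have st: "star_d (\<lambda>p. l (chart_inv c p)) (snd c y) v = star_d (\<lambda>q. l (chart_inv e q)) (snd e y) (t * v)"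
        if l: "smooth_on S (\<lambda>q. l (chart_inv e q))" for l :: "'x \<Rightarrow> real"
      proof -
        have d: "((\<lambda>q. l (chart_inv e q)) has_derivative frechet_derivative (\<lambda>q. l (chart_inv e q)) (at (snd e y))) (at (T (snd c y)))"
          unfolding Ty using smooth_on_has_derivative[OF l] ye by (simp add: S_def)
        have "(T has_field_derivative t) (at (snd c y))" using dT by (simp add: has_field_derivative_def)
        from star_d_holomorphic[OF d this]
        have "star_d (\<lambda>p. l (chart_inv e (T p))) (snd c y) v = star_d (\<lambda>q. l (chart_inv e q)) (snd e y) (t * v)"
          by (simp add: Ty)
        moreover have "frechet_derivative (\<lambda>p. l (chart_inv c p)) (at (snd c y)) w = frechet_derivative (\<lambda>p. l (chart_inv e (T p))) (at (snd c y)) w" for w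
        proof (rule frechet_derivative_eq)
          have "((\<lambda>p. l (chart_inv e (T p))) has_derivative (\<lambda>v. frechet_derivative (\<lambda>q. l (chart_inv e q)) (at (snd e y)) (t * v))) (at (snd c y))"
            by (rule has_derivative_compose[OF dT d])
          then have "((\<lambda>p. l (chart_inv e (T p))) has_derivative frechet_derivative (\<lambda>p. l (chart_inv e (T p))) (at (snd c y))) (at (snd c y))"
            using frechet_derivative_works differentiable_def by blast
          then show "((\<lambda>p. l (chart_inv c p)) has_derivative frechet_derivative (\<lambda>p. l (chart_inv e (T p))) (at (snd c y))) (at (snd c y))"
            by (rule has_derivative_transform_within_open[OF _ S']) (simp add: Teq(2))
        qed
        ultimately show ?thesis by (simp add: star_d_def)
      qed
      have st1: "star_d (\<lambda>p. ln ((\<alpha>m (chart_inv c p))\<^sup>2)) (snd c y) v = star_d L1 (snd e y) (t * v)"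
        using st[of "\<lambda>x. ln ((\<alpha>m x)\<^sup>2)"] L(1) by (simp add: L1_def[abs_def])
      have st2: "star_d (\<lambda>p. ln ((\<alpha>p (chart_inv c p))\<^sup>2)) (snd c y) v = star_d L2 (snd e y) (t * v)"
        using st[of "\<lambda>x. ln ((\<alpha>p x)\<^sup>2)"] L(2) by (simp add: L2_def[abs_def])
      have lv: "ln ((\<alpha>m (chart_inv c (snd c y)))\<^sup>2) = L1 (snd e y)" "ln ((\<alpha>p (chart_inv c (snd c y)))\<^sup>2) = L2 (snd e y)"
        using ci ei ye by (simp_all add: L1_def L2_def)
      have fy: "f y c = u * t" using u(2)[OF ye(1), of c] c ye(2) by (simp add: fe_def t_def T_def)
      have wv: "\<omega> c y 1 * v = u * of_real (exp (- (L1 (snd e y) + L2 (snd e y)) / 8)) * (t * v)"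
        unfolding \<omega>[OF c ye(2)] exps fy using ei ye by simp
      show ?thesis
        unfolding A_def surface_connection_def curve_connection_def st1 st2 lv wv ..
    qed
    ultimately show "((F \<circ> chart_inv c) has_derivative (\<lambda>v. F y \<odot> surface_connection \<alpha>m \<alpha>p \<omega> c y v)) (at (snd c y))"
      by simp
  qed
  ultimately show ?thesis by blast
qed

text \<open>Bootstrapping: if f is of class k, so is the right side of its equation, and f is of
  class k + 1.\<close>

lemma smooth_on_linear_ode:
  assumes S: "open S" and f: "\<And>p. p \<in> S \<Longrightarrow> (f has_derivative (\<lambda>v. f p \<odot> N p v)) (at p)"
    and N: "\<And>v. smooth_on S (\<lambda>p. N p v)"
  shows "smooth_on S f"
proof -
  have "Ck_on k S f" for k
  proof (induction k)
    case 0
    show ?case using f by (auto intro!: continuous_at_imp_continuous_on has_derivative_continuous)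
  next
    case (Suc k)
    have "Ck_on k S (\<lambda>p. f p \<odot> N p v)" for v
      by (rule Ck_on_bounded_bilinear[OF S bounded_bilinear_qmat_mult Suc]) (use N in \<open>simp add: smooth_on_def\<close>)
    then show ?case by (intro Ck_onI[OF S f]) auto
  qed
  with S show ?thesis by (simp add: smooth_on_def)
qed

text \<open>Frames with arbitrary values in \<open>Sp2\<close> form a locally constant sheaf, so a
  global frame exists. The curve is the image of the base point under the frame, and its properties
  are read off from the Maurer-Cartan form of the frame.\<close>

lemma curve_exists:
  fixes X :: "'x::t2_space chart set"
  assumes X: "riemann_surface X" and sc: "simply_connected (UNIV :: 'x set)"
    and g: "compatible_metric X g0" "flat_metric X g0"
    and sm: "smooth_map X UNIV \<alpha>m" "smooth_map X UNIV \<alpha>p"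
    and pos: "\<And>x. \<alpha>m x > 0" "\<And>x. \<alpha>p x > 0"
    and lap: "has_laplacian X g0 (\<lambda>x. ln ((\<alpha>m x)\<^sup>2))
           (\<lambda>x. - 4 * (3 * (\<alpha>m x)\<^sup>2 + (\<alpha>p x)\<^sup>2 - 2) * (gamma_fun \<alpha>m \<alpha>p x)\<^sup>2)"
      "has_laplacian X g0 (\<lambda>x. ln ((\<alpha>p x)\<^sup>2))
           (\<lambda>x. - 4 * (3 * (\<alpha>p x)\<^sup>2 + (\<alpha>m x)\<^sup>2 - 2) * (gamma_fun \<alpha>m \<alpha>p x)\<^sup>2)"
    and ad: "admissible_form X g0 \<alpha>m \<alpha>p 1 \<omega>"
  shows "\<exists>\<phi>. transverse_immersion X \<alpha>m \<alpha>p \<phi> \<and> has_scale X g0 \<alpha>m \<alpha>p \<phi> 1 \<and> associated_form X \<alpha>m \<alpha>p \<phi> \<omega>"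
proof -
  let ?\<gamma> = "gamma_fun \<alpha>m \<alpha>p"
  obtain f where f: "parallel_form X g0 UNIV f"
    and "\<forall>c\<in>X. \<forall>x\<in>fst c. \<forall>v. \<omega> c x v = complex_of_real (1 * ?\<gamma> x) * f x c * v"
    using admissible_iff_parallel[OF X g(1) sm pos zero_less_one] ad by blast
  then have \<omega>: "\<omega> c x v = complex_of_real (?\<gamma> x) * f x c * v" if "c \<in> X" "x \<in> fst c" for c x v
    using that by simp
  have local: "\<exists>W F. x \<in> W \<and> path_connected W \<and> parallel_frame X \<alpha>m \<alpha>p \<omega> W F" for x
    by (rule parallel_frame_local[OF X g sm pos lap f \<omega>])
  interpret local_system "parallel_frame X \<alpha>m \<alpha>p \<omega>" "\<lambda>_. Sp2"
  proof
    show "open U" if "parallel_frame X \<alpha>m \<alpha>p \<omega> U F" for U F using that by (simp add: parallel_frame_def)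
    show "F x \<in> Sp2" if "parallel_frame X \<alpha>m \<alpha>p \<omega> U F" "x \<in> U" for U F x
      using that by (simp add: parallel_frame_def)
  next
    fix x
    obtain W F where W: "x \<in> W" "path_connected W" "parallel_frame X \<alpha>m \<alpha>p \<omega> W F" using local by blast
    have FS: "F y \<in> Sp2" if "y \<in> W" for y using W(3) that by (simp add: parallel_frame_def)
    \<comment> \<open>Left multiplication by constants in \<open>Sp2\<close> preserves solutions and
      acts transitively on initial values.\<close>
    have "\<exists>G. parallel_frame X \<alpha>m \<alpha>p \<omega> W G \<and> G y = b" if "y \<in> W" "b \<in> Sp2" for y b
      using parallel_frame_mult[OF W(3) Sp2_mult[OF that(2) Sp2_qadjoint[OF FS[OF that(1)]]]]
        Sp2_cancel(4)[OF FS[OF that(1)]]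
      by (intro exI[of _ "\<lambda>x. (b \<odot> qadjoint (F y)) \<odot> F x"]) simp
    with W show "\<exists>W. open W \<and> x \<in> W \<and> path_connected W \<and>
        (\<forall>y\<in>W. \<forall>b\<in>Sp2. \<exists>G. parallel_frame X \<alpha>m \<alpha>p \<omega> W G \<and> G y = b)"
      by (intro exI[of _ W]) (auto simp: parallel_frame_def)
  next
    fix U F V G x assume F: "parallel_frame X \<alpha>m \<alpha>p \<omega> U F" "parallel_frame X \<alpha>m \<alpha>p \<omega> V G" and x: "x \<in> U" "x \<in> V"
    obtain W C where W: "open W" "x \<in> W" "W \<subseteq> U \<inter> V" "\<And>y. y \<in> W \<Longrightarrow> F y = C \<odot> G y"
      using parallel_frame_ratio[OF X F x] by blast
    \<comment> \<open>Solutions differ locally by a constant left factor C, so a coincidence at one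
      point makes C the identity and gives agreement on all of W.\<close>
    have "F y = G y \<longleftrightarrow> C = qid" if y: "y \<in> W" for y
    proof
      have GS: "G y \<in> Sp2" using F(2) y W(3) by (auto simp: parallel_frame_def)
      assume "F y = G y"
      then have "C \<odot> G y \<odot> qadjoint (G y) = G y \<odot> qadjoint (G y)" using W(4)[OF y] by simp
      then show "C = qid" using Sp2_cancel(3)[OF GS] Sp2_right[OF GS] by simp
    qed (use W(4)[OF y] in simp)
    then show "\<exists>W. open W \<and> x \<in> W \<and> ((\<forall>y\<in>W. F y = G y) \<or> (\<forall>y\<in>W. F y \<noteq> G y))"
      using W(1,2) by blast
  qed
  fix x0 :: 'x
  obtain \<Phi> where "\<forall>x. \<exists>U F. parallel_frame X \<alpha>m \<alpha>p \<omega> U F \<and> x \<in> U \<and> (\<forall>y\<in>U. \<Phi> y = F y)"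
    using global_solution[OF sc qid_Sp2, of x0] by (elim exE conjE)
  then have \<Phi>: "\<And>x. \<exists>U F. parallel_frame X \<alpha>m \<alpha>p \<omega> U F \<and> x \<in> U \<and> (\<forall>y\<in>U. \<Phi> y = F y)"
    by blast
  have S\<Phi>: "\<Phi> x \<in> Sp2" for x using \<Phi>[of x] by (auto simp: parallel_frame_def)
  have d\<Phi>: "((\<Phi> \<circ> chart_inv c) has_derivative (\<lambda>v. \<Phi> x \<odot> surface_connection \<alpha>m \<alpha>p \<omega> c x v)) (at (snd c x))"
    if c: "c \<in> X" "x \<in> fst c" for c x
  proof -
    note cc = surface_coordinates[OF X c(1)]
    note ci = coordinates_inverse[OF cc]
    obtain U F where U: "parallel_frame X \<alpha>m \<alpha>p \<omega> U F" "x \<in> U" "\<And>y. y \<in> U \<Longrightarrow> \<Phi> y = F y" using \<Phi> by blast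
    have "((F \<circ> chart_inv c) has_derivative (\<lambda>v. F x \<odot> surface_connection \<alpha>m \<alpha>p \<omega> c x v)) (at (snd c x))"
      using U(1,2) c unfolding parallel_frame_def by blast
    then have "((\<Phi> \<circ> chart_inv c) has_derivative (\<lambda>v. F x \<odot> surface_connection \<alpha>m \<alpha>p \<omega> c x v)) (at (snd c x))"
    proof (rule has_derivative_transform_within_open)
      show "open (snd c ` (fst c \<inter> U))" using U(1) coordinates_open_image[OF cc] by (simp add: parallel_frame_def)
      show "snd c x \<in> snd c ` (fst c \<inter> U)" using c U(2) by blast
      show "(F \<circ> chart_inv c) p = (\<Phi> \<circ> chart_inv c) p" if "p \<in> snd c ` (fst c \<inter> U)" for p
        using that U(3) ci by auto
    qed
    then show ?thesis using U(2,3) by simp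
  qed
  have sm\<Phi>: "smooth_map X UNIV \<Phi>"
    unfolding smooth_map_def
  proof (intro conjI ballI open_UNIV)
    fix c assume c: "c \<in> X"
    note cc = surface_coordinates[OF X c]
    note ci = coordinates_inverse[OF cc]
    let ?S = "snd c ` fst c"
    have S: "open ?S" using cc by (simp add: coordinates_def)
    have "smooth_on ?S (\<Phi> \<circ> chart_inv c)"
    proof (rule smooth_on_linear_ode[OF S, where N = "\<lambda>p. surface_connection \<alpha>m \<alpha>p \<omega> c (chart_inv c p)"])
      fix p assume p: "p \<in> ?S"
      show "((\<Phi> \<circ> chart_inv c) has_derivative (\<lambda>v. (\<Phi> \<circ> chart_inv c) p \<odot> surface_connection \<alpha>m \<alpha>p \<omega> c (chart_inv c p) v)) (at p)"
        using d\<Phi>[OF c ci(3)[OF p]] by (simp add: ci(2)[OF p])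
    next
      fix v
      have "smooth_on ?S (\<lambda>p. \<omega> c (chart_inv c p) 1)"
        using ad c unfolding admissible_form_def smooth_form_def by blast
      then have "smooth_on ?S (\<lambda>p. curve_connection (\<lambda>p. ln ((\<alpha>m (chart_inv c p))\<^sup>2)) (\<lambda>p. ln ((\<alpha>p (chart_inv c p))\<^sup>2)) p (\<omega> c (chart_inv c p) 1) v)"
        by (intro smooth_on_curve_connection smooth_on_ln_sq smooth_map_chart[OF sm(1) c] smooth_map_chart[OF sm(2) c] pos)
      then show "smooth_on ?S (\<lambda>p. surface_connection \<alpha>m \<alpha>p \<omega> c (chart_inv c p) v)"
        by (rule smooth_on_cong) (simp add: surface_connection_def ci(2))
    qed
    then show "smooth_on (snd c ` (fst c \<inter> UNIV)) (\<Phi> \<circ> chart_inv c)" by simp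
  qed
  define \<phi> where "\<phi> x = sp2_act (\<Phi> x) base_point" for x
  have lift: "sp2_lift X \<phi> UNIV \<Phi>" using sm\<Phi> S\<Phi> by (simp add: sp2_lift_def \<phi>_def)
  \<comment> \<open>The Maurer-Cartan form of the frame is the prescribed connection, so the forms
    of the lift are its entries.\<close>
  have mc: "maurer_cartan (\<Phi> x) (chart_deriv c \<Phi> x v) =
      mc_matrix (\<alpha>m x) (\<alpha>p x)
        ((3 * star_d (\<lambda>p. ln ((\<alpha>m (chart_inv c p))\<^sup>2)) (snd c x) v - star_d (\<lambda>p. ln ((\<alpha>p (chart_inv c p))\<^sup>2)) (snd c x) v) / 16)
        ((star_d (\<lambda>p. ln ((\<alpha>m (chart_inv c p))\<^sup>2)) (snd c x) v - 3 * star_d (\<lambda>p. ln ((\<alpha>p (chart_inv c p))\<^sup>2)) (snd c x) v) / 16)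
        (\<omega> c x v)" if c: "c \<in> X" "x \<in> fst c" for c x v
  proof -
    note ci = coordinates_inverse[OF surface_coordinates[OF X c(1)]]
    have "chart_deriv c \<Phi> x v = \<Phi> x \<odot> surface_connection \<alpha>m \<alpha>p \<omega> c x v"
      unfolding chart_deriv_def by (rule frechet_derivative_eq[OF d\<Phi>[OF c]])
    then have "maurer_cartan (\<Phi> x) (chart_deriv c \<Phi> x v) = surface_connection \<alpha>m \<alpha>p \<omega> c x v"
      by (simp add: maurer_cartan_def Sp2_cancel[OF S\<Phi>])
    moreover have "exp (ln (a\<^sup>2) / 2) = a" if "a > 0" for a :: real using that by (simp add: ln_realpow)
    moreover have "\<omega> c x 1 * v = \<omega> c x v" using \<omega>[OF c] by simp
    ultimately show ?thesis
      by (simp add: surface_connection_def curve_connection_def ci(1)[OF c(2)] pos)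
  qed
  have forms: "lift_form \<Phi> omega1 c x v = \<omega> c x v" "lift_form \<Phi> omega2 c x v = 0"
    "lift_form \<Phi> omega3 c x v = \<alpha>m x * \<omega> c x v" "lift_form \<Phi> tau c x v = \<alpha>p x * \<omega> c x v"
    if "c \<in> X" "x \<in> fst c" for c x v
    by (simp_all add: lift_form_def omega1_def omega2_def omega3_def tau_def mc[OF that] mc_matrix_def)
  have nrm: "(cmod (\<omega> c x v))\<^sup>2 = 1\<^sup>2 * (?\<gamma> x)\<^sup>2 * g0 c x v v" if "c \<in> X" "x \<in> fst c" for c x v
    using ad that unfolding admissible_form_def by blast
  have "transverse_immersion X \<alpha>m \<alpha>p \<phi>"
  proof (rule transverse_immersion_lift[OF X lift pos])
    fix c x and v :: complex assume c: "c \<in> X" "x \<in> fst c" and v: "v \<noteq> 0"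
    have "f x c \<noteq> 0" by (rule parallel_at_nonzero[OF g(1) _ c]) (use f in \<open>simp add: parallel_form_def\<close>)
    then show "lift_form \<Phi> omega1 c x v \<noteq> 0"
      using v gamma_fun_pos[of \<alpha>m x \<alpha>p] pos[of x] by (simp add: forms[OF c] \<omega>[OF c])
  qed (simp_all add: forms \<omega>)
  moreover have "has_scale X g0 \<alpha>m \<alpha>p \<phi> 1"
    unfolding has_scale_def
  proof (intro conjI ballI allI)
    fix c x v assume c: "c \<in> X" "x \<in> fst c"
    show "g_H (curve_deriv X \<phi> c x v) = 1\<^sup>2 * (?\<gamma> x)\<^sup>2 * g0 c x v v"
      unfolding g_curve_lift(1)[OF X lift UNIV_I c] forms[OF c] nrm[OF c, symmetric] by simp
  qed simp
  moreover have "associated_form X \<alpha>m \<alpha>p \<phi> \<omega>"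
    unfolding associated_form_def by (intro exI[of _ \<Phi>] conjI lift ballI allI) (simp_all add: forms)
  ultimately show ?thesis by blast
qed

section \<open>Uniqueness\<close>

text \<open>Differentiating \<open>qadjoint (f p) \<odot> f p = qid\<close> shows that
  left-translated tangent vectors lie in the Lie algebra of skew-adjoint matrices.\<close>

lemma sp2_skew:
  assumes S: "open S" "p \<in> S" and f: "(f has_derivative f') (at p)" "\<And>p. p \<in> S \<Longrightarrow> f p \<in> Sp2"
  shows "qadjoint (qadjoint (f p) \<odot> f' v) = - (qadjoint (f p) \<odot> f' v)"
proof -
  have "((\<lambda>p. qadjoint (f p) \<odot> f p) has_derivative (\<lambda>v. qadjoint (f p) \<odot> f' v + qadjoint (f' v) \<odot> f p)) (at p)"
    by (rule qmat_mult.FDERIV[OF bounded_linear.has_derivative[OF bounded_linear_qadjoint f(1)] f(1)])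
  moreover have "((\<lambda>p. qadjoint (f p) \<odot> f p) has_derivative (\<lambda>v. 0)) (at p)"
    by (rule has_derivative_transform_within_open[OF has_derivative_const[of qid] S]) (use f(2) in \<open>simp add: Sp2_iff\<close>)
  ultimately have "(\<lambda>v. qadjoint (f p) \<odot> f' v + qadjoint (f' v) \<odot> f p) = (\<lambda>v. 0)"
    by (rule has_derivative_unique)
  from fun_cong[OF this, of v] show ?thesis
    by (simp add: qadjoint_mult eq_neg_iff_add_eq_0 add.commute)
qed

text \<open>The second derivatives of f cancel by symmetry, and the skewness of n rewrites the
  products of first derivatives as a commutator:
  \<open>d\<Omega> = - \<Omega> \<and> \<Omega>\<close> on the pair 1, i.\<close>

lemma structure_equation:
  fixes f :: "complex \<Rightarrow> quat^2^2"
  assumes f: "smooth_on S f" "\<And>p. p \<in> S \<Longrightarrow> f p \<in> Sp2" and p: "p \<in> S"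
  defines "n \<equiv> \<lambda>v p. qadjoint (f p) \<odot> frechet_derivative f (at p) v"
  shows "frechet_derivative (n \<i>) (at p) 1 - frechet_derivative (n 1) (at p) \<i> = n \<i> p \<odot> n 1 p - n 1 p \<odot> n \<i> p"
proof -
  let ?D = "\<lambda>v. frechet_derivative f (at p) v" and ?DD = "\<lambda>v h. frechet_derivative (\<lambda>p. frechet_derivative f (at p) v) (at p) h"
  have S: "open S" using f(1) by (rule smooth_on_open)
  note d = smooth_on_has_derivative[OF f(1) p]
  have dn: "frechet_derivative (n v) (at p) h = qadjoint (f p) \<odot> ?DD v h + qadjoint (?D h) \<odot> ?D v" for v h
    unfolding n_def
    by (rule frechet_derivative_eq)
      (rule qmat_mult.FDERIV[OF bounded_linear.has_derivative[OF bounded_linear_qadjoint d] smooth_on_has_derivative[OF smooth_on_derivative[OF f(1)] p]])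
  have m: "?DD \<i> 1 = ?DD 1 \<i>" by (rule mixed_partials[OF f(1) p])
  have nn: "qadjoint (?D h) \<odot> ?D v = - (n h p \<odot> n v p)" for h v
  proof -
    have "n h p \<odot> n v p = - (qadjoint (n h p) \<odot> n v p)"
      using sp2_skew[OF S p d f(2), of h] by (simp add: n_def qmat_mult.minus_left)
    also have "qadjoint (n h p) \<odot> n v p = qadjoint (?D h) \<odot> ?D v"
      by (simp add: n_def qadjoint_mult qmat_mult_assoc Sp2_cancel[OF f(2)[OF p]])
    finally show ?thesis by simp
  qed
  show ?thesis unfolding dn m nn by simp
qed

text \<open>Skewness determines the entry (1,2) and makes the complex parts of the diagonal
  imaginary; their imaginary parts are \<rho>1 and \<rho>2.\<close>

lemma skew_mc_matrix:
  assumes "qadjoint N = - N" "fst (N $ 2 $ 1) = w / of_real (sqrt 2)" "snd (N $ 2 $ 1) = 0"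
    "snd (N $ 1 $ 1) = of_real a * cnj w" "snd (N $ 2 $ 2) = of_real b * w"
  shows "N = mc_matrix a b (Im (fst (N $ 1 $ 1))) (Im (fst (N $ 2 $ 2))) w"
proof -
  have e: "qcnj (N $ j $ i) = - (N $ i $ j)" for i j
    using arg_cong[OF assms(1), of "\<lambda>M. M $ i $ j"] by simp
  have "Re (fst (N $ i $ i)) = 0" for i
    using e[of i i] by (simp add: qcnj_def prod_eq_iff complex_eq_iff)
  then have "fst (N $ i $ i) = \<i> * of_real (Im (fst (N $ i $ i)))" for i
    by (simp add: complex_eq_iff)
  moreover have "N $ 1 $ 2 = - qcnj (N $ 2 $ 1)" using e[of 2 1] by simp
  ultimately show ?thesis
    using assms(2-5) by (simp add: qmat_eq_iff mc_matrix_def prod_eq_iff qcnj_def)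
qed

lemma real_combination_eq_0:
  fixes w1 w2 :: complex
  assumes "\<And>x y :: real. of_real x * w1 + of_real y * w2 = 0 \<Longrightarrow> x = 0 \<and> y = 0"
    and "w2 * of_real x = w1 * of_real y"
  shows "x = 0" "y = 0"
  using assms(1)[of "- y" x] assms(2) by (auto simp: mult.commute)

text \<open>\<open>\<rho>\<^sub>1\<close> and \<open>\<rho>\<^sub>2\<close> are determined by \<open>\<omega>\<^sub>1\<close> and the angle functions: the structure equations
  for \<open>d\<omega>\<^sub>1\<close> and \<open>d\<omega>\<^sub>3\<close> give \<open>(\<rho>\<^sub>1 - \<rho>\<^sub>2) \<and> \<omega>\<^sub>1\<close> and \<open>\<rho>\<^sub>1 \<and> \<omega>\<^sub>1\<close>.\<close>

lemma mc_commutator_determines: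
  fixes a b :: real and w1 w2 :: complex and r1 r2 r1' r2' :: "bool \<Rightarrow> real"
  assumes a: "a > 0"
    and ind: "\<And>x y :: real. of_real x * w1 + of_real y * w2 = 0 \<Longrightarrow> x = 0 \<and> y = 0"
  defines "N \<equiv> mc_matrix a b (r1 False) (r2 False) w1" and "M \<equiv> mc_matrix a b (r1 True) (r2 True) w2"
  defines "N' \<equiv> mc_matrix a b (r1' False) (r2' False) w1" and "M' \<equiv> mc_matrix a b (r1' True) (r2' True) w2"
  assumes 21: "fst ((M \<odot> N - N \<odot> M) $ 2 $ 1) = fst ((M' \<odot> N' - N' \<odot> M') $ 2 $ 1)"
    and 11: "snd ((M \<odot> N - N \<odot> M) $ 1 $ 1) = snd ((M' \<odot> N' - N' \<odot> M') $ 1 $ 1)"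
  shows "N = N'" "M = M'"
proof -
  have s: "complex_of_real (sqrt 2) \<noteq> 0" by simp
  \<comment> \<open>The complex part of the entry (2,1) of the commutator involves the diagonal only
    through \<open>r1 - r2\<close>.\<close>
  have e1: "w2 * of_real ((r1 False - r1' False) - (r2 False - r2' False)) = w1 * of_real ((r1 True - r1' True) - (r2 True - r2' True))"
  proof -
    have "\<i> * (w2 * of_real (r1 False - r2 False) - w1 * of_real (r1 True - r2 True)) / of_real (sqrt 2) =
      \<i> * (w2 * of_real (r1' False - r2' False) - w1 * of_real (r1' True - r2' True)) / of_real (sqrt 2)"
      using 21 unfolding N_def M_def N'_def M'_def
      by (simp add: mc_matrix_def qmat_mult_nth qmult_def add_divide_distrib[symmetric] diff_divide_distrib[symmetric] algebra_simps)
    then have "w2 * of_real (r1 False - r2 False) - w1 * of_real (r1 True - r2 True) =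
      w2 * of_real (r1' False - r2' False) - w1 * of_real (r1' True - r2' True)" using s by simp
    then show ?thesis by (simp add: algebra_simps)
  qed
  \<comment> \<open>The j-part of the entry (1,1) involves the diagonal only through
    \<open>r1\<close>, with the nonzero factor \<open>2 * \<i> * a\<close>.\<close>
  have e2: "w2 * of_real (r1 False - r1' False) = w1 * of_real (r1 True - r1' True)"
  proof -
    have "2 * \<i> * of_real a * (cnj w2 * of_real (r1 False) - cnj w1 * of_real (r1 True)) =
      2 * \<i> * of_real a * (cnj w2 * of_real (r1' False) - cnj w1 * of_real (r1' True))"
      using 11 unfolding N_def M_def N'_def M'_def
      by (simp add: mc_matrix_def qmat_mult_nth qmult_def algebra_simps)
    then have "cnj w2 * of_real (r1 False) - cnj w1 * of_real (r1 True) = cnj w2 * of_real (r1' False) - cnj w1 * of_real (r1' True)"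
      using a by simp
    from arg_cong[OF this, of cnj] show ?thesis by (simp add: algebra_simps)
  qed
  note z1 = real_combination_eq_0[OF ind e1] and z2 = real_combination_eq_0[OF ind e2]
  have "r1 False = r1' False" "r1 True = r1' True" "r2 False = r2' False" "r2 True = r2' True"
    using z1 z2 by auto
  then show "N = N'" "M = M'" by (simp_all add: N_def M_def N'_def M'_def)
qed

text \<open>The conditions of \<open>associated_form\<close> on the frame alone; the curve is
  recovered as \<open>line (col1 (\<Phi> x))\<close>, so frames over one curve can be rotated
  freely.\<close>

definition adapted_frame ::
    "'x::t2_space chart set \<Rightarrow> ('x \<Rightarrow> real) \<Rightarrow> ('x \<Rightarrow> real) \<Rightarrow> 'x form \<Rightarrow> ('x \<Rightarrow> quat^2^2) \<Rightarrow> bool" where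
  "adapted_frame X \<alpha>m \<alpha>p \<omega> \<Phi> \<longleftrightarrow> smooth_map X UNIV \<Phi> \<and> (\<forall>x. \<Phi> x \<in> Sp2) \<and>
     (\<forall>c\<in>X. \<forall>x\<in>fst c. \<forall>v. lift_form \<Phi> omega1 c x v = \<omega> c x v \<and> lift_form \<Phi> omega2 c x v = 0 \<and>
        lift_form \<Phi> omega3 c x v = \<alpha>m x * \<omega> c x v \<and> lift_form \<Phi> tau c x v = \<alpha>p x * \<omega> c x v)"

lemma adapted_frame_mc:
  fixes X :: "'x::t2_space chart set"
  assumes X: "riemann_surface X" and \<Phi>: "adapted_frame X \<alpha>m \<alpha>p \<omega> \<Phi>" and c: "c \<in> X" "x \<in> fst c"
  defines "N \<equiv> \<lambda>v. qadjoint (\<Phi> x) \<odot> chart_deriv c \<Phi> x v"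
  shows "N v = mc_matrix (\<alpha>m x) (\<alpha>p x) (Im (fst (N v $ 1 $ 1))) (Im (fst (N v $ 2 $ 2))) (\<omega> c x v)"
proof (rule skew_mc_matrix)
  note cc = surface_coordinates[OF X c(1)]
  note ci = coordinates_inverse[OF cc]
  have sm: "smooth_map X UNIV \<Phi>" and S: "\<And>x. \<Phi> x \<in> Sp2" using \<Phi> by (simp_all add: adapted_frame_def)
  have d: "((\<Phi> \<circ> chart_inv c) has_derivative chart_deriv c \<Phi> x) (at (snd c x))"
    by (rule smooth_map_has_derivative[OF X sm c(1)]) (use c in simp)
  have "qadjoint (qadjoint ((\<Phi> \<circ> chart_inv c) (snd c x)) \<odot> chart_deriv c \<Phi> x v) =
      - (qadjoint ((\<Phi> \<circ> chart_inv c) (snd c x)) \<odot> chart_deriv c \<Phi> x v)"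
    by (rule sp2_skew[OF open_UNIV UNIV_I d]) (simp add: S)
  then show "qadjoint (N v) = - N v" by (simp add: N_def ci(1)[OF c(2)])
  have "\<forall>v. lift_form \<Phi> omega1 c x v = \<omega> c x v \<and> lift_form \<Phi> omega2 c x v = 0 \<and>
        lift_form \<Phi> omega3 c x v = \<alpha>m x * \<omega> c x v \<and> lift_form \<Phi> tau c x v = \<alpha>p x * \<omega> c x v"
    using \<Phi> c unfolding adapted_frame_def by blast
  then have l: "lift_form \<Phi> omega1 c x v = \<omega> c x v" "lift_form \<Phi> omega2 c x v = 0"
        "lift_form \<Phi> omega3 c x v = \<alpha>m x * \<omega> c x v" "lift_form \<Phi> tau c x v = \<alpha>p x * \<omega> c x v" by auto
  have Nv: "qadjoint (\<Phi> x) \<odot> chart_deriv c \<Phi> x v = N v" by (simp add: N_def)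
  note defs = lift_form_def omega1_def omega2_def omega3_def tau_def maurer_cartan_def Nv
  show "fst (N v $ 2 $ 1) = \<omega> c x v / of_real (sqrt 2)" using l(1) by (simp add: defs eq_divide_eq mult.commute)
  show "snd (N v $ 2 $ 1) = 0" using l(2) by (simp add: defs)
  show "snd (N v $ 1 $ 1) = of_real (\<alpha>m x) * cnj (\<omega> c x v)"
    using arg_cong[OF l(3), of cnj] by (simp add: defs)
  show "snd (N v $ 2 $ 2) = of_real (\<alpha>p x) * \<omega> c x v" using l(4) by (simp add: defs)
qed

text \<open>The two Maurer-Cartan forms share all entries except possibly \<rho>1 and \<rho>2. Equal
  entries have equal derivatives, the structure equation turns these into equal entries of
  commutators, and \<open>mc_commutator_determines\<close> yields the diagonals.\<close>

lemma adapted_frames_same_mc: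
  fixes X :: "'x::t2_space chart set"
  assumes X: "riemann_surface X" and \<Phi>: "adapted_frame X \<alpha>m \<alpha>p \<omega> \<Phi>" and \<Psi>: "adapted_frame X \<alpha>m \<alpha>p \<omega> \<Psi>"
    and pos: "\<And>x. \<alpha>m x > 0" and nz: "\<And>c x v. c \<in> X \<Longrightarrow> x \<in> fst c \<Longrightarrow> v \<noteq> 0 \<Longrightarrow> \<omega> c x v \<noteq> 0"
    and c: "c \<in> X" "x \<in> fst c"
  shows "qadjoint (\<Phi> x) \<odot> chart_deriv c \<Phi> x v = qadjoint (\<Psi> x) \<odot> chart_deriv c \<Psi> x v"
proof -
  note cc = surface_coordinates[OF X c(1)]
  note ci = coordinates_inverse[OF cc]
  let ?S = "snd c ` fst c" and ?p = "snd c x"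
  have S: "open ?S" using cc by (simp add: coordinates_def)
  have pS: "?p \<in> ?S" using c by blast
  define n where "n F v p = qadjoint ((F \<circ> chart_inv c) p) \<odot> frechet_derivative (F \<circ> chart_inv c) (at p) v" for F :: "'x \<Rightarrow> quat^2^2" and v p
  define N where "N F v y = qadjoint (F y) \<odot> chart_deriv c F y v" for F v y
  have nN: "n F v (snd c y) = N F v y" if "y \<in> fst c" for F v y
    using ci(1)[OF that] by (simp add: n_def N_def chart_deriv_def)
  have st: "frechet_derivative (n F \<i>) (at ?p) 1 - frechet_derivative (n F 1) (at ?p) \<i> = N F \<i> x \<odot> N F 1 x - N F 1 x \<odot> N F \<i> x"
    and dn: "(n F v has_derivative frechet_derivative (n F v) (at ?p)) (at ?p)"
    and lin: "linear (\<lambda>v. N F v x)"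
    if F: "adapted_frame X \<alpha>m \<alpha>p \<omega> F" for F v
  proof -
    have sm: "smooth_map X UNIV F" and FS: "\<And>x. F x \<in> Sp2" using F by (simp_all add: adapted_frame_def)
    have smF: "smooth_on ?S (F \<circ> chart_inv c)" using sm c(1) by (simp add: smooth_map_def)
    have "frechet_derivative (n F \<i>) (at ?p) 1 - frechet_derivative (n F 1) (at ?p) \<i> = n F \<i> ?p \<odot> n F 1 ?p - n F 1 ?p \<odot> n F \<i> ?p"
      unfolding n_def[abs_def] by (rule structure_equation[OF smF _ pS]) (simp add: FS)
    then show "frechet_derivative (n F \<i>) (at ?p) 1 - frechet_derivative (n F 1) (at ?p) \<i> = N F \<i> x \<odot> N F 1 x - N F 1 x \<odot> N F \<i> x"
      by (simp add: nN[OF c(2)])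
    have "smooth_on ?S (n F v)"
      unfolding n_def[abs_def]
      by (intro smooth_on_bounded_bilinear[OF bounded_bilinear_qmat_mult] smooth_on_bounded_linear[OF smF bounded_linear_qadjoint]
          smooth_on_derivative smF)
    then show "(n F v has_derivative frechet_derivative (n F v) (at ?p)) (at ?p)"
      by (rule smooth_on_has_derivative[OF _ pS])
    have "linear (chart_deriv c F x)"
      using has_derivative_linear[OF smooth_on_has_derivative[OF smF pS]] by (simp add: chart_deriv_def[abs_def])
    then show "linear (\<lambda>v. N F v x)"
      unfolding N_def by (intro linearI) (simp_all add: linear_add linear_scale qmat_mult.add_right qmat_mult.scaleR_right)
  qed
  have mc: "N F v y = mc_matrix (\<alpha>m y) (\<alpha>p y) (Im (fst (N F v y $ 1 $ 1))) (Im (fst (N F v y $ 2 $ 2))) (\<omega> c y v)"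
    if "adapted_frame X \<alpha>m \<alpha>p \<omega> F" "y \<in> fst c" for F v y
    unfolding N_def by (rule adapted_frame_mc[OF X that(1) c(1) that(2)])
  \<comment> \<open>Agreement on the whole chart, not only at x, is what allows the equality to be
    differentiated.\<close>
  have eqD: "l (frechet_derivative (n \<Phi> v) (at ?p) h) = l (frechet_derivative (n \<Psi> v) (at ?p) h)"
    if l: "bounded_linear l" and eq: "\<And>y. y \<in> fst c \<Longrightarrow> l (N \<Phi> v y) = l (N \<Psi> v y)" for l :: "quat^2^2 \<Rightarrow> complex" and v h
  proof -
    have "((\<lambda>p. l (n \<Phi> v p)) has_derivative (\<lambda>h. l (frechet_derivative (n \<Phi> v) (at ?p) h))) (at ?p)"
      by (rule bounded_linear.has_derivative[OF l dn[OF \<Phi>]])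
    then have "((\<lambda>p. l (n \<Psi> v p)) has_derivative (\<lambda>h. l (frechet_derivative (n \<Phi> v) (at ?p) h))) (at ?p)"
      by (rule has_derivative_transform_within_open[OF _ S pS]) (use eq nN in auto)
    from has_derivative_unique[OF this bounded_linear.has_derivative[OF l dn[OF \<Psi>]]] show ?thesis
      by (rule fun_cong)
  qed
  have l21: "bounded_linear (\<lambda>M::quat^2^2. fst (M $ 2 $ 1))" and l11: "bounded_linear (\<lambda>M::quat^2^2. snd (M $ 1 $ 1))"
    by (intro bounded_linear_compose[OF bounded_linear_fst] bounded_linear_compose[OF bounded_linear_snd]
        bounded_linear_compose[OF bounded_linear_vec_nth] bounded_linear_vec_nth)+
  have e21: "fst (N \<Phi> v y $ 2 $ 1) = fst (N \<Psi> v y $ 2 $ 1)" and e11: "snd (N \<Phi> v y $ 1 $ 1) = snd (N \<Psi> v y $ 1 $ 1)"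
    if y: "y \<in> fst c" for v y
    by (subst mc[OF \<Phi> y], subst mc[OF \<Psi> y], simp add: mc_matrix_def)+
  have lc: "l (N \<Phi> \<i> x \<odot> N \<Phi> 1 x - N \<Phi> 1 x \<odot> N \<Phi> \<i> x) = l (N \<Psi> \<i> x \<odot> N \<Psi> 1 x - N \<Psi> 1 x \<odot> N \<Psi> \<i> x)"
    if l: "bounded_linear l" and eq: "\<And>v y. y \<in> fst c \<Longrightarrow> l (N \<Phi> v y) = l (N \<Psi> v y)" for l :: "quat^2^2 \<Rightarrow> complex"
    unfolding st[OF \<Phi>, symmetric] st[OF \<Psi>, symmetric] linear_diff[OF bounded_linear.linear[OF l]]
    using eqD[OF l eq] by simp
  have lin\<omega>: "\<omega> c x v = sqrt 2 * fst (N \<Phi> v x $ 2 $ 1)" for v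
    by (subst mc[OF \<Phi> c(2)]) (simp add: mc_matrix_def)
  \<comment> \<open>\<omega> is real linear at x and vanishes on no nonzero vector, so its values on
    1 and i are independent over the reals.\<close>
  have ind: "a = 0 \<and> b = 0" if ab: "of_real a * \<omega> c x 1 + of_real b * \<omega> c x \<i> = 0" for a b :: real
  proof -
    have "N \<Phi> (a *\<^sub>R 1 + b *\<^sub>R \<i>) x = a *\<^sub>R N \<Phi> 1 x + b *\<^sub>R N \<Phi> \<i> x"
      using linear_add[OF lin[OF \<Phi>]] linear_scale[OF lin[OF \<Phi>]] by (simp only:)
    then have "\<omega> c x (a *\<^sub>R 1 + b *\<^sub>R \<i>) = of_real a * \<omega> c x 1 + of_real b * \<omega> c x \<i>"
      by (simp add: lin\<omega> scaleR_conv_of_real algebra_simps)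
    then have "a *\<^sub>R 1 + b *\<^sub>R \<i> = 0" using nz[OF c] ab by metis
    then show ?thesis by (simp add: complex_eq_iff)
  qed
  define r1 where "r1 F t = (if t then Im (fst (N F \<i> x $ 1 $ 1)) else Im (fst (N F 1 x $ 1 $ 1)))" for F t
  define r2 where "r2 F t = (if t then Im (fst (N F \<i> x $ 2 $ 2)) else Im (fst (N F 1 x $ 2 $ 2)))" for F t
  have N1: "N F 1 x = mc_matrix (\<alpha>m x) (\<alpha>p x) (r1 F False) (r2 F False) (\<omega> c x 1)"
    and Ni: "N F \<i> x = mc_matrix (\<alpha>m x) (\<alpha>p x) (r1 F True) (r2 F True) (\<omega> c x \<i>)"
    if "adapted_frame X \<alpha>m \<alpha>p \<omega> F" for F
    unfolding r1_def r2_def using mc[OF that c(2)] by (simp_all only: if_True if_False)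
  have "N \<Phi> 1 x = N \<Psi> 1 x" "N \<Phi> \<i> x = N \<Psi> \<i> x"
    unfolding N1[OF \<Phi>] N1[OF \<Psi>] Ni[OF \<Phi>] Ni[OF \<Psi>]
    by (rule mc_commutator_determines[where ?w1.0 = "\<omega> c x 1" and ?w2.0 = "\<omega> c x \<i>", OF pos ind],
        use lc[OF l21 e21] lc[OF l11 e11] in \<open>simp_all only: N1[OF \<Phi>] N1[OF \<Psi>] Ni[OF \<Phi>] Ni[OF \<Psi>]\<close>)+
  moreover have "N F v x = Re v *\<^sub>R N F 1 x + Im v *\<^sub>R N F \<i> x" if "adapted_frame X \<alpha>m \<alpha>p \<omega> F" for F
  proof -
    have "N F v x = N F (Re v *\<^sub>R 1 + Im v *\<^sub>R \<i>) x"
      by (rule arg_cong[of _ _ "\<lambda>v. N F v x"]) (simp add: complex_eq_iff)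
    then show ?thesis
      using linear_add[OF lin[OF that]] linear_scale[OF lin[OF that]] by (simp only:)
  qed
  ultimately have "N \<Phi> v x = N \<Psi> v x" using \<Phi> \<Psi> by simp
  then show ?thesis by (simp add: N_def)
qed

text \<open>Both frames solve the equation of one connection, so
  \<open>\<Psi> x \<odot> qadjoint (\<Phi> x)\<close> is locally constant, and the surface is
  connected.\<close>

lemma adapted_frames_congruent:
  fixes X :: "'x::t2_space chart set"
  assumes X: "riemann_surface X" and \<Phi>: "adapted_frame X \<alpha>m \<alpha>p \<omega> \<Phi>" and \<Psi>: "adapted_frame X \<alpha>m \<alpha>p \<omega> \<Psi>"
    and pos: "\<And>x. \<alpha>m x > 0" and nz: "\<And>c x v. c \<in> X \<Longrightarrow> x \<in> fst c \<Longrightarrow> v \<noteq> 0 \<Longrightarrow> \<omega> c x v \<noteq> 0"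
  shows "\<exists>A\<in>Sp2. \<forall>x. \<Psi> x = A \<odot> \<Phi> x"
proof -
  have \<Phi>S: "\<Phi> x \<in> Sp2" and \<Psi>S: "\<Psi> x \<in> Sp2" for x using \<Phi> \<Psi> by (simp_all add: adapted_frame_def)
  have sm: "smooth_map X UNIV \<Phi>" "smooth_map X UNIV \<Psi>" using \<Phi> \<Psi> by (simp_all add: adapted_frame_def)
  have conn: "connected (UNIV :: 'x set)" using X by (simp add: riemann_surface_def)
  define P where "P x = \<Psi> x \<odot> qadjoint (\<Phi> x)" for x
  have const: "P a = P b" for a b
  proof (rule connected_local_const[OF conn UNIV_I UNIV_I], rule ballI)
    fix x
    obtain c where c: "c \<in> X" "x \<in> fst c" using surface_chart_exists[OF X] by blast
    note cc = surface_coordinates[OF X c(1)]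
    note ci = coordinates_inverse[OF cc]
    have "open (snd c ` fst c)" using cc by (simp add: coordinates_def)
    then obtain r where r: "r > 0" "ball (snd c x) r \<subseteq> snd c ` fst c" using c(2) by (meson imageI openE)
    let ?B = "ball (snd c x) r"
    have d: "((F \<circ> chart_inv c) has_derivative (\<lambda>v. (F \<circ> chart_inv c) p \<odot>
        (qadjoint (\<Phi> (chart_inv c p)) \<odot> chart_deriv c \<Phi> (chart_inv c p) v))) (at p)"
      if p: "p \<in> ?B" and F: "adapted_frame X \<alpha>m \<alpha>p \<omega> F" for F p
    proof -
      have pc: "p \<in> snd c ` fst c" using p r(2) by blast
      let ?y = "chart_inv c p"
      have y: "?y \<in> fst c" by (rule ci(3)[OF pc])
      have smF: "smooth_map X UNIV F" and FS: "F ?y \<in> Sp2" using F by (simp_all add: adapted_frame_def)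
      have dF: "((F \<circ> chart_inv c) has_derivative chart_deriv c F ?y) (at (snd c ?y))"
        by (rule smooth_map_has_derivative[OF X smF c(1)]) (use y in simp)
      have "chart_deriv c F ?y v = F ?y \<odot> (qadjoint (\<Phi> ?y) \<odot> chart_deriv c \<Phi> ?y v)" for v
      proof -
        have "qadjoint (\<Phi> ?y) \<odot> chart_deriv c \<Phi> ?y v = qadjoint (F ?y) \<odot> chart_deriv c F ?y v"
          by (rule adapted_frames_same_mc[OF X \<Phi> F pos _ c(1) y]) (rule nz)
        then show ?thesis by (simp add: Sp2_cancel[OF FS])
      qed
      then have "chart_deriv c F ?y = (\<lambda>v. F ?y \<odot> (qadjoint (\<Phi> ?y) \<odot> chart_deriv c \<Phi> ?y v))" by blast
      from dF[unfolded this] show ?thesis by (simp add: ci(2)[OF pc])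
    qed
    have "\<exists>C. \<forall>p\<in>?B. (\<Psi> \<circ> chart_inv c) p = C \<odot> (\<Phi> \<circ> chart_inv c) p"
    proof (rule Sp2_ratio_constant[OF open_ball connected_ball,
          where N = "\<lambda>p v. qadjoint (\<Phi> (chart_inv c p)) \<odot> chart_deriv c \<Phi> (chart_inv c p) v"])
      show "qadjoint (qadjoint (\<Phi> (chart_inv c p)) \<odot> chart_deriv c \<Phi> (chart_inv c p) v) =
          - (qadjoint (\<Phi> (chart_inv c p)) \<odot> chart_deriv c \<Phi> (chart_inv c p) v)" if "p \<in> ?B" for p v
      proof -
        have "chart_inv c p \<in> fst c" using ci(3) that r(2) by blast
        from adapted_frame_mc[OF X \<Phi> c(1) this, of v] show ?thesis
          using qadjoint_mc_matrix by metis
      qed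
      show "(\<Phi> \<circ> chart_inv c) p \<in> Sp2" for p by (simp add: \<Phi>S)
    qed (fact d[OF _ \<Psi>], fact d[OF _ \<Phi>])
    then obtain C where C: "\<And>p. p \<in> ?B \<Longrightarrow> \<Psi> (chart_inv c p) = C \<odot> \<Phi> (chart_inv c p)" by auto
    define W where "W = {y \<in> fst c. snd c y \<in> ?B}"
    have W: "open W" "x \<in> W"
      unfolding W_def using coordinates_open_preimage[OF cc open_ball] c(2) r(1) by auto
    have "P y = C" if "y \<in> W" for y
    proof -
      have "\<Psi> y = C \<odot> \<Phi> y" using C[of "snd c y"] that ci(1) by (simp add: W_def)
      then show ?thesis by (simp add: P_def Sp2_cancel[OF \<Phi>S])
    qed
    then show "\<forall>\<^sub>F y in at x within UNIV. P x = P y"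
      unfolding eventually_at_topological using W by metis
  qed
  fix x0 :: 'x
  have "\<Psi> x = P x0 \<odot> \<Phi> x" for x
    unfolding const[of x0 x] unfolding P_def by (simp add: Sp2_cancel[OF \<Phi>S])
  moreover have "P x0 \<in> Sp2" unfolding P_def by (intro Sp2_mult Sp2_qadjoint \<Phi>S \<Psi>S)
  ultimately show ?thesis by blast
qed

text \<open>The structure group \<open>S\<^sup>1 \<times> S\<^sup>1\<close> acts on adapted frames through \<open>diag(a, a u)\<close> with
  \<open>a\<^sup>2 = u\<close>; the condition on \<open>\<tau>\<close> forces \<open>u\<^sup>4 = 1\<close>.\<close>

lemma adapted_frame_rotate:
  fixes X :: "'x::t2_space chart set"
  assumes X: "riemann_surface X" and \<Psi>: "adapted_frame X \<alpha>m \<alpha>p \<omega>' \<Psi>" and u: "u ^ 4 = 1"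
    and mult: "\<And>c x v. c \<in> X \<Longrightarrow> x \<in> fst c \<Longrightarrow> \<omega>' c x v = u * \<omega> c x v"
  shows "\<exists>T a. a \<noteq> 0 \<and> adapted_frame X \<alpha>m \<alpha>p \<omega> (\<lambda>x. \<Psi> x \<odot> T) \<and> (\<forall>x. col1 (\<Psi> x \<odot> T) = a *s col1 (\<Psi> x))"
proof -
  define a where "a = csqrt u"
  define b where "b = a * u"
  have a2: "a * a = u" unfolding a_def using power2_csqrt[of u] by (simp add: power2_eq_square)
  have "cmod u ^ 4 = 1" using u by (simp flip: norm_power)
  then have nu: "cmod u = 1" using power_eq_imp_eq_base[of "cmod u" 4 1] by simp
  have "cmod a * cmod a = 1" using a2 nu by (simp flip: norm_mult)
  then have na: "cmod a = 1" using abs_square_eq_1[of "cmod a"] by (simp add: power2_eq_square)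
  then have nb: "cmod b = 1" using nu by (simp add: b_def norm_mult)
  have aa: "cnj a * a = 1" and bb: "cnj b * b = 1" and uu: "cnj u * u = 1"
    using na nb nu by (simp_all add: complex_norm_square[symmetric] mult.commute)
  \<comment> \<open>\<open>c1\<close>, \<open>c2\<close> and \<open>c3\<close> are the factors by
    which \<open>diag(a, b)\<close> changes \<omega>1, \<omega>3 and \<tau>, times the u from the
    passage from \<omega> to \<omega>'; the third product is \<open>u ^ 4\<close>.\<close>
  have c1: "cnj b * a * u = 1" using bb by (simp add: b_def mult.assoc)
  have c2: "cnj (a * a) * u = 1" using a2 uu by simp
  have c3: "b * b * u = 1"
  proof -
    have "b * b * u = (a * a) * (u * u * u)" by (simp add: b_def mult_ac)
    also have "\<dots> = u ^ 4" unfolding a2 by (simp add: power4_eq_xxxx mult_ac)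
    finally show ?thesis using u by simp
  qed
  define T where "T = qmat (a, 0) 0 0 (b, 0)"
  have T: "T \<in> Sp2"
    unfolding Sp2_iff by (simp add: qmat_eq_iff qmat_mult_nth T_def qcnj_def qmult_complex aa bb zero_prod_def)
  have \<Psi>S: "\<Psi> x \<in> Sp2" for x using \<Psi> by (simp add: adapted_frame_def)
  have sm: "smooth_map X UNIV \<Psi>" using \<Psi> by (simp add: adapted_frame_def)
  have "adapted_frame X \<alpha>m \<alpha>p \<omega> (\<lambda>x. \<Psi> x \<odot> T)"
    unfolding adapted_frame_def
  proof (intro conjI ballI allI)
    show "smooth_map X UNIV (\<lambda>x. \<Psi> x \<odot> T)"
      unfolding smooth_map_def
    proof (intro conjI ballI open_UNIV)
      fix c assume "c \<in> X"
      then have "smooth_on (snd c ` (fst c \<inter> UNIV)) (\<Psi> \<circ> chart_inv c)" using sm by (simp add: smooth_map_def)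
      from smooth_on_bounded_linear[OF this qmat_mult.bounded_linear_left]
      show "smooth_on (snd c ` (fst c \<inter> UNIV)) ((\<lambda>x. \<Psi> x \<odot> T) \<circ> chart_inv c)" by (simp add: o_def)
    qed
    show "\<Psi> x \<odot> T \<in> Sp2" for x by (rule Sp2_mult[OF \<Psi>S T])
    fix c x v assume c: "c \<in> X" "x \<in> fst c"
    have "((\<Psi> \<circ> chart_inv c) has_derivative chart_deriv c \<Psi> x) (at (snd c x))"
      by (rule smooth_map_has_derivative[OF X sm c(1)]) (use c in simp)
    from bounded_linear.has_derivative[OF qmat_mult.bounded_linear_left this]
    have "(((\<lambda>x. \<Psi> x \<odot> T) \<circ> chart_inv c) has_derivative (\<lambda>v. chart_deriv c \<Psi> x v \<odot> T)) (at (snd c x))"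
      by (simp add: o_def)
    then have cd: "chart_deriv c (\<lambda>x. \<Psi> x \<odot> T) x v = chart_deriv c \<Psi> x v \<odot> T"
      unfolding chart_deriv_def[of c "\<lambda>x. \<Psi> x \<odot> T"] by (rule frechet_derivative_eq)
    define N where "N = maurer_cartan (\<Psi> x) (chart_deriv c \<Psi> x v)"
    have N: "maurer_cartan (\<Psi> x \<odot> T) (chart_deriv c (\<lambda>x. \<Psi> x \<odot> T) x v) = qadjoint T \<odot> (N \<odot> T)"
      by (simp add: cd N_def maurer_cartan_def qadjoint_mult qmat_mult_assoc)
    have "\<forall>v. lift_form \<Psi> omega1 c x v = \<omega>' c x v \<and> lift_form \<Psi> omega2 c x v = 0 \<and>
        lift_form \<Psi> omega3 c x v = \<alpha>m x * \<omega>' c x v \<and> lift_form \<Psi> tau c x v = \<alpha>p x * \<omega>' c x v"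
      using \<Psi> c unfolding adapted_frame_def by blast
    then have l: "sqrt 2 * fst (N $ 2 $ 1) = u * \<omega> c x v" "snd (N $ 2 $ 1) = 0"
        "cnj (snd (N $ 1 $ 1)) = \<alpha>m x * (u * \<omega> c x v)" "snd (N $ 2 $ 2) = \<alpha>p x * (u * \<omega> c x v)"
      by (simp_all add: lift_form_def omega1_def omega2_def omega3_def tau_def N_def mult[OF c])
    have e: "(qadjoint T \<odot> (N \<odot> T)) $ 2 $ 1 = (cnj b * (fst (N $ 2 $ 1) * a), b * (snd (N $ 2 $ 1) * a))"
      "snd ((qadjoint T \<odot> (N \<odot> T)) $ 1 $ 1) = a * (snd (N $ 1 $ 1) * a)"
      "snd ((qadjoint T \<odot> (N \<odot> T)) $ 2 $ 2) = b * (snd (N $ 2 $ 2) * b)"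
      by (simp_all add: qmat_mult_nth T_def qcnj_def qmult_complex flip: zero_prod_def)
    show "lift_form (\<lambda>x. \<Psi> x \<odot> T) omega1 c x v = \<omega> c x v"
    proof -
      have "lift_form (\<lambda>x. \<Psi> x \<odot> T) omega1 c x v = cnj b * a * (sqrt 2 * fst (N $ 2 $ 1))"
        unfolding lift_form_def omega1_def N e by simp
      also have "\<dots> = (cnj b * a * u) * \<omega> c x v" unfolding l by simp
      finally show ?thesis unfolding c1 by simp
    qed
    show "lift_form (\<lambda>x. \<Psi> x \<odot> T) omega2 c x v = 0"
      unfolding lift_form_def omega2_def N e by (simp add: l)
    show "lift_form (\<lambda>x. \<Psi> x \<odot> T) omega3 c x v = \<alpha>m x * \<omega> c x v"
    proof -
      have "lift_form (\<lambda>x. \<Psi> x \<odot> T) omega3 c x v = cnj (a * a) * cnj (snd (N $ 1 $ 1))"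
        unfolding lift_form_def omega3_def N e by simp
      also have "\<dots> = (cnj (a * a) * u) * (\<alpha>m x * \<omega> c x v)" unfolding l by simp
      finally show ?thesis unfolding c2 by simp
    qed
    show "lift_form (\<lambda>x. \<Psi> x \<odot> T) tau c x v = \<alpha>p x * \<omega> c x v"
    proof -
      have "lift_form (\<lambda>x. \<Psi> x \<odot> T) tau c x v = b * b * snd (N $ 2 $ 2)"
        unfolding lift_form_def tau_def N e by simp
      also have "\<dots> = (b * b * u) * (\<alpha>p x * \<omega> c x v)" unfolding l by simp
      finally show ?thesis unfolding c3 by simp
    qed
  qed
  moreover have "col1 (\<Psi> x \<odot> T) = a *s col1 (\<Psi> x)" for x
    by (simp add: vec4_eq_iff qmat_mult_nth T_def qmult_complex)
  moreover have "a \<noteq> 0" using na by auto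
  ultimately show ?thesis by blast
qed

text \<open>The second frame is rotated so that both belong to \<omega>. The rotation multiplies the
  first column by a scalar, so the curve below is unchanged, and the constant left factor between
  the frames is the isometry.\<close>

lemma curves_congruent:
  fixes X :: "'x::t2_space chart set"
  assumes X: "riemann_surface X" and g: "compatible_metric X g0"
    and pos: "\<And>x. \<alpha>m x > 0" "\<And>x. \<alpha>p x > 0"
    and \<phi>: "has_scale X g0 \<alpha>m \<alpha>p \<phi> lam" "associated_form X \<alpha>m \<alpha>p \<phi> \<omega>"
    and \<psi>: "associated_form X \<alpha>m \<alpha>p \<psi> \<omega>'"
    and u: "u ^ 4 = 1" "form_multiple X u \<omega> \<omega>'"
  shows "\<exists>A\<in>Sp2. \<forall>x. \<psi> x = sp2_act A (\<phi> x)"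
proof -
  have ad: "\<exists>\<Phi>. sp2_lift X \<eta> UNIV \<Phi> \<and> adapted_frame X \<alpha>m \<alpha>p \<beta> \<Phi>"
    if h: "associated_form X \<alpha>m \<alpha>p \<eta> \<beta>" for \<eta> \<beta>
  proof -
    obtain \<Phi> where \<Phi>: "sp2_lift X \<eta> UNIV \<Phi>" and f: "\<forall>c\<in>X. \<forall>x\<in>fst c. \<forall>v.
        lift_form \<Phi> omega2 c x v = 0 \<and>
        lift_form \<Phi> omega3 c x v = \<alpha>m x * lift_form \<Phi> omega1 c x v \<and>
        lift_form \<Phi> tau c x v = \<alpha>p x * lift_form \<Phi> omega1 c x v \<and>
        \<beta> c x v = lift_form \<Phi> omega1 c x v" using h unfolding associated_form_def by blast
    have "adapted_frame X \<alpha>m \<alpha>p \<beta> \<Phi>"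
      unfolding adapted_frame_def
    proof (intro conjI ballI allI)
      show "smooth_map X UNIV \<Phi>" "\<And>x. \<Phi> x \<in> Sp2" using \<Phi> by (simp_all add: sp2_lift_def)
      fix c x v assume "c \<in> X" "x \<in> fst c"
      then have *: "lift_form \<Phi> omega2 c x v = 0 \<and>
        lift_form \<Phi> omega3 c x v = \<alpha>m x * lift_form \<Phi> omega1 c x v \<and>
        lift_form \<Phi> tau c x v = \<alpha>p x * lift_form \<Phi> omega1 c x v \<and>
        \<beta> c x v = lift_form \<Phi> omega1 c x v" using f by blast
      then show "lift_form \<Phi> omega1 c x v = \<beta> c x v" "lift_form \<Phi> omega2 c x v = 0"
        "lift_form \<Phi> omega3 c x v = \<alpha>m x * \<beta> c x v" "lift_form \<Phi> tau c x v = \<alpha>p x * \<beta> c x v" by simp_all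
    qed
    with \<Phi> show ?thesis by blast
  qed
  obtain \<Phi> where \<Phi>: "sp2_lift X \<phi> UNIV \<Phi>" "adapted_frame X \<alpha>m \<alpha>p \<omega> \<Phi>" using ad[OF \<phi>(2)] by blast
  obtain \<Psi> where \<Psi>: "sp2_lift X \<psi> UNIV \<Psi>" "adapted_frame X \<alpha>m \<alpha>p \<omega>' \<Psi>" using ad[OF \<psi>] by blast
  \<comment> \<open>Since \<omega>2 vanishes, \<open>g_H\<close> is the squared modulus of \<omega>
    along the curve, and a positive scale makes it positive on nonzero vectors.\<close>
  have nz: "\<omega> c x v \<noteq> 0" if c: "c \<in> X" "x \<in> fst c" and v: "v \<noteq> 0" for c x v
  proof -
    have l: "lift_form \<Phi> omega1 c x v = \<omega> c x v" "lift_form \<Phi> omega2 c x v = 0"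
      using \<Phi>(2) c unfolding adapted_frame_def by blast+
    have "g_H (curve_deriv X \<phi> c x v) = lam\<^sup>2 * (gamma_fun \<alpha>m \<alpha>p x)\<^sup>2 * g0 c x v v" "lam > 0"
      using \<phi>(1) c unfolding has_scale_def by blast+
    moreover have "g0 c x v v > 0" using g c v unfolding compatible_metric_def riemannian_metric_def by blast
    ultimately have "g_H (curve_deriv X \<phi> c x v) > 0"
      using gamma_fun_pos[of \<alpha>m x \<alpha>p] pos[of x] by simp
    then show ?thesis unfolding g_curve_lift(1)[OF X \<Phi>(1) UNIV_I c] l by auto
  qed
  have "\<omega>' c x v = u * \<omega> c x v" if "c \<in> X" "x \<in> fst c" for c x v
    using u(2) that unfolding form_multiple_def by blast
  from adapted_frame_rotate[OF X \<Psi>(2) u(1) this] obtain T a where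
    a: "a \<noteq> 0" and T: "adapted_frame X \<alpha>m \<alpha>p \<omega> (\<lambda>x. \<Psi> x \<odot> T)" and col: "\<And>x. col1 (\<Psi> x \<odot> T) = a *s col1 (\<Psi> x)"
    by blast
  obtain A where A: "A \<in> Sp2" "\<And>x. \<Psi> x \<odot> T = A \<odot> \<Phi> x"
    using adapted_frames_congruent[OF X \<Phi>(2) T pos(1) nz] by blast
  have "\<psi> x = sp2_act A (\<phi> x)" for x
  proof -
    have "\<psi> x = line (col1 (\<Psi> x))" "\<phi> x = sp2_act (\<Phi> x) base_point"
      using \<Psi>(1) \<Phi>(1) by (simp_all add: sp2_lift_def flip: sp2_act_base_point)
    then have "\<psi> x = line (col1 (\<Psi> x \<odot> T))" by (simp add: col line_cscale[OF a])
    also have "\<dots> = sp2_act A (sp2_act (\<Phi> x) base_point)"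
      unfolding A(2) sp2_act_base_point[symmetric] sp2_act_mult ..
    finally show ?thesis using \<open>\<phi> x = _\<close> by simp
  qed
  with A(1) show ?thesis by blast
qed

theorem theorem5p2:
  fixes X :: "'x::t2_space chart set"
    and g0 :: "'x metric"
    and \<alpha>m \<alpha>p :: "'x \<Rightarrow> real"
  assumes "riemann_surface X"
    and "simply_connected (UNIV :: 'x set)"
    and "compatible_metric X g0"
    and "flat_metric X g0"
    and "smooth_map X UNIV \<alpha>m" and "smooth_map X UNIV \<alpha>p"
    and "\<forall>x. \<alpha>m x > 0" and "\<forall>x. \<alpha>p x > 0"
    and "has_laplacian X g0 (\<lambda>x. ln ((\<alpha>m x)\<^sup>2))
           (\<lambda>x. - 4 * (3 * (\<alpha>m x)\<^sup>2 + (\<alpha>p x)\<^sup>2 - 2) * (gamma_fun \<alpha>m \<alpha>p x)\<^sup>2)"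
    and "has_laplacian X g0 (\<lambda>x. ln ((\<alpha>p x)\<^sup>2))
           (\<lambda>x. - 4 * (3 * (\<alpha>p x)\<^sup>2 + (\<alpha>m x)\<^sup>2 - 2) * (gamma_fun \<alpha>m \<alpha>p x)\<^sup>2)"
  shows
    \<comment> \<open>existence\<close>
    "(\<exists>\<phi>. transverse_immersion X \<alpha>m \<alpha>p \<phi>) \<and>
    \<comment> \<open>for some scale, every admissible choice of form is realised\<close>
     (\<exists>lam>0. \<forall>\<omega>0. admissible_form X g0 \<alpha>m \<alpha>p lam \<omega>0 \<longrightarrow>
        (\<exists>\<phi>. transverse_immersion X \<alpha>m \<alpha>p \<phi> \<and> has_scale X g0 \<alpha>m \<alpha>p \<phi> lam \<and>
             associated_form X \<alpha>m \<alpha>p \<phi> \<omega>0)) \<and>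
    \<comment> \<open>for each scale, the admissible forms are parametrised by the unit circle\<close>
     (\<forall>lam>0. \<exists>\<omega>0. \<forall>\<omega>. admissible_form X g0 \<alpha>m \<alpha>p lam \<omega> \<longleftrightarrow>
        (\<exists>u. cmod u = 1 \<and> form_multiple X u \<omega>0 \<omega>)) \<and>
    \<comment> \<open>uniqueness\<close>
     (\<forall>\<phi> \<psi> lam \<omega> \<omega>'.
        transverse_immersion X \<alpha>m \<alpha>p \<phi> \<and> has_scale X g0 \<alpha>m \<alpha>p \<phi> lam \<and>
        associated_form X \<alpha>m \<alpha>p \<phi> \<omega> \<and>
        transverse_immersion X \<alpha>m \<alpha>p \<psi> \<and> has_scale X g0 \<alpha>m \<alpha>p \<psi> lam \<and>
        associated_form X \<alpha>m \<alpha>p \<psi> \<omega>' \<and>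
        (\<exists>u. u ^ 4 = 1 \<and> form_multiple X u \<omega> \<omega>') \<longrightarrow>
        (\<exists>A\<in>Sp2. \<forall>x. \<psi> x = sp2_act A (\<phi> x)))"
proof -
  note X = assms(1) and sc = assms(2) and g = assms(3,4) and sm = assms(5,6)
  have pos: "\<And>x. \<alpha>m x > 0" "\<And>x. \<alpha>p x > 0" using assms(7,8) by auto
  note lap = assms(9,10)
  have ex: "\<exists>\<phi>. transverse_immersion X \<alpha>m \<alpha>p \<phi> \<and> has_scale X g0 \<alpha>m \<alpha>p \<phi> 1 \<and> associated_form X \<alpha>m \<alpha>p \<phi> \<omega>"
    if "admissible_form X g0 \<alpha>m \<alpha>p 1 \<omega>" for \<omega>
    by (rule curve_exists[OF X sc g sm pos lap that])
  have circle: "\<exists>\<omega>0. \<forall>\<omega>. admissible_form X g0 \<alpha>m \<alpha>p lam \<omega> \<longleftrightarrow> (\<exists>u. cmod u = 1 \<and> form_multiple X u \<omega>0 \<omega>)"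
    if "lam > 0" for lam
    by (rule admissible_forms_circle[OF X sc g sm pos that])
  obtain \<omega>0 where \<omega>0: "\<And>\<omega>. admissible_form X g0 \<alpha>m \<alpha>p 1 \<omega> \<longleftrightarrow> (\<exists>u. cmod u = 1 \<and> form_multiple X u \<omega>0 \<omega>)"
    using circle[of 1] by auto
  \<comment> \<open>Taking u = 1 shows that the reference form of the circle is itself admissible,
    so at least one curve exists.\<close>
  have "admissible_form X g0 \<alpha>m \<alpha>p 1 \<omega>0"
    unfolding \<omega>0 by (intro exI[of _ 1]) (simp add: form_multiple_def)
  then have "\<exists>\<phi>. transverse_immersion X \<alpha>m \<alpha>p \<phi>" using ex by blast
  \<comment> \<open>Scale 1 is the one for which the given Laplace equations express flatness of the
    connection.\<close>
  moreover have "\<exists>lam>0. \<forall>\<omega>0. admissible_form X g0 \<alpha>m \<alpha>p lam \<omega>0 \<longrightarrow>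
        (\<exists>\<phi>. transverse_immersion X \<alpha>m \<alpha>p \<phi> \<and> has_scale X g0 \<alpha>m \<alpha>p \<phi> lam \<and>
             associated_form X \<alpha>m \<alpha>p \<phi> \<omega>0)"
    using ex by (intro exI[of _ 1]) auto
  moreover have "\<exists>A\<in>Sp2. \<forall>x. \<psi> x = sp2_act A (\<phi> x)"
    if "has_scale X g0 \<alpha>m \<alpha>p \<phi> lam" "associated_form X \<alpha>m \<alpha>p \<phi> \<omega>"
      "associated_form X \<alpha>m \<alpha>p \<psi> \<omega>'" "u ^ 4 = 1" "form_multiple X u \<omega> \<omega>'" for \<phi> \<psi> lam \<omega> \<omega>' u
    by (rule curves_congruent[OF X g(1) pos that])
  ultimately show ?thesis using circle by blast
qed

end
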